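(* Let $N\ge 3$, let $\Omega\subset\mathbb{R}^N$ be a bounded domain with $0\in\Omega$, let $M>0$, $p\ge \frac{N}{N-2}$, $1<q\le \frac{2p}{p+1}$, and assume $(p,q)\neq\left(\frac{N}{N-2},\frac{N}{N-1}\right)$. Let $u\in C^2(\Omega\setminus\{0\})$ be a nonnegative solution of $$-\Delta u+u^p-M|\nabla u|^q=0\quad\text{in }\Omega\setminus\{0\}.$$ Then $u\in W^{1,q}_{loc}(\Omega)\cap L^p_{loc}(\Omega)$ and $u$ is a weak solution of the same equation in $\Omega$, i.e. $$\int_\Omega \langle\nabla u,\nabla\zeta\rangle\,dx+\int_\Omega u^p\zeta\,dx-M\int_\Omega|\nabla u|^q\zeta\,dx=0\quad\text{for all }\zeta\in C_c^\infty(\Omega).$$ Furthermore, if either (i) $p\ge\frac{N}{N-2}$ and $1<q<\frac{2p}{p+1}$, or (ii) $p>\frac{N}{N-2}$, $q=\frac{2p}{p+1}$ and $$M<m^*:=(p+1)\left(\frac{(N-2)p-N}{2p}\right)^{\frac{p}{p+1}},$$ then $u$ extends to a function of class $C^2(\Omega)$ which solves $-\Delta u+u^p-M|\nabla u|^q=0$ in $\Omega$. *)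

theory Defs
  imports "HOL-Analysis.Analysis"
begin

definition pdiff :: "'n::finite \<Rightarrow> (real^'n \<Rightarrow> real) \<Rightarrow> real^'n \<Rightarrow> real" where
  "pdiff i f x = frechet_derivative f (at x) (axis i 1)"

fun pdiffs :: "'n::finite list \<Rightarrow> (real^'n \<Rightarrow> real) \<Rightarrow> real^'n \<Rightarrow> real" where
  "pdiffs [] f = f"
| "pdiffs (i # is) f = pdiff i (pdiffs is f)"

definition grad :: "(real^'n::finite \<Rightarrow> real) \<Rightarrow> real^'n \<Rightarrow> real^'n" where
  "grad f x = (\<chi> i. pdiff i f x)"

definition laplacian :: "(real^'n::finite \<Rightarrow> real) \<Rightarrow> real^'n \<Rightarrow> real" where
  "laplacian f x = (\<Sum>i\<in>UNIV. pdiffs [i, i] f x)"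

definition C2_on :: "(real^'n::finite) set \<Rightarrow> (real^'n \<Rightarrow> real) \<Rightarrow> bool" where
  "C2_on S f \<longleftrightarrow> open S \<and>
     (\<forall>x\<in>S. f differentiable (at x) \<and> (\<forall>i. pdiff i f differentiable (at x))) \<and>
     (\<forall>i j. continuous_on S (pdiffs [j, i] f))"

definition smooth :: "(real^'n::finite \<Rightarrow> real) \<Rightarrow> bool" where
  "smooth f \<longleftrightarrow> (\<forall>is x. pdiffs is f differentiable (at x))"

definition test_fun :: "(real^'n::finite) set \<Rightarrow> (real^'n \<Rightarrow> real) \<Rightarrow> bool" where
  "test_fun \<Omega> \<zeta> \<longleftrightarrow> smooth \<zeta> \<and> compact (closure {x. \<zeta> x \<noteq> 0}) \<and> closure {x. \<zeta> x \<noteq> 0} \<subseteq> \<Omega>"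

definition Lloc :: "real \<Rightarrow> (real^'n::finite) set \<Rightarrow> (real^'n \<Rightarrow> real) \<Rightarrow> bool" where
  "Lloc r \<Omega> f \<longleftrightarrow> (\<forall>K. compact K \<and> K \<subseteq> \<Omega> \<longrightarrow> set_integrable lborel K (\<lambda>x. \<bar>f x\<bar> powr r))"

definition weak_grad :: "(real^'n::finite) set \<Rightarrow> (real^'n \<Rightarrow> real) \<Rightarrow> (real^'n \<Rightarrow> real^'n) \<Rightarrow> bool" where
  "weak_grad \<Omega> u g \<longleftrightarrow> (\<forall>\<zeta> i. test_fun \<Omega> \<zeta> \<longrightarrow>
      (LINT x:\<Omega>|lborel. u x * pdiff i \<zeta> x) = - (LINT x:\<Omega>|lborel. g x $ i * \<zeta> x))"

definition W1loc :: "real \<Rightarrow> (real^'n::finite) set \<Rightarrow> (real^'n \<Rightarrow> real) \<Rightarrow> bool" where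
  "W1loc r \<Omega> u \<longleftrightarrow> Lloc r \<Omega> u \<and> (\<exists>g. weak_grad \<Omega> u g \<and> (\<forall>i. Lloc r \<Omega> (\<lambda>x. g x $ i)))"

end

theory Submission imports Defs begin

text \<open>All estimates are by explicit barriers and the maximum principle. A Keller--Osserman
supersolution that is infinite on a sphere gives $u = O(|x|^{-2/(p-1)})$. In the removable cases,
$A + l\,|x|^{-s}$ is a supersolution near $0$ for a suitable $s > 2/(p-1)$ and every small $l > 0$, and letting
$l \to 0$ shows that $u$ is bounded; for $p = N/(N-2)$ one first shows $u = o(|x|^{2-N})$.
In all cases $u = O(|x|^{-\sigma})$ with $\sigma < N - 2$ and $\sigma p < N$, which suffices to integrate
by parts across the puncture with cutoffs.
A bounded $u$ has $|\nabla u| = O(|x|^{-1})$; as $q < 2$, the Newtonian potential expands $u$ at $0$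
better than this, and iterating improves the decay of the right-hand side until $u$ has a second
order expansion together with its derivatives.\<close>

text \<open>Write k = 2/(p-1), the exponent at which u^p and the Laplacian scale alike. The
  condition on q says that the gradient term is no stronger at this scaling, (k+1)q \<le> k+2; the
  condition on p says k \<le> N-2, so u is no worse than the fundamental solution. The weak equation
  needs k < N-2. At p = N/(N-2) this fails and the decay has to be improved, which works for q <
  N/(N-1); the excluded pair is the one where both conditions are equalities. At a genuine
  singularity no pointwise gradient bound is at hand. The integrability of |grad u|^q is therefore
  read off from the equation: tested with a cutoff, all other terms converge, and Fatou's lemma
  bounds this one. In the classical part the right-hand side contains the gradient, whose decay is
  not known in advance. First and later second derivatives are bounded by maximising them times the
  distance to a sphere and absorbing the nonlinear term on a small ball. Each pass through the
  potential then turns a gradient of order |x|^{-t} into one of order |x|^{1-qt}, until qt <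
  1.\<close>

section \<open>Twice continuously differentiable functions\<close>

text \<open>\<open>G\<close> and \<open>H\<close> are the gradient and the Hessian of \<open>f\<close>; the Laplacian becomes \<open>trace H\<close>.\<close>
definition has_C2 :: "(real^'n::finite) set \<Rightarrow> (real^'n \<Rightarrow> real) \<Rightarrow> (real^'n \<Rightarrow> real^'n) \<Rightarrow>
    (real^'n \<Rightarrow> real^'n^'n) \<Rightarrow> bool" where
  "has_C2 S f G H \<longleftrightarrow> open S \<and> (\<forall>x\<in>S. (f has_derivative (\<lambda>h. G x \<bullet> h)) (at x)) \<and>
     (\<forall>x\<in>S. (G has_derivative (\<lambda>h. H x *v h)) (at x)) \<and> continuous_on S H"

lemma has_C2D:
  assumes "has_C2 S f G H"
  shows "open S" "x \<in> S \<Longrightarrow> (f has_derivative (\<lambda>h. G x \<bullet> h)) (at x)"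
    "x \<in> S \<Longrightarrow> (G has_derivative (\<lambda>h. H x *v h)) (at x)" "continuous_on S H"
    "continuous_on S f" "continuous_on S G"
proof -
  show 1: "open S" "continuous_on S H"
    and 2: "x \<in> S \<Longrightarrow> (f has_derivative (\<lambda>h. G x \<bullet> h)) (at x)"
           "x \<in> S \<Longrightarrow> (G has_derivative (\<lambda>h. H x *v h)) (at x)" for x
    using assms unfolding has_C2_def by auto
  show "continuous_on S f" "continuous_on S G"
    by (meson 2 continuous_at_imp_continuous_on has_derivative_continuous)+
qed

lemma has_C2_subset: "has_C2 S f G H \<Longrightarrow> open T \<Longrightarrow> T \<subseteq> S \<Longrightarrow> has_C2 T f G H"
  unfolding has_C2_def by (auto intro: continuous_on_subset)

lemma has_C2_Un:
  assumes "has_C2 S f G H" "has_C2 T f G H" shows "has_C2 (S \<union> T) f G H"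
  using assms unfolding has_C2_def
  by (auto intro: continuous_on_open_Un)

lemma has_C2_cong:
  assumes "has_C2 S f G H" "\<And>x. x \<in> S \<Longrightarrow> f' x = f x" "\<And>x. x \<in> S \<Longrightarrow> G' x = G x"
    "\<And>x. x \<in> S \<Longrightarrow> H' x = H x"
  shows "has_C2 S f' G' H'"
proof -
  note D = has_C2D[OF assms(1)]
  have "(f' has_derivative (\<lambda>h. G' x \<bullet> h)) (at x)" if "x \<in> S" for x
    using has_derivative_transform_within_open[OF D(2)[OF that] D(1) that, of f'] assms that by auto
  moreover have "(G' has_derivative (\<lambda>h. H' x *v h)) (at x)" if "x \<in> S" for x
    using has_derivative_transform_within_open[OF D(3)[OF that] D(1) that, of G'] assms that by auto
  moreover have "continuous_on S H'" using D(4) assms(4) by (simp cong: continuous_on_cong)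
  ultimately show ?thesis unfolding has_C2_def using D(1) by auto
qed

lemma pdiff_eqI: "(f has_derivative (\<lambda>h. g \<bullet> h)) (at x) \<Longrightarrow> pdiff i f x = g $ i"
  unfolding pdiff_def by (metis frechet_derivative_at cart_eq_inner_axis inner_commute)

lemma has_derivative_grad:
  fixes f :: "real^'n \<Rightarrow> real"
  assumes "f differentiable (at x)"
  shows "(f has_derivative (\<lambda>h. grad f x \<bullet> h)) (at x)"
proof -
  have d: "(f has_derivative frechet_derivative f (at x)) (at x)"
    using assms by (simp add: frechet_derivative_works)
  interpret linear "frechet_derivative f (at x)" using d has_derivative_linear by blast
  have "frechet_derivative f (at x) h = grad f x \<bullet> h" for h
  proof -
    have "h = (\<Sum>i\<in>UNIV. h $ i *\<^sub>R axis i 1)"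
      by (simp add: vec_eq_iff axis_def if_distrib cong: if_cong)
    then have "frechet_derivative f (at x) h = (\<Sum>i\<in>UNIV. h $ i *\<^sub>R frechet_derivative f (at x) (axis i 1))"
      by (metis (no_types, lifting) scale sum sum.cong)
    then show ?thesis by (simp add: grad_def inner_vec_def pdiff_def mult.commute)
  qed
  with d show ?thesis by (metis (full_types) ext)
qed

lemma has_derivative_vec_iff:
  fixes G :: "'a::real_normed_vector \<Rightarrow> real^'n"
  shows "(G has_derivative G') (at x) \<longleftrightarrow> (\<forall>i. ((\<lambda>x. G x $ i) has_derivative (\<lambda>h. G' h $ i)) (at x))"
  by (subst has_derivative_componentwise_within)
     (auto simp: Basis_vec_def inner_axis)

lemma mat_vec_nth: "((A::real^'n^'m) *v h) $ i = A $ i \<bullet> h"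
  by (simp add: matrix_vector_mult_def inner_vec_def)

text \<open>The way back to the notions of the statement. \<open>pdiff i f\<close> agrees with a
  component of \<open>G\<close> on \<open>S\<close> only, so the second derivatives are transferred
  along the open set \<open>S\<close>.\<close>

lemma has_C2_imp:
  assumes "has_C2 S f G H"
  shows "C2_on S f" "x \<in> S \<Longrightarrow> grad f x = G x" "x \<in> S \<Longrightarrow> laplacian f x = trace (H x)"
proof -
  note D = has_C2D[OF assms]
  have p: "pdiff i f x = G x $ i" if "x \<in> S" for i x
    using pdiff_eqI D(2) that by blast
  have dp: "(pdiff i f has_derivative (\<lambda>h. H x $ i \<bullet> h)) (at x)" if "x \<in> S" for i x
  proof -
    have "((\<lambda>x. G x $ i) has_derivative (\<lambda>h. H x $ i \<bullet> h)) (at x)"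
      using D(3)[OF that] by (simp add: has_derivative_vec_iff mat_vec_nth)
    then show ?thesis
      using has_derivative_transform_within_open[OF _ D(1) that] p by (metis (no_types, lifting))
  qed
  have pp: "pdiffs [j,i] f x = H x $ i $ j" if "x \<in> S" for i j x
    using pdiff_eqI[OF dp[OF that]] by simp
  show "C2_on S f"
    unfolding C2_on_def
  proof (intro conjI ballI allI)
    show "open S" by (rule D)
    show "f differentiable (at x)" if "x \<in> S" for x using D(2) that differentiable_def by blast
    show "pdiff i f differentiable (at x)" if "x \<in> S" for i x using dp that differentiable_def by blast
    fix i j
    have "continuous_on S (\<lambda>x. H x $ i $ j)" by (intro continuous_intros D)
    then show "continuous_on S (pdiffs [j, i] f)" using pp by (simp cong: continuous_on_cong)
  qed
  show "x \<in> S \<Longrightarrow> grad f x = G x" by (simp add: grad_def p vec_eq_iff)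
  show "x \<in> S \<Longrightarrow> laplacian f x = trace (H x)" unfolding laplacian_def trace_def using pp by simp
qed

text \<open>Row \<open>i\<close> is the gradient of \<open>pdiff i f\<close>. With this order of
  indices \<open>hess f x *v h\<close> is the derivative of \<open>grad f\<close> in the direction
  \<open>h\<close> without any appeal to the symmetry of second derivatives.\<close>

definition hess :: "(real^'n::finite \<Rightarrow> real) \<Rightarrow> real^'n \<Rightarrow> real^'n^'n" where
  "hess f x = (\<chi> i j. pdiffs [j, i] f x)"

lemma trace_hess: "trace (hess f x) = laplacian f x"
  by (simp add: trace_def hess_def laplacian_def)

lemma C2_on_imp_has_C2:
  assumes "C2_on S f" shows "has_C2 S f (grad f) (hess f)"
  unfolding has_C2_def
proof (intro conjI ballI)
  note A = assms[unfolded C2_on_def]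
  show "open S" using A by auto
  show "(f has_derivative (\<lambda>h. grad f x \<bullet> h)) (at x)" if "x \<in> S" for x
    using A that by (intro has_derivative_grad) auto
  show "(grad f has_derivative (\<lambda>h. hess f x *v h)) (at x)" if "x \<in> S" for x
    unfolding has_derivative_vec_iff mat_vec_nth
  proof
    fix i
    have "(pdiff i f has_derivative (\<lambda>h. grad (pdiff i f) x \<bullet> h)) (at x)"
      using A that by (intro has_derivative_grad) auto
    then show "((\<lambda>x. grad f x $ i) has_derivative (\<lambda>h. hess f x $ i \<bullet> h)) (at x)"
      by (simp add: grad_def hess_def)
  qed
  show "continuous_on S (hess f)"
    unfolding hess_def using A by (intro continuous_intros) auto
qed

section \<open>Calculus rules for a function together with its gradient and Hessian\<close>

definition outer :: "real^'n \<Rightarrow> real^'n \<Rightarrow> real^'n^'n::finite" where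
  "outer a b = (\<chi> i j. a $ i * b $ j)"

lemma trace_outer[simp]: "trace (outer a b) = a \<bullet> b"
  by (simp add: trace_def outer_def inner_vec_def)

lemma outer_mv: "outer a b *v h = (b \<bullet> h) *\<^sub>R a"
  by (simp add: vec_eq_iff mat_vec_nth outer_def inner_vec_def sum_distrib_right sum_distrib_left mult_ac)

lemma trace_scaleR[simp]: "trace (c *\<^sub>R (A::real^'n^'n)) = c * trace A"
  by (simp add: trace_def sum_distrib_left)

lemma trace_uminus[simp]: "trace (- (A::real^'n^'n)) = - trace A"
  by (simp add: trace_def sum_negf)

lemma continuous_on_outer[continuous_intros]:
  "continuous_on S f \<Longrightarrow> continuous_on S g \<Longrightarrow> continuous_on S (\<lambda>x. outer (f x) (g x))"
  unfolding outer_def by (intro continuous_intros)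

lemma has_C2_const: "has_C2 UNIV (\<lambda>x. c) (\<lambda>x. 0) (\<lambda>x. 0)"
  unfolding has_C2_def by (auto intro!: derivative_eq_intros)

lemma has_C2_linear: "has_C2 UNIV (\<lambda>x. g \<bullet> x) (\<lambda>x. g) (\<lambda>x. 0)"
  unfolding has_C2_def by (auto intro!: derivative_eq_intros)

lemma has_C2_add:
  assumes "has_C2 S f G H" "has_C2 S f' G' H'"
  shows "has_C2 S (\<lambda>x. f x + f' x) (\<lambda>x. G x + G' x) (\<lambda>x. H x + H' x)"
  using assms unfolding has_C2_def
  by (auto intro!: derivative_eq_intros continuous_intros simp: inner_add_left matrix_vector_mult_add_rdistrib)

lemma has_C2_cmul:
  assumes "has_C2 S f G H"
  shows "has_C2 S (\<lambda>x. c * f x) (\<lambda>x. c *\<^sub>R G x) (\<lambda>x. c *\<^sub>R H x)"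
  using assms unfolding has_C2_def
  by (auto intro!: derivative_eq_intros continuous_intros simp: scaleR_matrix_vector_assoc)

lemma has_C2_diff:
  assumes "has_C2 S f G H" "has_C2 S f' G' H'"
  shows "has_C2 S (\<lambda>x. f x - f' x) (\<lambda>x. G x - G' x) (\<lambda>x. H x - H' x)"
  using assms unfolding has_C2_def
  by (auto intro!: derivative_eq_intros continuous_intros simp: inner_diff_left matrix_vector_mult_diff_rdistrib)

lemma has_C2_mult:
  assumes "has_C2 S f G H" "has_C2 S f' G' H'"
  shows "has_C2 S (\<lambda>x. f x * f' x) (\<lambda>x. f x *\<^sub>R G' x + f' x *\<^sub>R G x)
     (\<lambda>x. f x *\<^sub>R H' x + f' x *\<^sub>R H x + (outer (G x) (G' x) + outer (G' x) (G x)))"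
proof -
  note D = has_C2D[OF assms(1)] and D' = has_C2D[OF assms(2)]
  show ?thesis unfolding has_C2_def
    by (auto intro!: derivative_eq_intros continuous_intros D D' simp: inner_add_left
       matrix_vector_mult_add_rdistrib outer_mv scaleR_matrix_vector_assoc[symmetric] algebra_simps)
qed

text \<open>The profile takes the squared distance as its argument, which is smooth also at the
  centre \<open>a\<close>. One rule thus covers barriers on full balls, mollified kernels and
  cutoffs as well as powers of the norm on a punctured space.\<close>

lemma has_C2_radial:
  fixes a :: "real^'n"
  assumes T: "\<And>t. t \<in> T \<Longrightarrow> (\<phi> has_real_derivative \<phi>' t) (at t)"
    "\<And>t. t \<in> T \<Longrightarrow> (\<phi>' has_real_derivative \<phi>'' t) (at t)" "continuous_on T \<phi>''"
    and S: "open S" "\<And>x. x \<in> S \<Longrightarrow> (norm (x - a))\<^sup>2 \<in> T"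
  shows "has_C2 S (\<lambda>x. \<phi> ((norm (x - a))\<^sup>2)) (\<lambda>x. (2 * \<phi>' ((norm (x - a))\<^sup>2)) *\<^sub>R (x - a))
     (\<lambda>x. (4 * \<phi>'' ((norm (x - a))\<^sup>2)) *\<^sub>R outer (x - a) (x - a) + (2 * \<phi>' ((norm (x - a))\<^sup>2)) *\<^sub>R mat 1)"
proof -
  have n: "((\<lambda>x. (norm (x - a))\<^sup>2) has_derivative (\<lambda>h. 2 * ((x - a) \<bullet> h))) (at x)" for x
    unfolding power2_norm_eq_inner by (auto intro!: derivative_eq_intros simp: inner_commute inner_diff_left inner_diff_right)
  have d1: "((\<lambda>x. \<phi> ((norm (x - a))\<^sup>2)) has_derivative (\<lambda>h. \<phi>' ((norm (x - a))\<^sup>2) * (2 * ((x - a) \<bullet> h)))) (at x)" if "x \<in> S" for x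
    by (rule has_derivative_compose[OF n T(1)[OF S(2)[OF that], unfolded has_field_derivative_def]])
  have d2: "((\<lambda>x. \<phi>' ((norm (x - a))\<^sup>2)) has_derivative (\<lambda>h. \<phi>'' ((norm (x - a))\<^sup>2) * (2 * ((x - a) \<bullet> h)))) (at x)" if "x \<in> S" for x
    by (rule has_derivative_compose[OF n T(2)[OF S(2)[OF that], unfolded has_field_derivative_def]])
  have c'': "continuous_on S (\<lambda>x. \<phi>'' ((norm (x - a))\<^sup>2))"
    by (rule continuous_on_compose2[OF T(3)]) (auto intro!: continuous_intros S)
  have c': "continuous_on S (\<lambda>x. \<phi>' ((norm (x - a))\<^sup>2))"
    using d2 has_derivative_continuous by (blast intro: continuous_at_imp_continuous_on)
  show ?thesis unfolding has_C2_def
  proof (intro conjI ballI)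
    show "open S" by fact
    fix x assume x: "x \<in> S"
    show "((\<lambda>x. \<phi> ((norm (x - a))\<^sup>2)) has_derivative (\<bullet>) ((2 * \<phi>' ((norm (x - a))\<^sup>2)) *\<^sub>R (x - a))) (at x)"
      by (rule has_derivative_eq_rhs[OF d1[OF x]]) (simp add: fun_eq_iff)
    show "((\<lambda>x. (2 * \<phi>' ((norm (x - a))\<^sup>2)) *\<^sub>R (x - a)) has_derivative
       (*v) ((4 * \<phi>'' ((norm (x - a))\<^sup>2)) *\<^sub>R outer (x - a) (x - a) + (2 * \<phi>' ((norm (x - a))\<^sup>2)) *\<^sub>R mat 1)) (at x)"
      by (rule derivative_eq_intros d2[OF x] refl)+
         (auto simp: fun_eq_iff matrix_vector_mult_add_rdistrib scaleR_matrix_vector_assoc[symmetric] outer_mv algebra_simps)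
  next
    show "continuous_on S (\<lambda>x. (4 * \<phi>'' ((norm (x - a))\<^sup>2)) *\<^sub>R outer (x - a) (x - a) + (2 * \<phi>' ((norm (x - a))\<^sup>2)) *\<^sub>R mat 1)"
      by (intro continuous_intros c' c'')
  qed
qed

lemma trace_radial:
  "trace ((4 * b) *\<^sub>R outer x x + (2 * c) *\<^sub>R mat 1 :: real^'n^'n) = 4 * b * (norm x)\<^sup>2 + 2 * real CARD('n) * c"
  by (simp add: trace_add trace_I power2_norm_eq_inner)

lemma has_C2_translate:
  assumes "has_C2 S f G H"
  shows "has_C2 ((\<lambda>x. x - a) ` S) (\<lambda>x. f (x + a)) (\<lambda>x. G (x + a)) (\<lambda>x. H (x + a))"
proof -
  note D = has_C2D[OF assms]
  have sh: "((\<lambda>x. x + a) has_derivative (\<lambda>h. h)) (at x)" for x :: "real^'a"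
    by (auto intro!: derivative_eq_intros)
  show ?thesis unfolding has_C2_def
  proof (intro conjI ballI)
    show "open ((\<lambda>x. x - a) ` S)" using D(1) by (rule open_translation_subtract)
    show "continuous_on ((\<lambda>x. x - a) ` S) (\<lambda>x. H (x + a))"
      by (rule continuous_on_compose2[OF D(4)]) (auto intro!: continuous_intros)
    fix x assume "x \<in> (\<lambda>x. x - a) ` S" then have x: "x + a \<in> S" by auto
    show "((\<lambda>x. f (x + a)) has_derivative (\<bullet>) (G (x + a))) (at x)"
      using has_derivative_compose[OF sh D(2)[OF x]] by simp
    show "((\<lambda>x. G (x + a)) has_derivative (*v) (H (x + a))) (at x)"
      using has_derivative_compose[OF sh D(3)[OF x]] by simp
  qed
qed

section \<open>Comparison principles\<close>

text \<open>The trace is handled one diagonal entry at a time. Were \<open>H z $ i $ i\<close>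
  positive, the \<open>i\<close>-th partial derivative, which vanishes at \<open>z\<close>, would be
  positive just beyond \<open>z\<close> on the \<open>i\<close>-th axis, and \<open>f\<close> would
  rise above its maximum.\<close>

lemma has_C2_local_max:
  assumes f: "has_C2 S f G H" and z: "z \<in> S" and mx: "\<And>x. x \<in> S \<Longrightarrow> f x \<le> f z"
  shows "G z = 0" "trace (H z) \<le> 0"
proof -
  note D = has_C2D[OF f]
  obtain e where e: "e > 0" "ball z e \<subseteq> S" using D(1) z openE by blast
  have "(\<bullet>) (G z) = (\<lambda>v. 0)"
    by (rule has_derivative_local_max[OF D(2)[OF z]])
       (use D(1) z mx in \<open>auto simp: eventually_at_topological\<close>)
  then have "G z \<bullet> G z = 0" by metis
  then show G0: "G z = 0" by simp
  have "H z $ i $ i \<le> 0" for i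
  proof (rule ccontr)
    assume neg: "\<not> H z $ i $ i \<le> 0"
    define c where "c t = z + t *\<^sub>R axis i 1" for t :: real
    have cS: "c t \<in> S" if "\<bar>t\<bar> < e" for t
      using e that by (auto simp: c_def dist_norm)
    have dc: "(c has_derivative (\<lambda>h. h *\<^sub>R axis i 1)) (at t)" for t
      unfolding c_def by (auto intro!: derivative_eq_intros)
    have df: "((\<lambda>t. f (c t)) has_real_derivative G (c t) $ i) (at t)" if "\<bar>t\<bar> < e" for t
      using has_derivative_compose[OF dc D(2)[OF cS[OF that]]]
      by (simp add: has_field_derivative_def inner_axis mult_commute_abs)
    have "((\<lambda>t. G (c t)) has_derivative (\<lambda>h. H z *v (h *\<^sub>R axis i 1))) (at 0)"
      using has_derivative_compose[OF dc D(3)[OF cS], of 0] e by (simp add: c_def)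
    then have "((\<lambda>t. G (c t) $ i) has_derivative (\<lambda>h. H z $ i \<bullet> (h *\<^sub>R axis i 1))) (at 0)"
      unfolding has_derivative_vec_iff mat_vec_nth by blast
    then have dG: "((\<lambda>t. G (c t) $ i) has_real_derivative H z $ i $ i) (at 0)"
      by (simp add: has_field_derivative_def inner_axis mult_commute_abs)
    obtain d where d: "d > 0" "\<And>h. 0 < h \<Longrightarrow> h < d \<Longrightarrow> G (c 0) $ i < G (c h) $ i"
      using DERIV_pos_inc_right[OF dG] neg by auto
    define t where "t = min d e / 2"
    have t: "0 < t" "t < d" "t < e" using d e by (auto simp: t_def)
    have "f (c 0) < f (c t)"
    proof (rule DERIV_pos_imp_increasing_open[OF t(1)])
      show "\<exists>y. ((\<lambda>t. f (c t)) has_real_derivative y) (at x) \<and> 0 < y" if "0 < x" "x < t" for x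
        using df[of x] d(2)[of x] t G0 that by (intro exI[of _ "G (c x) $ i"]) (auto simp: c_def)
      show "continuous_on {0..t} (\<lambda>t. f (c t))"
      proof (rule continuous_at_imp_continuous_on, intro ballI)
        show "isCont (\<lambda>t. f (c t)) x" if "x \<in> {0..t}" for x
          using DERIV_isCont[OF df[of x]] t that by auto
      qed
    qed
    moreover have "f (c t) \<le> f z" using mx cS[of t] t by auto
    ultimately show False by (simp add: c_def)
  qed
  then show "trace (H z) \<le> 0" by (simp add: trace_def sum_nonpos)
qed

text \<open>At a positive maximum of \<open>u - w\<close> the gradients coincide, so in
  \<open>pt\<close> the gradient terms of the two functions cancel and no linearisation of the power
  of the gradient is required. The compact \<open>K\<close> allows for a \<open>w\<close> that blows
  up at the boundary of \<open>U\<close>.\<close>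

lemma comparison:
  fixes u w :: "real^'n \<Rightarrow> real"
  assumes u: "has_C2 U u Gu Hu" and w: "has_C2 U w Gw Hw"
    and K: "compact K" "K \<subseteq> U" "\<And>x. x \<in> U - K \<Longrightarrow> u x \<le> w x"
    and pt: "\<And>x. x \<in> K \<Longrightarrow> Gu x = Gw x \<Longrightarrow> trace (Hu x) \<le> trace (Hw x) \<Longrightarrow> u x \<le> w x"
    and x: "x \<in> U"
  shows "u x \<le> w x"
proof (rule ccontr)
  assume c: "\<not> u x \<le> w x"
  note d = has_C2_diff[OF u w]
  from c K(3) x have "x \<in> K" by blast
  have "continuous_on K (\<lambda>x. u x - w x)" using has_C2D(5)[OF d] K(2) continuous_on_subset by blast
  then obtain z where z: "z \<in> K" "\<And>y. y \<in> K \<Longrightarrow> u y - w y \<le> u z - w z"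
    using continuous_attains_sup[OF K(1)] \<open>x \<in> K\<close> by blast
  have pos: "u z - w z > 0" using z(2)[OF \<open>x \<in> K\<close>] c by linarith
  have mx: "u y - w y \<le> u z - w z" if "y \<in> U" for y
    using z(2) K(3) that pos by (cases "y \<in> K") fastforce+
  have "z \<in> U" using z K by blast
  from has_C2_local_max[OF d this mx] have "Gu z = Gw z" "trace (Hu z) \<le> trace (Hw z)"
    by (auto simp: trace_sub)
  from pt[OF z(1) this] pos show False by simp
qed

text \<open>The variant for functions that are regular up to the boundary of \<open>K\<close>, where
  the inequality is known on that boundary only. It serves the half cube in the gradient
  estimate.\<close>

lemma comparison_frontier:
  fixes u w :: "real^'n \<Rightarrow> real"
  assumes u: "has_C2 S u Gu Hu" and w: "has_C2 S w Gw Hw"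
    and K: "compact K" "K \<subseteq> S" "\<And>x. x \<in> K - interior K \<Longrightarrow> u x \<le> w x"
    and pt: "\<And>x. x \<in> interior K \<Longrightarrow> Gu x = Gw x \<Longrightarrow> trace (Hu x) \<le> trace (Hw x) \<Longrightarrow> u x \<le> w x"
    and x: "x \<in> K"
  shows "u x \<le> w x"
proof (rule ccontr)
  assume c: "\<not> u x \<le> w x"
  note d = has_C2_diff[OF u w]
  have "continuous_on K (\<lambda>x. u x - w x)" using has_C2D(5)[OF d] K(2) continuous_on_subset by blast
  then obtain z where z: "z \<in> K" "\<And>y. y \<in> K \<Longrightarrow> u y - w y \<le> u z - w z"
    using continuous_attains_sup[OF K(1)] x by blast
  have pos: "u z - w z > 0" using z(2)[OF x] c by linarith
  then have zi: "z \<in> interior K" using K(3)[of z] z(1) by force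
  have di: "has_C2 (interior K) (\<lambda>x. u x - w x) (\<lambda>x. Gu x - Gw x) (\<lambda>x. Hu x - Hw x)"
    using has_C2_subset[OF d] K(2) interior_subset by blast
  have "Gu z = Gw z" "trace (Hu z) \<le> trace (Hw z)"
    using has_C2_local_max[OF di zi] z(2) interior_subset[of K] by (auto simp: trace_sub)
  from pt[OF zi this] pos show False by simp
qed

text \<open>Conjugating the Hessian by the diagonal sign matrix of the reflection multiplies the
  entry \<open>(i, j)\<close> by \<open>s i * s j\<close>, which is 1 on the diagonal; hence the
  Laplacian is preserved.\<close>

lemma has_C2_reflect:
  fixes k :: "'n::finite"
  assumes s_def: "s = (\<lambda>i. if i = k then -1 else 1 :: real)"
    and r_def: "r = (\<lambda>x::real^'n. \<chi> i. s i * x $ i)"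
    and v: "has_C2 (ball 0 R) v G H"
  shows "has_C2 (ball 0 R) (\<lambda>x. v (r x)) (\<lambda>x. r (G (r x))) (\<lambda>x. \<chi> i j. s i * s j * H (r x) $ i $ j)"
    and "trace (\<chi> i j. s i * s j * H y $ i $ j) = trace (H y)"
    and "norm (r x) = norm x"
proof -
  note D = has_C2D[OF v]
  have ss: "s i * s i = 1" for i by (simp add: s_def)
  show nr: "norm (r x) = norm x" for x
    unfolding norm_vec_def L2_set_def r_def
    by (intro arg_cong[of _ _ sqrt] sum.cong) (auto simp: s_def)
  show "trace (\<chi> i j. s i * s j * H y $ i $ j) = trace (H y)"
    by (simp add: trace_def ss)
  have lin: "linear r" by (rule linearI) (auto simp: r_def vec_eq_iff algebra_simps)
  then have bl: "bounded_linear r" by (simp add: linear_conv_bounded_linear)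
  have dr: "(r has_derivative r) (at x)" for x using bl by (rule bounded_linear_imp_has_derivative)
  have rin: "r x \<in> ball 0 R" if "x \<in> ball 0 R" for x using that nr by simp
  have rr: "a \<bullet> r b = r a \<bullet> b" for a b by (simp add: inner_vec_def r_def mult_ac)
  have rH: "r (A *v r h) = (\<chi> i j. s i * s j * A $ i $ j) *v h" for A h
    by (simp add: vec_eq_iff r_def mat_vec_nth inner_vec_def sum_distrib_left mult_ac)
  have cr: "continuous_on UNIV r" using bl by (simp add: linear_continuous_on)
  show "has_C2 (ball 0 R) (\<lambda>x. v (r x)) (\<lambda>x. r (G (r x))) (\<lambda>x. \<chi> i j. s i * s j * H (r x) $ i $ j)"
    unfolding has_C2_def
  proof (intro conjI ballI)
    fix x :: "real^'n" assume x: "x \<in> ball 0 R"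
    show "((\<lambda>x. v (r x)) has_derivative (\<bullet>) (r (G (r x)))) (at x)"
      using has_derivative_compose[OF dr D(2)[OF rin[OF x]]] by (simp add: rr)
    have "((\<lambda>x. G (r x)) has_derivative (\<lambda>h. H (r x) *v r h)) (at x)"
      by (rule has_derivative_compose[OF dr D(3)[OF rin[OF x]]])
    from has_derivative_compose[OF this dr]
    show "((\<lambda>x. r (G (r x))) has_derivative (*v) (\<chi> i j. s i * s j * H (r x) $ i $ j)) (at x)"
      by (simp add: rH)
  next
    have "continuous_on (ball 0 R) (\<lambda>x. H (r x))"
      by (rule continuous_on_compose2[OF D(4) continuous_on_subset[OF cr]]) (use rin in auto)
    then show "continuous_on (ball 0 R) (\<lambda>x. \<chi> i j. s i * s j * H (r x) $ i $ j)"
      by (intro continuous_intros)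
  qed simp
qed

section \<open>Interior estimates for the Poisson equation\<close>

text \<open>The barrier of Gilbarg and Trudinger, Section 3.4: compare the odd part of \<open>v\<close> in the direction \<open>k\<close>
with a quadratic polynomial on half a cube and divide by the distance to the symmetry plane.\<close>
lemma gradient_bound_component:
  fixes v :: "real^'n \<Rightarrow> real"
  assumes v: "has_C2 (ball 0 R) v G H" and R: "R > 0"
    and a: "\<And>x. x \<in> ball 0 R \<Longrightarrow> \<bar>v x\<bar> \<le> a" and b: "\<And>x. x \<in> ball 0 R \<Longrightarrow> \<bar>trace (H x)\<bar> \<le> b"
  shows "G 0 $ k \<le> 2 * (real CARD('n))\<^sup>2 * a / R + R * b"
proof -
  define N where "N = real CARD('n)"
  \<comment> \<open>This half side gives \<open>N * d < R\<close>, so the l1 norm keeps the whole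
    cube inside the ball.\<close>
  define d where "d = R / (2 * N)"
  have N: "N \<ge> 1" unfolding N_def by (simp add: Suc_leI)
  have d: "d > 0" "N * d = R / 2" using N R by (auto simp: d_def)
  have a0: "a \<ge> 0" using a[of 0] R by force
  have b0: "b \<ge> 0" using b[of 0] R by force
  define s where "s = (\<lambda>i. if i = k then -1 else 1 :: real)"
  define r where "r = (\<lambda>x::real^'n. \<chi> i. s i * x $ i)"
  note rf = has_C2_reflect[OF s_def r_def v]
  define \<phi> where "\<phi> = (\<lambda>x. v x - v (r x))"
  have \<phi>: "has_C2 (ball 0 R) \<phi> (\<lambda>x. G x - r (G (r x))) (\<lambda>x. H x - (\<chi> i j. s i * s j * H (r x) $ i $ j))"
    unfolding \<phi>_def by (rule has_C2_diff[OF v rf(1)])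
  \<comment> \<open>The odd part satisfies \<bar>\<phi>\<bar> \<le> 2a, and \<open>A\<close> is
    chosen so that \<open>A * d\<^sup>2\<close> equals this bound.\<close>
  define A where "A = 2 * a / d\<^sup>2"
  have A: "A \<ge> 0" "A * d\<^sup>2 = 2 * a" using a0 d by (auto simp: A_def)
  \<comment> \<open>The Laplacian of the odd part is at least -2b, that of the barrier is -2b'. With
    b' > b an interior contact is impossible, so the interior hypothesis of the comparison holds
    vacuously.\<close>
  have main: "2 * G 0 $ k \<le> A * N * d + b' * d" if b': "b' > b" for b'
  proof -
    \<comment> \<open>The coefficient of the squared \<open>k\<close>-th coordinate fixes the
      Laplacian at -2b', since the first summand contributes 2AN. The linear coefficient is the
      slope that survives at the origin and becomes the gradient bound.\<close>
    define \<psi> where "\<psi> = (\<lambda>x::real^'n. A * (norm (x - 0))\<^sup>2 + ((A * N * d + b' * d) * (axis k 1 \<bullet> x) - (A * N + b') * ((axis k 1 \<bullet> x) * (axis k 1 \<bullet> x))))"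
    have q: "has_C2 UNIV (\<lambda>x::real^'n. (norm (x - 0))\<^sup>2) (\<lambda>x. (2 * 1) *\<^sub>R (x - 0))
        (\<lambda>x. (4 * 0) *\<^sub>R outer (x - 0) (x - 0) + (2 * 1) *\<^sub>R mat 1)"
      by (rule has_C2_radial[where T=UNIV and \<phi>="\<lambda>t. t" and \<phi>'="\<lambda>t. 1" and \<phi>''="\<lambda>t. 0"])
         (auto intro!: derivative_eq_intros)
    note \<psi>0 = has_C2_add[OF has_C2_cmul[OF q, of A] has_C2_diff[OF has_C2_cmul[OF has_C2_linear]
        has_C2_cmul[OF has_C2_mult[OF has_C2_linear has_C2_linear]]]]
    have "\<exists>G\<psi> H\<psi>. has_C2 UNIV \<psi> G\<psi> H\<psi> \<and> (\<forall>x. trace (H\<psi> x) = - 2 * b')"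
      unfolding \<psi>_def
      by (rule exI, rule exI, rule conjI, rule \<psi>0, simp only: trace_add trace_sub trace_scaleR trace_outer trace_I)
         (simp add: N_def inner_axis_axis trace_0[unfolded mat_0] algebra_simps)
    then obtain G\<psi> H\<psi> where \<psi>: "has_C2 UNIV \<psi> G\<psi> H\<psi>" and tr\<psi>: "\<And>x. trace (H\<psi> x) = - 2 * b'" by blast
    \<comment> \<open>The cube is cut in half in the direction \<open>k\<close> only: the odd part
      vanishes on the face in the symmetry plane.\<close>
    define l :: "real^'n" where "l = (\<chi> i. if i = k then 0 else - d)"
    define u :: "real^'n" where "u = (\<chi> i. d)"
    have u_l: "u $ i = d" "l $ i = (if i = k then 0 else - d)" for i by (auto simp: u_def l_def)
    have "norm x < R" if x: "x \<in> cbox l u" for x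
    proof -
      have "\<bar>x $ i\<bar> \<le> d" for i using spec[OF x[unfolded mem_box_cart u_l], of i] d by (auto split: if_splits)
      then have "(\<Sum>i\<in>UNIV. \<bar>x $ i\<bar>) \<le> N * d"
        unfolding N_def by (rule order_trans[OF sum_bounded_above]) auto
      with norm_le_l1_cart[of x] d R show ?thesis by simp
    qed
    then have sub: "cbox l u \<subseteq> ball 0 R" by auto
    have le: "\<phi> x \<le> \<psi> x" if "x \<in> cbox l u" for x
    proof (rule comparison_frontier[OF \<phi> has_C2_subset[OF \<psi>] _ sub _ _ that])
      fix z assume z: "z \<in> cbox l u - interior (cbox l u)"
      have zb: "0 \<le> z $ k" "z $ k \<le> d" using z unfolding Diff_iff mem_box_cart u_l by metis+
      have zR: "z \<in> ball 0 R" "r z \<in> ball 0 R" using z sub rf(3) by auto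
      have nz: "(norm z)\<^sup>2 = (\<Sum>i\<in>UNIV. (z $ i)\<^sup>2)" by (simp add: norm_vec_def L2_set_def sum_nonneg)
      have \<phi>z: "\<phi> z \<le> A * d\<^sup>2" using a[OF zR(1)] a[OF zR(2)] A unfolding \<phi>_def by linarith
      obtain i where i: "\<not> (l $ i < z $ i \<and> z $ i < u $ i)"
        using z unfolding interior_cbox Diff_iff mem_box_cart by blast
      \<comment> \<open>In this form all three summands are nonnegative on the half cube. On the
        face in the symmetry plane \<phi> is 0; on the opposite face and on the lateral faces the
        terms with factor \<open>A\<close> alone reach \<open>A * d\<^sup>2\<close>.\<close>
      have \<psi>z: "\<psi> z = A * ((norm z)\<^sup>2 - (z $ k)\<^sup>2) + A * z $ k * (N * d - (N - 1) * z $ k) + b' * z $ k * (d - z $ k)"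
        unfolding \<psi>_def by (simp add: inner_axis' algebra_simps power2_eq_square)
      have "(N - 1) * z $ k \<le> (N - 1) * d" using N zb by (intro mult_left_mono) auto
      then have t: "0 \<le> N * d - (N - 1) * z $ k" using d by (simp add: algebra_simps)
      show "\<phi> z \<le> \<psi> z"
      proof (cases "z $ k = 0")
        case True
        then have "r z = z" by (auto simp: r_def s_def vec_eq_iff)
        then show ?thesis using A True unfolding \<psi>z by (simp add: \<phi>_def)
      next
        case k0: False
        show ?thesis
        proof (cases "z $ k = d")
          case True
          have "(z $ k)\<^sup>2 \<le> (norm z)\<^sup>2" unfolding nz by (rule member_le_sum) auto
          then have "A * d\<^sup>2 \<le> A * (norm z)\<^sup>2" using A True by (intro mult_left_mono) auto
          then show ?thesis using \<phi>z True unfolding \<psi>z by (simp add: algebra_simps power2_eq_square)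
        next
          case False
          then have ik: "i \<noteq> k" using i k0 zb by (auto simp: u_l)
          then have "\<bar>z $ i\<bar> = d" using i z unfolding Diff_iff mem_box_cart u_l
            by (smt (verit, best))
          then have "d\<^sup>2 + (z $ k)\<^sup>2 \<le> (norm z)\<^sup>2"
          proof -
            have "(\<Sum>j\<in>{i,k}. (z $ j)\<^sup>2) \<le> (norm z)\<^sup>2" unfolding nz by (rule sum_mono2) auto
            then show ?thesis using ik \<open>\<bar>z $ i\<bar> = d\<close> by (metis (no_types, lifting) empty_iff finite.emptyI finite.insertI power2_abs sum.empty sum.insert add.right_neutral singletonD)
          qed
          then have "A * d\<^sup>2 \<le> A * ((norm z)\<^sup>2 - (z $ k)\<^sup>2)" using A by (intro mult_left_mono) auto
          moreover have "0 \<le> A * z $ k * (N * d - (N - 1) * z $ k)" using A zb t by simp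
          moreover have "0 \<le> b' * z $ k * (d - z $ k)" using b' b0 zb by simp
          ultimately show ?thesis using \<phi>z unfolding \<psi>z by linarith
        qed
      qed
    next
      fix x assume x: "x \<in> interior (cbox l u)" and tr: "trace (H x - (\<chi> i j. s i * s j * H (r x) $ i $ j)) \<le> trace (H\<psi> x)"
      have xR: "x \<in> ball 0 R" "r x \<in> ball 0 R" using x sub interior_subset rf(3) by fastforce+
      have "\<bar>trace (H x)\<bar> \<le> b" "\<bar>trace (H (r x))\<bar> \<le> b" using b xR by auto
      with tr b' show "\<phi> x \<le> \<psi> x" unfolding trace_sub rf(2) tr\<psi> by linarith
    qed auto
    \<comment> \<open>Both functions vanish at the origin, so \<phi> \<le> \<psi> along the
      \<open>k\<close>-th axis compares their slopes there. The slope of the odd part is twice that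
      of \<open>v\<close>.\<close>
    define c where "c t = t *\<^sub>R (axis k 1 :: real^'n)" for t
    have dc: "(c has_derivative (\<lambda>h. h *\<^sub>R axis k 1)) (at t)" for t
      unfolding c_def by (auto intro!: derivative_eq_intros)
    have c0: "c 0 = 0" "r 0 = 0" by (auto simp: c_def r_def vec_eq_iff)
    have "(\<phi> has_derivative (\<bullet>) (G 0 - r (G 0))) (at (c 0))"
      using has_C2D(2)[OF \<phi>, of 0] R by (simp add: c0)
    from has_derivative_compose[OF dc this]
    have d\<phi>: "((\<lambda>t. \<phi> (c t)) has_real_derivative 2 * G 0 $ k) (at 0)"
      by (simp add: has_field_derivative_def inner_axis mult_commute_abs r_def s_def)
    show ?thesis
    proof (rule ccontr)
      assume "\<not> 2 * G 0 $ k \<le> A * N * d + b' * d"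
      then have pos: "2 * G 0 $ k - (A * N * d + b' * d) > 0" by simp
      have "((\<lambda>t. \<phi> (c t) - (A * N * d + b' * d) * t) has_real_derivative 2 * G 0 $ k - (A * N * d + b' * d)) (at 0)"
        by (auto intro!: derivative_eq_intros d\<phi>)
      from DERIV_pos_inc_right[OF this pos] obtain e where e: "e > 0"
        "\<And>h. 0 < h \<Longrightarrow> h < e \<Longrightarrow> \<phi> (c 0) < \<phi> (c h) - (A * N * d + b' * d) * h" by auto
      define t where "t = min d e / 2"
      have t: "0 < t" "t < d" "t < e" using d e by (auto simp: t_def)
      have "c t \<in> cbox l u" using t d unfolding mem_box_cart u_l by (auto simp: c_def axis_def)
      from le[OF this] have "\<phi> (c t) \<le> (A * N * d + b' * d) * t + (A - (A * N + b')) * t\<^sup>2"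
        unfolding \<psi>_def by (simp add: c_def inner_axis_axis algebra_simps power2_eq_square)
      moreover have "A * 1 \<le> A * N" using A N by (intro mult_left_mono) auto
      then have "(A - (A * N + b')) * t\<^sup>2 \<le> 0" using b' b0 by (intro mult_nonpos_nonneg) auto
      moreover have "\<phi> (c 0) = 0" by (simp add: c0 \<phi>_def)
      ultimately show False using e(2)[OF t(1,3)] by linarith
    qed
  qed
  \<comment> \<open>Here b' decreases to b.\<close>
  have "2 * G 0 $ k \<le> A * N * d + b * d"
  proof (rule field_le_epsilon)
    fix e :: real assume "e > 0"
    then have "2 * G 0 $ k \<le> A * N * d + (b + e / d) * d" using d by (intro main) auto
    then show "2 * G 0 $ k \<le> A * N * d + b * d + e" using d(1) by (simp add: distrib_right)
  qed
  moreover have "A * N * d = 2 * (2 * N\<^sup>2 * a / R)" using N R by (simp add: A_def d_def power2_eq_square field_simps)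
  moreover have "b * d \<le> 2 * (R * b)"
  proof -
    have "d \<le> R" using d(2) N R by (simp add: d_def field_simps)
    then have "b * d \<le> b * (2 * R)" using b0 R by (intro mult_left_mono) auto
    then show ?thesis by (simp add: mult_ac)
  qed
  ultimately show ?thesis by (simp add: N_def)
qed

text \<open>Each component costs a factor 2N^2, and adding N components in the l1 norm gives the
  third power.\<close>

definition "gradient_const (_::'n::finite itself) = 2 * (real CARD('n)) ^ 3"

lemma gradient_const_ge: "gradient_const TYPE('n::finite) \<ge> 2"
proof -
  have "1 ^ 3 \<le> real CARD('n) ^ 3" by (intro power_mono) (auto simp: Suc_leI)
  then show ?thesis by (simp add: gradient_const_def)
qed

lemma gradient_bound:
  fixes v :: "real^'n \<Rightarrow> real"
  assumes v: "has_C2 (ball z R) v G H" and R: "R > 0"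
    and a: "\<And>x. x \<in> ball z R \<Longrightarrow> \<bar>v x\<bar> \<le> a" and b: "\<And>x. x \<in> ball z R \<Longrightarrow> \<bar>trace (H x)\<bar> \<le> b"
  shows "norm (G z) \<le> gradient_const TYPE('n) * (a / R + R * b)"
proof -
  have im: "(\<lambda>x. x - z) ` ball z R = ball 0 R"
    by (auto simp: dist_norm image_iff norm_minus_commute intro!: bexI[of _ "_ + z"])
  have t: "x + z \<in> ball z R" if "x \<in> ball 0 R" for x using that by (simp add: dist_norm norm_minus_commute)
  note v0 = has_C2_translate[OF v, of z, unfolded im]
  have up: "G z $ k \<le> 2 * (real CARD('n))\<^sup>2 * a / R + R * b" for k
    using gradient_bound_component[OF v0 R] a b t by force
  have lo: "- G z $ k \<le> 2 * (real CARD('n))\<^sup>2 * a / R + R * b" for k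
    using gradient_bound_component[OF has_C2_cmul[OF v0, of "-1"] R, of a b k] a b t by force
  have N: "real CARD('n) \<ge> 1" by (simp add: Suc_leI)
  have ab: "a \<ge> 0" "b \<ge> 0" using a[of z] b[of z] R by force+
  have "norm (G z) \<le> (\<Sum>k\<in>UNIV. \<bar>G z $ k\<bar>)" by (rule norm_le_l1_cart)
  also have "\<dots> \<le> real CARD('n) * (2 * (real CARD('n))\<^sup>2 * a / R + R * b)"
    by (rule order_trans[OF sum_bounded_above]) (use up lo in \<open>auto simp: abs_le_iff\<close>)
  also have "\<dots> \<le> gradient_const TYPE('n) * (a / R + R * b)"
  proof -
    have "1 \<le> (real CARD('n))\<^sup>2" using N by (rule one_le_power)
    then have "real CARD('n) * 1 \<le> real CARD('n) * (2 * (real CARD('n))\<^sup>2)" using N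
      by (intro mult_left_mono) linarith+
    then have "real CARD('n) * (R * b) \<le> 2 * real CARD('n) ^ 3 * (R * b)"
      using R ab by (intro mult_right_mono) (auto simp: power2_eq_square power3_eq_cube)
    then show ?thesis unfolding gradient_const_def by (simp add: algebra_simps power2_eq_square power3_eq_cube)
  qed
  finally show ?thesis .
qed


section \<open>Second derivatives through difference quotients\<close>

lemma norm_matrix_vector_le: "norm ((A::real^'n^'m) *v h) \<le> norm A * norm h"
proof -
  have "norm (A *v h) \<le> L2_set (\<lambda>i. norm (A $ i) * norm h) UNIV"
    unfolding norm_vec_def[of "A *v h"] mat_vec_nth
    by (rule L2_set_mono) (auto simp: Cauchy_Schwarz_ineq2)
  also have "\<dots> = norm A * norm h"
    unfolding norm_vec_def[of A] by (rule L2_set_left_distrib[symmetric]) simp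
  finally show ?thesis .
qed

lemma norm_matrix_le_columns:
  fixes A :: "real^'n^'n"
  assumes "\<And>k. norm (A *v axis k 1) \<le> b"
  shows "norm A \<le> (real CARD('n))\<^sup>2 * b"
proof -
  have e: "\<bar>A $ i $ k\<bar> \<le> b" for i k
  proof -
    have "\<bar>(A *v axis k 1) $ i\<bar> \<le> norm (A *v axis k 1)" by (rule component_le_norm_cart)
    then show ?thesis using assms[of k] by (simp add: mat_vec_nth inner_axis)
  qed
  have "norm (A $ i) \<le> real CARD('n) * b" for i
    by (rule order_trans[OF norm_le_l1_cart order_trans[OF sum_bounded_above]]) (use e in auto)
  then have "(\<Sum>i\<in>UNIV. norm (A $ i)) \<le> real CARD('n) * (real CARD('n) * b)"
    by (intro order_trans[OF sum_bounded_above]) auto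
  moreover have "norm A \<le> (\<Sum>i\<in>UNIV. norm (A $ i))"
    unfolding norm_vec_def by (rule L2_set_le_sum) auto
  ultimately show ?thesis by (simp add: power2_eq_square)
qed

lemma has_C2_lipschitz:
  assumes v: "has_C2 S v G H" and T: "convex T" "T \<subseteq> S" and xy: "x \<in> T" "y \<in> T"
  shows "(\<And>x. x \<in> T \<Longrightarrow> norm (G x) \<le> a) \<Longrightarrow> \<bar>v x - v y\<bar> \<le> a * norm (x - y)"
    and "(\<And>x. x \<in> T \<Longrightarrow> norm (H x) \<le> b) \<Longrightarrow> norm (G x - G y) \<le> b * norm (x - y)"
proof -
  note D = has_C2D[OF v]
  { assume a: "\<And>x. x \<in> T \<Longrightarrow> norm (G x) \<le> a"
    have "norm (v x - v y) \<le> a * norm (x - y)"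
    proof (rule differentiable_bound[OF T(1) _ _ xy])
      show "(v has_derivative (\<bullet>) (G x)) (at x within T)" if "x \<in> T" for x
        using D(2) T that by (blast intro: has_derivative_at_withinI)
      show "onorm ((\<bullet>) (G x)) \<le> a" if "x \<in> T" for x
        by (rule onorm_le, rule order_trans[OF Cauchy_Schwarz_ineq2[folded real_norm_def]])
           (use a[OF that] in \<open>auto intro: mult_right_mono\<close>)
    qed
    then show "\<bar>v x - v y\<bar> \<le> a * norm (x - y)" by simp }
  { assume b: "\<And>x. x \<in> T \<Longrightarrow> norm (H x) \<le> b"
    show "norm (G x - G y) \<le> b * norm (x - y)"
    proof (rule differentiable_bound[OF T(1) _ _ xy])
      show "(G has_derivative (*v) (H x)) (at x within T)" if "x \<in> T" for x
        using D(3) T that by (blast intro: has_derivative_at_withinI)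
      show "onorm ((*v) (H x)) \<le> b" if "x \<in> T" for x
        by (rule onorm_le, rule order_trans[OF norm_matrix_vector_le])
           (use b[OF that] in \<open>auto intro: mult_right_mono\<close>)
    qed }
qed

text \<open>The factor N^2 leads from columns to the whole matrix; the 2 comes from working on the
  ball of half the radius.\<close>

definition "hessian_const (i::'n::finite itself) = 2 * (real CARD('n))\<^sup>2 * gradient_const i"

lemma hessian_const_ge: "hessian_const TYPE('n::finite) \<ge> 4"
proof -
  have "2 * 1\<^sup>2 * 2 \<le> 2 * (real CARD('n))\<^sup>2 * gradient_const TYPE('n)"
    using gradient_const_ge[where 'n='n] by (intro mult_mono power_mono) (auto simp: Suc_leI)
  then show ?thesis by (simp add: hessian_const_def)
qed

text \<open>There are no third derivatives, so the gradient bound is applied to the difference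
  quotients of \<open>v\<close> in a coordinate direction. They are bounded by \<open>a\<close>,
  because \<open>a\<close> is a Lipschitz constant of \<open>v\<close>, and their Laplacian is
  bounded by \<open>L\<close>. Their gradient at \<open>z\<close> tends to a column of
  \<open>H z\<close>.\<close>

lemma hessian_bound:
  fixes v :: "real^'n \<Rightarrow> real"
  assumes v: "has_C2 (ball z R) v G H" and R: "R > 0"
    and a: "\<And>x. x \<in> ball z R \<Longrightarrow> norm (G x) \<le> a"
    and L: "\<And>x y. x \<in> ball z R \<Longrightarrow> y \<in> ball z R \<Longrightarrow> \<bar>trace (H x) - trace (H y)\<bar> \<le> L * norm (x - y)"
  shows "norm (H z) \<le> hessian_const TYPE('n) * (a / R + R * L)"
proof -
  note D = has_C2D[OF v]
  have zR: "z \<in> ball z R" using R by simp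
  have L0: "L \<ge> 0"
  proof -
    have "z + (R/2) *\<^sub>R axis undefined 1 \<in> ball z R" using R by (simp add: dist_norm)
    from L[OF zR this] R have "0 \<le> L * (R/2)" by (simp add: norm_minus_commute) (smt (verit))
    then show ?thesis using R by (simp add: zero_le_mult_iff)
  qed
  have "norm (H z *v axis k 1) \<le> gradient_const TYPE('n) * (2 * a / R + R * L)" for k
  proof -
    define e where "e = (axis k 1 :: real^'n)"
    have ne: "norm e = 1" by (simp add: e_def)
    define q where "q h = (1/h) *\<^sub>R (G (z + h *\<^sub>R e) - G z)" for h :: real
    have "((\<lambda>h. z + h *\<^sub>R e) has_derivative (\<lambda>h. h *\<^sub>R e)) (at 0)"
      by (auto intro!: derivative_eq_intros)
    from has_derivative_compose[OF this, of G "\<lambda>h. H z *v h"] D(3)[OF zR]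
    have "((\<lambda>h. G (z + h *\<^sub>R e)) has_derivative (\<lambda>h. H z *v (h *\<^sub>R e))) (at 0)" by simp
    then have "((\<lambda>h. G (z + h *\<^sub>R e) $ i) has_derivative (\<lambda>h. (H z *v (h *\<^sub>R e)) $ i)) (at 0)" for i
      unfolding has_derivative_vec_iff by blast
    then have "((\<lambda>h. G (z + h *\<^sub>R e) $ i) has_real_derivative (H z *v e) $ i) (at 0)" for i
      by (simp add: has_field_derivative_def mat_vec_nth mult_commute_abs)
    then have lim: "(q \<longlongrightarrow> H z *v e) (at 0)"
      by (intro vec_tendstoI) (simp add: DERIV_def q_def)
    \<comment> \<open>For x in the half ball and \<bar>h\<bar> < R/2 the shifted point stays in the
      full ball, so all bounds are available at both points of the quotient.\<close>
    have bd: "norm (q h) \<le> gradient_const TYPE('n) * (2 * a / R + R * L)" if h: "h \<noteq> 0" "\<bar>h\<bar> < R/2" for h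
    proof -
      have tr: "x + h *\<^sub>R e \<in> ball z R" "x \<in> ball z R" if "x \<in> ball z (R/2)" for x
      proof -
        have "dist z x < R/2" using that by simp
        moreover have "dist z (x + h *\<^sub>R e) \<le> dist z x + \<bar>h\<bar>"
          using dist_triangle[of z "x + h *\<^sub>R e" x] by (simp add: dist_norm ne)
        ultimately show "x + h *\<^sub>R e \<in> ball z R" "x \<in> ball z R" using h R by auto
      qed
      have im: "ball z (R/2) \<subseteq> (\<lambda>x. x - h *\<^sub>R e) ` ball z R"
        using tr(1) by (force simp: image_iff intro!: bexI[of _ "_ + h *\<^sub>R e"])
      have sub: "ball z (R/2) \<subseteq> ball z R" using tr(2) by auto
      have c2: "has_C2 (ball z (R/2)) (\<lambda>x. (1/h) * (v (x + h *\<^sub>R e) - v x))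
        (\<lambda>x. (1/h) *\<^sub>R (G (x + h *\<^sub>R e) - G x)) (\<lambda>x. (1/h) *\<^sub>R (H (x + h *\<^sub>R e) - H x))"
        by (intro has_C2_cmul has_C2_diff has_C2_subset[OF has_C2_translate[OF v] _ im] has_C2_subset[OF v _ sub]) auto
      have "norm (q h) \<le> gradient_const TYPE('n) * (a / (R/2) + (R/2) * L)"
        unfolding q_def
      proof (rule gradient_bound[OF c2])
        show "\<bar>1 / h * (v (x + h *\<^sub>R e) - v x)\<bar> \<le> a" if "x \<in> ball z (R/2)" for x
          using has_C2_lipschitz(1)[OF v convex_ball subset_refl tr[OF that] a] h ne
          by (simp add: abs_mult field_simps)
        show "\<bar>trace ((1/h) *\<^sub>R (H (x + h *\<^sub>R e) - H x))\<bar> \<le> L" if "x \<in> ball z (R/2)" for x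
          using L[OF tr[OF that]] h ne by (simp add: trace_sub abs_mult field_simps)
      qed (use R in auto)
      also have "\<dots> \<le> gradient_const TYPE('n) * (2 * a / R + R * L)"
        using gradient_const_ge[where 'n='n] L0 R by (intro mult_left_mono add_mono) (auto simp: mult.commute)
      finally show ?thesis .
    qed
    have "eventually (\<lambda>h. norm (q h) \<le> gradient_const TYPE('n) * (2 * a / R + R * L)) (at 0)"
      unfolding eventually_at using bd R by (intro exI[of _ "R/2"]) auto
    from tendsto_upperbound[OF tendsto_norm[OF lim] this] show ?thesis by (simp add: e_def)
  qed
  from norm_matrix_le_columns[OF this]
  have "norm (H z) \<le> (real CARD('n))\<^sup>2 * (gradient_const TYPE('n) * (2 * a / R + R * L))" .
  also have "\<dots> \<le> (real CARD('n))\<^sup>2 * (gradient_const TYPE('n) * (2 * (a / R + R * L)))"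
    using gradient_const_ge[where 'n='n] L0 R by (intro mult_left_mono) (auto simp: mult.commute)
  also have "\<dots> = hessian_const TYPE('n) * (a / R + R * L)" by (simp add: hessian_const_def)
  finally show ?thesis .
qed

section \<open>Integrals of powers of the norm\<close>

lemma nn_integral_affine:
  fixes f :: "'a::euclidean_space \<Rightarrow> ennreal"
  assumes [measurable]: "f \<in> borel_measurable borel" and c: "c \<noteq> 0"
  shows "(\<integral>\<^sup>+x. f x \<partial>lborel) = ennreal (\<bar>c\<bar> ^ DIM('a)) * (\<integral>\<^sup>+x. f (t + c *\<^sub>R x) \<partial>lborel)"
  by (subst lborel_affine[OF c, of t])
     (simp add: nn_integral_density nn_integral_distr nn_integral_cmult ennreal_power)

lemma integrable_affine:
  fixes f :: "'a::euclidean_space \<Rightarrow> real"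
  assumes f: "integrable lborel f" and c: "c \<noteq> 0"
  shows "integrable lborel (\<lambda>x. f (t + c *\<^sub>R x))"
    "(LINT x|lborel. f x) = \<bar>c\<bar> ^ DIM('a) * (LINT x|lborel. f (t + c *\<^sub>R x))"
proof -
  have [measurable]: "f \<in> borel_measurable borel" using borel_measurable_integrable[OF f] by simp
  have "(\<integral>\<^sup>+x. ennreal (norm (f x)) \<partial>lborel) < \<infinity>" using f by (simp add: integrable_iff_bounded)
  then have "(\<integral>\<^sup>+x. ennreal (norm (f (t + c *\<^sub>R x))) \<partial>lborel) < \<infinity>"
    using nn_integral_affine[of "\<lambda>x. ennreal (norm (f x))" c t] c by (auto simp: ennreal_mult_less_top)
  then show 1: "integrable lborel (\<lambda>x. f (t + c *\<^sub>R x))" by (intro integrableI_bounded) auto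
  show "(LINT x|lborel. f x) = \<bar>c\<bar> ^ DIM('a) * (LINT x|lborel. f (t + c *\<^sub>R x))"
    by (subst lborel_affine[OF c, of t])
       (simp add: integral_density integral_distr)
qed

lemma nn_integral_bound_imp:
  fixes f :: "'a \<Rightarrow> real"
  assumes [measurable]: "f \<in> borel_measurable M" and b: "(\<integral>\<^sup>+x. ennreal \<bar>f x\<bar> \<partial>M) \<le> ennreal C" and C: "C \<ge> 0"
  shows "integrable M f" "\<bar>LINT x|M. f x\<bar> \<le> C"
proof -
  show i: "integrable M f"
    using b by (intro integrableI_bounded) (auto simp: le_less_trans)
  have "\<bar>LINT x|M. f x\<bar> \<le> (LINT x|M. \<bar>f x\<bar>)" by (rule integral_abs_bound)
  also have "ennreal (LINT x|M. \<bar>f x\<bar>) = (\<integral>\<^sup>+x. ennreal \<bar>f x\<bar> \<partial>M)"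
    by (rule nn_integral_eq_integral[symmetric]) (use i in auto)
  with b C have "(LINT x|M. \<bar>f x\<bar>) \<le> C" by (metis ennreal_le_iff)
  finally show "\<bar>LINT x|M. f x\<bar> \<le> C" .
qed

text \<open>Homogeneity: the dilation by \<rho> multiplies the weight by \<rho>^{-\<gamma>} and the
  measure by \<rho>^N, so one radius determines all the others.\<close>

lemma power_integral_scale:
  fixes \<gamma> :: real
  assumes [measurable]: "A \<in> sets borel" and \<rho>: "\<rho> > 0"
    and A: "\<And>y::'a::euclidean_space. \<rho> *\<^sub>R y \<in> B \<longleftrightarrow> y \<in> A" and [measurable]: "B \<in> sets borel"
    and b: "(\<integral>\<^sup>+y. ennreal (norm y powr (-\<gamma>)) * indicator A y \<partial>(lborel::'a measure)) \<le> ennreal C" and C: "C \<ge> 0"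
  shows "(\<integral>\<^sup>+y. ennreal (norm y powr (-\<gamma>)) * indicator B y \<partial>lborel) \<le> ennreal (C * \<rho> powr (DIM('a) - \<gamma>))"
proof -
  have "(\<integral>\<^sup>+y. ennreal (norm y powr (-\<gamma>)) * indicator B y \<partial>lborel)
     = ennreal (\<bar>\<rho>\<bar> ^ DIM('a)) * (\<integral>\<^sup>+y. ennreal (norm (0 + \<rho> *\<^sub>R y) powr (-\<gamma>)) * indicator B (0 + \<rho> *\<^sub>R y) \<partial>lborel)"
    by (rule nn_integral_affine) (use \<rho> in auto)
  also have "\<dots> = ennreal (\<bar>\<rho>\<bar> ^ DIM('a)) * (\<integral>\<^sup>+y. ennreal (\<rho> powr (-\<gamma>)) * (ennreal (norm y powr (-\<gamma>)) * indicator A y) \<partial>lborel)"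
  proof (rule arg_cong[OF nn_integral_cong])
    fix y :: 'a
    have "ennreal (norm (0 + \<rho> *\<^sub>R y) powr (-\<gamma>)) = ennreal (\<rho> powr (-\<gamma>)) * ennreal (norm y powr (-\<gamma>))"
      using \<rho> by (simp add: powr_mult ennreal_mult)
    moreover have "indicator B (0 + \<rho> *\<^sub>R y) = (indicator A y :: ennreal)" by (simp add: indicator_def A)
    ultimately show "ennreal (norm (0 + \<rho> *\<^sub>R y) powr (-\<gamma>)) * indicator B (0 + \<rho> *\<^sub>R y)
        = ennreal (\<rho> powr (-\<gamma>)) * (ennreal (norm y powr (-\<gamma>)) * indicator A y)" by (simp add: mult.assoc)
  qed
  also have "\<dots> = ennreal (\<bar>\<rho>\<bar> ^ DIM('a)) * (ennreal (\<rho> powr (-\<gamma>)) * (\<integral>\<^sup>+y. (ennreal (norm y powr (-\<gamma>)) * indicator A y) \<partial>lborel))"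
    by (subst nn_integral_cmult) auto
  also have "\<dots> \<le> ennreal (\<bar>\<rho>\<bar> ^ DIM('a)) * (ennreal (\<rho> powr (-\<gamma>)) * ennreal C)"
    by (intro mult_left_mono b) auto
  also have "\<dots> = ennreal (C * \<rho> powr (DIM('a) - \<gamma>))"
    using \<rho> C by (simp add: ennreal_mult'[symmetric] powr_realpow[symmetric] powr_add[symmetric] powr_diff divide_inverse powr_minus mult_ac)
  finally show ?thesis .
qed

text \<open>Dyadic shells stand in for polar coordinates. All are dilates of the shell 1 \<le> |y| <
  2, where the weight is bounded.\<close>

lemma annulus_integral:
  fixes \<gamma> :: real
  obtains c where "c \<ge> 0" "\<And>k. (\<integral>\<^sup>+y. ennreal (norm y powr (-\<gamma>)) * indicator {y. 2 powr k \<le> norm y \<and> norm y < 2 powr (k + 1)} y \<partial>(lborel::'a::euclidean_space measure))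
     \<le> ennreal (c * 2 powr (k * (DIM('a) - \<gamma>)))"
proof -
  define J where "J k = (\<integral>\<^sup>+y. ennreal (norm y powr (-\<gamma>)) * indicator {y. 2 powr k \<le> norm y \<and> norm y < 2 powr (k + 1)} y \<partial>(lborel::'a measure))" for k :: real
  have "J 0 \<le> (\<integral>\<^sup>+y. ennreal (2 powr \<bar>\<gamma>\<bar>) * indicator (ball 0 2) y \<partial>(lborel::'a measure))"
    unfolding J_def
  proof (rule nn_integral_mono)
    fix y :: 'a
    have "norm y powr (-\<gamma>) \<le> 2 powr \<bar>\<gamma>\<bar>" if "1 \<le> norm y" "norm y < 2"
    proof -
      have "norm y powr (-\<gamma>) \<le> norm y powr \<bar>\<gamma>\<bar>" using that by (intro powr_mono) auto
      also have "\<dots> \<le> 2 powr \<bar>\<gamma>\<bar>" using that by (intro powr_mono2) auto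
      finally show ?thesis .
    qed
    then show "ennreal (norm y powr - \<gamma>) * indicator {y. 2 powr 0 \<le> norm y \<and> norm y < 2 powr (0 + 1)} y
         \<le> ennreal (2 powr \<bar>\<gamma>\<bar>) * indicator (ball 0 2) y"
      by (auto simp: indicator_def intro!: ennreal_leI)
  qed
  also have "\<dots> = ennreal (2 powr \<bar>\<gamma>\<bar>) * emeasure lborel (ball (0::'a) 2)" by (simp add: nn_integral_cmult_indicator)
  also have "\<dots> < \<infinity>" using emeasure_lborel_ball_finite by (auto simp: ennreal_mult_less_top)
  finally have fin: "J 0 < \<infinity>" .
  define c where "c = enn2real (J 0)"
  have c: "J 0 = ennreal c" "c \<ge> 0" using fin by (auto simp: c_def less_top)
  have J0: "J 0 \<le> ennreal c" using c by simp
  have "J k \<le> ennreal (c * (2 powr k) powr (DIM('a) - \<gamma>))" for k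
    unfolding J_def
    by (rule power_integral_scale[OF _ _ _ _ J0[unfolded J_def] c(2)]) (auto simp: powr_add)
  then show ?thesis using that[OF c(2)] unfolding J_def by (simp add: powr_powr)
qed

lemma dyadic_ex:
  assumes "t > 0" obtains k :: int where "2 powr k \<le> (t::real)" "t < 2 powr (k + 1)"
  using floor_log_eq_powr_iff[OF assms, of 2 "\<lfloor>log 2 t\<rfloor>"] by auto

lemma dyadic_series:
  fixes J :: "nat \<Rightarrow> ennreal"
  assumes "\<And>j. J j \<le> ennreal (c * r ^ j)" "0 \<le> r" "r < 1" "c \<ge> 0"
  shows "(\<Sum>j. J j) \<le> ennreal (c / (1 - r))"
proof -
  have "(\<Sum>j. J j) \<le> (\<Sum>j. ennreal (c * r ^ j))" by (intro suminf_le assms) auto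
  also have "\<dots> = ennreal (\<Sum>j. c * r ^ j)"
    by (rule suminf_ennreal2) (use assms in \<open>auto intro!: summable_mult summable_geometric\<close>)
  also have "(\<Sum>j. c * r ^ j) = c / (1 - r)"
    using assms by (simp add: suminf_mult suminf_geometric summable_geometric)
  finally show ?thesis .
qed

text \<open>The shells inside the unit ball contribute a geometric series of ratio
  2^{-(N-\<gamma>)}; a dilation then reaches every radius.\<close>

lemma power_integral_near:
  fixes \<gamma> :: real
  assumes \<gamma>: "\<gamma> < DIM('a::euclidean_space)"
  shows "\<exists>C\<ge>0. \<forall>\<rho>>0. (\<integral>\<^sup>+y. ennreal (norm y powr (-\<gamma>)) * indicator (ball 0 \<rho>) y \<partial>(lborel::'a measure))
    \<le> ennreal (C * \<rho> powr (DIM('a) - \<gamma>))"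
proof -
  obtain c where c: "c \<ge> 0" "\<And>k. (\<integral>\<^sup>+y. ennreal (norm y powr (-\<gamma>)) * indicator {y. 2 powr k \<le> norm y \<and> norm y < 2 powr (k + 1)} y \<partial>(lborel::'a measure))
     \<le> ennreal (c * 2 powr (k * (DIM('a) - \<gamma>)))" by (rule annulus_integral[where 'a='a and \<gamma>=\<gamma>], rule that)
  define A where "A j = {y::'a. 2 powr (- real j - 1) \<le> norm y \<and> norm y < 2 powr (- real j)}" for j
  have [measurable]: "A j \<in> sets borel" for j unfolding A_def by measurable
  define r where "r = 2 powr (- (DIM('a) - \<gamma>))"
  have r: "0 \<le> r" "r < 1" using \<gamma> powr_less_cancel_iff[of 2 "- (DIM('a) - \<gamma>)" 0] by (auto simp: r_def)
  have "(\<integral>\<^sup>+y. ennreal (norm y powr (-\<gamma>)) * indicator (ball 0 1) y \<partial>(lborel::'a measure))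
      \<le> (\<integral>\<^sup>+y. (\<Sum>j. ennreal (norm y powr (-\<gamma>)) * indicator (A j) y) \<partial>(lborel::'a measure))"
  proof (rule nn_integral_mono)
    fix y :: 'a
    show "ennreal (norm y powr (-\<gamma>)) * indicator (ball 0 1) y \<le> (\<Sum>j. ennreal (norm y powr (-\<gamma>)) * indicator (A j) y)"
    proof (cases "y = 0 \<or> norm y \<ge> 1")
      \<comment> \<open>The shells do not cover the origin, but \<open>0 powr (-\<gamma>)\<close> is
        0 by convention, so nothing is lost there.\<close>
      case True then show ?thesis by (auto simp: indicator_def)
    next
      case False
      then obtain k :: int where k: "2 powr k \<le> norm y" "norm y < 2 powr (k + 1)" using dyadic_ex[of "norm y"] by auto
      have "2 powr k < 2 powr 0" using k False by auto
      then have "k < 0" using powr_less_cancel[of 2 "real_of_int k" 0] by simp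
      then have "y \<in> A (nat (- k - 1))" using k by (auto simp: A_def add.commute)
      then have "ennreal (norm y powr (-\<gamma>)) * indicator (ball 0 1) y \<le> (\<Sum>j\<in>{nat (- k - 1)}. ennreal (norm y powr (-\<gamma>)) * indicator (A j) y)"
        by (auto simp: indicator_def)
      also have "\<dots> \<le> (\<Sum>j. ennreal (norm y powr (-\<gamma>)) * indicator (A j) y)"
        by (rule sum_le_suminf) auto
      finally show ?thesis .
    qed
  qed
  also have "\<dots> = (\<Sum>j. \<integral>\<^sup>+y. ennreal (norm y powr (-\<gamma>)) * indicator (A j) y \<partial>(lborel::'a measure))"
    by (rule nn_integral_suminf) auto
  also have "\<dots> \<le> ennreal ((c * r) / (1 - r))"
  proof (rule dyadic_series)
    fix j
    have "2 powr ((- real j - 1) * (DIM('a) - \<gamma>)) = r * r ^ j"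
      unfolding r_def by (simp add: powr_realpow[symmetric] powr_powr powr_add[symmetric] algebra_simps)
    then show "(\<integral>\<^sup>+y. ennreal (norm y powr (-\<gamma>)) * indicator (A j) y \<partial>(lborel::'a measure)) \<le> ennreal (c * r * r ^ j)"
      using c(2)[of "- real j - 1"] by (simp add: A_def mult.assoc)
  qed (use r c in auto)
  finally have 1: "(\<integral>\<^sup>+y. ennreal (norm y powr (-\<gamma>)) * indicator (ball 0 1) y \<partial>(lborel::'a measure)) \<le> ennreal ((c * r) / (1 - r))" .
  have C: "(c * r) / (1 - r) \<ge> 0" using c r by simp
  show ?thesis
  proof (intro exI conjI allI impI)
    show "(\<integral>\<^sup>+y. ennreal (norm y powr (-\<gamma>)) * indicator (ball 0 \<rho>) y \<partial>(lborel::'a measure))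
      \<le> ennreal (((c * r) / (1 - r)) * \<rho> powr (DIM('a) - \<gamma>))" if "\<rho> > 0" for \<rho>
      using that by (intro power_integral_scale[OF _ _ _ _ 1 C]) auto
  qed (rule C)
qed

lemma power_integral_far:
  fixes \<gamma> :: real
  assumes \<gamma>: "\<gamma> > DIM('a::euclidean_space)"
  shows "\<exists>C\<ge>0. \<forall>\<rho>>0. (\<integral>\<^sup>+y. ennreal (norm y powr (-\<gamma>)) * indicator {y. \<rho> \<le> norm y} y \<partial>(lborel::'a measure))
    \<le> ennreal (C * \<rho> powr (DIM('a) - \<gamma>))"
proof -
  obtain c where c: "c \<ge> 0" "\<And>k. (\<integral>\<^sup>+y. ennreal (norm y powr (-\<gamma>)) * indicator {y. 2 powr k \<le> norm y \<and> norm y < 2 powr (k + 1)} y \<partial>(lborel::'a measure))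
     \<le> ennreal (c * 2 powr (k * (DIM('a) - \<gamma>)))" by (rule annulus_integral[where 'a='a and \<gamma>=\<gamma>], rule that)
  define A where "A j = {y::'a. 2 powr (real j) \<le> norm y \<and> norm y < 2 powr (real j + 1)}" for j
  have [measurable]: "A j \<in> sets borel" for j unfolding A_def by measurable
  define r where "r = 2 powr (DIM('a) - \<gamma>)"
  have r: "0 \<le> r" "r < 1" using \<gamma> powr_less_cancel_iff[of 2 "(DIM('a) - \<gamma>)" 0] by (auto simp: r_def)
  have "(\<integral>\<^sup>+y. ennreal (norm y powr (-\<gamma>)) * indicator {y. 1 \<le> norm y} y \<partial>(lborel::'a measure))
      \<le> (\<integral>\<^sup>+y. (\<Sum>j. ennreal (norm y powr (-\<gamma>)) * indicator (A j) y) \<partial>(lborel::'a measure))"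
  proof (rule nn_integral_mono)
    fix y :: 'a
    show "ennreal (norm y powr (-\<gamma>)) * indicator {y. 1 \<le> norm y} y \<le> (\<Sum>j. ennreal (norm y powr (-\<gamma>)) * indicator (A j) y)"
    proof (cases "norm y < 1")
      case True then show ?thesis by (auto simp: indicator_def)
    next
      case False
      then have "norm y > 0" by linarith
      then obtain k :: int where k: "2 powr k \<le> norm y" "norm y < 2 powr (k + 1)" using dyadic_ex[of "norm y"] by auto
      have "2 powr 0 < 2 powr (real_of_int k + 1)" using k False by auto
      then have "k \<ge> 0" using powr_less_cancel[of 2 0 "real_of_int k + 1"] by simp
      then have "y \<in> A (nat k)" using k by (auto simp: A_def)
      then have "ennreal (norm y powr (-\<gamma>)) * indicator {y. 1 \<le> norm y} y \<le> (\<Sum>j\<in>{nat k}. ennreal (norm y powr (-\<gamma>)) * indicator (A j) y)"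
        by (auto simp: indicator_def)
      also have "\<dots> \<le> (\<Sum>j. ennreal (norm y powr (-\<gamma>)) * indicator (A j) y)"
        by (rule sum_le_suminf) auto
      finally show ?thesis .
    qed
  qed
  also have "\<dots> = (\<Sum>j. \<integral>\<^sup>+y. ennreal (norm y powr (-\<gamma>)) * indicator (A j) y \<partial>(lborel::'a measure))"
    by (rule nn_integral_suminf) auto
  also have "\<dots> \<le> ennreal (c / (1 - r))"
  proof (rule dyadic_series)
    fix j
    have "2 powr (real j * (DIM('a) - \<gamma>)) = r ^ j"
      unfolding r_def by (simp add: powr_realpow[symmetric] powr_powr mult.commute)
    then show "(\<integral>\<^sup>+y. ennreal (norm y powr (-\<gamma>)) * indicator (A j) y \<partial>(lborel::'a measure)) \<le> ennreal (c * r ^ j)"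
      using c(2)[of "real j"] by (simp add: A_def)
  qed (use r c in auto)
  finally have 1: "(\<integral>\<^sup>+y. ennreal (norm y powr (-\<gamma>)) * indicator {y. 1 \<le> norm y} y \<partial>(lborel::'a measure)) \<le> ennreal (c / (1 - r))" .
  have C: "c / (1 - r) \<ge> 0" using c r by simp
  show ?thesis
  proof (intro exI conjI allI impI)
    show "(\<integral>\<^sup>+y. ennreal (norm y powr (-\<gamma>)) * indicator {y. \<rho> \<le> norm y} y \<partial>(lborel::'a measure))
      \<le> ennreal ((c / (1 - r)) * \<rho> powr (DIM('a) - \<gamma>))" if "\<rho> > 0" for \<rho>
      using that by (intro power_integral_scale[OF _ _ _ _ 1 C]) auto
  qed (rule C)
qed

section \<open>Green's formula\<close>

lemma integrable_compact_support:
  fixes f :: "real^'n \<Rightarrow> real"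
  assumes "compact K" "continuous_on K f" "\<And>x. x \<notin> K \<Longrightarrow> f x = 0"
  shows "integrable lborel f"
proof -
  have "(\<lambda>x. indicator K x *\<^sub>R f x) = f" using assms(3) by (auto simp: fun_eq_iff indicator_def)
  then show ?thesis using borel_integrable_compact[OF assms(1,2)] by simp
qed

text \<open>By translation invariance the difference quotients of \<open>V\<close> along a
  coordinate axis have integral 0. They are bounded by a Lipschitz constant of \<open>V\<close> on a
  fixed ball, so dominated convergence passes this to the partial derivative.\<close>

lemma integral_derivative_zero:
  fixes V :: "real^'n \<Rightarrow> real"
  assumes S: "open S" and K: "compact K" "K \<subseteq> S"
    and dV: "\<And>x. x \<in> S \<Longrightarrow> (V has_derivative (\<lambda>h. D x \<bullet> h)) (at x)"
    and cD: "continuous_on S D" and V0: "\<And>x. x \<notin> K \<Longrightarrow> V x = 0"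
  shows "x \<in> S - K \<Longrightarrow> D x = 0" "integrable lborel (\<lambda>x. indicator K x * D x $ i)"
    "(LINT x|lborel. indicator K x * D x $ i) = 0"
proof -
  have oK: "open (- K)" using K by (simp add: compact_imp_closed open_Compl)
  have z: "(V has_derivative (\<lambda>h. 0)) (at x)" if "x \<notin> K" for x
    using has_derivative_transform_within_open[OF has_derivative_const oK, of x 0 V] that V0 by auto
  show D0: "D x = 0" if "x \<in> S - K" for x
  proof -
    have "(\<lambda>h. D x \<bullet> h) = (\<lambda>h. 0)" using has_derivative_unique[OF dV z, of x] that by blast
    then have "D x \<bullet> D x = 0" by meson
    then show ?thesis by simp
  qed
  show int: "integrable lborel (\<lambda>x. indicator K x * D x $ i)"
    using borel_integrable_compact[OF K(1), of "\<lambda>x. D x $ i"] continuous_on_subset[OF cD K(2)]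
    by (auto intro: continuous_intros)
  \<comment> \<open>\<open>D\<close> is meaningful on \<open>S\<close> only. Cut off by the
    indicator of \<open>K\<close> it is the derivative of \<open>V\<close> on the whole
    space.\<close>
  have dV': "(V has_derivative (\<lambda>h. (indicator K x *\<^sub>R D x) \<bullet> h)) (at x)" for x
  proof (cases "x \<in> K")
    case True then show ?thesis using dV K by (auto simp: indicator_def)
  next
    case False then show ?thesis using z by (simp add: indicator_def)
  qed
  have "bounded (D ` K)" by (rule compact_imp_bounded[OF compact_continuous_image[OF continuous_on_subset[OF cD K(2)] K(1)]])
  then obtain B where B: "B > 0" "\<And>x. x \<in> K \<Longrightarrow> norm (D x) \<le> B" by (auto simp: bounded_pos)
  have lip: "\<bar>V x - V y\<bar> \<le> B * norm (x - y)" for x y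
  proof -
    have "norm (V x - V y) \<le> B * norm (x - y)"
    proof (rule differentiable_bound[where S=UNIV and f'="\<lambda>x h. (indicator K x *\<^sub>R D x) \<bullet> h"])
      show "onorm ((\<bullet>) (indicat_real K x *\<^sub>R D x)) \<le> B" for x
      proof (rule onorm_le, rule order_trans[OF Cauchy_Schwarz_ineq2[folded real_norm_def]])
        fix h
        have "norm (indicat_real K x *\<^sub>R D x) \<le> B" using B by (auto simp: indicator_def)
        then show "norm (indicat_real K x *\<^sub>R D x) * norm h \<le> B * norm h" by (rule mult_right_mono) simp
      qed
    qed (use dV' in auto)
    then show ?thesis by simp
  qed
  obtain R where R: "R > 0" "\<And>x. x \<in> K \<Longrightarrow> norm x \<le> R" using compact_imp_bounded[OF K(1)] by (auto simp: bounded_pos)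
  define e where "e = (axis i 1 :: real^'n)"
  have ne: "norm e = 1" by (simp add: e_def)
  have cV: "continuous_on UNIV V" using dV' has_derivative_continuous by (blast intro: continuous_at_imp_continuous_on)
  have iV: "integrable lborel V"
    by (rule integrable_compact_support[OF K(1)]) (use continuous_on_subset[OF cV] V0 in auto)
  define t where "t n = 1 / (real n + 1)" for n
  have t: "t n > 0" "t n \<le> 1" for n by (auto simp: t_def)
  have "t \<longlonglongrightarrow> 0" unfolding t_def using LIMSEQ_inverse_real_of_nat by (simp add: inverse_eq_divide add.commute)
  have "(\<lambda>n. LINT x|lborel. (V (x + t n *\<^sub>R e) - V x) / t n) \<longlonglongrightarrow> (LINT x|lborel. indicator K x * D x $ i)"
  proof (rule integral_dominated_convergence)
    have [measurable]: "V \<in> borel_measurable borel" using cV by (rule borel_measurable_continuous_onI)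
    show "(\<lambda>x. indicator K x * D x $ i) \<in> borel_measurable lborel" using int by auto
    show "(\<lambda>x. (V (x + t n *\<^sub>R e) - V x) / t n) \<in> borel_measurable lborel" for n by measurable
    \<comment> \<open>The shifts are at most 1, so enlarging the radius by 1 covers the supports of
      all difference quotients.\<close>
    show "integrable lborel (\<lambda>x::real^'n. B * indicator (cball 0 (R + 1)) x)"
      using emeasure_lborel_cball_finite[of "0::real^'n" "R+1"] by (auto intro!: integrable_real_indicator)
    show "AE x in lborel. norm ((V (x + t n *\<^sub>R e) - V x) / t n) \<le> B * indicator (cball 0 (R + 1)) x" for n
    proof (rule AE_I2)
      fix x
      show "norm ((V (x + t n *\<^sub>R e) - V x) / t n) \<le> B * indicator (cball 0 (R + 1)) x"
      proof (cases "norm x \<le> R + 1")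
        case True
        then show ?thesis using lip[of "x + t n *\<^sub>R e" x] t[of n] by (simp add: ne abs_div field_simps)
      next
        case False
        moreover have "norm x \<le> norm (x + t n *\<^sub>R e) + t n"
          using norm_triangle_ineq4[of "x + t n *\<^sub>R e" "t n *\<^sub>R e"] t[of n] by (simp add: ne)
        ultimately have "x \<notin> K" "x + t n *\<^sub>R e \<notin> K" using R t[of n] by fastforce+
        then show ?thesis using V0 B by (simp add: indicator_def)
      qed
    qed
    show "AE x in lborel. (\<lambda>n. (V (x + t n *\<^sub>R e) - V x) / t n) \<longlonglongrightarrow> indicator K x * D x $ i"
    proof (rule AE_I2)
      fix x
      have "((\<lambda>h. x + h *\<^sub>R e) has_derivative (\<lambda>h. h *\<^sub>R e)) (at 0)"
        by (auto intro!: derivative_eq_intros)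
      moreover have "(V has_derivative (\<lambda>h. (indicator K x *\<^sub>R D x) \<bullet> h)) (at (x + 0 *\<^sub>R e))"
        using dV' by simp
      ultimately have "((\<lambda>h. V (x + h *\<^sub>R e)) has_derivative (\<lambda>h. (indicator K x *\<^sub>R D x) \<bullet> (h *\<^sub>R e))) (at 0)"
        by (rule has_derivative_compose)
      then have "((\<lambda>h. V (x + h *\<^sub>R e)) has_real_derivative indicator K x * D x $ i) (at 0)"
        unfolding has_field_derivative_def
        by (rule has_derivative_eq_rhs) (simp add: fun_eq_iff e_def inner_axis)
      then have "((\<lambda>h. (V (x + h *\<^sub>R e) - V x) / h) \<longlongrightarrow> indicator K x * D x $ i) (at 0)"
        by (simp add: DERIV_def)
      then show "(\<lambda>n. (V (x + t n *\<^sub>R e) - V x) / t n) \<longlonglongrightarrow> indicator K x * D x $ i"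
        by (rule filterlim_compose) (use \<open>t \<longlonglongrightarrow> 0\<close> t in \<open>auto simp: filterlim_at eventually_sequentially less_imp_neq[THEN not_sym]\<close>)
    qed
  qed
  moreover have "(\<lambda>n. LINT x|lborel. (V (x + t n *\<^sub>R e) - V x) / t n) = (\<lambda>n. 0)"
  proof
    fix n
    have "integrable lborel (\<lambda>x. V (x + t n *\<^sub>R e))"
      using integrable_affine(1)[OF iV, of 1 "t n *\<^sub>R e"] by (simp add: add.commute)
    moreover have "(LINT x|lborel. V (x + t n *\<^sub>R e)) = (LINT x|lborel. V x)"
      using integrable_affine(2)[OF iV, of 1 "t n *\<^sub>R e", symmetric] by (simp add: add.commute)
    ultimately show "(LINT x|lborel. (V (x + t n *\<^sub>R e) - V x) / t n) = 0"
      using iV by simp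
  qed
  ultimately have "(\<lambda>n. 0::real) \<longlonglongrightarrow> (LINT x|lborel. indicator K x * D x $ i)" by simp
  then show "(LINT x|lborel. indicator K x * D x $ i) = 0"
    using LIMSEQ_unique[OF tendsto_const] by metis
qed

lemma has_C2_zero_outside:
  assumes \<xi>: "has_C2 UNIV \<xi> G H" and K: "closed K" "\<And>x. x \<notin> K \<Longrightarrow> \<xi> x = 0" and x: "x \<notin> K"
  shows "G x = 0" "H x = 0"
proof -
  have oK: "open (- K)" using K by (simp add: open_Compl)
  note D = has_C2D[OF \<xi>]
  have G0: "G x = 0" if "x \<notin> K" for x
  proof -
    have "(\<xi> has_derivative (\<lambda>h. 0)) (at x)"
      using has_derivative_transform_within_open[OF has_derivative_const oK, of x 0 \<xi>] that K by auto
    then have "(\<lambda>h. G x \<bullet> h) = (\<lambda>h. 0)" using has_derivative_unique D(2) by blast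
    then have "G x \<bullet> G x = 0" by meson
    then show ?thesis by simp
  qed
  then show "G x = 0" using x by blast
  have "(G has_derivative (\<lambda>h. 0)) (at x)"
    using has_derivative_transform_within_open[OF has_derivative_const oK, of x 0 G] x G0 by auto
  then have "(\<lambda>h. H x *v h) = (\<lambda>h. 0)" using has_derivative_unique D(3) by blast
  then show "H x = 0" by (metis matrix_eq matrix_vector_mult_0)
qed

lemma green_formulas:
  assumes f: "has_C2 S f G H" and \<xi>: "has_C2 UNIV \<xi> G' H'" and K: "compact K" "K \<subseteq> S"
    and \<xi>0: "\<And>x. x \<notin> K \<Longrightarrow> \<xi> x = 0"
  shows "(LINT x|lborel. \<xi> x * G x $ i) = - (LINT x|lborel. f x * G' x $ i)"
    "(LINT x|lborel. \<xi> x * trace (H x)) = (LINT x|lborel. f x * trace (H' x))"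
    "integrable lborel (\<lambda>x. \<xi> x * trace (H x))"
proof -
  note D = has_C2D[OF f] and D' = has_C2D[OF \<xi>]
  note z = has_C2_zero_outside[OF \<xi> compact_imp_closed[OF K(1)] \<xi>0]
  have cS: "continuous_on S \<xi>" "continuous_on S G'" "continuous_on S H'"
    using D' continuous_on_subset by blast+
  note cK = continuous_on_subset[OF D(4) K(2)] continuous_on_subset[OF D(5) K(2)] continuous_on_subset[OF D(6) K(2)]
    continuous_on_subset[OF cS(1) K(2)] continuous_on_subset[OF cS(2) K(2)] continuous_on_subset[OF cS(3) K(2)]
  have ctr: "continuous_on K (\<lambda>x. trace (H x))" "continuous_on K (\<lambda>x. trace (H' x))"
    unfolding trace_def by (intro continuous_intros cK)+
  have i1: "integrable lborel (\<lambda>x. \<xi> x * G x $ i)" "integrable lborel (\<lambda>x. f x * G' x $ i)"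
    by (rule integrable_compact_support[OF K(1)]; use \<xi>0 z in \<open>auto intro!: continuous_intros cK\<close>)+
  have "(LINT x|lborel. indicator K x * (\<xi> x *\<^sub>R G x + f x *\<^sub>R G' x) $ i) = 0"
    by (rule integral_derivative_zero(3)[OF D(1) K, of "\<lambda>x. \<xi> x * f x"])
       (auto intro!: derivative_eq_intros continuous_intros D D'(2) cS simp: \<xi>0 inner_add_left)
  moreover have "(\<lambda>x. indicator K x * (\<xi> x *\<^sub>R G x + f x *\<^sub>R G' x) $ i) = (\<lambda>x. \<xi> x * G x $ i + f x * G' x $ i)"
    using \<xi>0 z by (auto simp: indicator_def fun_eq_iff)
  ultimately have "(LINT x|lborel. \<xi> x * G x $ i + f x * G' x $ i) = 0" by metis
  then show "(LINT x|lborel. \<xi> x * G x $ i) = - (LINT x|lborel. f x * G' x $ i)"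
    using i1 by (simp add: eq_neg_iff_add_eq_0)
  show i2: "integrable lborel (\<lambda>x. \<xi> x * trace (H x))"
    by (rule integrable_compact_support[OF K(1)]; use \<xi>0 z in \<open>auto intro!: continuous_intros cK ctr\<close>)
  have i3: "integrable lborel (\<lambda>x. f x * trace (H' x))"
    by (rule integrable_compact_support[OF K(1)]; use \<xi>0 z in \<open>auto intro!: continuous_intros cK ctr simp: trace_0[unfolded mat_0]\<close>)
  have Gj: "((\<lambda>x. G x $ j) has_derivative (\<lambda>h. H x $ j \<bullet> h)) (at x)" if "x \<in> S" for x j
    using D(3)[OF that] unfolding has_derivative_vec_iff mat_vec_nth by blast
  have G'j: "((\<lambda>x. G' x $ j) has_derivative (\<lambda>h. H' x $ j \<bullet> h)) (at x)" for x j
    using D'(3) unfolding has_derivative_vec_iff mat_vec_nth by blast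
  \<comment> \<open>\<open>E j\<close> is the gradient of \<xi> \<partial>_j f - f \<partial>_j
    \<xi>. Summing the \<open>j\<close>-th components over \<open>j\<close> cancels the products of
    first derivatives and leaves \<xi> times the Laplacian of f minus f times that of \<xi>.\<close>
  define E where "E j x = G x $ j *\<^sub>R G' x + \<xi> x *\<^sub>R (H x $ j) - (G' x $ j *\<^sub>R G x + f x *\<^sub>R (H' x $ j))" for j x
  have "continuous_on S (E j)" for j unfolding E_def by (intro continuous_intros D cS)
  note E = integral_derivative_zero[OF D(1) K _ this, of "\<lambda>x. \<xi> x * G x $ j - f x * G' x $ j" j for j]
  have E': "integrable lborel (\<lambda>x. indicator K x * E j x $ j)" "(LINT x|lborel. indicator K x * E j x $ j) = 0" for j
    by (rule E; auto intro!: derivative_eq_intros Gj D(2) D'(2) G'j simp: \<xi>0 z E_def algebra_simps)+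
  have "(LINT x|lborel. \<xi> x * trace (H x) - f x * trace (H' x)) = (LINT x|lborel. (\<Sum>j\<in>UNIV. indicator K x * E j x $ j))"
    by (rule Bochner_Integration.integral_cong)
       (use \<xi>0 z in \<open>auto simp: E_def trace_def indicator_def sum_subtractf sum_distrib_left\<close>)
  also have "\<dots> = (\<Sum>j\<in>UNIV. LINT x|lborel. indicator K x * E j x $ j)"
    by (rule Bochner_Integration.integral_sum) (use E' in auto)
  finally show "(LINT x|lborel. \<xi> x * trace (H x)) = (LINT x|lborel. f x * trace (H' x))"
    using i2 i3 E'(2) by simp
qed

section \<open>Cutoff functions\<close>

text \<open>An exponent of at least 2 makes the derivatives from both sides agree at 0. Cubes of
  positive parts are therefore twice continuously differentiable, which is what the cutoffs are
  built from.\<close>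

lemma DERIV_max_power:
  "((\<lambda>t. (max 0 t) ^ Suc (Suc n)) has_real_derivative (real n + 2) * (max 0 t) ^ Suc n) (at (t::real))"
proof -
  consider "t < 0" | "t > 0" | "t = 0" by linarith
  then show ?thesis
  proof cases
    case 1
    have "((\<lambda>t. 0) has_real_derivative 0) (at t)" by simp
    then have "((\<lambda>t. (max 0 t) ^ Suc (Suc n)) has_real_derivative 0) (at t)"
      by (rule has_field_derivative_transform_within[where d="-t"]) (use 1 in \<open>auto simp: dist_real_def max_def\<close>)
    then show ?thesis using 1 by (simp add: max_def)
  next
    case 2
    have "((\<lambda>t. t ^ Suc (Suc n)) has_real_derivative (real n + 2) * t ^ Suc n) (at t)"
      by (rule DERIV_cong[OF DERIV_pow]) simp
    then have "((\<lambda>t. (max 0 t) ^ Suc (Suc n)) has_real_derivative (real n + 2) * t ^ Suc n) (at t)"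
      by (rule has_field_derivative_transform_within[where d="t"]) (use 2 in \<open>auto simp: dist_real_def max_def\<close>)
    then show ?thesis using 2 by (simp add: max_def)
  next
    case 3
    have "((\<lambda>h. (max 0 h) ^ Suc (Suc n) / h) \<longlongrightarrow> (0::real)) (at 0)"
    proof (rule Lim_null_comparison)
      show "eventually (\<lambda>h::real. norm ((max 0 h) ^ Suc (Suc n) / h) \<le> \<bar>h\<bar> ^ Suc n) (at 0)"
        by (rule eventuallyI) (auto simp: max_def mult_nonpos_nonneg)
      have "((\<lambda>h::real. \<bar>h\<bar> ^ Suc n) \<longlongrightarrow> \<bar>0\<bar> ^ Suc n) (at 0)" by (intro tendsto_intros)
      then show "((\<lambda>h::real. \<bar>h\<bar> ^ Suc n) \<longlongrightarrow> 0) (at 0)" by simp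
    qed
    then show ?thesis using 3 by (simp add: DERIV_def)
  qed
qed

text \<open>Rises from 0 for s \<le> 1 to 1 for s \<ge> 2, as a nested pair of cubed positive parts.
  Green's formula asks for two continuous derivatives of the test function, and \<open>cut1\<close>
  and \<open>cut2\<close> below are these derivatives.\<close>

definition "cut0 s = 1 - (max 0 (1 - (max 0 (s - 1)) ^ 3)) ^ 3" for s :: real
definition "cut1 s = 9 * (max 0 (1 - (max 0 (s - 1)) ^ 3))\<^sup>2 * (max 0 (s - 1))\<^sup>2" for s :: real
definition "cut2 s = - 54 * (max 0 (1 - (max 0 (s - 1)) ^ 3)) * (max 0 (s - 1)) ^ 4
   + 18 * (max 0 (1 - (max 0 (s - 1)) ^ 3))\<^sup>2 * (max 0 (s - 1))" for s :: real

lemma DERIV_max3: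
  assumes "(f has_real_derivative f') (at t)"
  shows "((\<lambda>t. (max 0 (f t)) ^ 3) has_real_derivative 3 * (max 0 (f t))\<^sup>2 * f') (at t)"
proof -
  have "Suc (Suc 1) = 3" "Suc 1 = 2" by simp_all
  then have "((\<lambda>t. (max 0 t) ^ 3) has_real_derivative 3 * (max 0 (f t))\<^sup>2) (at (f t))"
    using DERIV_max_power[of 1 "f t"] by (simp only:) simp
  from DERIV_chain2[where g=f, OF this assms] show ?thesis .
qed

lemma DERIV_max2:
  assumes "(f has_real_derivative f') (at t)"
  shows "((\<lambda>t. (max 0 (f t))\<^sup>2) has_real_derivative 2 * (max 0 (f t)) * f') (at t)"
proof -
  have "Suc (Suc 0) = 2" by simp
  then have "((\<lambda>t. (max 0 t)\<^sup>2) has_real_derivative 2 * (max 0 (f t))) (at (f t))"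
    using DERIV_max_power[of 0 "f t"] by (simp only:) simp
  from DERIV_chain2[where g=f, OF this assms] show ?thesis .
qed

lemma cut_deriv: "(cut0 has_real_derivative cut1 s) (at s)" "(cut1 has_real_derivative cut2 s) (at s)" "continuous_on UNIV cut2"
proof -
  have d: "((\<lambda>s. s - 1) has_real_derivative 1) (at s)" by (auto intro!: derivative_eq_intros)
  have d3: "((\<lambda>s. 1 - (max 0 (s - 1)) ^ 3) has_real_derivative - (3 * (max 0 (s - 1))\<^sup>2)) (at s)"
    using DERIV_diff[OF DERIV_const[of 1] DERIV_max3[OF d]] by simp
  have "cut0 = (\<lambda>s. 1 - (max 0 (1 - (max 0 (s - 1)) ^ 3)) ^ 3)" by (auto simp: cut0_def)
  then show "(cut0 has_real_derivative cut1 s) (at s)"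
    using DERIV_diff[OF DERIV_const[of 1] DERIV_max3[OF d3]] by (simp add: cut1_def algebra_simps)
  have "cut1 = (\<lambda>s. 9 * ((max 0 (1 - (max 0 (s - 1)) ^ 3))\<^sup>2 * (max 0 (s - 1))\<^sup>2))" by (auto simp: cut1_def)
  then have "(cut1 has_real_derivative 9 * (2 * max 0 (1 - (max 0 (s - 1)) ^ 3) * - (3 * (max 0 (s - 1))\<^sup>2) * (max 0 (s - 1))\<^sup>2
      + 2 * max 0 (s - 1) * 1 * (max 0 (1 - (max 0 (s - 1)) ^ 3))\<^sup>2)) (at s)"
    using DERIV_cmult[OF DERIV_mult[OF DERIV_max2[OF d3] DERIV_max2[OF d]], of 9] by simp
  moreover have "9 * (2 * A * - (3 * B\<^sup>2) * B\<^sup>2 + 2 * B * 1 * A\<^sup>2) = - 54 * A * B ^ 4 + 18 * A\<^sup>2 * B" for A B :: real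
    by (simp add: algebra_simps power2_eq_square power4_eq_xxxx)
  ultimately show "(cut1 has_real_derivative cut2 s) (at s)" by (simp only: cut2_def)
  show "continuous_on UNIV cut2" unfolding cut2_def by (intro continuous_intros)
qed

lemma cut_values:
  "s \<le> 1 \<Longrightarrow> cut0 s = 0" "2 \<le> s \<Longrightarrow> cut0 s = 1" "0 \<le> cut0 s" "cut0 s \<le> 1"
  "s \<le> 1 \<or> 2 \<le> s \<Longrightarrow> cut1 s = 0" "s \<le> 1 \<or> 2 \<le> s \<Longrightarrow> cut2 s = 0"
proof -
  have *: "s \<le> 1 \<Longrightarrow> max 0 (s - 1) = 0" by simp
  have **: "max 0 (1 - (max 0 (s - 1)) ^ 3) = 0" if "2 \<le> s"
  proof -
    have "1 \<le> (max 0 (s - 1)) ^ 3" using that by (intro one_le_power) auto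
    then show ?thesis by simp
  qed
  show "s \<le> 1 \<Longrightarrow> cut0 s = 0" "2 \<le> s \<Longrightarrow> cut0 s = 1" "s \<le> 1 \<or> 2 \<le> s \<Longrightarrow> cut1 s = 0" "s \<le> 1 \<or> 2 \<le> s \<Longrightarrow> cut2 s = 0"
    using * ** by (auto simp: cut0_def cut1_def cut2_def)
  have "0 \<le> max 0 (1 - (max 0 (s - 1)) ^ 3)" "max 0 (1 - (max 0 (s - 1)) ^ 3) \<le> 1" by (auto simp: max_def)
  then have "0 \<le> (max 0 (1 - (max 0 (s - 1)) ^ 3)) ^ 3" "(max 0 (1 - (max 0 (s - 1)) ^ 3)) ^ 3 \<le> 1"
    by (auto intro: power_le_one)
  then show "0 \<le> cut0 s" "cut0 s \<le> 1" unfolding cut0_def by linarith+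
qed

lemma cut_bounded: obtains C where "C \<ge> 0" "\<And>s. \<bar>cut1 s\<bar> \<le> C" "\<And>s. \<bar>cut2 s\<bar> \<le> C"
proof -
  have c1: "continuous_on {1..2} cut1"
    by (rule continuous_at_imp_continuous_on) (auto intro: DERIV_isCont[OF cut_deriv(2)])
  have c2: "continuous_on {1..2} cut2" by (rule continuous_on_subset[OF cut_deriv(3)]) simp
  obtain a where "\<forall>x\<in>cut1 ` {1..2}. norm x \<le> a"
    using compact_imp_bounded[OF compact_continuous_image[OF c1 compact_Icc]] unfolding bounded_iff by blast
  moreover obtain b where "\<forall>x\<in>cut2 ` {1..2}. norm x \<le> b"
    using compact_imp_bounded[OF compact_continuous_image[OF c2 compact_Icc]] unfolding bounded_iff by blast
  ultimately have "\<bar>cut1 s\<bar> \<le> a" "\<bar>cut2 s\<bar> \<le> b" if "s \<in> {1..2}" for s using that by auto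
  then have "\<bar>cut1 s\<bar> \<le> max 0 (max a b) \<and> \<bar>cut2 s\<bar> \<le> max 0 (max a b)" for s
  proof (cases "s \<in> {1..2}")
    case True
    then show ?thesis using \<open>\<And>s. s \<in> {1..2} \<Longrightarrow> \<bar>cut1 s\<bar> \<le> a\<close> \<open>\<And>s. s \<in> {1..2} \<Longrightarrow> \<bar>cut2 s\<bar> \<le> b\<close>
      by (meson max.cobounded1 max.cobounded2 order_trans)
  next
    case False
    then show ?thesis using cut_values(5,6)[of s] by auto
  qed
  then show ?thesis using that[of "max 0 (max a b)"] by simp
qed

text \<open>The value is 0 for |x|^2 \<le> 1/a and 1 for |x|^2 \<ge> 2/a. A large \<open>a\<close>
  thus cuts a small hole around the origin, while \<open>1 - cutoff a x\<close> is a bump around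
  it.\<close>

definition cutoff :: "real \<Rightarrow> real^'n::finite \<Rightarrow> real" where "cutoff a x = cut0 (a * (norm x)\<^sup>2)"
definition cutoffG :: "real \<Rightarrow> real^'n::finite \<Rightarrow> real^'n" where
  "cutoffG a x = (2 * (a * cut1 (a * (norm x)\<^sup>2))) *\<^sub>R x"
definition cutoffH :: "real \<Rightarrow> real^'n::finite \<Rightarrow> real^'n^'n" where
  "cutoffH a x = (4 * (a * a * cut2 (a * (norm x)\<^sup>2))) *\<^sub>R outer x x + (2 * (a * cut1 (a * (norm x)\<^sup>2))) *\<^sub>R mat 1"

lemma has_C2_cutoff: "has_C2 UNIV (cutoff a) (cutoffG a) (cutoffH a :: real^'n \<Rightarrow> _)"
proof -
  have d: "((\<lambda>t. a * t) has_real_derivative a) (at t)" for t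
    using DERIV_cmult_Id[of a t UNIV] by simp
  have "((\<lambda>t. cut0 (a * t)) has_real_derivative a * cut1 (a * t)) (at t)" for t
    by (rule DERIV_cong[OF DERIV_chain2[where g="\<lambda>t. a * t", OF cut_deriv(1) d]]) simp
  moreover have "((\<lambda>t. a * cut1 (a * t)) has_real_derivative a * a * cut2 (a * t)) (at t)" for t
    by (rule DERIV_cong[OF DERIV_cmult[OF DERIV_chain2[where g="\<lambda>t. a * t", OF cut_deriv(2) d]]]) simp
  moreover have "continuous_on UNIV (\<lambda>t. a * a * cut2 (a * t))"
    by (intro continuous_intros continuous_on_compose2[OF cut_deriv(3)]) auto
  ultimately show ?thesis
    using has_C2_radial[of UNIV "\<lambda>t. cut0 (a * t)" "\<lambda>t. a * cut1 (a * t)" "\<lambda>t. a * a * cut2 (a * t)" UNIV "0::real^'n"]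
    by (simp add: cutoff_def[abs_def] cutoffG_def[abs_def] cutoffH_def[abs_def])
qed

lemma cutoff_values:
  fixes x :: "real^'n" and a :: real
  assumes "a > 0"
  shows "a * (norm x)\<^sup>2 \<le> 1 \<Longrightarrow> cutoff a x = 0" "2 \<le> a * (norm x)\<^sup>2 \<Longrightarrow> cutoff a x = 1"
    "0 \<le> cutoff a x" "cutoff a x \<le> 1"
    "2 \<le> a * (norm x)\<^sup>2 \<Longrightarrow> cutoffG a x = 0" "2 \<le> a * (norm x)\<^sup>2 \<Longrightarrow> cutoffH a x = 0"
  using assms by (auto simp: cutoff_def cutoffG_def cutoffH_def cut_values)

text \<open>With s = a |x|^2 the derivatives contain \<open>a\<close> through s \<open>cut1\<close>
  s and s^2 \<open>cut2\<close> s only, and these are bounded since \<open>cut1\<close> and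
  \<open>cut2\<close> vanish outside 1 \<le> s \<le> 2. The uniformity in \<open>a\<close> is what
  makes shrinking holes harmless.\<close>

lemma cutoff_bounds:
  "\<exists>C\<ge>0. \<forall>a>0. \<forall>x::real^'n. x \<noteq> 0 \<longrightarrow>
     norm (cutoffG a x) \<le> C / norm x \<and> \<bar>trace (cutoffH a x)\<bar> \<le> C / (norm x)\<^sup>2"
proof -
  obtain c where c: "c \<ge> 0" "\<And>s. \<bar>cut1 s\<bar> \<le> c" "\<And>s. \<bar>cut2 s\<bar> \<le> c" using cut_bounded by blast
  have b1: "\<bar>s * cut1 s\<bar> \<le> 2 * c" "\<bar>s * s * cut2 s\<bar> \<le> 4 * c" if "s > 0" for s
  proof -
    have *: "\<bar>s * cut1 s\<bar> \<le> 2 * c \<and> \<bar>s * s * cut2 s\<bar> \<le> 4 * c"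
    proof (cases "s \<le> 2")
      case True
      have "s * s \<le> 2 * 2" using True that by (intro mult_mono) auto
      then show ?thesis using True that c by (auto simp: abs_mult intro!: mult_mono)
    next
      case False then show ?thesis using cut_values(5,6)[of s] c by auto
    qed
    then show "\<bar>s * cut1 s\<bar> \<le> 2 * c" "\<bar>s * s * cut2 s\<bar> \<le> 4 * c" by blast+
  qed
  define C where "C = 16 * c + 4 * real CARD('n) * c"
  have C: "C \<ge> 4 * c" "C \<ge> 0" using c mult_nonneg_nonneg[of "real CARD('n)" c] by (auto simp: C_def)
  show ?thesis
  proof (intro exI[of _ C] conjI allI impI C(2))
    fix a :: real and x :: "real^'n" assume a: "a > 0" "x \<noteq> 0"
    define s where "s = a * (norm x)\<^sup>2"
    have s: "s > 0" "a = s / (norm x)\<^sup>2" using a by (auto simp: s_def)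
    have "norm (cutoffG a x) = 2 * (a * \<bar>cut1 s\<bar>) * norm x"
      unfolding cutoffG_def s_def[symmetric] using a by (simp add: abs_mult)
    also have "\<dots> = 2 * \<bar>s * cut1 s\<bar> / norm x"
      using a by (simp add: abs_mult s_def power2_eq_square)
    also have "\<dots> \<le> C / norm x" using b1(1)[OF s(1)] C a by (intro divide_right_mono) auto
    finally show "norm (cutoffG a x) \<le> C / norm x" .
    have "trace (cutoffH a x) = (4 * (s * s * cut2 s) + 2 * real CARD('n) * (s * cut1 s)) / (norm x)\<^sup>2"
      unfolding cutoffH_def s_def[symmetric] trace_radial
    proof -
      define m where "m = (norm x)\<^sup>2"
      have "m > 0" "s = a * m" using a by (auto simp: m_def s_def)
      then show "4 * (a * a * cut2 s) * (norm x)\<^sup>2 + 2 * real CARD('n) * (a * cut1 s) = (4 * (s * s * cut2 s) + 2 * real CARD('n) * (s * cut1 s)) / (norm x)\<^sup>2"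
        unfolding m_def[symmetric] by (simp only: eq_divide_eq) (simp add: algebra_simps)
    qed
    also have "\<bar>\<dots>\<bar> \<le> C / (norm x)\<^sup>2"
    proof -
      have "\<bar>4 * (s * s * cut2 s) + 2 * real CARD('n) * (s * cut1 s)\<bar> \<le> 4 * \<bar>s * s * cut2 s\<bar> + 2 * real CARD('n) * \<bar>s * cut1 s\<bar>"
        by (rule order_trans[OF abs_triangle_ineq]) (simp add: abs_mult)
      also have "\<dots> \<le> 4 * (4 * c) + 2 * real CARD('n) * (2 * c)"
        using b1[OF s(1)] by (intro add_mono mult_left_mono) auto
      finally show ?thesis using a unfolding C_def by (simp add: divide_right_mono)
    qed
    finally show "\<bar>trace (cutoffH a x)\<bar> \<le> C / (norm x)\<^sup>2" .
  qed
qed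

section \<open>Integration by parts across the puncture\<close>

lemma integrable_power_near:
  fixes \<gamma> :: real
  assumes "\<gamma> < DIM('a::euclidean_space)" "\<rho> > 0"
  shows "integrable lborel (\<lambda>y::'a. norm y powr (-\<gamma>) * indicator (ball 0 \<rho>) y)"
proof -
  obtain C where C: "C \<ge> 0" "(\<integral>\<^sup>+y. ennreal (norm y powr (-\<gamma>)) * indicator (ball 0 \<rho>) y \<partial>(lborel::'a measure))
    \<le> ennreal (C * \<rho> powr (DIM('a) - \<gamma>))" using power_integral_near[OF assms(1)] assms(2) by auto
  have "(\<integral>\<^sup>+y. ennreal \<bar>norm y powr (-\<gamma>) * indicator (ball 0 \<rho>) y\<bar> \<partial>(lborel::'a measure))
      = (\<integral>\<^sup>+y. ennreal (norm y powr (-\<gamma>)) * indicator (ball 0 \<rho>) y \<partial>(lborel::'a measure))"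
    by (rule nn_integral_cong) (simp split: split_indicator)
  with C(2) have b: "(\<integral>\<^sup>+y. ennreal \<bar>norm y powr (-\<gamma>) * indicator (ball 0 \<rho>) y\<bar> \<partial>(lborel::'a measure)) \<le> ennreal (C * \<rho> powr (DIM('a) - \<gamma>))"
    by (simp only:)
  have m: "(\<lambda>y::'a. norm y powr (-\<gamma>) * indicator (ball 0 \<rho>) y) \<in> borel_measurable lborel"
    by measurable simp
  show ?thesis by (rule nn_integral_bound_imp(1)[OF m b]) (use C(1) in simp)
qed

text \<open>The test quantities may grow like |x|^{-2} at the origin. Together with the bound on
  \<open>u\<close> the majorant there is a multiple of |x|^{-(\<sigma>+2)}, which is integrable
  because \<sigma> + 2 < N; elsewhere on \<open>K\<close> a constant does.\<close>

lemma dominated_singular: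
  fixes u :: "real^'n \<Rightarrow> real" and T :: "nat \<Rightarrow> real^'n \<Rightarrow> real"
  assumes \<Omega>: "open \<Omega>" and u: "continuous_on (\<Omega> - {0}) u" and K: "compact K" "K \<subseteq> \<Omega>"
    and r: "r > 0" and ub: "\<And>x. 0 < norm x \<Longrightarrow> norm x < r \<Longrightarrow> \<bar>u x\<bar> \<le> C * norm x powr (-\<sigma>)"
    and \<sigma>: "\<sigma> + 2 < CARD('n)" and C: "C \<ge> 0"
    and Tm[measurable]: "\<And>n. T n \<in> borel_measurable borel" and Tm'[measurable]: "T' \<in> borel_measurable borel"
    and T0: "\<And>n x. x \<notin> K \<Longrightarrow> T n x = 0" "\<And>x. x \<notin> K \<Longrightarrow> T' x = 0"
    and B: "\<And>n x. x \<in> K \<Longrightarrow> x \<noteq> 0 \<Longrightarrow> \<bar>T n x\<bar> \<le> B * (1 + 1 / (norm x)\<^sup>2)" "B \<ge> 0"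
    and lim: "\<And>x. x \<noteq> 0 \<Longrightarrow> (\<lambda>n. T n x) \<longlonglongrightarrow> T' x"
  shows "integrable lborel (\<lambda>x. u x * T' x)" "(\<lambda>n. LINT x|lborel. u x * T n x) \<longlonglongrightarrow> (LINT x|lborel. u x * T' x)"
proof -
  define \<rho> where "\<rho> = min r 1 / 2"
  have \<rho>: "0 < \<rho>" "\<rho> < r" "\<rho> < 1" using r by (auto simp: \<rho>_def)
  have K': "compact (K - ball 0 \<rho>)" using K(1) by (intro compact_diff) auto
  have "K - ball 0 \<rho> \<subseteq> \<Omega> - {0}" using K \<rho> by auto
  then have "bounded (u ` (K - ball 0 \<rho>))"
    using compact_imp_bounded compact_continuous_image K' continuous_on_subset[OF u] by blast
  then obtain A where A: "A > 0" "\<And>x. x \<in> K - ball 0 \<rho> \<Longrightarrow> \<bar>u x\<bar> \<le> A" by (auto simp: bounded_pos)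
  define W where "W x = A * (B * (1 + 1 / \<rho>\<^sup>2)) * indicator K x + 2 * C * B * (norm x powr (-(\<sigma> + 2)) * indicator (ball 0 1) x)" for x :: "real^'n"
  have Wi: "integrable lborel W"
    unfolding W_def using \<sigma> emeasure_compact_finite[OF K(1)] K(1)
    by (intro Bochner_Integration.integrable_add integrable_mult_right integrable_power_near integrable_real_indicator)
       (auto simp: borel_compact)
  have dom: "\<bar>u x * T n x\<bar> \<le> W x" if x: "x \<noteq> 0" for x n
  proof (cases "x \<in> K")
    case False
    have "W x \<ge> 0" unfolding W_def using A B C by (intro add_nonneg_nonneg mult_nonneg_nonneg) auto
    then show ?thesis using T0(1)[OF False, of n] by simp
  next
    case True
    show ?thesis
    proof (cases "norm x < \<rho>")
      case False
      have "1 / (norm x)\<^sup>2 \<le> 1 / \<rho>\<^sup>2" using False \<rho> x by (intro divide_left_mono power_mono) auto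
      then have "\<bar>T n x\<bar> \<le> B * (1 + 1 / \<rho>\<^sup>2)"
        using B(1)[OF True x, of n] B(2) by (intro order_trans[OF B(1)[OF True x]] mult_left_mono) auto
      then have "\<bar>u x * T n x\<bar> \<le> A * (B * (1 + 1 / \<rho>\<^sup>2))"
        using A(2)[of x] True False A(1) unfolding abs_mult by (intro mult_mono) auto
      also have "\<dots> \<le> W x" unfolding W_def using True B C by simp
      finally show ?thesis .
    next
      case nx: True
      have n1: "(norm x)\<^sup>2 \<le> 1" using nx \<rho> by (intro power_le_one) auto
      have "1 \<le> 1 / (norm x)\<^sup>2" using n1 x by simp
      then have "\<bar>T n x\<bar> \<le> B * (2 / (norm x)\<^sup>2)"
        using B(2) by (intro order_trans[OF B(1)[OF True x]] mult_left_mono) auto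
      then have "\<bar>u x * T n x\<bar> \<le> (C * norm x powr (-\<sigma>)) * (B * (2 / (norm x)\<^sup>2))"
        using ub[of x] x nx \<rho> C unfolding abs_mult by (intro mult_mono) auto
      also have "\<dots> = 2 * C * B * (norm x powr (-\<sigma>) / (norm x)\<^sup>2)" by simp
      also have "norm x powr (-\<sigma>) / (norm x)\<^sup>2 = norm x powr (-(\<sigma> + 2))"
      proof -
        have "-(\<sigma> + 2) = -\<sigma> - 2" by simp
        then show ?thesis using x by (simp only: powr_diff) simp
      qed
      also have "2 * C * B * \<dots> \<le> W x" unfolding W_def using nx \<rho> A B by simp
      finally show ?thesis .
    qed
  qed
  have AE0: "AE x in lborel. x \<noteq> (0::real^'n)" by (rule AE_lborel_singleton)
  \<comment> \<open>Nothing is known about \<open>u\<close> outside \<Omega>. Its Borel modification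
    \<open>u'\<close> gives the same products, since the test quantities vanish off
    \<open>K\<close>.\<close>
  define u' where "u' x = indicator (K - {0}) x *\<^sub>R u x + indicator {0} x * u 0" for x
  have "(\<lambda>x. indicator (K - {0}) x *\<^sub>R u x) \<in> borel_measurable borel"
    using K by (intro borel_measurable_continuous_on_indicator continuous_on_subset[OF u]) (auto simp: borel_compact)
  then have [measurable]: "u' \<in> borel_measurable borel" unfolding u'_def by measurable
  have eq: "u x * T n x = u' x * T n x" "u x * T' x = u' x * T' x" for x n
    using T0 by (auto simp: u'_def indicator_def)
  have m: "(\<lambda>x. u x * T n x) \<in> borel_measurable lborel" "(\<lambda>x. u x * T' x) \<in> borel_measurable lborel" for n
    unfolding eq by measurable
  have l: "AE x in lborel. (\<lambda>n. u x * T n x) \<longlonglongrightarrow> u x * T' x"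
    using AE0 by eventually_elim (intro tendsto_mult tendsto_const lim)
  have d: "AE x in lborel. norm (u x * T n x) \<le> W x" for n
    using AE0 by eventually_elim (use dom in auto)
  show "integrable lborel (\<lambda>x. u x * T' x)" by (rule integrable_dominated_convergence[OF m(2) m(1) Wi l d])
  show "(\<lambda>n. LINT x|lborel. u x * T n x) \<longlonglongrightarrow> (LINT x|lborel. u x * T' x)"
    by (rule integral_dominated_convergence[OF m(2) m(1) Wi l d])
qed

text \<open>The square makes the radius of the hole 1/(n+1).\<close>

definition hole :: "nat \<Rightarrow> real^'n::finite \<Rightarrow> real" where "hole n = cutoff ((real n + 1)\<^sup>2)"

lemma hole_eventually:
  fixes x :: "real^'n"
  assumes "x \<noteq> 0"
  obtains m where "\<And>n. n \<ge> m \<Longrightarrow> 2 \<le> (real n + 1)\<^sup>2 * (norm x)\<^sup>2"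
proof -
  obtain m :: nat where m: "real m > 2 / norm x" using reals_Archimedean2 by blast
  have "2 \<le> (real n + 1)\<^sup>2 * (norm x)\<^sup>2" if "n \<ge> m" for n
  proof -
    have "2 / norm x \<le> real n + 1" using m that by linarith
    then have "2 \<le> (real n + 1) * norm x" using assms by (simp add: pos_divide_le_eq)
    then have "2\<^sup>2 \<le> ((real n + 1) * norm x)\<^sup>2" by (intro power_mono) auto
    then show ?thesis by (simp add: power_mult_distrib)
  qed
  then show ?thesis using that by blast
qed

text \<open>The product of \<zeta> and a hole vanishes near the origin, so Green's formula applies
  exactly and moves all derivatives off \<open>u\<close>. What remains contains \<open>u\<close>
  itself and at most two derivatives of the hole, of size |x|^{-2}, and passes to the limit by
  domination; at a fixed x \<noteq> 0 the hole is eventually 1.\<close>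

lemma removable_limits:
  fixes u :: "real^'n \<Rightarrow> real"
  assumes \<Omega>: "open \<Omega>" and u: "has_C2 (\<Omega> - {0}) u G H" and K: "compact K" "K \<subseteq> \<Omega>"
    and r: "r > 0" and ub: "\<And>x. 0 < norm x \<Longrightarrow> norm x < r \<Longrightarrow> \<bar>u x\<bar> \<le> C * norm x powr (-\<sigma>)"
    and \<sigma>: "\<sigma> + 2 < CARD('n)" and C: "C \<ge> 0"
    and \<zeta>: "has_C2 UNIV \<zeta> G' H'" and \<zeta>0: "\<And>x. x \<notin> K \<Longrightarrow> \<zeta> x = 0"
  shows "(\<lambda>n. LINT x|lborel. \<zeta> x * hole n x * trace (H x)) \<longlonglongrightarrow> (LINT x|lborel. u x * trace (H' x))"
    "(\<lambda>n. LINT x|lborel. \<zeta> x * hole n x * G x $ i) \<longlonglongrightarrow> - (LINT x|lborel. u x * G' x $ i)"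
    "integrable lborel (\<lambda>x. u x * trace (H' x))" "integrable lborel (\<lambda>x. u x * G' x $ i)"
    "integrable lborel (\<lambda>x. \<zeta> x * hole n x * trace (H x))"
proof -
  note Kc = compact_imp_closed[OF K(1)]
  have z: "G' x = 0" "H' x = 0" if "x \<notin> K" for x
    using has_C2_zero_outside[OF \<zeta> Kc _ that] \<zeta>0 by blast+
  define a where "a n = (real n + 1)\<^sup>2" for n
  have a: "a n > 0" for n by (auto simp: a_def)
  define \<xi> where "\<xi> n x = \<zeta> x * hole n x" for n x
  define G1 where "G1 n x = \<zeta> x *\<^sub>R cutoffG (a n) x + hole n x *\<^sub>R G' x" for n x
  define H1 where "H1 n x = \<zeta> x *\<^sub>R cutoffH (a n) x + hole n x *\<^sub>R H' x + (outer (G' x) (cutoffG (a n) x) + outer (cutoffG (a n) x) (G' x))" for n x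
  have \<xi>: "has_C2 UNIV (\<xi> n) (G1 n) (H1 n)" for n
    unfolding \<xi>_def G1_def H1_def hole_def a_def[symmetric] by (rule has_C2_mult[OF \<zeta> has_C2_cutoff])
  define Kn where "Kn n = K - ball 0 (1 / (real n + 1))" for n
  have Kn: "compact (Kn n)" "Kn n \<subseteq> \<Omega> - {0}" for n using K by (auto simp: Kn_def intro!: compact_diff)
  have \<xi>0: "\<xi> n x = 0" if "x \<notin> Kn n" for n x
  proof (cases "x \<in> K")
    case False then show ?thesis by (simp add: \<xi>_def \<zeta>0)
  next
    case True
    then have "norm x < 1 / (real n + 1)" using that by (auto simp: Kn_def)
    then have "(real n + 1) * norm x \<le> 1" by (simp add: field_simps)
    then have "((real n + 1) * norm x)\<^sup>2 \<le> 1" by (intro power_le_one) auto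
    then show ?thesis using cutoff_values(1)[OF a, of n x] by (simp add: \<xi>_def hole_def a_def power_mult_distrib)
  qed
  note g = green_formulas[OF u \<xi> Kn \<xi>0]
  show "integrable lborel (\<lambda>x. \<zeta> x * hole n x * trace (H x))" using g(3)[of n] by (simp add: \<xi>_def)
  from cutoff_bounds[where 'n='n] obtain c where c0: "c \<ge> 0 \<and> (\<forall>a>0. \<forall>x::real^'n. x \<noteq> 0 \<longrightarrow>
     norm (cutoffG a x) \<le> c / norm x \<and> \<bar>trace (cutoffH a x)\<bar> \<le> c / (norm x)\<^sup>2)" ..
  have c: "c \<ge> 0" "norm (cutoffG a x) \<le> c / norm x" "\<bar>trace (cutoffH a x)\<bar> \<le> c / (norm x)\<^sup>2"
    if "a > 0" "x \<noteq> 0" for a and x :: "real^'n" using c0 that by auto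
  have c': "c \<ge> 0" using c0 by blast
  have bd: "bounded (h ` K)" if "continuous_on UNIV h" for h :: "real^'n \<Rightarrow> 'b::metric_space"
    by (rule compact_imp_bounded[OF compact_continuous_image[OF continuous_on_subset[OF that subset_UNIV] K(1)]])
  have ct: "continuous_on UNIV (\<lambda>x. trace (H' x))"
    unfolding trace_def by (intro continuous_intros has_C2D(4)[OF \<zeta>])
  have "bounded (\<zeta> ` K)" "bounded (G' ` K)" "bounded ((\<lambda>x. trace (H' x)) ` K)"
    using bd[OF has_C2D(5)[OF \<zeta>]] bd[OF has_C2D(6)[OF \<zeta>]] bd[OF ct] by blast+
  then obtain b1 b2 b3 where bb: "b1 > 0" "\<And>x. x \<in> K \<Longrightarrow> \<bar>\<zeta> x\<bar> \<le> b1" "b2 > 0" "\<And>x. x \<in> K \<Longrightarrow> norm (G' x) \<le> b2"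
    "b3 > 0" "\<And>x. x \<in> K \<Longrightarrow> \<bar>trace (H' x)\<bar> \<le> b3" by (auto simp: bounded_pos)
  define b where "b = b1 + b2 + b3"
  have b: "b \<ge> 0" "\<And>x. x \<in> K \<Longrightarrow> \<bar>\<zeta> x\<bar> \<le> b" "\<And>x. x \<in> K \<Longrightarrow> norm (G' x) \<le> b" "\<And>x. x \<in> K \<Longrightarrow> \<bar>trace (H' x)\<bar> \<le> b"
    using bb unfolding b_def by (fastforce)+
  have h: "\<bar>hole n x\<bar> \<le> 1" for n x using cutoff_values(3,4)[OF a, of n x] by (simp add: hole_def a_def)
  \<comment> \<open>First derivatives of the hole are of order 1/|x|; this inequality puts them
    under the same majorant as the second derivatives.\<close>
  have inv: "1 / norm x \<le> 1 + 1 / (norm x)\<^sup>2" for x :: "real^'n"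
  proof -
    have "0 \<le> (1 - 1 / norm x)\<^sup>2 + 1 / norm x" by simp
    then show ?thesis by (simp add: power2_eq_square algebra_simps)
  qed
  have trH1: "trace (H1 n x) = \<zeta> x * trace (cutoffH (a n) x) + hole n x * trace (H' x) + 2 * (G' x \<bullet> cutoffG (a n) x)" for n x
    unfolding H1_def by (simp add: trace_add inner_commute)
  define B where "B = b * c + b + 2 * b * c"
  have B: "B \<ge> 0" using b c' by (simp add: B_def)
  have B1: "\<bar>trace (H1 n x)\<bar> \<le> B * (1 + 1 / (norm x)\<^sup>2)" if x: "x \<in> K" "x \<noteq> 0" for n x
  proof -
    have "\<bar>\<zeta> x * trace (cutoffH (a n) x)\<bar> \<le> b * (c / (norm x)\<^sup>2)"
      unfolding abs_mult using b(1,2) x c(3)[OF a x(2)] by (intro mult_mono) auto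
    also have "\<dots> \<le> (b * c) * (1 + 1 / (norm x)\<^sup>2)" using b c' by (simp add: distrib_left)
    finally have 1: "\<bar>\<zeta> x * trace (cutoffH (a n) x)\<bar> \<le> (b * c) * (1 + 1 / (norm x)\<^sup>2)" .
    have "\<bar>hole n x * trace (H' x)\<bar> \<le> 1 * b"
      unfolding abs_mult using b x h by (intro mult_mono) auto
    also have "\<dots> \<le> b * (1 + 1 / (norm x)\<^sup>2)" using b by (simp add: distrib_left)
    finally have 2: "\<bar>hole n x * trace (H' x)\<bar> \<le> b * (1 + 1 / (norm x)\<^sup>2)" .
    have "\<bar>G' x \<bullet> cutoffG (a n) x\<bar> \<le> b * (c / norm x)"
      using b x c' by (intro order_trans[OF Cauchy_Schwarz_ineq2] mult_mono c(2)[OF a]) auto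
    also have "\<dots> = (b * c) * (1 / norm x)" by simp
    also have "\<dots> \<le> (b * c) * (1 + 1 / (norm x)\<^sup>2)" using b c' inv by (intro mult_left_mono) auto
    finally have 3: "\<bar>G' x \<bullet> cutoffG (a n) x\<bar> \<le> (b * c) * (1 + 1 / (norm x)\<^sup>2)" .
    show ?thesis unfolding trH1 using 1 2 3 by (simp add: B_def distrib_right)
  qed
  have B2: "\<bar>G1 n x $ i\<bar> \<le> B * (1 + 1 / (norm x)\<^sup>2)" if x: "x \<in> K" "x \<noteq> 0" for n x
  proof -
    have "\<bar>\<zeta> x * cutoffG (a n) x $ i\<bar> \<le> b * (c / norm x)"
      unfolding abs_mult using b x c'
      by (intro mult_mono order_trans[OF component_le_norm_cart c(2)[OF a]]) auto
    also have "\<dots> = (b * c) * (1 / norm x)" by simp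
    also have "\<dots> \<le> (b * c) * (1 + 1 / (norm x)\<^sup>2)" using b c' inv by (intro mult_left_mono) auto
    finally have 1: "\<bar>\<zeta> x * cutoffG (a n) x $ i\<bar> \<le> (b * c) * (1 + 1 / (norm x)\<^sup>2)" .
    have "\<bar>hole n x * G' x $ i\<bar> \<le> 1 * b"
      unfolding abs_mult using b x h by (intro mult_mono order_trans[OF component_le_norm_cart]) auto
    also have "\<dots> \<le> b * (1 + 1 / (norm x)\<^sup>2)" using b by (simp add: distrib_left)
    finally have 2: "\<bar>hole n x * G' x $ i\<bar> \<le> b * (1 + 1 / (norm x)\<^sup>2)" .
    have "0 \<le> (2 * b * c) * (1 + 1 / (norm x)\<^sup>2)" using b c' by simp
    then show ?thesis unfolding G1_def using 1 2 by (simp add: B_def distrib_right)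
  qed
  have l1: "(\<lambda>n. trace (H1 n x)) \<longlonglongrightarrow> trace (H' x)" "(\<lambda>n. G1 n x $ i) \<longlonglongrightarrow> G' x $ i" if x0: "x \<noteq> 0" for x
  proof -
    obtain m where m: "\<And>n. n \<ge> m \<Longrightarrow> 2 \<le> (real n + 1)\<^sup>2 * (norm x)\<^sup>2" using hole_eventually[OF x0] by blast
    have e: "hole n x = 1" "cutoffG (a n) x = 0" "cutoffH (a n) x = 0" if "n \<ge> m" for n
      using m[OF that] cutoff_values(2,5,6)[OF a[of n], of x] by (auto simp: hole_def a_def)
    show "(\<lambda>n. trace (H1 n x)) \<longlonglongrightarrow> trace (H' x)"
      by (rule tendsto_eventually) (auto simp: eventually_sequentially trH1 e trace_0[unfolded mat_0] intro!: exI[of _ m])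
    show "(\<lambda>n. G1 n x $ i) \<longlonglongrightarrow> G' x $ i"
      by (rule tendsto_eventually) (auto simp: eventually_sequentially G1_def e intro!: exI[of _ m])
  qed
  have m1: "(\<lambda>x. trace (H1 n x)) \<in> borel_measurable borel" "(\<lambda>x. G1 n x $ i) \<in> borel_measurable borel" for n
    by (rule borel_measurable_continuous_onI; use has_C2D[OF \<xi>] in \<open>auto simp: trace_def intro!: continuous_intros\<close>)+
  have m2: "(\<lambda>x. trace (H' x)) \<in> borel_measurable borel" "(\<lambda>x. G' x $ i) \<in> borel_measurable borel"
    by (rule borel_measurable_continuous_onI; use has_C2D[OF \<zeta>] in \<open>auto simp: trace_def intro!: continuous_intros\<close>)+
  have z1: "trace (H1 n x) = 0" "G1 n x $ i = 0" if "x \<notin> K" for n x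
    using that z[OF that] \<zeta>0 by (auto simp: trH1 G1_def trace_0[unfolded mat_0])
  have z2: "trace (H' x) = 0" "G' x $ i = 0" if "x \<notin> K" for x
    using z[OF that] by (auto simp: trace_0[unfolded mat_0])
  note ds = dominated_singular[OF \<Omega> has_C2D(5)[OF u] K r ub \<sigma> C]
  show "integrable lborel (\<lambda>x. u x * trace (H' x))"
    by (rule ds(1)[OF _ _ m1(1) m2(1) z1(1) z2(1) B1 B l1(1)])
  show "integrable lborel (\<lambda>x. u x * G' x $ i)"
    by (rule ds(1)[OF _ _ m1(2) m2(2) z1(2) z2(2) B2 B l1(2)])
  show "(\<lambda>n. LINT x|lborel. \<zeta> x * hole n x * trace (H x)) \<longlonglongrightarrow> (LINT x|lborel. u x * trace (H' x))"
    using ds(2)[OF _ _ m1(1) m2(1) z1(1) z2(1) B1 B l1(1)] g(2) by (simp add: \<xi>_def)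
  show "(\<lambda>n. LINT x|lborel. \<zeta> x * hole n x * G x $ i) \<longlonglongrightarrow> - (LINT x|lborel. u x * G' x $ i)"
    using tendsto_minus[OF ds(2)[OF _ _ m1(2) m2(2) z1(2) z2(2) B2 B l1(2)]] g(1) by (simp add: \<xi>_def)
qed

lemma measurable_singular:
  fixes h :: "real^'n \<Rightarrow> real"
  assumes h: "continuous_on (\<Omega> - {0}) h" and K: "compact K" "K \<subseteq> \<Omega>"
    and \<phi>[measurable]: "\<phi> \<in> borel_measurable borel" and \<phi>0: "\<And>x. x \<notin> K \<Longrightarrow> \<phi> x = 0"
  shows "(\<lambda>x. \<phi> x * h x) \<in> borel_measurable lborel"
proof -
  define h' where "h' x = indicator (K - {0}) x *\<^sub>R h x + indicator {0} x * h 0" for x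
  have "(\<lambda>x. indicator (K - {0}) x *\<^sub>R h x) \<in> borel_measurable borel"
    using K by (intro borel_measurable_continuous_on_indicator continuous_on_subset[OF h]) (auto simp: borel_compact)
  then have [measurable]: "h' \<in> borel_measurable borel" unfolding h'_def by measurable
  have "(\<lambda>x. \<phi> x * h x) = (\<lambda>x. \<phi> x * h' x)"
    using \<phi>0 by (auto simp: h'_def indicator_def fun_eq_iff)
  then show ?thesis by simp
qed

lemma set_integrable_singular:
  fixes h :: "real^'n \<Rightarrow> real"
  assumes h: "continuous_on (\<Omega> - {0}) h" and K: "compact K" "K \<subseteq> \<Omega>" and r: "r > 0"
    and b: "set_integrable lborel (ball 0 r) h"
  shows "set_integrable lborel K h"
proof -
  have 1: "set_integrable lborel (K \<inter> ball 0 r) h"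
    by (rule set_integrable_subset[OF b]) (use borel_compact[OF K(1)] in auto)
  have "compact (K - ball 0 r)" using K by (intro compact_diff) auto
  moreover have "continuous_on (K - ball 0 r) h" using r K by (intro continuous_on_subset[OF h]) auto
  ultimately have "set_integrable lborel (K - ball 0 r) h"
    unfolding set_integrable_def by (rule borel_integrable_compact)
  from set_integrable_Un[OF 1 this] have "set_integrable lborel (K \<inter> ball 0 r \<union> (K - ball 0 r)) h"
    using borel_compact[OF K(1)] by auto
  moreover have "K \<inter> ball 0 r \<union> (K - ball 0 r) = K" by blast
  ultimately show ?thesis by simp
qed

lemma set_integrable_ball_power:
  fixes h :: "real^'n \<Rightarrow> real"
  assumes h: "continuous_on (\<Omega> - {0}) h" and r: "r > 0" "cball 0 r \<subseteq> \<Omega>"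
    and b: "\<And>x. 0 < norm x \<Longrightarrow> norm x < r \<Longrightarrow> \<bar>h x\<bar> \<le> C * norm x powr (-\<gamma>)" and \<gamma>: "\<gamma> < CARD('n)"
  shows "set_integrable lborel (ball 0 r) h"
  unfolding set_integrable_def
proof (rule Bochner_Integration.integrable_bound)
  show "integrable lborel (\<lambda>x::real^'n. C * (norm x powr (-\<gamma>) * indicator (ball 0 r) x))"
    using \<gamma> r by (intro integrable_mult_right integrable_power_near) auto
  show "(\<lambda>x. indicat_real (ball 0 r) x *\<^sub>R h x) \<in> borel_measurable lborel"
    using measurable_singular[OF h compact_cball r(2) borel_measurable_indicator, of "ball 0 r"] by simp
  have "AE x in lborel. x \<noteq> (0::real^'n)" by (rule AE_lborel_singleton)
  then show "AE x in lborel. norm (indicat_real (ball 0 r) x *\<^sub>R h x) \<le> norm (C * (norm x powr (-\<gamma>) * indicator (ball 0 r) x))"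
  proof eventually_elim
    case (elim x)
    then show ?case using b[of x] by (auto simp: indicator_def)
  qed
qed

text \<open>The counterpart for the terms of the equation: no derivative falls on the hole, but
  integrability of \<open>h\<close> across the origin has to be known.\<close>

lemma hole_limit:
  fixes h \<zeta> :: "real^'n \<Rightarrow> real"
  assumes h: "continuous_on (\<Omega> - {0}) h" and K: "compact K" "K \<subseteq> \<Omega>"
    and i: "set_integrable lborel K h"
    and \<zeta>: "continuous_on UNIV \<zeta>" and \<zeta>0: "\<And>x. x \<notin> K \<Longrightarrow> \<zeta> x = 0"
  shows "integrable lborel (\<lambda>x. \<zeta> x * h x)"
    "(\<lambda>n. LINT x|lborel. \<zeta> x * hole n x * h x) \<longlonglongrightarrow> (LINT x|lborel. \<zeta> x * h x)"
proof -
  have [measurable]: "\<zeta> \<in> borel_measurable borel" using \<zeta> by (rule borel_measurable_continuous_onI)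
  have [measurable]: "hole n \<in> borel_measurable borel" for n :: nat
    unfolding hole_def using has_C2D(5)[OF has_C2_cutoff] by (rule borel_measurable_continuous_onI)
  have hole: "0 \<le> hole n x" "hole n x \<le> 1" for n and x :: "real^'n"
    unfolding hole_def by (rule cutoff_values; simp)+
  have "bounded (\<zeta> ` K)"
    by (rule compact_imp_bounded[OF compact_continuous_image[OF continuous_on_subset[OF \<zeta> subset_UNIV] K(1)]])
  then obtain b where b: "b > 0" "\<And>x. x \<in> K \<Longrightarrow> \<bar>\<zeta> x\<bar> \<le> b" by (auto simp: bounded_pos)
  define W where "W x = b * \<bar>indicator K x *\<^sub>R h x\<bar>" for x
  have W: "integrable lborel W" unfolding W_def using i unfolding set_integrable_def
    by (intro integrable_mult_right integrable_abs)
  have m: "(\<lambda>x. \<zeta> x * hole n x * h x) \<in> borel_measurable lborel" for n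
    by (rule measurable_singular[OF h K]) (auto simp: \<zeta>0)
  have m': "(\<lambda>x. \<zeta> x * h x) \<in> borel_measurable lborel"
    by (rule measurable_singular[OF h K]) (auto simp: \<zeta>0)
  have d: "AE x in lborel. norm (\<zeta> x * hole n x * h x) \<le> W x" for n
  proof (rule AE_I2)
    fix x
    show "norm (\<zeta> x * hole n x * h x) \<le> W x"
    proof (cases "x \<in> K")
      case True
      have "\<bar>\<zeta> x\<bar> * hole n x * \<bar>h x\<bar> \<le> b * 1 * \<bar>h x\<bar>" using hole[of n x] b(1) b(2)[OF True]
        by (intro mult_mono) auto
      then show ?thesis using True hole[of n x] by (simp add: W_def abs_mult)
    next
      case False then show ?thesis by (simp add: W_def \<zeta>0)
    qed
  qed
  have l: "AE x in lborel. (\<lambda>n. \<zeta> x * hole n x * h x) \<longlonglongrightarrow> \<zeta> x * h x"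
  proof -
    have "AE x in lborel. x \<noteq> (0::real^'n)" by (rule AE_lborel_singleton)
    then show ?thesis
    proof eventually_elim
      case (elim x)
      obtain m where m: "\<And>n. n \<ge> m \<Longrightarrow> 2 \<le> (real n + 1)\<^sup>2 * (norm x)\<^sup>2" using hole_eventually[OF elim] by blast
      have "hole n x = 1" if "n \<ge> m" for n
        unfolding hole_def by (rule cutoff_values(2)[OF _ m[OF that]]) simp
      then show ?case by (intro tendsto_eventually) (auto simp: eventually_sequentially intro!: exI[of _ m])
    qed
  qed
  show "integrable lborel (\<lambda>x. \<zeta> x * h x)"
    by (rule integrable_dominated_convergence[OF m' m W l d])
  show "(\<lambda>n. LINT x|lborel. \<zeta> x * hole n x * h x) \<longlonglongrightarrow> (LINT x|lborel. \<zeta> x * h x)"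
    by (rule integral_dominated_convergence[OF m' m W l d])
qed

section \<open>The weak equation\<close>

lemma smooth_has_C2:
  assumes "smooth \<zeta>"
  shows "has_C2 UNIV \<zeta> (grad \<zeta>) (hess \<zeta>)"
proof (rule C2_on_imp_has_C2, unfold C2_on_def, intro conjI ballI allI)
  have d: "pdiffs is \<zeta> differentiable (at x)" for "is" x using assms unfolding smooth_def by blast
  show "\<zeta> differentiable (at x)" for x using d[of "[]"] by simp
  show "pdiff i \<zeta> differentiable (at x)" for i x using d[of "[i]"] by simp
  show "continuous_on UNIV (pdiffs [j, i] \<zeta>)" for i j
    using d[of "[j,i]"] differentiable_imp_continuous_within by (blast intro: continuous_at_imp_continuous_on)
qed simp

lemma pdiffs_snoc: "pdiffs (is @ [i]) f = pdiffs is (pdiff i f)"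
  by (induction "is") auto

lemma smooth_pdiff: "smooth \<zeta> \<Longrightarrow> smooth (pdiff i \<zeta>)"
  unfolding smooth_def by (metis pdiffs_snoc)

text \<open>The two conditions on \<sigma> have separate roles: \<sigma> + 2 < N lets the Laplacian
  of the cut off test functions act on \<open>u\<close>, and \<sigma>p < N makes u^p integrable. The
  weak gradient is the classical gradient off the origin.\<close>

lemma weak_solution:
  fixes u :: "real^'n \<Rightarrow> real"
  assumes \<Omega>: "open \<Omega>" "0 \<in> \<Omega>" and u: "has_C2 (\<Omega> - {0}) u (grad u) H"
    and u0: "\<And>x. x \<in> \<Omega> - {0} \<Longrightarrow> u x \<ge> 0"
    and eq: "\<And>x. x \<in> \<Omega> - {0} \<Longrightarrow> trace (H x) = u x powr p - M * norm (grad u x) powr q"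
    and M: "M > 0" and pq: "1 < q" "q \<le> p"
    and r: "r > 0" and ub: "\<And>x. 0 < norm x \<Longrightarrow> norm x < r \<Longrightarrow> u x \<le> C * norm x powr (-\<sigma>)" and C: "C \<ge> 0"
    and \<sigma>: "\<sigma> + 2 < CARD('n)" "\<sigma> * p < CARD('n)"
  shows "W1loc q \<Omega> u \<and> Lloc p \<Omega> u \<and>
     (\<exists>g. weak_grad \<Omega> u g \<and>
        (\<forall>\<zeta>. test_fun \<Omega> \<zeta> \<longrightarrow>
           (LINT x:\<Omega>|lborel. g x \<bullet> grad \<zeta> x) + (LINT x:\<Omega>|lborel. u x powr p * \<zeta> x)
             - M * (LINT x:\<Omega>|lborel. norm (g x) powr q * \<zeta> x) = 0))"
proof -
  note D = has_C2D[OF u]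
  obtain r0 where r0: "r0 > 0" "cball 0 r0 \<subseteq> \<Omega>" using \<Omega> open_contains_cball by blast
  define \<rho> where "\<rho> = min r r0"
  have \<rho>: "\<rho> > 0" "cball 0 \<rho> \<subseteq> \<Omega>" "\<rho> \<le> r" using r r0 by (auto simp: \<rho>_def)
  have ub': "\<bar>u x\<bar> \<le> C * norm x powr (-\<sigma>)" if "0 < norm x" "norm x < \<rho>" for x
    using ub[of x] u0[of x] that \<rho> by force
  have cup: "continuous_on (\<Omega> - {0}) (\<lambda>x. u x powr p)"
    by (intro continuous_on_powr' D continuous_intros) (use u0 pq in auto)
  have cgq: "continuous_on (\<Omega> - {0}) (\<lambda>x. norm (grad u x) powr q)"
    by (intro continuous_on_powr' D continuous_intros) (use pq in auto)
  have upK: "set_integrable lborel K (\<lambda>x. u x powr p)" if K: "compact K" "K \<subseteq> \<Omega>" for K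
  proof (rule set_integrable_singular[OF cup K \<rho>(1)], rule set_integrable_ball_power[OF cup \<rho>(1,2) _ \<sigma>(2)])
    fix x :: "real^'n" assume x: "0 < norm x" "norm x < \<rho>"
    then have "0 \<le> u x" using u0[of x] \<rho> by force
    then have "u x powr p \<le> (C * norm x powr (-\<sigma>)) powr p" using ub'[OF x] pq by (intro powr_mono2) auto
    also have "\<dots> = C powr p * norm x powr (-(\<sigma> * p))" using C by (simp add: powr_mult powr_powr)
    finally show "\<bar>u x powr p\<bar> \<le> C powr p * norm x powr (-(\<sigma> * p))" by simp
  qed
  note rl = removable_limits[OF \<Omega>(1) u _ _ \<rho>(1) ub' \<sigma>(1) C]
  have gqb: "set_integrable lborel (ball 0 (\<rho>/2)) (\<lambda>x. norm (grad u x) powr q)"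
  proof -
    \<comment> \<open>With this \<open>a\<close> the bump \<zeta> is 1 on the ball of radius
      \<rho>/2 and 0 outside that of radius \<rho>.\<close>
    define a where "a = 2 / \<rho>\<^sup>2"
    have a: "a > 0" using \<rho> by (simp add: a_def)
    define \<zeta> where "\<zeta> x = 1 - cutoff a x" for x :: "real^'n"
    have \<zeta>C: "has_C2 UNIV \<zeta> (\<lambda>x. 0 - cutoffG a x) (\<lambda>x. 0 - cutoffH a x)"
      unfolding \<zeta>_def by (rule has_C2_diff[OF has_C2_const has_C2_cutoff])
    have \<zeta>0: "\<zeta> x = 0" if "x \<notin> cball 0 \<rho>" for x
    proof -
      have "\<rho>\<^sup>2 \<le> (norm x)\<^sup>2" using that \<rho> by (intro power_mono) auto
      then have "2 \<le> a * (norm x)\<^sup>2" using \<rho> by (simp add: a_def field_simps)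
      then show ?thesis using cutoff_values(2)[OF a] by (simp add: \<zeta>_def)
    qed
    have \<zeta>1: "\<zeta> x = 1" if "x \<in> ball 0 (\<rho>/2)" for x
    proof -
      have "(norm x)\<^sup>2 \<le> (\<rho>/2)\<^sup>2" using that \<rho> by (intro power_mono) auto
      then have "a * (norm x)\<^sup>2 \<le> 1" using \<rho>(1)
        by (simp add: a_def field_simps, use zero_le_power2[of "norm x"] in linarith)
      then show ?thesis using cutoff_values(1)[OF a] by (simp add: \<zeta>_def)
    qed
    have \<zeta>p: "0 \<le> \<zeta> x" for x using cutoff_values(4)[OF a] by (simp add: \<zeta>_def)
    note Kb = compact_cball[of 0 \<rho>] \<rho>(2)
    have R1: "(\<lambda>n. LINT x|lborel. \<zeta> x * hole n x * trace (H x)) \<longlonglongrightarrow> (LINT x|lborel. u x * trace (0 - cutoffH a x))"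
      and R2: "\<And>n. integrable lborel (\<lambda>x. \<zeta> x * hole n x * trace (H x))"
      using rl(1,5)[OF Kb _ _ \<zeta>C \<zeta>0] by auto
    have U: "(\<lambda>n. LINT x|lborel. \<zeta> x * hole n x * u x powr p) \<longlonglongrightarrow> (LINT x|lborel. \<zeta> x * u x powr p)"
      by (rule hole_limit(2)[OF cup Kb upK[OF Kb] has_C2D(5)[OF \<zeta>C] \<zeta>0])
    have Ui: "integrable lborel (\<lambda>x. \<zeta> x * hole n x * u x powr p)" for n
    proof (rule hole_limit(1)[OF cup Kb upK[OF Kb]])
      show "continuous_on UNIV (\<lambda>x. \<zeta> x * hole n x)"
        unfolding hole_def by (intro continuous_intros has_C2D(5)[OF \<zeta>C] has_C2D(5)[OF has_C2_cutoff])
    qed (simp add: \<zeta>0)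
    have hole: "0 \<le> hole n x" "hole n x \<le> 1" for n and x :: "real^'n"
      unfolding hole_def by (rule cutoff_values; simp)+
    have hole0: "hole n (0::real^'n) = 0" for n unfolding hole_def by (rule cutoff_values) auto
    \<comment> \<open>Multiplied by \<zeta> and the hole the equation holds at every point: at the
      origin and outside the ball the factor vanishes.\<close>
    have Me: "M * (\<zeta> x * hole n x * norm (grad u x) powr q) = \<zeta> x * hole n x * u x powr p - \<zeta> x * hole n x * trace (H x)" for x n
    proof (cases "x = 0 \<or> x \<notin> cball 0 \<rho>")
      case True then show ?thesis using \<zeta>0 by (auto simp: hole0)
    next
      case False
      then have "x \<in> \<Omega> - {0}" using \<rho>(2) by auto
      then show ?thesis by (simp add: eq algebra_simps)
    qed
    have Mi: "integrable lborel (\<lambda>x. \<zeta> x * hole n x * norm (grad u x) powr q)" for n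
    proof -
      have "integrable lborel (\<lambda>x. M * (\<zeta> x * hole n x * norm (grad u x) powr q))"
        unfolding Me by (intro Bochner_Integration.integrable_diff Ui R2)
      then show ?thesis using M by simp
    qed
    have "convergent (\<lambda>n. LINT x|lborel. \<zeta> x * hole n x * norm (grad u x) powr q)"
    proof -
      have "(LINT x|lborel. \<zeta> x * hole n x * norm (grad u x) powr q) =
        ((LINT x|lborel. \<zeta> x * hole n x * u x powr p) - (LINT x|lborel. \<zeta> x * hole n x * trace (H x))) / M" for n
      proof -
        have "M * (LINT x|lborel. \<zeta> x * hole n x * norm (grad u x) powr q) = (LINT x|lborel. M * (\<zeta> x * hole n x * norm (grad u x) powr q))" by simp
        also have "\<dots> = (LINT x|lborel. \<zeta> x * hole n x * u x powr p) - (LINT x|lborel. \<zeta> x * hole n x * trace (H x))"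
          unfolding Me by (intro Bochner_Integration.integral_diff Ui R2)
        finally show ?thesis using M by (simp add: field_simps)
      qed
      then show ?thesis using tendsto_divide[OF tendsto_diff[OF U R1] tendsto_const[of M]] M
        by (auto simp: convergent_def)
    qed
    then have "Bseq (\<lambda>n. LINT x|lborel. \<zeta> x * hole n x * norm (grad u x) powr q)" by (rule convergent_imp_Bseq)
    then obtain B where B: "B > 0" "\<And>n. \<bar>LINT x|lborel. \<zeta> x * hole n x * norm (grad u x) powr q\<bar> \<le> B"
      by (auto simp: Bseq_def)
    have mz: "(\<lambda>x. \<zeta> x * norm (grad u x) powr q) \<in> borel_measurable lborel"
      by (rule measurable_singular[OF cgq Kb _ \<zeta>0]) (use has_C2D(5)[OF \<zeta>C] in \<open>auto intro: borel_measurable_continuous_onI\<close>)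
    define F where "F n x = ennreal (\<zeta> x * hole n x * norm (grad u x) powr q)" for n x
    \<comment> \<open>Fatou's lemma. The integrals with a hole are bounded because the two other
      terms of the tested equation converge, and the integrands are nonnegative.\<close>
    have "(\<integral>\<^sup>+x. ennreal \<bar>\<zeta> x * norm (grad u x) powr q\<bar> \<partial>lborel) = (\<integral>\<^sup>+x. liminf (\<lambda>n. F n x) \<partial>lborel)"
    proof (rule nn_integral_cong_AE)
      have "AE x in lborel. x \<noteq> (0::real^'n)" by (rule AE_lborel_singleton)
      then show "AE x in lborel. ennreal \<bar>\<zeta> x * norm (grad u x) powr q\<bar> = liminf (\<lambda>n. F n x)"
      proof eventually_elim
        case (elim x)
        obtain m where m: "\<And>n. n \<ge> m \<Longrightarrow> 2 \<le> (real n + 1)\<^sup>2 * (norm x)\<^sup>2" using hole_eventually[OF elim] by blast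
        have "hole n x = 1" if "n \<ge> m" for n
          unfolding hole_def by (rule cutoff_values(2)[OF _ m[OF that]]) simp
        then have "(\<lambda>n. F n x) \<longlonglongrightarrow> ennreal (\<zeta> x * norm (grad u x) powr q)"
          unfolding F_def by (intro tendsto_eventually) (auto simp: eventually_sequentially intro!: exI[of _ m])
        from lim_imp_Liminf[OF _ this] show ?case using \<zeta>p by (simp add: abs_mult)
      qed
    qed
    also have "\<dots> \<le> liminf (\<lambda>n. \<integral>\<^sup>+x. F n x \<partial>lborel)"
      by (rule nn_integral_liminf) (use Mi in \<open>auto simp: F_def\<close>)
    also have "\<dots> \<le> limsup (\<lambda>n. \<integral>\<^sup>+x. F n x \<partial>lborel)" by (rule Liminf_le_Limsup) simp
    also have "\<dots> \<le> ennreal B"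
    proof (rule Limsup_bounded, rule always_eventually, rule allI)
      fix n
      have "(\<integral>\<^sup>+x. F n x \<partial>lborel) = ennreal (LINT x|lborel. \<zeta> x * hole n x * norm (grad u x) powr q)"
        unfolding F_def by (rule nn_integral_eq_integral[OF Mi]) (use \<zeta>p hole in auto)
      also have "\<dots> \<le> ennreal B" using B(2)[of n] by (intro ennreal_leI) auto
      finally show "(\<integral>\<^sup>+x. F n x \<partial>lborel) \<le> ennreal B" .
    qed
    finally have "integrable lborel (\<lambda>x. \<zeta> x * norm (grad u x) powr q)"
      using B(1) by (intro nn_integral_bound_imp(1)[OF mz]) auto
    then have "integrable lborel (\<lambda>x. indicator (ball 0 (\<rho>/2)) x *\<^sub>R (\<zeta> x * norm (grad u x) powr q))"
      by (intro integrable_mult_indicator) auto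
    moreover have "(\<lambda>x. indicator (ball 0 (\<rho>/2)) x *\<^sub>R (\<zeta> x * norm (grad u x) powr q)) = (\<lambda>x. indicator (ball 0 (\<rho>/2)) x *\<^sub>R norm (grad u x) powr q)"
      using \<zeta>1 by (auto simp: indicator_def fun_eq_iff)
    ultimately show ?thesis unfolding set_integrable_def by simp
  qed
  have gqK: "set_integrable lborel K (\<lambda>x. norm (grad u x) powr q)" if K: "compact K" "K \<subseteq> \<Omega>" for K
    using \<rho>(1) by (intro set_integrable_singular[OF cgq K _ gqb]) auto
  have oneK: "set_integrable lborel K (\<lambda>x. 1::real)" if K: "compact K" for K :: "(real^'n) set"
    unfolding set_integrable_def using borel_integrable_compact[OF K, of "\<lambda>x. 1::real"] by simp
  \<comment> \<open>On a compact set the constant 1 is integrable, so integrability of a higher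
    power gives that of every lower one.\<close>
  have powle: "\<bar>t\<bar> powr a \<le> 1 + s powr b" if "\<bar>t\<bar> \<le> s" "0 \<le> a" "a \<le> b" for t s a b :: real
  proof (cases "\<bar>t\<bar> \<le> 1")
    case True
    then have "\<bar>t\<bar> powr a \<le> 1 powr a" using that by (intro powr_mono2) auto
    then show ?thesis by (smt (verit) powr_ge_zero powr_one_eq_one)
  next
    case False
    then have "\<bar>t\<bar> powr a \<le> \<bar>t\<bar> powr b" using that by (intro powr_mono) auto
    also have "\<dots> \<le> s powr b" using that by (intro powr_mono2) auto
    finally show ?thesis by simp
  qed
  have bnd: "set_integrable lborel K f"
    if K: "compact K" "K \<subseteq> \<Omega>" and f: "continuous_on (\<Omega> - {0}) f" and h: "set_integrable lborel K h"
      and le: "\<And>x. x \<in> K - {0} \<Longrightarrow> \<bar>f x\<bar> \<le> 1 + h x" for K and f h :: "real^'n \<Rightarrow> real"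
    unfolding set_integrable_def
  proof (rule Bochner_Integration.integrable_bound)
    show "integrable lborel (\<lambda>x. indicator K x *\<^sub>R 1 + indicator K x *\<^sub>R h x)"
      using oneK[OF K(1)] h unfolding set_integrable_def by (rule Bochner_Integration.integrable_add)
    show "(\<lambda>x. indicat_real K x *\<^sub>R f x) \<in> borel_measurable lborel"
      using measurable_singular[OF f K borel_measurable_indicator[OF borel_compact[OF K(1)]]] by simp
    have "AE x in lborel. x \<noteq> (0::real^'n)" by (rule AE_lborel_singleton)
    then show "AE x in lborel. norm (indicat_real K x *\<^sub>R f x) \<le> norm (indicator K x *\<^sub>R 1 + indicator K x *\<^sub>R h x)"
    proof eventually_elim
      case (elim x) then show ?case using le[of x] by (auto simp: indicator_def)
    qed
  qed
  have cabs: "continuous_on (\<Omega> - {0}) (\<lambda>x. \<bar>u x\<bar> powr a)" "continuous_on (\<Omega> - {0}) (\<lambda>x. \<bar>grad u x $ i\<bar> powr a)" if "a > 0" for a i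
    by (intro continuous_on_powr' D continuous_intros; use that in auto)+
  have Lp: "Lloc p \<Omega> u" unfolding Lloc_def
  proof (intro allI impI)
    fix K assume K: "compact K \<and> K \<subseteq> \<Omega>"
    then show "set_integrable lborel K (\<lambda>x. \<bar>u x\<bar> powr p)"
      using pq u0 by (intro bnd[OF _ _ _ upK] cabs) (auto intro!: order_trans[OF powle[where b=p]])
  qed
  have Lq: "Lloc q \<Omega> u" unfolding Lloc_def
  proof (intro allI impI)
    fix K assume K: "compact K \<and> K \<subseteq> \<Omega>"
    have "\<bar>\<bar>u x\<bar> powr q\<bar> \<le> 1 + u x powr p" if "x \<in> K - {0}" for x
    proof -
      have "\<bar>u x\<bar> = u x" using u0[of x] that K by auto
      with powle[of "u x" "u x" q p] pq show ?thesis by auto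
    qed
    then show "set_integrable lborel K (\<lambda>x. \<bar>u x\<bar> powr q)"
      using pq K by (intro bnd[OF _ _ _ upK] cabs) auto
  qed
  have giK: "set_integrable lborel K (\<lambda>x. \<bar>grad u x $ i\<bar> powr q)" "set_integrable lborel K (\<lambda>x. grad u x $ i)"
    if K: "compact K" "K \<subseteq> \<Omega>" for K i
  proof -
    have c: "\<bar>grad u x $ i\<bar> \<le> norm (grad u x)" for x by (rule component_le_norm_cart)
    show "set_integrable lborel K (\<lambda>x. \<bar>grad u x $ i\<bar> powr q)"
      using pq powle[OF c, of q q] by (intro bnd[OF K _ gqK[OF K]] cabs) auto
    show "set_integrable lborel K (\<lambda>x. grad u x $ i)"
      using pq powle[OF c, of 1 q] by (intro bnd[OF K _ gqK[OF K]] continuous_intros D) auto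
  qed
  have Lg: "Lloc q \<Omega> (\<lambda>x. grad u x $ i)" for i unfolding Lloc_def using giK by blast
  have cgi: "continuous_on (\<Omega> - {0}) (\<lambda>x. grad u x $ i)" for i by (intro continuous_intros D)
  have W: "integrable lborel (\<lambda>x. \<zeta> x * grad u x $ i)"
      "(LINT x|lborel. \<zeta> x * grad u x $ i) = - (LINT x|lborel. u x * G' x $ i)"
      "integrable lborel (\<lambda>x. u x * G' x $ i)"
    if K: "compact K" "K \<subseteq> \<Omega>" and \<zeta>: "has_C2 UNIV \<zeta> G' H'" "\<And>x. x \<notin> K \<Longrightarrow> \<zeta> x = 0" for K \<zeta> G' H' i
  proof -
    note hl = hole_limit[OF cgi K giK(2)[OF K] has_C2D(5)[OF \<zeta>(1)] \<zeta>(2)]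
    show "integrable lborel (\<lambda>x. \<zeta> x * grad u x $ i)" by (rule hl(1))
    show "(LINT x|lborel. \<zeta> x * grad u x $ i) = - (LINT x|lborel. u x * G' x $ i)"
      by (rule LIMSEQ_unique[OF hl(2) rl(2)[OF K _ _ \<zeta>]])
    show "integrable lborel (\<lambda>x. u x * G' x $ i)" by (rule rl(4)[OF K _ _ \<zeta>])
  qed
  have Ti: "(LINT x:\<Omega>|lborel. f x) = (LINT x|lborel. f x)" if "\<And>x. x \<notin> K \<Longrightarrow> f x = 0" "K \<subseteq> \<Omega>" for K and f :: "real^'n \<Rightarrow> real"
    unfolding set_lebesgue_integral_def
    by (rule Bochner_Integration.integral_cong) (use that in \<open>auto simp: indicator_def\<close>)
  have tf: "compact (closure {x. \<zeta> x \<noteq> 0})" "closure {x. \<zeta> x \<noteq> 0} \<subseteq> \<Omega>" "has_C2 UNIV \<zeta> (grad \<zeta>) (hess \<zeta>)"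
      "\<And>x. x \<notin> closure {x. \<zeta> x \<noteq> 0} \<Longrightarrow> \<zeta> x = 0" if "test_fun \<Omega> \<zeta>" for \<zeta> :: "real^'n \<Rightarrow> real"
    using that smooth_has_C2 closure_subset[of "{x. \<zeta> x \<noteq> 0}"] by (auto simp: test_fun_def)
  have z0: "grad \<zeta> x = 0" "hess \<zeta> x = 0" if "test_fun \<Omega> \<zeta>" "x \<notin> closure {x. \<zeta> x \<noteq> 0}" for \<zeta> and x :: "real^'n"
    by (rule has_C2_zero_outside[OF tf(3)[OF that(1)] closed_closure tf(4)[OF that(1)] that(2)]; assumption)+
  have wg: "weak_grad \<Omega> u (grad u)" unfolding weak_grad_def
  proof (intro allI impI)
    fix \<zeta> :: "real^'n \<Rightarrow> real" and i assume t: "test_fun \<Omega> \<zeta>"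
    define K where "K = closure {x. \<zeta> x \<noteq> 0}"
    note T = tf[OF t, folded K_def] and Z = z0[OF t, folded K_def]
    have "(LINT x:\<Omega>|lborel. u x * pdiff i \<zeta> x) = (LINT x:\<Omega>|lborel. u x * grad \<zeta> x $ i)"
      by (simp add: grad_def)
    also have "\<dots> = (LINT x|lborel. u x * grad \<zeta> x $ i)" by (rule Ti[OF _ T(2)]) (simp add: Z)
    also have "\<dots> = - (LINT x|lborel. \<zeta> x * grad u x $ i)" using W(2)[OF T(1,2,3) T(4)] by simp
    also have "(LINT x|lborel. \<zeta> x * grad u x $ i) = (LINT x:\<Omega>|lborel. \<zeta> x * grad u x $ i)"
      by (rule Ti[OF _ T(2), symmetric]) (simp add: T(4))
    finally show "(LINT x:\<Omega>|lborel. u x * pdiff i \<zeta> x) = - (LINT x:\<Omega>|lborel. grad u x $ i * \<zeta> x)"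
      by (simp only: mult.commute)
  qed
  have main: "(LINT x:\<Omega>|lborel. grad u x \<bullet> grad \<zeta> x) + (LINT x:\<Omega>|lborel. u x powr p * \<zeta> x)
             - M * (LINT x:\<Omega>|lborel. norm (grad u x) powr q * \<zeta> x) = 0" if t: "test_fun \<Omega> \<zeta>" for \<zeta>
  proof -
    define K where "K = closure {x. \<zeta> x \<noteq> 0}"
    note T = tf[OF t, folded K_def] and Z = z0[OF t, folded K_def]
    have sm: "smooth \<zeta>" using t by (simp add: test_fun_def)
    \<comment> \<open>The relation \<open>W\<close> is applied to the partial derivatives of \<zeta>
      as test functions; this replaces the integral of the product of gradients by minus the
      integral of \<open>u\<close> times the Laplacian of \<zeta>.\<close>
    have gi: "has_C2 UNIV (\<lambda>x. grad \<zeta> x $ i) (grad (pdiff i \<zeta>)) (hess (pdiff i \<zeta>))" for i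
      using smooth_has_C2[OF smooth_pdiff[OF sm, of i]] by (simp add: grad_def)
    have gi0: "grad \<zeta> x $ i = 0" if "x \<notin> K" for x i using Z(1)[OF that] by simp
    note Wi = W[OF T(1,2) gi gi0]
    have "(LINT x:\<Omega>|lborel. grad u x \<bullet> grad \<zeta> x) = (LINT x|lborel. (\<Sum>i\<in>UNIV. grad \<zeta> x $ i * grad u x $ i))"
      by (subst Ti[OF _ T(2)]) (simp_all add: Z inner_vec_def mult.commute[of _ "grad \<zeta> _ $ _"])
    also have "\<dots> = (\<Sum>i\<in>UNIV. LINT x|lborel. grad \<zeta> x $ i * grad u x $ i)"
      by (rule Bochner_Integration.integral_sum) (use Wi(1) in auto)
    also have "\<dots> = - (\<Sum>i\<in>UNIV. LINT x|lborel. u x * grad (pdiff i \<zeta>) x $ i)"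
      by (simp add: Wi(2) sum_negf)
    also have "(\<Sum>i\<in>UNIV. LINT x|lborel. u x * grad (pdiff i \<zeta>) x $ i) = (LINT x|lborel. (\<Sum>i\<in>UNIV. u x * grad (pdiff i \<zeta>) x $ i))"
      by (rule Bochner_Integration.integral_sum[symmetric]) (use Wi(3) in auto)
    also have "\<dots> = (LINT x|lborel. u x * trace (hess \<zeta> x))"
      by (simp add: trace_hess laplacian_def grad_def sum_distrib_left)
    finally have 1: "(LINT x:\<Omega>|lborel. grad u x \<bullet> grad \<zeta> x) = - (LINT x|lborel. u x * trace (hess \<zeta> x))" .
    have A: "integrable lborel (\<lambda>x. \<zeta> x * u x powr p)" "integrable lborel (\<lambda>x. \<zeta> x * norm (grad u x) powr q)"
      using hole_limit(1)[OF cup T(1,2) upK[OF T(1,2)] has_C2D(5)[OF T(3)] T(4)]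
        hole_limit(1)[OF cgq T(1,2) gqK[OF T(1,2)] has_C2D(5)[OF T(3)] T(4)] by auto
    \<comment> \<open>The same sequence of integrals with holes has two limits: with derivatives
      moved to the test function it gives the integral of \<open>u\<close> times the Laplacian of
      \<zeta>, with the equation inserted it gives that of \<zeta> f.\<close>
    define f where "f x = u x powr p - M * norm (grad u x) powr q" for x
    have cf: "continuous_on (\<Omega> - {0}) f" unfolding f_def by (intro continuous_intros cup cgq)
    have fK: "set_integrable lborel K f" unfolding f_def
      by (intro set_integral_diff set_integrable_mult_right upK gqK T)
    have hole0: "hole n (0::real^'n) = 0" for n unfolding hole_def by (rule cutoff_values) auto
    have "\<zeta> x * hole n x * trace (H x) = \<zeta> x * hole n x * f x" for x n
    proof (cases "x = 0 \<or> x \<notin> K")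
      case True then show ?thesis using T(4) by (auto simp: hole0)
    next
      case False
      then have "x \<in> \<Omega> - {0}" using T(2) by auto
      then show ?thesis by (simp add: eq f_def)
    qed
    then have "(\<lambda>n. LINT x|lborel. \<zeta> x * hole n x * trace (H x)) = (\<lambda>n. LINT x|lborel. \<zeta> x * hole n x * f x)"
      by (simp only:)
    with rl(1)[OF T(1,2) _ _ T(3,4)] have "(\<lambda>n. LINT x|lborel. \<zeta> x * hole n x * f x) \<longlonglongrightarrow> (LINT x|lborel. u x * trace (hess \<zeta> x))"
      by simp
    from LIMSEQ_unique[OF this hole_limit(2)[OF cf T(1,2) fK has_C2D(5)[OF T(3)] T(4)]]
    have "(LINT x|lborel. u x * trace (hess \<zeta> x)) = (LINT x|lborel. \<zeta> x * f x)" by simp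
    also have "\<dots> = (LINT x|lborel. \<zeta> x * u x powr p) - M * (LINT x|lborel. \<zeta> x * norm (grad u x) powr q)"
      using A by (simp add: f_def right_diff_distrib mult.left_commute[of _ M])
    finally have 2: "(LINT x|lborel. u x * trace (hess \<zeta> x)) = \<dots>" .
    have "(LINT x:\<Omega>|lborel. u x powr p * \<zeta> x) = (LINT x|lborel. \<zeta> x * u x powr p)"
      "(LINT x:\<Omega>|lborel. norm (grad u x) powr q * \<zeta> x) = (LINT x|lborel. \<zeta> x * norm (grad u x) powr q)"
      by (subst Ti[OF _ T(2)], simp add: T(4), simp only: mult.commute)+
    with 1 2 show ?thesis by simp
  qed
  show ?thesis using Lp Lq Lg wg main unfolding W1loc_def by blast
qed

section \<open>Expansion of the Newtonian potential at the origin\<close>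

lemma LINT_power_near:
  fixes \<gamma> :: real
  assumes "\<gamma> < DIM('a::euclidean_space)"
  shows "\<exists>C\<ge>0. \<forall>\<rho>>0. (LINT y|(lborel::'a measure). norm y powr (-\<gamma>) * indicator (ball 0 \<rho>) y) \<le> C * \<rho> powr (DIM('a) - \<gamma>)"
proof -
  obtain C where C: "C \<ge> 0" "\<And>\<rho>. \<rho> > 0 \<Longrightarrow> (\<integral>\<^sup>+y. ennreal (norm y powr (-\<gamma>)) * indicator (ball 0 \<rho>) y \<partial>(lborel::'a measure))
    \<le> ennreal (C * \<rho> powr (DIM('a) - \<gamma>))" using power_integral_near[OF assms] by auto
  have "(LINT y|(lborel::'a measure). norm y powr (-\<gamma>) * indicator (ball 0 \<rho>) y) \<le> C * \<rho> powr (DIM('a) - \<gamma>)" if \<rho>: "\<rho> > 0" for \<rho>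
  proof -
    have "(\<integral>\<^sup>+y. ennreal \<bar>norm y powr (-\<gamma>) * indicator (ball 0 \<rho>) y\<bar> \<partial>(lborel::'a measure))
        = (\<integral>\<^sup>+y. ennreal (norm y powr (-\<gamma>)) * indicator (ball 0 \<rho>) y \<partial>(lborel::'a measure))"
      by (rule nn_integral_cong) (simp split: split_indicator)
    with C(2)[OF \<rho>] have b: "(\<integral>\<^sup>+y. ennreal \<bar>norm y powr (-\<gamma>) * indicator (ball 0 \<rho>) y\<bar> \<partial>(lborel::'a measure)) \<le> ennreal (C * \<rho> powr (DIM('a) - \<gamma>))"
      by (simp only:)
    have m: "(\<lambda>y::'a. norm y powr (-\<gamma>) * indicator (ball 0 \<rho>) y) \<in> borel_measurable lborel"
      by measurable simp
    show ?thesis using nn_integral_bound_imp(2)[OF m b] C(1) by simp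
  qed
  then show ?thesis using C(1) by blast
qed

lemma LINT_power_far:
  fixes \<gamma> :: real
  assumes "\<gamma> > DIM('a::euclidean_space)"
  shows "\<exists>C\<ge>0. \<forall>\<rho>>0. integrable (lborel::'a measure) (\<lambda>y. norm y powr (-\<gamma>) * indicator {y. \<rho> \<le> norm y} y) \<and>
    (LINT y|(lborel::'a measure). norm y powr (-\<gamma>) * indicator {y. \<rho> \<le> norm y} y) \<le> C * \<rho> powr (DIM('a) - \<gamma>)"
proof -
  obtain C where C: "C \<ge> 0" "\<And>\<rho>. \<rho> > 0 \<Longrightarrow> (\<integral>\<^sup>+y. ennreal (norm y powr (-\<gamma>)) * indicator {y. \<rho> \<le> norm y} y \<partial>(lborel::'a measure))
    \<le> ennreal (C * \<rho> powr (DIM('a) - \<gamma>))" using power_integral_far[OF assms] by auto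
  have "integrable (lborel::'a measure) (\<lambda>y. norm y powr (-\<gamma>) * indicator {y. \<rho> \<le> norm y} y) \<and>
    (LINT y|(lborel::'a measure). norm y powr (-\<gamma>) * indicator {y. \<rho> \<le> norm y} y) \<le> C * \<rho> powr (DIM('a) - \<gamma>)" if \<rho>: "\<rho> > 0" for \<rho>
  proof -
    have "(\<integral>\<^sup>+y. ennreal \<bar>norm y powr (-\<gamma>) * indicator {y. \<rho> \<le> norm y} y\<bar> \<partial>(lborel::'a measure))
        = (\<integral>\<^sup>+y. ennreal (norm y powr (-\<gamma>)) * indicator {y. \<rho> \<le> norm y} y \<partial>(lborel::'a measure))"
      by (rule nn_integral_cong) (simp split: split_indicator)
    with C(2)[OF \<rho>] have b: "(\<integral>\<^sup>+y. ennreal \<bar>norm y powr (-\<gamma>) * indicator {y. \<rho> \<le> norm y} y\<bar> \<partial>(lborel::'a measure)) \<le> ennreal (C * \<rho> powr (DIM('a) - \<gamma>))"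
      by (simp only:)
    have m: "(\<lambda>y::'a. norm y powr (-\<gamma>) * indicator {y. \<rho> \<le> norm y} y) \<in> borel_measurable lborel"
      by measurable
    have "0 \<le> C * \<rho> powr (DIM('a) - \<gamma>)" using C(1) by simp
    from nn_integral_bound_imp[OF m b this] show ?thesis by auto
  qed
  then show ?thesis using C(1) by blast
qed

text \<open>The \<open>j\<close>-th derivative of \<open>\<lambda>t. norm (t *\<^sub>R x - y) powr (-2 * m)\<close>, for \<open>j \<le> 3\<close>.\<close>
definition kernel_deriv :: "real \<Rightarrow> nat \<Rightarrow> real^'n::finite \<Rightarrow> real^'n \<Rightarrow> real \<Rightarrow> real" where
  "kernel_deriv m j x y t = (let Q = (norm (t *\<^sub>R x - y))\<^sup>2; Q' = 2 * (x \<bullet> (t *\<^sub>R x - y)); a = (norm x)\<^sup>2 in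
    if j = 0 then Q powr (-m)
    else if j = 1 then - m * Q powr (-m-1) * Q'
    else if j = 2 then m * (m+1) * Q powr (-m-2) * Q'\<^sup>2 - 2 * a * m * Q powr (-m-1)
    else - m * (m+1) * (m+2) * Q powr (-m-3) * Q' ^ 3 + 6 * a * m * (m+1) * Q powr (-m-2) * Q')"

lemma kernel_deriv_has_derivative:
  assumes "t *\<^sub>R x \<noteq> y" "j < 3"
  shows "((kernel_deriv m j x y) has_real_derivative kernel_deriv m (Suc j) x y t) (at t)"
proof -
  define Q where "Q t = (norm (t *\<^sub>R x - y))\<^sup>2" for t
  define Q' where "Q' t = 2 * (x \<bullet> (t *\<^sub>R x - y))" for t
  have Qp: "Q t > 0" using assms by (simp add: Q_def)
  have dQ: "(Q has_real_derivative Q' t) (at t)" for t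
  proof -
    have "Q = (\<lambda>t. t\<^sup>2 * (x \<bullet> x) - 2 * t * (x \<bullet> y) + y \<bullet> y)"
      unfolding fun_eq_iff Q_def power2_norm_eq_inner
      by (simp add: inner_diff_left inner_diff_right inner_commute[of y x] algebra_simps power2_eq_square)
    moreover have "((\<lambda>t. t\<^sup>2 * (x \<bullet> x) - 2 * t * (x \<bullet> y) + y \<bullet> y) has_real_derivative Q' t) (at t)"
      by (auto intro!: derivative_eq_intros simp: Q'_def inner_diff_right algebra_simps)
    ultimately show ?thesis by simp
  qed
  have dQ': "(Q' has_real_derivative 2 * (norm x)\<^sup>2) (at t)" for t
  proof -
    have "Q' = (\<lambda>t. t * (2 * (norm x)\<^sup>2) - 2 * (x \<bullet> y))"
      by (auto simp: Q'_def fun_eq_iff power2_norm_eq_inner inner_diff_right algebra_simps)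
    then show ?thesis by (auto intro!: derivative_eq_intros)
  qed
  have dP: "((\<lambda>t. Q t powr s) has_real_derivative s * Q t powr (s - 1) * Q' t) (at t)" for s
    using DERIV_fun_powr[OF dQ Qp, of s] by simp
  have "j = 0 \<or> j = 1 \<or> j = 2" using assms by auto
  then consider (a) "j = 0" | (b) "j = 1" | (c) "j = 2" by blast
  then show ?thesis
  proof cases
    case a
    then have "kernel_deriv m j x y = (\<lambda>t. Q t powr (-m))" by (simp add: fun_eq_iff kernel_deriv_def Q_def Let_def)
    moreover have "kernel_deriv m (Suc j) x y t = (-m) * Q t powr (-m-1) * Q' t"
      using a by (simp add: kernel_deriv_def Let_def Q_def Q'_def)
    ultimately show ?thesis using dP[of "-m"] by simp
  next
    case b
    then have e: "kernel_deriv m j x y = (\<lambda>t. - m * Q t powr (-m-1) * Q' t)" by (simp add: fun_eq_iff kernel_deriv_def Q_def Q'_def Let_def)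
    have "kernel_deriv m (Suc j) x y t = m * (m+1) * Q t powr (-m-2) * (Q' t)\<^sup>2 - 2 * (norm x)\<^sup>2 * m * Q t powr (-m-1)"
      using b by (simp add: kernel_deriv_def Let_def Q_def Q'_def)
    also have "\<dots> = (-m * ((-m-1) * Q t powr (-m-1-1) * Q' t)) * Q' t + (2 * (norm x)\<^sup>2) * (- m * Q t powr (-m-1))"
      by (simp add: algebra_simps power2_eq_square)
    finally show ?thesis unfolding e using DERIV_mult[OF DERIV_cmult[OF dP[of "-m-1"], of "-m"] dQ'] by simp
  next
    case c
    then have e: "kernel_deriv m j x y = (\<lambda>t. (m * (m+1) * Q t powr (-m-2)) * (Q' t * Q' t) - (2 * (norm x)\<^sup>2 * m) * Q t powr (-m-1))"
      by (simp add: fun_eq_iff kernel_deriv_def Q_def Q'_def Let_def power2_eq_square)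
    have "kernel_deriv m (Suc j) x y t = - m * (m+1) * (m+2) * Q t powr (-m-3) * Q' t ^ 3 + 6 * (norm x)\<^sup>2 * m * (m+1) * Q t powr (-m-2) * Q' t"
      using c by (simp add: kernel_deriv_def Let_def Q_def Q'_def)
    also have "\<dots> = ((m * (m+1)) * ((-m-2) * Q t powr (-m-2-1) * Q' t)) * (Q' t * Q' t)
        + (2 * (norm x)\<^sup>2 * Q' t + 2 * (norm x)\<^sup>2 * Q' t) * (m * (m+1) * Q t powr (-m-2))
        - (2 * (norm x)\<^sup>2 * m) * ((-m-1) * Q t powr (-m-1-1) * Q' t)"
      by (simp add: algebra_simps power2_eq_square power3_eq_cube)
    finally show ?thesis unfolding e
      using DERIV_diff[OF DERIV_mult[OF DERIV_cmult[OF dP[of "-m-2"], of "m * (m+1)"] DERIV_mult[OF dQ' dQ']] DERIV_cmult[OF dP[of "-m-1"], of "2 * (norm x)\<^sup>2 * m"]]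
      by simp
  qed
qed

text \<open>For 2t|x| \<le> |y| the point tx stays at distance at least |y|/2 from y, and every
  derivative in t costs a factor of order |x|/|y|.\<close>

lemma kernel_deriv_bound:
  assumes m: "m \<ge> 0"
  shows "\<exists>c\<ge>0. \<forall>j\<le>3. \<forall>(x::real^'n) y t. 0 \<le> t \<longrightarrow> t \<le> 1 \<longrightarrow> 2 * t * norm x \<le> norm y \<longrightarrow> y \<noteq> 0 \<longrightarrow>
    \<bar>kernel_deriv m j x y t\<bar> \<le> c * norm x ^ j * norm y powr (-(2 * m + real j))"
proof -
  \<comment> \<open>The summands are the coefficients of the four derivatives after \<bar>Q'\<bar>
    \<le> 2 |x| s, with s the distance from tx to y. The power of 2 in \<open>c\<close> below passes
    from s to |y|.\<close>
  define c0 where "c0 = 1 + 2 * m + (4 * m * (m+1) + 2 * m) + (8 * m * (m+1) * (m+2) + 12 * m * (m+1))"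
  define c where "c = c0 * 2 powr (2 * m + 3)"
  have c0: "1 \<le> c0" "2 * m \<le> c0" "4 * m * (m+1) + 2 * m \<le> c0" "8 * m * (m+1) * (m+2) + 12 * m * (m+1) \<le> c0"
    unfolding c0_def using m by (auto intro!: add_increasing add_increasing2)
  have "\<bar>kernel_deriv m j x y t\<bar> \<le> c * norm x ^ j * norm y powr (-(2 * m + real j))"
    if j: "j \<le> 3" and t: "0 \<le> t" "t \<le> 1" "2 * t * norm x \<le> norm y" and y: "y \<noteq> 0" for j x t and y :: "real^'n"
  proof -
    define s where "s = norm (t *\<^sub>R x - y)"
    have s: "norm y / 2 \<le> s"
      using norm_triangle_ineq3[of "t *\<^sub>R x" y] t unfolding s_def by simp
    have s0: "s > 0" using s y by (smt (verit) divide_pos_pos zero_less_norm_iff)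
    define P where "P = 2 * (x \<bullet> (t *\<^sub>R x - y))"
    define X where "X = norm x"
    have X: "X \<ge> 0" by (simp add: X_def)
    have P: "\<bar>P\<bar> \<le> 2 * X * s"
      using Cauchy_Schwarz_ineq2[of x "t *\<^sub>R x - y"] by (simp add: P_def X_def s_def)
    have sp: "(s\<^sup>2) powr a * s ^ i = s powr (2 * a + real i)" for a i
    proof -
      have "s\<^sup>2 = s powr 2" using s0 by simp
      then show ?thesis by (simp only: powr_powr powr_realpow[OF s0, symmetric] powr_add[symmetric])
    qed
    have sp0: "(s\<^sup>2) powr a = s powr (2 * a)" for a using sp[of a 0] by simp
    have P2: "P\<^sup>2 \<le> (2 * X * s)\<^sup>2" using power_mono[OF P, of 2] by simp
    have P3: "\<bar>P\<bar> ^ 3 \<le> (2 * X * s) ^ 3" by (rule power_mono[OF P]) simp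
    have k: "\<bar>kernel_deriv m j x y t\<bar> \<le> c0 * (X ^ j * s powr (-(2 * m + real j)))"
    proof -
      consider (a) "j = 0" | (b) "j = 1" | (c) "j = 2" | (d) "j = 3" using j by linarith
      then show ?thesis
      proof cases
        case a
        then have "kernel_deriv m j x y t = s powr (-(2 * m))" by (simp add: kernel_deriv_def Let_def s_def[symmetric] sp0)
        then have "\<bar>kernel_deriv m j x y t\<bar> = 1 * (X ^ j * s powr (-(2 * m + real j)))" using a by simp
        also have "\<dots> \<le> c0 * (X ^ j * s powr (-(2 * m + real j)))" using c0 X by (intro mult_right_mono) auto
        finally show ?thesis .
      next
        case b
        then have "\<bar>kernel_deriv m j x y t\<bar> = m * (s\<^sup>2) powr (-m-1) * \<bar>P\<bar>" using m by (simp add: kernel_deriv_def Let_def s_def[symmetric] P_def abs_mult)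
        also have "\<dots> \<le> m * (s\<^sup>2) powr (-m-1) * (2 * X * s)" using m P by (intro mult_left_mono) auto
        also have "\<dots> = 2 * m * (X * ((s\<^sup>2) powr (-m-1) * s ^ 1))" by simp
        also have "\<dots> = 2 * m * (X ^ j * s powr (-(2 * m + real j)))" unfolding sp using b by (simp add: algebra_simps)
        also have "\<dots> \<le> c0 * (X ^ j * s powr (-(2 * m + real j)))" using c0 X by (intro mult_right_mono) auto
        finally show ?thesis .
      next
        case c
        then have "kernel_deriv m j x y t = m * (m+1) * (s\<^sup>2) powr (-m-2) * P\<^sup>2 - 2 * X\<^sup>2 * m * (s\<^sup>2) powr (-m-1)"
          by (simp add: kernel_deriv_def Let_def s_def[symmetric] P_def X_def)
        then have "\<bar>kernel_deriv m j x y t\<bar> \<le> m * (m+1) * (s\<^sup>2) powr (-m-2) * P\<^sup>2 + 2 * X\<^sup>2 * m * (s\<^sup>2) powr (-m-1)"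
          using m by (intro order_trans[OF eq_refl[OF arg_cong[of _ _ abs]] abs_triangle_ineq4[THEN order_trans]]) (auto simp: abs_mult)
        also have "\<dots> \<le> m * (m+1) * (s\<^sup>2) powr (-m-2) * (2 * X * s)\<^sup>2 + 2 * X\<^sup>2 * m * (s\<^sup>2) powr (-m-1)"
          using m P2 by (intro add_right_mono mult_left_mono) auto
        also have "\<dots> = 4 * m * (m+1) * (X\<^sup>2 * ((s\<^sup>2) powr (-m-2) * s ^ 2)) + 2 * m * (X\<^sup>2 * (s\<^sup>2) powr (-m-1))"
          by (simp add: power_mult_distrib)
        also have "\<dots> = (4 * m * (m+1) + 2 * m) * (X ^ j * s powr (-(2 * m + real j)))"
        proof -
          have e: "2 * (-m-2) + real 2 = -(2 * m + real j)" "2 * (-m-1) = -(2 * m + real j)" "X ^ j = X\<^sup>2"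
            using c by simp_all
          show ?thesis unfolding sp unfolding sp0 by (simp only: e distrib_right)
        qed
        also have "\<dots> \<le> c0 * (X ^ j * s powr (-(2 * m + real j)))" using c0 X by (intro mult_right_mono) auto
        finally show ?thesis .
      next
        case d
        then have "kernel_deriv m j x y t = 6 * X\<^sup>2 * m * (m+1) * (s\<^sup>2) powr (-m-2) * P - m * (m+1) * (m+2) * (s\<^sup>2) powr (-m-3) * P ^ 3"
          by (simp add: kernel_deriv_def Let_def s_def[symmetric] P_def X_def)
        then have "\<bar>kernel_deriv m j x y t\<bar> \<le> 6 * X\<^sup>2 * m * (m+1) * (s\<^sup>2) powr (-m-2) * \<bar>P\<bar> + m * (m+1) * (m+2) * (s\<^sup>2) powr (-m-3) * \<bar>P\<bar> ^ 3"
          using m by (intro order_trans[OF eq_refl[OF arg_cong[of _ _ abs]] abs_triangle_ineq4[THEN order_trans]]) (auto simp: abs_mult power_abs)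
        also have "\<dots> \<le> 6 * X\<^sup>2 * m * (m+1) * (s\<^sup>2) powr (-m-2) * (2 * X * s) + m * (m+1) * (m+2) * (s\<^sup>2) powr (-m-3) * (2 * X * s) ^ 3"
          using m P P3 by (intro add_mono mult_left_mono) auto
        also have "\<dots> = 12 * m * (m+1) * (X ^ 3 * ((s\<^sup>2) powr (-m-2) * s ^ 1)) + 8 * m * (m+1) * (m+2) * (X ^ 3 * ((s\<^sup>2) powr (-m-3) * s ^ 3))"
          by (simp add: power_mult_distrib power2_eq_square power3_eq_cube)
        also have "\<dots> = (12 * m * (m+1) + 8 * m * (m+1) * (m+2)) * (X ^ j * s powr (-(2 * m + real j)))"
        proof -
          have e: "2 * (-m-2) + real 1 = -(2 * m + real j)" "2 * (-m-3) + real 3 = -(2 * m + real j)" "X ^ j = X ^ 3"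
            using d by simp_all
          show ?thesis unfolding sp by (simp only: e distrib_right)
        qed
        also have "\<dots> \<le> c0 * (X ^ j * s powr (-(2 * m + real j)))" using c0 X by (intro mult_right_mono) auto
        finally show ?thesis .
      qed
    qed
    have "s powr (-(2 * m + real j)) \<le> (norm y / 2) powr (-(2 * m + real j))"
      using s y m by (intro powr_mono2') auto
    also have "\<dots> = 2 powr (2 * m + real j) * norm y powr (-(2 * m + real j))"
    proof -
      have "(n / 2) powr (-a) = 2 powr a * n powr (-a)" if "n \<ge> 0" for n a :: real
        unfolding powr_divide by (simp only: powr_minus[of 2] divide_inverse inverse_inverse_eq mult.commute)
      from this[OF norm_ge_zero] show ?thesis .
    qed
    also have "\<dots> \<le> 2 powr (2 * m + 3) * norm y powr (-(2 * m + real j))"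
      using j by (intro mult_right_mono powr_mono) auto
    finally have "c0 * (X ^ j * s powr (-(2 * m + real j))) \<le> c0 * (X ^ j * (2 powr (2 * m + 3) * norm y powr (-(2 * m + real j))))"
      using c0 X by (intro mult_left_mono) auto
    with k show ?thesis by (simp add: c_def X_def mult_ac)
  qed
  moreover have "c \<ge> 0" using c0 by (simp add: c_def)
  ultimately show ?thesis by blast
qed

text \<open>The scalar Taylor formula in t between 0 and 1 along the segment from 0 to x takes the
  place of a multivariate expansion.\<close>

lemma kernel_taylor:
  assumes m: "m \<ge> 0" and k: "k \<le> 2"
  shows "\<exists>c\<ge>0. \<forall>(x::real^'n) y. 2 * norm x \<le> norm y \<longrightarrow> y \<noteq> 0 \<longrightarrow>
    \<bar>norm (x - y) powr (-2 * m) - (\<Sum>j<Suc k. kernel_deriv m j x y 0 / fact j)\<bar> \<le> c * norm x ^ Suc k * norm y powr (-(2 * m + real (Suc k)))"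
proof -
  obtain c where c0: "c \<ge> 0 \<and> (\<forall>j\<le>3. \<forall>(x::real^'n) y t. 0 \<le> t \<longrightarrow> t \<le> 1 \<longrightarrow> 2 * t * norm x \<le> norm y \<longrightarrow> y \<noteq> 0 \<longrightarrow>
    \<bar>kernel_deriv m j x y t\<bar> \<le> c * norm x ^ j * norm y powr (-(2 * m + real j)))" using kernel_deriv_bound[OF m] ..
  have "\<bar>norm (x - y) powr (-2 * m) - (\<Sum>j<Suc k. kernel_deriv m j x y 0 / fact j)\<bar> \<le> c * norm x ^ Suc k * norm y powr (-(2 * m + real (Suc k)))"
    if xy: "2 * norm x \<le> norm y" "y \<noteq> 0" for x y :: "real^'n"
  proof -
    have ne: "t *\<^sub>R x \<noteq> y" if "0 \<le> t" "t \<le> 1" for t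
    proof
      assume "t *\<^sub>R x = y"
      then have "norm y = t * norm x" using that by auto
      also have "\<dots> \<le> 1 * norm x" using that by (intro mult_right_mono) auto
      finally show False using xy zero_less_norm_iff[of y] by linarith
    qed
    have "\<forall>i t. i < Suc k \<and> 0 \<le> t \<and> t \<le> 1 \<longrightarrow> ((kernel_deriv m i x y) has_real_derivative kernel_deriv m (Suc i) x y t) (at t)"
      by (intro allI impI, rule kernel_deriv_has_derivative) (use ne k in auto)
    from Maclaurin[OF zero_less_one zero_less_Suc refl this]
    obtain t where t: "0 < t" "t < 1" and e: "kernel_deriv m 0 x y 1 = (\<Sum>j<Suc k. kernel_deriv m j x y 0 / fact j * 1 ^ j) + kernel_deriv m (Suc k) x y t / fact (Suc k) * 1 ^ Suc k"
      by blast
    have e0: "kernel_deriv m 0 x y 1 = norm (x - y) powr (-2 * m)"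
    proof -
      have "norm (x - y) > 0" using ne[of 1] by simp
      then have "(norm (x - y))\<^sup>2 = norm (x - y) powr 2" by simp
      then have "((norm (x - y))\<^sup>2) powr (-m) = norm (x - y) powr (2 * -m)" by (simp only: powr_powr)
      then show ?thesis by (simp add: kernel_deriv_def Let_def)
    qed
    have "t * norm x \<le> 1 * norm x" using t by (intro mult_right_mono) auto
    then have t2: "2 * t * norm x \<le> norm y" using xy by simp
    have "\<bar>kernel_deriv m (Suc k) x y t / fact (Suc k)\<bar> \<le> \<bar>kernel_deriv m (Suc k) x y t\<bar> / 1"
      unfolding abs_divide by (intro frac_le) (auto simp: fact_ge_1 simp del: fact_Suc)
    also have "\<dots> \<le> c * norm x ^ Suc k * norm y powr (-(2 * m + real (Suc k)))"
      using c0 t t2 xy k by (simp del: power_Suc of_nat_Suc)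
    finally show ?thesis using e unfolding e0 by simp
  qed
  then show ?thesis using c0 by blast
qed

text \<open>The common shape of the error terms in the expansion of the potential: a power of a =
  |x| times the integral of a power over a ball of radius proportional to a.\<close>

lemma power_piece:
  fixes \<gamma> e b c :: real
  assumes "\<gamma> < DIM('a::euclidean_space)" "b \<ge> 0" "c > 0"
  shows "\<exists>D\<ge>0. \<forall>a>0. b * a powr e * (LINT y|(lborel::'a measure). norm y powr (-\<gamma>) * indicator (ball 0 (c * a)) y) \<le> D * a powr (e + (DIM('a) - \<gamma>))"
proof -
  obtain C where C: "C \<ge> 0" "\<And>\<rho>. \<rho> > 0 \<Longrightarrow> (LINT y|(lborel::'a measure). norm y powr (-\<gamma>) * indicator (ball 0 \<rho>) y) \<le> C * \<rho> powr (DIM('a) - \<gamma>)"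
    using LINT_power_near[OF assms(1)] by auto
  have "b * a powr e * (LINT y|(lborel::'a measure). norm y powr (-\<gamma>) * indicator (ball 0 (c * a)) y)
      \<le> (b * C * c powr (DIM('a) - \<gamma>)) * a powr (e + (DIM('a) - \<gamma>))" if a: "a > 0" for a
  proof -
    have "b * a powr e * (LINT y|(lborel::'a measure). norm y powr (-\<gamma>) * indicator (ball 0 (c * a)) y)
      \<le> b * a powr e * (C * (c * a) powr (DIM('a) - \<gamma>))"
      using a assms by (intro mult_left_mono C(2)) auto
    also have "\<dots> = (b * C * c powr (DIM('a) - \<gamma>)) * (a powr e * a powr (DIM('a) - \<gamma>))"
      by (simp only: powr_mult mult_ac)
    finally show ?thesis by (simp only: powr_add)
  qed
  then show ?thesis using C assms by (intro exI[of _ "b * C * c powr (DIM('a) - \<gamma>)"]) auto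
qed

lemma power_piece_far:
  fixes \<gamma> e b c :: real
  assumes "\<gamma> > DIM('a::euclidean_space)" "b \<ge> 0" "c > 0"
  shows "\<exists>D\<ge>0. \<forall>a>0. b * a powr e * (LINT y|(lborel::'a measure). norm y powr (-\<gamma>) * indicator {y. c * a \<le> norm y} y) \<le> D * a powr (e + (DIM('a) - \<gamma>))"
proof -
  obtain C where C: "C \<ge> 0" "\<And>\<rho>. \<rho> > 0 \<Longrightarrow> (LINT y|(lborel::'a measure). norm y powr (-\<gamma>) * indicator {y. \<rho> \<le> norm y} y) \<le> C * \<rho> powr (DIM('a) - \<gamma>)"
    using LINT_power_far[OF assms(1)] by auto
  have "b * a powr e * (LINT y|(lborel::'a measure). norm y powr (-\<gamma>) * indicator {y. c * a \<le> norm y} y)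
      \<le> (b * C * c powr (DIM('a) - \<gamma>)) * a powr (e + (DIM('a) - \<gamma>))" if a: "a > 0" for a
  proof -
    have "b * a powr e * (LINT y|(lborel::'a measure). norm y powr (-\<gamma>) * indicator {y. c * a \<le> norm y} y)
      \<le> b * a powr e * (C * (c * a) powr (DIM('a) - \<gamma>))"
      using a assms by (intro mult_left_mono C(2)) auto
    also have "\<dots> = (b * C * c powr (DIM('a) - \<gamma>)) * (a powr e * a powr (DIM('a) - \<gamma>))"
      by (simp only: powr_mult mult_ac)
    finally show ?thesis by (simp only: powr_add)
  qed
  then show ?thesis using C assms by (intro exI[of _ "b * C * c powr (DIM('a) - \<gamma>)"]) auto
qed

lemma kernel_deriv_linear: "kernel_deriv m 1 x y 0 = (\<Sum>i\<in>UNIV. x $ i * kernel_deriv m 1 (axis i 1) y 0)"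
proof -
  have e: "kernel_deriv m 1 x y 0 = 2 * m * ((norm y)\<^sup>2) powr (-m-1) * (x \<bullet> y)" for x
    by (simp add: kernel_deriv_def Let_def)
  show ?thesis unfolding e inner_axis' by (simp add: inner_vec_def sum_distrib_left sum_distrib_right mult_ac)
qed

text \<open>Half the Hessian at x = 0 of |x - y|^{-2m}, entry by entry, for y \<noteq> 0.\<close>

definition "kernel_quadratic m y i j = 2 * m * (m+1) * ((norm y)\<^sup>2) powr (-m-2) * (y $ i * y $ j) - m * ((norm y)\<^sup>2) powr (-m-1) * (if i = j then 1 else 0)"
  for y :: "real^'n::finite"

text \<open>The second identity is polarisation: it reduces integrability of each matrix entry to
  that of second derivatives along fixed directions. The third is the harmonicity of the kernel
  |y|^{2-N}.\<close>

lemma kernel_deriv_quadratic: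
  fixes x y :: "real^'n"
  shows "kernel_deriv m 2 x y 0 / 2 = (\<Sum>i\<in>UNIV. \<Sum>j\<in>UNIV. x $ i * x $ j * kernel_quadratic m y i j)"
    "kernel_quadratic m y i j = (kernel_deriv m 2 (axis i 1 + axis j 1) y 0 / 2 - kernel_deriv m 2 (axis i 1 - axis j 1) y 0 / 2) / 4"
    "m = (real CARD('n) - 2) / 2 \<Longrightarrow> (\<Sum>i\<in>UNIV. kernel_quadratic m y i i) = 0"
proof -
  define A where "A = 2 * m * (m+1) * ((norm y)\<^sup>2) powr (-m-2)"
  define B where "B = m * ((norm y)\<^sup>2) powr (-m-1)"
  have kqA: "kernel_quadratic m y i j = A * (y $ i * y $ j) - B * (if i = j then 1 else 0)" for i j
    by (simp add: kernel_quadratic_def A_def B_def)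
  have e: "kernel_deriv m 2 x y 0 / 2 = A * (x \<bullet> y)\<^sup>2 - B * (x \<bullet> x)" for x :: "real^'n"
    by (simp add: kernel_deriv_def Let_def A_def B_def power2_norm_eq_inner[of x] power_mult_distrib)
  have "(\<Sum>i\<in>UNIV. \<Sum>j\<in>UNIV. x $ i * x $ j * kernel_quadratic m y i j) =
     A * (\<Sum>i\<in>UNIV. \<Sum>j\<in>UNIV. (x $ i * y $ i) * (x $ j * y $ j)) - B * (\<Sum>i\<in>UNIV. \<Sum>j\<in>UNIV. (if i = j then x $ i * x $ j else 0))"
    unfolding kqA sum_distrib_left sum_subtractf[symmetric]
    by (intro sum.cong refl) (simp add: algebra_simps)
  also have "\<dots> = A * (x \<bullet> y)\<^sup>2 - B * (x \<bullet> x)"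
    by (simp add: sum_product[symmetric] inner_vec_def power2_eq_square)
  finally show "kernel_deriv m 2 x y 0 / 2 = (\<Sum>i\<in>UNIV. \<Sum>j\<in>UNIV. x $ i * x $ j * kernel_quadratic m y i j)" unfolding e by simp
  have h1: "(axis i 1 + axis j 1) \<bullet> y = y $ i + y $ j" "(axis i 1 - axis j 1) \<bullet> y = y $ i - y $ j"
    by (simp_all add: inner_add_left inner_diff_left inner_axis')
  have h2: "(axis i 1 + axis j 1 :: real^'n) \<bullet> (axis i 1 + axis j 1) = 2 + 2 * (if i = j then 1 else 0)"
    "(axis i 1 - axis j 1 :: real^'n) \<bullet> (axis i 1 - axis j 1) = 2 - 2 * (if i = j then 1 else 0)"
    by (auto simp: inner_add_left inner_diff_left inner_add_right inner_diff_right inner_axis_axis)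
  show "kernel_quadratic m y i j = (kernel_deriv m 2 (axis i 1 + axis j 1) y 0 / 2 - kernel_deriv m 2 (axis i 1 - axis j 1) y 0 / 2) / 4"
    unfolding e kqA h1 h2 by (simp add: power2_eq_square algebra_simps)
  show "(\<Sum>i\<in>UNIV. kernel_quadratic m y i i) = 0" if m: "m = (real CARD('n) - 2) / 2"
  proof -
    have s: "(\<Sum>i\<in>UNIV. kernel_quadratic m y i i) = A * (norm y)\<^sup>2 - B * real CARD('n)"
      unfolding kqA by (simp add: sum_subtractf sum_distrib_left[symmetric] power2_norm_eq_inner inner_vec_def)
    show ?thesis
    proof (cases "y = 0")
      case True then show ?thesis unfolding s by (simp add: A_def B_def)
    next
      case False
      then have p: "(norm y)\<^sup>2 > 0" by simp
      have "((norm y)\<^sup>2) powr (-m-2) * (norm y)\<^sup>2 = ((norm y)\<^sup>2) powr (-m-2) * ((norm y)\<^sup>2) powr 1" using p by simp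
      also have "\<dots> = ((norm y)\<^sup>2) powr (-m-1)"
      proof -
        have "-m-2+1 = -m-1" by simp
        then show ?thesis by (simp only: powr_add[symmetric])
      qed
      finally have "A * (norm y)\<^sup>2 = 2 * m * (m+1) * ((norm y)\<^sup>2) powr (-m-1)" by (simp add: A_def mult.assoc)
      moreover have "real CARD('n) = 2 * (m + 1)" using m by simp
      ultimately show ?thesis unfolding s by (simp add: B_def algebra_simps)
    qed
  qed
qed

lemma kernel_deriv_measurable[measurable]: "(\<lambda>y. kernel_deriv m j x y t) \<in> borel_measurable borel"
  unfolding kernel_deriv_def Let_def by measurable

text \<open>The Taylor polynomial of the kernel is integrated against F. For |y| \<ge> 2|x| the
  Taylor remainder is used; for |y| < 2|x| kernel and polynomial are estimated separately. Given the
  growth of F, \<beta> > 0 makes the terms up to degree k integrable at the origin, \<beta> < 1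
  makes the remainder of degree k + 1 integrable at infinity, and every piece scales as
  |x|^{k+\<beta>}.\<close>

lemma potential_expansion:
  fixes F :: "real^'n \<Rightarrow> real" and k :: nat
  assumes N3: "CARD('n) \<ge> 3" and m: "m = (real CARD('n) - 2) / 2"
    and k: "k \<le> 2" and \<beta>: "0 < \<beta>" "\<beta> < 1" and C: "C \<ge> 0" and R: "R > 0"
    and Fm[measurable]: "F \<in> borel_measurable borel"
    and F: "\<And>y. \<bar>F y\<bar> \<le> C * norm y powr (real k - 2 + \<beta>)" and FR: "\<And>y. norm y > R \<Longrightarrow> F y = 0"
  shows "\<exists>c g B. \<exists>D\<ge>0. (k < 1 \<longrightarrow> g = 0) \<and> (k < 2 \<longrightarrow> B = 0) \<and> trace (B::real^'n^'n) = 0 \<and>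
    (\<forall>x. x \<noteq> 0 \<longrightarrow> integrable lborel (\<lambda>y. norm (x - y) powr (-2 * m) * F y) \<and>
      \<bar>(LINT y|lborel. norm (x - y) powr (-2 * m) * F y) - (c + g \<bullet> x + x \<bullet> (B *v x))\<bar> \<le> D * norm x powr (real k + \<beta>))"
proof -
  define s where "s = real k - 2 + \<beta>"
  define N where "N = real CARD('n)"
  have N: "N \<ge> 3" "2 * m = N - 2" "m \<ge> 0" using N3 m by (auto simp: N_def)
  obtain c1 where c1: "c1 \<ge> 0" "\<And>j x y. j \<le> 3 \<Longrightarrow> y \<noteq> (0::real^'n) \<Longrightarrow> \<bar>kernel_deriv m j x y 0\<bar> \<le> c1 * norm x ^ j * norm y powr (-(2 * m + real j))"
    using kernel_deriv_bound[OF N(3), where 'n='n] by fastforce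
  obtain c2 where c2: "c2 \<ge> 0" "\<And>x y. 2 * norm x \<le> norm y \<Longrightarrow> y \<noteq> (0::real^'n) \<Longrightarrow>
    \<bar>norm (x - y) powr (-2 * m) - (\<Sum>j<Suc k. kernel_deriv m j x y 0 / fact j)\<bar> \<le> c2 * norm x ^ Suc k * norm y powr (-(2 * m + real (Suc k)))"
    using kernel_taylor[OF N(3) k, where 'n='n] by auto
  have TF: "integrable lborel (\<lambda>y. kernel_deriv m j x y 0 / fact j * F y)" if j: "j \<le> k" for j and x :: "real^'n"
  proof (rule Bochner_Integration.integrable_bound)
    show "integrable lborel (\<lambda>y::real^'n. (c1 * norm x ^ j * C) * (norm y powr (-(2 * m + real j - s)) * indicator (ball 0 (R + 1)) y))"
      using N j \<beta> R by (intro integrable_mult_right integrable_power_near) (auto simp: s_def N_def)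
    show "(\<lambda>y. kernel_deriv m j x y 0 / fact j * F y) \<in> borel_measurable lborel" by measurable
    have "norm (kernel_deriv m j x y 0 / fact j * F y) \<le> norm ((c1 * norm x ^ j * C) * (norm y powr (-(2 * m + real j - s)) * indicator (ball 0 (R + 1)) y))" for y
    proof (cases "y = 0 \<or> norm y > R")
      case True
      have "F 0 = 0" using F[of 0] by simp
      then show ?thesis using FR True by auto
    next
      case False
      then have y: "y \<noteq> 0" "norm y \<le> R" by auto
      have "\<bar>kernel_deriv m j x y 0 / fact j\<bar> \<le> \<bar>kernel_deriv m j x y 0\<bar> / 1" unfolding abs_divide by (intro frac_le) (auto simp: fact_ge_1)
      also have "\<dots> \<le> c1 * norm x ^ j * norm y powr (-(2 * m + real j))" using c1(2)[OF _ y(1)] j k by simp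
      finally have "\<bar>kernel_deriv m j x y 0 / fact j * F y\<bar> \<le> (c1 * norm x ^ j * norm y powr (-(2 * m + real j))) * (C * norm y powr s)"
        unfolding abs_mult s_def using F c1 by (intro mult_mono) auto
      also have "\<dots> = (c1 * norm x ^ j * C) * (norm y powr (-(2 * m + real j)) * norm y powr s)" by (simp only: mult_ac)
      also have "norm y powr (-(2 * m + real j)) * norm y powr s = norm y powr (-(2 * m + real j - s))"
        by (simp only: powr_add[symmetric]) (simp add: algebra_simps)
      finally show ?thesis using y c1(1) C by simp
    qed
    then show "AE y in lborel. norm (kernel_deriv m j x y 0 / fact j * F y) \<le> norm ((c1 * norm x ^ j * C) * (norm y powr (-(2 * m + real j - s)) * indicator (ball 0 (R + 1)) y))" by simp
  qed
  \<comment> \<open>With a = |x|: \<open>pf\<close> carries the Taylor remainder for |y| \<ge> 2a,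
    \<open>pn j\<close> the polynomial terms for |y| < 2a, \<open>pm\<close> the kernel for |y| <
    a/2, where |x - y| \<ge> a/2, and \<open>pk\<close> the kernel around x for a/2 \<le> |y| < 2a,
    where F is at most of order a^s and |y - x| < 3a.\<close>
  define pf where "pf a = (\<lambda>y::real^'n. norm y powr (-(N + 1 - \<beta>)) * indicator {y. 2 * a \<le> norm y} y)" for a :: real
  define pn where "pn j a = (\<lambda>y::real^'n. norm y powr (-(N + real j - real k - \<beta>)) * indicator (ball 0 (2 * a)) y)" for a :: real and j :: nat
  define pm where "pm a = (\<lambda>y::real^'n. norm y powr (-(- s)) * indicator (ball 0 (1/2 * a)) y)" for a :: real
  define pk where "pk a = (\<lambda>y::real^'n. norm y powr (-(2 * m)) * indicator (ball 0 (3 * a)) y)" for a :: real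
  have ipf: "integrable lborel (pf a)" if "a > 0" for a
    using LINT_power_far[where 'a="real^'n" and \<gamma>="N + 1 - \<beta>"] that \<beta> unfolding pf_def N_def by auto
  have ipn: "integrable lborel (pn j a)" if "a > 0" "j \<le> k" for a j
    unfolding pn_def using that \<beta> by (intro integrable_power_near) (auto simp: N_def)
  have ipm: "integrable lborel (pm a)" if "a > 0" for a
    unfolding pm_def using that \<beta> N by (intro integrable_power_near) (auto simp: N_def s_def)
  have ipk: "integrable lborel (pk a)" if "a > 0" for a
    unfolding pk_def using that \<beta> N by (intro integrable_power_near) (auto simp: N_def s_def)
  have ipk': "integrable lborel (\<lambda>y. pk a (y - x))" "(LINT y|lborel. pk a (y - x)) = (LINT y|lborel. pk a y)" if "a > 0" for a x
    using integrable_affine[OF ipk[OF that], of 1 "-x"] by (simp_all add: add.commute)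
  obtain D1 where D1: "D1 \<ge> 0" "\<And>a. a > 0 \<Longrightarrow> c2 * C * a powr (real k + 1) * (LINT y|lborel. pf a y) \<le> D1 * a powr (real k + 1 + (N - (N + 1 - \<beta>)))"
    using power_piece_far[where 'a="real^'n" and \<gamma>="N + 1 - \<beta>" and b="c2 * C" and c=2 and e="real k + 1"] \<beta> c2(1) C
    unfolding pf_def N_def by (auto simp: DIM_cart)
  have "\<exists>D\<ge>0. \<forall>a>0. c1 * C * a powr (real j) * (LINT y|lborel. pn j a y) \<le> D * a powr (real j + (N - (N + real j - real k - \<beta>)))" if "j \<le> k" for j
    using power_piece[where 'a="real^'n" and \<gamma>="N + real j - real k - \<beta>" and b="c1 * C" and c=2 and e="real j"] \<beta> c1(1) C that
    unfolding pn_def N_def by (auto simp: DIM_cart)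
  then obtain D2 where D2: "\<And>j. j \<le> k \<Longrightarrow> D2 j \<ge> 0" "\<And>j a. j \<le> k \<Longrightarrow> a > 0 \<Longrightarrow> c1 * C * a powr (real j) * (LINT y|lborel. pn j a y) \<le> D2 j * a powr (real j + (N - (N + real j - real k - \<beta>)))"
    by metis
  obtain D3 where D3: "D3 \<ge> 0" "\<And>a. a > 0 \<Longrightarrow> C * (1/2) powr (-2 * m) * a powr (-2 * m) * (LINT y|lborel. pm a y) \<le> D3 * a powr (-2 * m + (N - (- s)))"
    using power_piece[where 'a="real^'n" and \<gamma>="-s" and b="C * (1/2) powr (-2 * m)" and c="1/2" and e="-2 * m"] \<beta> C N
    unfolding pm_def N_def by (auto simp: DIM_cart s_def)
  obtain D4 where D4: "D4 \<ge> 0" "\<And>a. a > 0 \<Longrightarrow> C * 2 powr \<bar>s\<bar> * a powr s * (LINT y|lborel. pk a y) \<le> D4 * a powr (s + (N - 2 * m))"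
    using power_piece[where 'a="real^'n" and \<gamma>="2 * m" and b="C * 2 powr \<bar>s\<bar>" and c=3 and e=s] \<beta> C N
    unfolding pk_def N_def by (auto simp: DIM_cart s_def)
  define D where "D = D1 + (\<Sum>j<Suc k. D2 j) + D3 + D4"
  have D: "D \<ge> 0" unfolding D_def using D1 D2 D3 D4 by (auto intro!: add_nonneg_nonneg sum_nonneg)
  have main: "integrable lborel (\<lambda>y. norm (x - y) powr (-2 * m) * F y) \<and>
      \<bar>(LINT y|lborel. norm (x - y) powr (-2 * m) * F y) - (\<Sum>j<Suc k. LINT y|lborel. kernel_deriv m j x y 0 / fact j * F y)\<bar> \<le> D * norm x powr (real k + \<beta>)"
    if x: "x \<noteq> 0" for x
  proof -
    define a where "a = norm x"
    have a: "a > 0" using x by (simp add: a_def)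
    define E where "E y = c2 * C * a powr (real k + 1) * pf a y + (\<Sum>j<Suc k. c1 * C * a powr (real j) * pn j a y)
       + C * (1/2) powr (-2 * m) * a powr (-2 * m) * pm a y + C * 2 powr \<bar>s\<bar> * a powr s * pk a (y - x)" for y
    have iE: "integrable lborel E" unfolding E_def
      using a by (intro Bochner_Integration.integrable_add integrable_mult_right ipf ipn ipm ipk' Bochner_Integration.integrable_sum) auto
    have LE: "(LINT y|lborel. E y) \<le> D * a powr (real k + \<beta>)"
    proof -
      have "(LINT y|lborel. E y) = c2 * C * a powr (real k + 1) * (LINT y|lborel. pf a y) + (\<Sum>j<Suc k. c1 * C * a powr (real j) * (LINT y|lborel. pn j a y))
       + C * (1/2) powr (-2 * m) * a powr (-2 * m) * (LINT y|lborel. pm a y) + C * 2 powr \<bar>s\<bar> * a powr s * (LINT y|lborel. pk a y)"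
      proof -
        note i1 = integrable_mult_right[OF ipf[OF a], of "c2 * C * a powr (real k + 1)"]
        have i2: "integrable lborel (\<lambda>y. \<Sum>j<Suc k. c1 * C * a powr (real j) * pn j a y)"
          using a by (intro Bochner_Integration.integrable_sum integrable_mult_right ipn) auto
        note i3 = integrable_mult_right[OF ipm[OF a], of "C * (1/2) powr (-2 * m) * a powr (-2 * m)"]
        note i4 = integrable_mult_right[OF ipk'(1)[OF a], of "C * 2 powr \<bar>s\<bar> * a powr s" x]
        note i12 = Bochner_Integration.integrable_add[OF i1 i2]
        note i123 = Bochner_Integration.integrable_add[OF i12 i3]
        have "(LINT y|lborel. (\<Sum>j<Suc k. c1 * C * a powr (real j) * pn j a y)) = (\<Sum>j<Suc k. LINT y|lborel. c1 * C * a powr (real j) * pn j a y)"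
          using a by (intro Bochner_Integration.integral_sum integrable_mult_right ipn) auto
        then show ?thesis
          by (simp only: E_def Bochner_Integration.integral_add[OF i123 i4] Bochner_Integration.integral_add[OF i12 i3]
              Bochner_Integration.integral_add[OF i1 i2] integral_mult_right_zero ipk'(2)[OF a])
      qed
      also have "\<dots> \<le> D1 * a powr (real k + 1 + (N - (N + 1 - \<beta>))) + (\<Sum>j<Suc k. D2 j * a powr (real j + (N - (N + real j - real k - \<beta>))))
         + D3 * a powr (-2 * m + (N - (- s))) + D4 * a powr (s + (N - 2 * m))"
        using a by (intro add_mono sum_mono D1 D2 D3 D4) auto
      also have "\<dots> = D1 * a powr (real k + \<beta>) + (\<Sum>j<Suc k. D2 j * a powr (real k + \<beta>)) + D3 * a powr (real k + \<beta>) + D4 * a powr (real k + \<beta>)"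
      proof -
        have "real k + 1 + (N - (N + 1 - \<beta>)) = real k + \<beta>" "real j + (N - (N + real j - real k - \<beta>)) = real k + \<beta>"
          "-2 * m + (N - (- s)) = real k + \<beta>" "s + (N - 2 * m) = real k + \<beta>" for j
          using N by (auto simp: s_def)
        then show ?thesis by (simp only:)
      qed
      finally show ?thesis by (simp only: D_def distrib_right sum_distrib_right)
    qed
    have pnn: "pf a y \<ge> 0" "pn j a y \<ge> 0" "pm a y \<ge> 0" "pk a y \<ge> 0" for y j
      by (auto simp: pf_def pn_def pm_def pk_def)
    have ptw: "\<bar>(norm (x - y) powr (-2 * m) - (\<Sum>j<Suc k. kernel_deriv m j x y 0 / fact j)) * F y\<bar> \<le> E y" for y
    proof (cases "y = 0")
      case True
      have "F 0 = 0" using F[of 0] by simp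
      moreover have "0 \<le> E 0" unfolding E_def using pnn c1(1) c2(1) C
        by (intro add_nonneg_nonneg sum_nonneg mult_nonneg_nonneg; simp)
      ultimately show ?thesis unfolding True by simp
    next
      case y: False
      have F': "\<bar>F y\<bar> \<le> C * norm y powr s" using F by (simp add: s_def)
      have nn: "0 \<le> c2 * C * a powr (real k + 1) * pf a y" "0 \<le> (\<Sum>j<Suc k. c1 * C * a powr (real j) * pn j a y)"
        "0 \<le> C * (1/2) powr (-2 * m) * a powr (-2 * m) * pm a y" "0 \<le> C * 2 powr \<bar>s\<bar> * a powr s * pk a (y - x)"
        using pnn c1(1) c2(1) C by (intro sum_nonneg mult_nonneg_nonneg; simp)+
      show ?thesis
      proof (cases "2 * a \<le> norm y")
        case True
        have "\<bar>(norm (x - y) powr (-2 * m) - (\<Sum>j<Suc k. kernel_deriv m j x y 0 / fact j)) * F y\<bar>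
           \<le> (c2 * norm x ^ Suc k * norm y powr (-(2 * m + real (Suc k)))) * (C * norm y powr s)"
          unfolding abs_mult using c2(2)[of x y] True y F' c2(1) C unfolding a_def by (intro mult_mono) auto
        also have "\<dots> = c2 * C * a ^ Suc k * (norm y powr (-(2 * m + real (Suc k))) * norm y powr s)" by (simp only: mult_ac a_def)
        also have "a ^ Suc k = a powr (real k + 1)" using a powr_realpow[OF a, of "Suc k"] by (simp add: add.commute)
        also have "norm y powr (-(2 * m + real (Suc k))) * norm y powr s = norm y powr (-(N + 1 - \<beta>))"
          using N by (simp only: powr_add[symmetric]) (simp add: s_def algebra_simps)
        also have "norm y powr (-(N + 1 - \<beta>)) = pf a y" using True by (simp add: pf_def)
        also have "c2 * C * a powr (real k + 1) * pf a y \<le> E y" unfolding E_def using nn by linarith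
        finally show ?thesis .
      next
        case False
        have T: "\<bar>(\<Sum>j<Suc k. kernel_deriv m j x y 0 / fact j) * F y\<bar> \<le> (\<Sum>j<Suc k. c1 * C * a powr (real j) * pn j a y)"
        proof -
          have "\<bar>(\<Sum>j<Suc k. kernel_deriv m j x y 0 / fact j) * F y\<bar> \<le> (\<Sum>j<Suc k. \<bar>kernel_deriv m j x y 0 / fact j * F y\<bar>)"
            unfolding sum_distrib_right by (rule sum_abs)
          also have "\<dots> \<le> (\<Sum>j<Suc k. c1 * C * a powr (real j) * pn j a y)"
          proof (rule sum_mono)
            fix j assume j: "j \<in> {..<Suc k}"
            have "\<bar>kernel_deriv m j x y 0 / fact j\<bar> \<le> \<bar>kernel_deriv m j x y 0\<bar> / 1" unfolding abs_divide by (intro frac_le) (auto simp: fact_ge_1)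
            also have "\<dots> \<le> c1 * norm x ^ j * norm y powr (-(2 * m + real j))" using c1(2)[OF _ y] j k by simp
            finally have "\<bar>kernel_deriv m j x y 0 / fact j * F y\<bar> \<le> (c1 * norm x ^ j * norm y powr (-(2 * m + real j))) * (C * norm y powr s)"
              unfolding abs_mult using F' c1 by (intro mult_mono) auto
            also have "\<dots> = (c1 * C * norm x ^ j) * (norm y powr (-(2 * m + real j)) * norm y powr s)" by (simp only: mult_ac)
            also have "norm y powr (-(2 * m + real j)) * norm y powr s = norm y powr (-(N + real j - real k - \<beta>))"
              using N by (simp only: powr_add[symmetric]) (simp add: s_def algebra_simps)
            also have "norm y powr (-(N + real j - real k - \<beta>)) = pn j a y" using False by (simp add: pn_def)
            also have "norm x ^ j = a powr real j" using a by (simp add: a_def powr_realpow)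
            finally show "\<bar>kernel_deriv m j x y 0 / fact j * F y\<bar> \<le> c1 * C * a powr (real j) * pn j a y" .
          qed
          finally show ?thesis .
        qed
        have K: "\<bar>norm (x - y) powr (-2 * m) * F y\<bar> \<le> C * (1/2) powr (-2 * m) * a powr (-2 * m) * pm a y + C * 2 powr \<bar>s\<bar> * a powr s * pk a (y - x)"
        proof (cases "norm y < 1/2 * a")
          case True
          have "a \<le> norm (x - y) + norm y" using norm_triangle_ineq[of "x - y" y] by (simp add: a_def)
          then have "1/2 * a \<le> norm (x - y)" using True by linarith
          then have "norm (x - y) powr (-2 * m) \<le> (1/2 * a) powr (-2 * m)" using a N by (intro powr_mono2') auto
          then have "\<bar>norm (x - y) powr (-2 * m) * F y\<bar> \<le> (1/2 * a) powr (-2 * m) * (C * norm y powr s)"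
            unfolding abs_mult using F' by (intro mult_mono) auto
          also have "\<dots> = C * (1/2) powr (-2 * m) * a powr (-2 * m) * norm y powr s" by (simp only: powr_mult mult_ac)
          also have "norm y powr s = pm a y" using True by (simp add: pm_def)
          finally show ?thesis using nn by linarith
        next
          case nF: False
          have "norm y powr s \<le> 2 powr \<bar>s\<bar> * a powr s"
          proof -
            define t where "t = norm y / a"
            have t: "1/2 \<le> t" "t \<le> 2" using nF False a by (auto simp: t_def field_simps)
            have "t powr s \<le> 2 powr \<bar>s\<bar>"
            proof (cases "s \<ge> 0")
              case True then show ?thesis using t by (simp add: powr_mono2)
            next
              case sF: False
              have "t powr s \<le> (1/2) powr s" using t sF by (intro powr_mono2') auto
              also have "(1/2) powr s = 2 powr \<bar>s\<bar>" using sF powr_minus_divide[of 2 "-s"] powr_divide[of 1 2 s] by simp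
              finally show ?thesis .
            qed
            moreover have "norm y powr s = t powr s * a powr s" using a by (simp add: t_def powr_mult[symmetric])
            ultimately show ?thesis by (simp add: mult_right_mono)
          qed
          then have "\<bar>F y\<bar> \<le> C * (2 powr \<bar>s\<bar> * a powr s)" using F' C by (meson mult_left_mono order_trans)
          then have "\<bar>norm (x - y) powr (-2 * m) * F y\<bar> \<le> norm (x - y) powr (-2 * m) * (C * (2 powr \<bar>s\<bar> * a powr s))"
            unfolding abs_mult by (intro mult_mono) auto
          also have "\<dots> = C * 2 powr \<bar>s\<bar> * a powr s * norm (x - y) powr (-(2 * m))" by (simp add: mult_ac)
          also have "norm (x - y) powr (-(2 * m)) = pk a (y - x)"
          proof -
            have "norm (y - x) \<le> norm y + a" using norm_triangle_ineq4[of y x] by (simp add: a_def)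
            then have "norm (y - x) < 3 * a" using False by linarith
            then show ?thesis by (simp add: pk_def norm_minus_commute)
          qed
          finally show ?thesis using nn by linarith
        qed
        have "\<bar>(norm (x - y) powr (-2 * m) - (\<Sum>j<Suc k. kernel_deriv m j x y 0 / fact j)) * F y\<bar>
          \<le> \<bar>norm (x - y) powr (-2 * m) * F y\<bar> + \<bar>(\<Sum>j<Suc k. kernel_deriv m j x y 0 / fact j) * F y\<bar>"
          unfolding left_diff_distrib by (rule abs_triangle_ineq4)
        also have "\<dots> \<le> E y" unfolding E_def using K T nn by linarith
        finally show ?thesis .
      qed
    qed
    have iS: "integrable lborel (\<lambda>y. (\<Sum>j<Suc k. kernel_deriv m j x y 0 / fact j) * F y)"
      unfolding sum_distrib_right by (intro Bochner_Integration.integrable_sum TF) auto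
    have iD: "integrable lborel (\<lambda>y. (norm (x - y) powr (-2 * m) - (\<Sum>j<Suc k. kernel_deriv m j x y 0 / fact j)) * F y)"
    proof (rule Bochner_Integration.integrable_bound[OF iE])
      show "(\<lambda>y. (norm (x - y) powr (-2 * m) - (\<Sum>j<Suc k. kernel_deriv m j x y 0 / fact j)) * F y) \<in> borel_measurable lborel" by measurable
      show "AE y in lborel. norm ((norm (x - y) powr (-2 * m) - (\<Sum>j<Suc k. kernel_deriv m j x y 0 / fact j)) * F y) \<le> norm (E y)"
        unfolding real_norm_def by (intro AE_I2 order_trans[OF ptw abs_ge_self])
    qed
    have e: "(\<lambda>y. norm (x - y) powr (-2 * m) * F y) = (\<lambda>y. (norm (x - y) powr (-2 * m) - (\<Sum>j<Suc k. kernel_deriv m j x y 0 / fact j)) * F y + (\<Sum>j<Suc k. kernel_deriv m j x y 0 / fact j) * F y)"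
      by (simp only: left_diff_distrib diff_add_cancel)
    have iK: "integrable lborel (\<lambda>y. norm (x - y) powr (-2 * m) * F y)"
      unfolding e by (rule Bochner_Integration.integrable_add[OF iD iS])
    have "(LINT y|lborel. (\<Sum>j<Suc k. kernel_deriv m j x y 0 / fact j) * F y) = (\<Sum>j<Suc k. LINT y|lborel. kernel_deriv m j x y 0 / fact j * F y)"
      unfolding sum_distrib_right by (intro Bochner_Integration.integral_sum TF) auto
    moreover have "(LINT y|lborel. norm (x - y) powr (-2 * m) * F y) =
       (LINT y|lborel. (norm (x - y) powr (-2 * m) - (\<Sum>j<Suc k. kernel_deriv m j x y 0 / fact j)) * F y) + (LINT y|lborel. (\<Sum>j<Suc k. kernel_deriv m j x y 0 / fact j) * F y)"
      unfolding e by (rule Bochner_Integration.integral_add[OF iD iS])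
    moreover have "\<bar>LINT y|lborel. (norm (x - y) powr (-2 * m) - (\<Sum>j<Suc k. kernel_deriv m j x y 0 / fact j)) * F y\<bar> \<le> (LINT y|lborel. E y)"
    proof (rule order_trans[OF integral_abs_bound integral_mono[OF integrable_abs[OF iD] iE]])
    qed (rule ptw)
    ultimately show ?thesis using iK LE unfolding a_def by simp
  qed
  \<comment> \<open>The coefficients are integrals of the Taylor coefficients of the kernel. Those
    of degree above \<open>k\<close> are set to 0, as their integrals may diverge.\<close>
  define c where "c = (LINT y|lborel. kernel_deriv m 0 0 y 0 * F y)"
  define g where "g = (if k < 1 then 0 else \<chi> i. LINT y|lborel. kernel_deriv m 1 (axis i 1) y 0 * F y)"
  define B where "B = (if k < 2 then 0 else \<chi> i j. LINT y|lborel. kernel_quadratic m y i j * F y)"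
  have ikq: "integrable lborel (\<lambda>y. kernel_quadratic m y i j * F y)" if "k \<ge> 2" for i j
  proof -
    have "(\<lambda>y. kernel_quadratic m y i j * F y) = (\<lambda>y. 1/4 * (kernel_deriv m 2 (axis i 1 + axis j 1) y 0 / fact 2 * F y) - 1/4 * (kernel_deriv m 2 (axis i 1 - axis j 1) y 0 / fact 2 * F y))"
      unfolding kernel_deriv_quadratic(2) by (simp add: fun_eq_iff algebra_simps diff_divide_distrib)
    then show ?thesis
      by (simp only:) (intro Bochner_Integration.integrable_diff integrable_mult_right TF that)
  qed
  \<comment> \<open>Inherited from the harmonicity of the kernel. It makes the expanding polynomial
    harmonic, so that subtracting it leaves the Laplacian of the solution unchanged.\<close>
  have tB: "trace B = 0"
  proof (cases "k < 2")
    case False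
    then have "trace B = (\<Sum>i\<in>UNIV. LINT y|lborel. kernel_quadratic m y i i * F y)" by (simp add: B_def trace_def)
    also have "\<dots> = (LINT y|lborel. (\<Sum>i\<in>UNIV. kernel_quadratic m y i i) * F y)"
      unfolding sum_distrib_right using False ikq by (intro Bochner_Integration.integral_sum[symmetric]) auto
    also have "\<dots> = 0" by (simp add: kernel_deriv_quadratic(3)[OF m])
    finally show ?thesis .
  qed (simp add: B_def trace_0[unfolded mat_0])
  have P0: "(LINT y|lborel. kernel_deriv m 0 x y 0 / fact 0 * F y) = c" for x
    unfolding c_def by (simp add: kernel_deriv_def)
  have P1: "(LINT y|lborel. kernel_deriv m 1 x y 0 / fact 1 * F y) = g \<bullet> x" if "k \<ge> 1" for x
  proof -
    have "(LINT y|lborel. kernel_deriv m 1 x y 0 / fact 1 * F y) = (LINT y|lborel. (\<Sum>i\<in>UNIV. x $ i * (kernel_deriv m 1 (axis i 1) y 0 * F y)))"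
      by (subst kernel_deriv_linear) (simp add: sum_distrib_right mult.assoc)
    also have "\<dots> = (\<Sum>i\<in>UNIV. x $ i * (LINT y|lborel. kernel_deriv m 1 (axis i 1) y 0 * F y))"
      using TF[OF that] by (subst Bochner_Integration.integral_sum) auto
    finally show ?thesis using that by (simp add: g_def inner_vec_def mult.commute)
  qed
  have P2: "(LINT y|lborel. kernel_deriv m 2 x y 0 / fact 2 * F y) = x \<bullet> (B *v x)" if "k \<ge> 2" for x
  proof -
    have "(LINT y|lborel. kernel_deriv m 2 x y 0 / fact 2 * F y) = (LINT y|lborel. (\<Sum>i\<in>UNIV. \<Sum>j\<in>UNIV. x $ i * x $ j * (kernel_quadratic m y i j * F y)))"
      by (simp add: kernel_deriv_quadratic(1) sum_distrib_right mult.assoc)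
    also have "\<dots> = (\<Sum>i\<in>UNIV. \<Sum>j\<in>UNIV. x $ i * x $ j * (LINT y|lborel. kernel_quadratic m y i j * F y))"
      using ikq[OF that] by (subst Bochner_Integration.integral_sum, simp)+ simp
    finally show ?thesis using that
      by (simp add: B_def inner_vec_def matrix_vector_mult_def sum_distrib_left mult_ac)
  qed
  have PS: "(\<Sum>j<Suc k. LINT y|lborel. kernel_deriv m j x y 0 / fact j * F y) = c + g \<bullet> x + x \<bullet> (B *v x)" for x
  proof -
    consider "k = 0" | "k = 1" | "k = 2" using k by linarith
    then show ?thesis
    proof cases
      case 1
      then have "g = 0" "B = 0" by (auto simp: g_def B_def)
      then show ?thesis using P0[of x] 1 by simp
    next
      case 2
      then have "B = 0" by (auto simp: B_def)
      moreover have "{..<Suc k} = {0, 1}" using 2 by auto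
      ultimately show ?thesis using P0[of x] P1[of x] 2 by simp
    next
      case 3
      have "{..<Suc k} = {0, 1, 2}" using 3 by auto
      then show ?thesis using P0[of x] P1[of x] P2[of x] 3 by simp
    qed
  qed
  show ?thesis
    using main tB D unfolding PS by (intro exI[of _ c] exI[of _ g] exI[of _ B] exI[of _ D]) (auto simp: g_def B_def)
qed

section \<open>Representation by the Newtonian potential\<close>

text \<open>The regularised fundamental solution. As N = 2(m+1), the terms with |y-a|^2 cancel in
  the Laplacian, and what is left is, up to a negative constant, an approximate identity as e tends
  to 0.\<close>

lemma has_C2_mollified:
  fixes a :: "real^'n"
  assumes m: "m = (real CARD('n) - 2) / 2" and e: "e > 0"
  shows "\<exists>G H. has_C2 UNIV (\<lambda>y. ((norm (y - a))\<^sup>2 + e) powr (-m)) G H \<and>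
    (\<forall>y. trace (H y) = - (2 * real CARD('n) * m) * (e * ((norm (y - a))\<^sup>2 + e) powr (-m-2)))"
proof -
  define \<phi> where "\<phi> t = (t + e) powr (-m)" for t
  define \<phi>' where "\<phi>' t = - m * (t + e) powr (-m-1)" for t
  define \<phi>'' where "\<phi>'' t = m * (m+1) * (t + e) powr (-m-2)" for t
  have 1: "(\<phi> has_real_derivative \<phi>' t) (at t)" if "t \<in> {-e<..}" for t
    unfolding \<phi>_def \<phi>'_def using that DERIV_fun_powr[of "\<lambda>t. t + e" 1 t "-m"]
    by (auto intro!: derivative_eq_intros)
  have 2: "(\<phi>' has_real_derivative \<phi>'' t) (at t)" if "t \<in> {-e<..}" for t
  proof -
    have "((\<lambda>t. (t + e) powr (-m-1)) has_real_derivative (-m-1) * (t + e) powr (-m-1-1) * 1) (at t)"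
      using that DERIV_fun_powr[of "\<lambda>t. t + e" 1 t "-m-1"] by (auto intro!: derivative_eq_intros)
    from DERIV_cmult[OF this, of "-m"] show ?thesis
      unfolding \<phi>'_def \<phi>''_def by (simp add: algebra_simps)
  qed
  have 3: "continuous_on {-e<..} \<phi>''" unfolding \<phi>''_def by (intro continuous_intros) auto
  have S: "(norm (x - a))\<^sup>2 \<in> {-e<..}" if "x \<in> UNIV" for x using e by (smt (verit) greaterThan_iff zero_le_power2)
  note C = has_C2_radial[OF 1 2 3 open_UNIV S]
  have "trace ((4 * \<phi>'' ((norm (y - a))\<^sup>2)) *\<^sub>R outer (y - a) (y - a) + (2 * \<phi>' ((norm (y - a))\<^sup>2)) *\<^sub>R mat 1)
     = - (2 * real CARD('n) * m) * (e * ((norm (y - a))\<^sup>2 + e) powr (-m-2))" for y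
  proof -
    define s where "s = (norm (y - a))\<^sup>2"
    have s: "s + e > 0" using e by (simp add: s_def add_nonneg_pos)
    have N: "real CARD('n) = 2 * (m + 1)" using m by simp
    have p: "(s + e) powr (-m-1) = (s + e) powr (-m-2) * (s + e)"
    proof -
      have "-m-1 = (-m-2) + 1" by simp
      then have "(s + e) powr (-m-1) = (s + e) powr (-m-2) * (s + e) powr 1" by (simp only: powr_add)
      then show ?thesis using s by simp
    qed
    show ?thesis unfolding trace_radial s_def[symmetric] N \<phi>'_def \<phi>''_def p by (simp add: algebra_simps)
  qed
  then show ?thesis using C unfolding \<phi>_def by blast
qed

text \<open>\<open>w\<close> is tested with the regularised kernel; since \<open>w\<close> is
  bounded, the puncture is crossed by the argument with holes. As e tends to 0, one side is
  dominated by the singular kernel and the other concentrates at x. The constant is left as some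
  positive \<open>I\<close>, since it only rescales the expansion of the potential.\<close>

lemma representation:
  fixes w :: "real^'n \<Rightarrow> real" and \<gamma> :: real
  assumes N3: "CARD('n) \<ge> 3" and m: "m = (real CARD('n) - 2) / 2"
    and w: "has_C2 (UNIV - {0}) w G H" and R: "R > 0" and wR: "\<And>x. norm x > R \<Longrightarrow> w x = 0"
    and A: "\<And>x. \<bar>w x\<bar> \<le> A" and C: "C \<ge> 0" and \<gamma>: "\<gamma> < CARD('n)"
    and H: "\<And>y. y \<noteq> 0 \<Longrightarrow> \<bar>trace (H y)\<bar> \<le> C * norm y powr (-\<gamma>)"
    and i: "\<And>x. x \<noteq> 0 \<Longrightarrow> integrable lborel (\<lambda>y. norm (x - y) powr (-2 * m) * trace (H y))"
  shows "\<exists>I>0. \<forall>x. x \<noteq> 0 \<longrightarrow> I * w x = - (LINT y|lborel. norm (x - y) powr (-2 * m) * trace (H y))"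
proof -
  note D = has_C2D[OF w]
  have mp: "m > 0" "2 * m = real CARD('n) - 2" using N3 m by auto
  \<comment> \<open>On the open set where \<open>w\<close> vanishes every point is a maximum of both
    \<open>w\<close> and \<open>-w\<close>, which gives both signs.\<close>
  have HR: "trace (H y) = 0" if "norm y > R" for y
  proof -
    have sub: "has_C2 (- cball 0 R) w G H"
      by (rule has_C2_subset[OF w]) (use R in \<open>auto simp: open_Compl\<close>)
    have "trace (H y) \<le> 0"
      by (rule has_C2_local_max(2)[OF sub]) (use that wR in auto)
    moreover have "trace (- 1 *\<^sub>R H y) \<le> 0"
      by (rule has_C2_local_max(2)[OF has_C2_cmul[OF sub]]) (use that wR in auto)
    ultimately show ?thesis by simp
  qed
  have ctr: "continuous_on (UNIV - {0}) (\<lambda>x. trace (H x))" unfolding trace_def by (intro continuous_intros D)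
  \<comment> \<open>The total mass of the profile of the approximate identity; its positivity allows
    the later division by \<open>I\<close>.\<close>
  define J where "J = (LINT z::real^'n|lborel. ((norm z)\<^sup>2 + 1) powr (-m-2))"
  have iJ: "integrable lborel (\<lambda>z::real^'n. ((norm z)\<^sup>2 + 1) powr (-m-2))"
  proof (rule Bochner_Integration.integrable_bound)
    have "integrable lborel (\<lambda>z::real^'n. norm z powr (-(real CARD('n) + 2)) * indicator {z. 1 \<le> norm z} z)"
      using LINT_power_far[where 'a="real^'n" and \<gamma>="real CARD('n) + 2"] by (auto simp: DIM_cart)
    moreover have "integrable lborel (indicator (ball 0 1) :: real^'n \<Rightarrow> real)"
      using emeasure_lborel_ball_finite by (intro integrable_real_indicator) auto
    ultimately show "integrable lborel (\<lambda>z::real^'n. indicator (ball 0 1) z + norm z powr (-(real CARD('n) + 2)) * indicator {z. 1 \<le> norm z} z)"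
      by (rule Bochner_Integration.integrable_add[rotated])
    show "(\<lambda>z::real^'n. ((norm z)\<^sup>2 + 1) powr (-m-2)) \<in> borel_measurable lborel" by measurable
    have "norm (((norm z)\<^sup>2 + 1) powr (-m-2)) \<le> norm (indicator (ball 0 1) z + norm z powr (-(real CARD('n) + 2)) * indicator {z. 1 \<le> norm z} z)" for z :: "real^'n"
    proof (cases "norm z < 1")
      case True
      have "((norm z)\<^sup>2 + 1) powr (-m-2) \<le> 1 powr (-m-2)" using mp by (intro powr_mono2') auto
      then show ?thesis using True by simp
    next
      case False
      then have z: "norm z > 0" by linarith
      have "((norm z)\<^sup>2 + 1) powr (-m-2) \<le> ((norm z)\<^sup>2) powr (-m-2)" using mp z by (intro powr_mono2') auto
      also have "\<dots> = norm z powr (2 * (-m-2))"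
      proof -
        have "(norm z)\<^sup>2 = norm z powr 2" using z by simp
        then show ?thesis by (simp only: powr_powr)
      qed
      also have "2 * (-m-2) = -(real CARD('n) + 2)" using mp by simp
      finally show ?thesis using False by simp
    qed
    then show "AE z in lborel. norm (((norm z)\<^sup>2 + 1) powr (-m-2)) \<le> norm (indicator (ball 0 1) z + norm z powr (-(real CARD('n) + 2)) * indicator {z. 1 \<le> norm (z::real^'n)} z)"
      by simp
  qed
  have Jp: "J > 0"
  proof -
    have "0 \<le> J" unfolding J_def by simp
    moreover have "J \<noteq> 0"
    proof
      assume "J = 0"
      then have "AE z::real^'n in lborel. ((norm z)\<^sup>2 + 1) powr (-m-2) = 0"
        unfolding J_def using integral_nonneg_eq_0_iff_AE[OF iJ] by simp
      then have ae: "AE z::real^'n in lborel. False"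
      proof eventually_elim
        case (elim z)
        then show ?case using zero_le_power2[of "norm z"] by (simp add: add_nonneg_eq_0_iff)
      qed
      then have "emeasure (lborel::(real^'n) measure) UNIV = 0"
        using AE_iff_measurable[of UNIV "lborel::(real^'n) measure" "\<lambda>z. False"] ae by simp
      then show False by (simp add: emeasure_lborel_UNIV)
    qed
    ultimately show ?thesis by simp
  qed
  define I where "I = 2 * real CARD('n) * m * J"
  have Ip: "I > 0" unfolding I_def using mp Jp by simp
  have [measurable]: "w \<in> borel_measurable borel"
  proof -
    have "(\<lambda>x. indicator (UNIV - {0}) x *\<^sub>R w x) \<in> borel_measurable borel"
      by (intro borel_measurable_continuous_on_indicator D) auto
    then have wm: "(\<lambda>x. indicator (UNIV - {0}) x *\<^sub>R w x + indicator {0} x * w 0) \<in> borel_measurable borel"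
      by measurable
    have we: "w = (\<lambda>x. indicator (UNIV - {0}) x *\<^sub>R w x + indicator {0} x * w 0)" by (auto simp: fun_eq_iff indicator_def)
    show ?thesis by (subst we) (rule wm)
  qed
  have A0: "A \<ge> 0" using A[of 0] by linarith
  have "I * w x = - (LINT y|lborel. norm (x - y) powr (-2 * m) * trace (H y))" if x: "x \<noteq> 0" for x
  proof -
    define gm where "gm e y = ((norm (y - x))\<^sup>2 + e) powr (-m)" for e :: real and y
    define lp where "lp e y = - (2 * real CARD('n) * m) * (e * ((norm (y - x))\<^sup>2 + e) powr (-m-2))" for e :: real and y
    have step1: "(LINT y|lborel. gm e y * trace (H y)) = (LINT y|lborel. w y * lp e y)" if e: "e > 0" for e
    proof -
      obtain Gg Hg where g: "has_C2 UNIV (gm e) Gg Hg" and tg: "\<And>y. trace (Hg y) = lp e y"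
        using has_C2_mollified[OF m e, of x] unfolding gm_def lp_def by blast
      \<comment> \<open>The bump is 1 on the ball of radius R containing the support of
        \<open>w\<close>, so multiplying the kernel by it makes it a compactly supported test
        function without changing any integral against \<open>w\<close> or its Laplacian.\<close>
      define a where "a = 1 / (R + 1)\<^sup>2"
      have a: "a > 0" using R by (simp add: a_def)
      have \<chi>: "has_C2 UNIV (\<lambda>y. 1 - cutoff a y) (\<lambda>y. 0 - cutoffG a y) (\<lambda>y::real^'n. 0 - cutoffH a y)"
        by (rule has_C2_diff[OF has_C2_const has_C2_cutoff])
      define \<zeta> where "\<zeta> y = gm e y * (1 - cutoff a y)" for y
      note \<zeta>C = has_C2_mult[OF g \<chi>, folded \<zeta>_def]
      have small: "a * (norm y)\<^sup>2 \<le> 1" if "norm y \<le> R" for y :: "real^'n"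
      proof -
        have "(norm y)\<^sup>2 \<le> (R + 1)\<^sup>2" using that by (intro power_mono) auto
        then show ?thesis using R by (simp add: a_def)
      qed
      have in1: "cutoff a y = 0" "cutoffG a y = 0" "cutoffH a y = 0" if "norm y \<le> R" for y :: "real^'n"
        using small[OF that] by (auto simp: cutoff_def cutoffG_def cutoffH_def cut_values)
      define K where "K = cball (0::real^'n) (2 * (R + 1))"
      have K: "compact K" "K \<subseteq> UNIV" by (auto simp: K_def)
      have \<zeta>0: "\<zeta> y = 0" if "y \<notin> K" for y
      proof -
        have "(2 * (R + 1))\<^sup>2 \<le> (norm y)\<^sup>2" using that R by (intro power_mono) (auto simp: K_def)
        then have "2 \<le> a * (norm y)\<^sup>2" using R unfolding a_def power_mult_distrib by (simp add: field_simps) (smt (verit) zero_le_power2)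
        then show ?thesis using cutoff_values(2)[OF a, of y] by (simp add: \<zeta>_def)
      qed
      \<comment> \<open>Boundedness is the case \<sigma> = 0 of the singular bound, and \<sigma> + 2
        < N is then N \<ge> 3.\<close>
      have wb: "\<bar>w y\<bar> \<le> A * norm y powr (-0)" if "0 < norm y" "norm y < 1" for y
        using A[of y] that by simp
      have s: "(0::real) + 2 < real CARD('n)" using N3 by simp
      have Hi: "set_integrable lborel K (\<lambda>y. trace (H y))"
        by (rule set_integrable_singular[OF ctr K zero_less_one set_integrable_ball_power[OF ctr zero_less_one _ _ \<gamma>]])
           (use H in auto)
      have l1: "(\<lambda>n. LINT y|lborel. \<zeta> y * hole n y * trace (H y)) \<longlonglongrightarrow> (LINT y|lborel. \<zeta> y * trace (H y))"
        by (rule hole_limit(2)[OF ctr K Hi has_C2D(5)[OF \<zeta>C] \<zeta>0])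
      have l2: "(\<lambda>n. LINT y|lborel. \<zeta> y * hole n y * trace (H y)) \<longlonglongrightarrow> (LINT y|lborel. w y * trace
          (gm e y *\<^sub>R (0 - cutoffH a y) + (1 - cutoff a y) *\<^sub>R Hg y + (outer (Gg y) (0 - cutoffG a y) + outer (0 - cutoffG a y) (Gg y))))"
        by (rule removable_limits(1)[OF open_UNIV w K zero_less_one wb s A0 \<zeta>C \<zeta>0])
      have "(LINT y|lborel. \<zeta> y * trace (H y)) = (LINT y|lborel. gm e y * trace (H y))"
        by (rule Bochner_Integration.integral_cong[OF refl])
           (metis HR \<zeta>_def diff_zero in1(1) mult_cancel_left2 mult_zero_right not_le)
      moreover have "(LINT y|lborel. w y * trace
          (gm e y *\<^sub>R (0 - cutoffH a y) + (1 - cutoff a y) *\<^sub>R Hg y + (outer (Gg y) (0 - cutoffG a y) + outer (0 - cutoffG a y) (Gg y)))) = (LINT y|lborel. w y * lp e y)"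
      proof (rule Bochner_Integration.integral_cong[OF refl])
        fix y
        show "w y * trace (gm e y *\<^sub>R (0 - cutoffH a y) + (1 - cutoff a y) *\<^sub>R Hg y + (outer (Gg y) (0 - cutoffG a y) + outer (0 - cutoffG a y) (Gg y))) = w y * lp e y"
        proof (cases "norm y \<le> R")
          case True
          show ?thesis unfolding in1[OF True] by (simp add: trace_add tg)
        next
          case False then show ?thesis using wR[of y] by simp
        qed
      qed
      ultimately show ?thesis using LIMSEQ_unique[OF l1 l2] by simp
    qed
    \<comment> \<open>The regularisation parameter is the square of \<open>ep n\<close>, so that
      \<open>ep n\<close> itself is the length by which the substitution rescales.\<close>
    define ep where "ep n = 1 / (real n + 1)" for n
    have ep: "ep n > 0" "ep n \<le> 1" for n by (auto simp: ep_def)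
    have epl: "ep \<longlonglongrightarrow> 0" unfolding ep_def using LIMSEQ_inverse_real_of_nat by (simp add: inverse_eq_divide add.commute)
    have Hm: "(\<lambda>y. trace (H y)) \<in> borel_measurable lborel"
    proof -
      have "(\<lambda>x. indicator (UNIV - {0}) x *\<^sub>R trace (H x)) \<in> borel_measurable borel"
        by (intro borel_measurable_continuous_on_indicator ctr) auto
      then have "(\<lambda>x. indicator (UNIV - {0}) x *\<^sub>R trace (H x) + indicator {0} x * trace (H 0)) \<in> borel_measurable borel"
        by measurable
      moreover have "(\<lambda>x. indicator (UNIV - {0}) x *\<^sub>R trace (H x) + indicator {0} x * trace (H 0)) = (\<lambda>y. trace (H y))"
        by (auto simp: fun_eq_iff indicator_def)
      ultimately show ?thesis by simp
    qed
    have nx: "norm (y - x) powr (-2 * m) = ((norm (y - x))\<^sup>2) powr (-m)" if "y \<noteq> x" for y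
    proof -
      have "(norm (y - x))\<^sup>2 = norm (y - x) powr 2" using that by simp
      then have "((norm (y - x))\<^sup>2) powr (-m) = norm (y - x) powr (2 * -m)" by (simp only: powr_powr)
      then show ?thesis by simp
    qed
    have lim1: "(\<lambda>n. LINT y|lborel. gm ((ep n)\<^sup>2) y * trace (H y)) \<longlonglongrightarrow> (LINT y|lborel. norm (x - y) powr (-2 * m) * trace (H y))"
    proof (rule integral_dominated_convergence[where w="\<lambda>y. \<bar>norm (x - y) powr (-2 * m) * trace (H y)\<bar>"])
      show "(\<lambda>y. norm (x - y) powr (-2 * m) * trace (H y)) \<in> borel_measurable lborel" using i[OF x] by simp
      show "(\<lambda>y. gm ((ep n)\<^sup>2) y * trace (H y)) \<in> borel_measurable lborel" for n
        using Hm unfolding gm_def by measurable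
      show "integrable lborel (\<lambda>y. \<bar>norm (x - y) powr (-2 * m) * trace (H y)\<bar>)" using i[OF x] by simp
      have ae: "AE y in lborel. y \<noteq> x" by (rule AE_lborel_singleton)
      show "AE y in lborel. (\<lambda>n. gm ((ep n)\<^sup>2) y * trace (H y)) \<longlonglongrightarrow> norm (x - y) powr (-2 * m) * trace (H y)"
        using ae
      proof eventually_elim
        case (elim y)
        have "(\<lambda>n. ((norm (y - x))\<^sup>2 + (ep n)\<^sup>2) powr (-m)) \<longlonglongrightarrow> ((norm (y - x))\<^sup>2 + 0\<^sup>2) powr (-m)"
          using elim by (intro tendsto_intros epl) auto
        then show ?case using nx[OF elim] by (intro tendsto_mult tendsto_const) (simp add: gm_def norm_minus_commute)
      qed
      show "AE y in lborel. norm (gm ((ep n)\<^sup>2) y * trace (H y)) \<le> \<bar>norm (x - y) powr (-2 * m) * trace (H y)\<bar>" for n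
        using ae
      proof eventually_elim
        case (elim y)
        have "gm ((ep n)\<^sup>2) y \<le> ((norm (y - x))\<^sup>2) powr (-m)"
          unfolding gm_def using elim mp by (intro powr_mono2') auto
        then show ?case using nx[OF elim] by (simp add: abs_mult norm_minus_commute gm_def mult_right_mono)
      qed
    qed
    \<comment> \<open>The substitution y = x + ez. The powers of e cancel, because 2 - 2(m+2) + N =
      0.\<close>
    have scale: "(LINT y|lborel. w y * lp (e\<^sup>2) y) = - (2 * real CARD('n) * m) * (LINT z|lborel. w (x + e *\<^sub>R z) * ((norm z)\<^sup>2 + 1) powr (-m-2))"
      if e: "e > 0" for e
    proof -
      define f where "f y = w y * (e\<^sup>2 * ((norm (y - x))\<^sup>2 + e\<^sup>2) powr (-m-2))" for y
      have fz: "f (x + e *\<^sub>R z) = (1 / e ^ CARD('n)) * (w (x + e *\<^sub>R z) * ((norm z)\<^sup>2 + 1) powr (-m-2))" for z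
      proof -
        have "(norm (e *\<^sub>R z))\<^sup>2 + e\<^sup>2 = e\<^sup>2 * ((norm z)\<^sup>2 + 1)" by (simp add: power_mult_distrib algebra_simps)
        then have "e\<^sup>2 * ((norm (e *\<^sub>R z))\<^sup>2 + e\<^sup>2) powr (-m-2) = (e\<^sup>2 * (e\<^sup>2) powr (-m-2)) * ((norm z)\<^sup>2 + 1) powr (-m-2)"
          by (simp add: powr_mult)
        also have "e\<^sup>2 * (e\<^sup>2) powr (-m-2) = 1 / e ^ CARD('n)"
        proof -
          have "e\<^sup>2 = e powr 2" using e by simp
          then have "e\<^sup>2 * (e\<^sup>2) powr (-m-2) = e powr 2 * e powr (2 * (-m-2))" by (simp only: powr_powr)
          also have "\<dots> = e powr (2 + 2 * (-m-2))" by (simp only: powr_add)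
          also have "2 + 2 * (-m-2) = - real CARD('n)" using mp by simp
          also have "e powr (- real CARD('n)) = 1 / e ^ CARD('n)" using e by (simp add: powr_minus powr_realpow divide_inverse)
          finally show ?thesis .
        qed
        finally have q: "e\<^sup>2 * ((norm (e *\<^sub>R z))\<^sup>2 + e\<^sup>2) powr (-m-2) = (1 / e ^ CARD('n)) * ((norm z)\<^sup>2 + 1) powr (-m-2)" .
        have "x + e *\<^sub>R z - x = e *\<^sub>R z" by simp
        then show ?thesis unfolding f_def by (simp only: q) (simp only: mult_ac)
      qed
      have wi: "integrable lborel (\<lambda>z. w (x + e *\<^sub>R z) * ((norm z)\<^sup>2 + 1) powr (-m-2))"
      proof (rule Bochner_Integration.integrable_bound[OF integrable_mult_right[OF iJ, of A]])
        show "(\<lambda>z. w (x + e *\<^sub>R z) * ((norm z)\<^sup>2 + 1) powr (-m-2)) \<in> borel_measurable lborel" by measurable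
        show "AE z in lborel. norm (w (x + e *\<^sub>R z) * ((norm z)\<^sup>2 + 1) powr (-m-2)) \<le> norm (A * ((norm z)\<^sup>2 + 1) powr (-m-2))"
          using A A0 by (intro AE_I2) (auto simp: abs_mult intro!: mult_right_mono)
      qed
      have fi: "integrable lborel f"
      proof -
        have "integrable lborel (\<lambda>z. f (x + e *\<^sub>R z))" unfolding fz using wi by simp
        from integrable_affine(1)[OF this, of "1/e" "-(1/e) *\<^sub>R x"] e
        have "integrable lborel (\<lambda>y. f (x + e *\<^sub>R (-(1/e) *\<^sub>R x + (1/e) *\<^sub>R y)))" by simp
        moreover have "x + e *\<^sub>R (-(1/e) *\<^sub>R x + (1/e) *\<^sub>R y) = y" for y using e by (simp add: algebra_simps)
        ultimately show ?thesis by simp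
      qed
      have "(LINT y|lborel. f y) = e ^ CARD('n) * (LINT z|lborel. f (x + e *\<^sub>R z))"
        using integrable_affine(2)[OF fi, of e x] e by simp
      also have "\<dots> = (LINT z|lborel. w (x + e *\<^sub>R z) * ((norm z)\<^sup>2 + 1) powr (-m-2))"
        unfolding fz using e by simp
      finally have F: "(LINT y|lborel. f y) = \<dots>" .
      have "(LINT y|lborel. w y * lp (e\<^sup>2) y) = (LINT y|lborel. - (2 * real CARD('n) * m) * f y)"
        by (rule Bochner_Integration.integral_cong[OF refl]) (simp add: lp_def f_def mult_ac)
      also have "\<dots> = - (2 * real CARD('n) * m) * (LINT y|lborel. f y)" by (rule integral_mult_right_zero)
      finally show ?thesis unfolding F .
    qed
    have lim2: "(\<lambda>n. LINT z|lborel. w (x + ep n *\<^sub>R z) * ((norm z)\<^sup>2 + 1) powr (-m-2)) \<longlonglongrightarrow> (LINT z::real^'n|lborel. w x * ((norm z)\<^sup>2 + 1) powr (-m-2))"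
    proof (rule integral_dominated_convergence[where w="\<lambda>z. A * ((norm z)\<^sup>2 + 1) powr (-m-2)"])
      show "(\<lambda>z::real^'n. w x * ((norm z)\<^sup>2 + 1) powr (-m-2)) \<in> borel_measurable lborel" by measurable
      show "(\<lambda>z. w (x + ep n *\<^sub>R z) * ((norm z)\<^sup>2 + 1) powr (-m-2)) \<in> borel_measurable lborel" for n by measurable
      show "integrable lborel (\<lambda>z::real^'n. A * ((norm z)\<^sup>2 + 1) powr (-m-2))" using iJ by (rule integrable_mult_right)
      show "AE z in lborel. norm (w (x + ep n *\<^sub>R z) * ((norm z)\<^sup>2 + 1) powr (-m-2)) \<le> A * ((norm z)\<^sup>2 + 1) powr (-m-2)" for n
        using A by (intro AE_I2) (auto simp: abs_mult intro!: mult_right_mono)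
      show "AE z in lborel. (\<lambda>n. w (x + ep n *\<^sub>R z) * ((norm z)\<^sup>2 + 1) powr (-m-2)) \<longlonglongrightarrow> w x * ((norm z)\<^sup>2 + 1) powr (-m-2)"
      proof (rule AE_I2, rule tendsto_mult[OF _ tendsto_const])
        fix z
        have c: "isCont w x" using D(5) x by (simp add: continuous_on_eq_continuous_at open_Diff)
        have "(\<lambda>n. x + ep n *\<^sub>R z) \<longlonglongrightarrow> x + 0 *\<^sub>R z" by (intro tendsto_intros epl)
        then have l: "(\<lambda>n. x + ep n *\<^sub>R z) \<longlonglongrightarrow> x" by simp
        show "(\<lambda>n. w (x + ep n *\<^sub>R z)) \<longlonglongrightarrow> w x" by (rule isCont_tendsto_compose[OF c l])
      qed
    qed
    have "(\<lambda>n. LINT y|lborel. gm ((ep n)\<^sup>2) y * trace (H y)) = (\<lambda>n. - (2 * real CARD('n) * m) * (LINT z|lborel. w (x + ep n *\<^sub>R z) * ((norm z)\<^sup>2 + 1) powr (-m-2)))"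
      by (simp only: step1[OF zero_less_power[OF ep(1)]] scale[OF ep(1)])
    moreover have "(\<lambda>n. - (2 * real CARD('n) * m) * (LINT z|lborel. w (x + ep n *\<^sub>R z) * ((norm z)\<^sup>2 + 1) powr (-m-2)))
        \<longlonglongrightarrow> - (2 * real CARD('n) * m) * (LINT z::real^'n|lborel. w x * ((norm z)\<^sup>2 + 1) powr (-m-2))"
      by (intro tendsto_mult tendsto_const lim2)
    ultimately have "(LINT y|lborel. norm (x - y) powr (-2 * m) * trace (H y)) = - (2 * real CARD('n) * m) * (LINT z::real^'n|lborel. w x * ((norm z)\<^sup>2 + 1) powr (-m-2))"
      using LIMSEQ_unique[OF lim1] by simp
    also have "\<dots> = - (I * w x)" unfolding I_def J_def by simp
    finally show ?thesis by simp
  qed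
  with Ip show ?thesis by blast
qed

section \<open>Expansion at an isolated singularity\<close>

lemma powr_comparable:
  fixes a t s :: real
  assumes "a > 0" "a / 2 \<le> t" "t \<le> 2 * a"
  shows "t powr s \<le> 2 powr \<bar>s\<bar> * a powr s"
proof -
  define b where "b = t / a"
  have b: "1/2 \<le> b" "b \<le> 2" using assms by (auto simp: b_def field_simps)
  have "b powr s \<le> 2 powr \<bar>s\<bar>"
  proof (cases "s \<ge> 0")
    case True then show ?thesis using b by (simp add: powr_mono2)
  next
    case False
    have "b powr s \<le> (1/2) powr s" using b False by (intro powr_mono2') auto
    also have "(1/2) powr s = 2 powr \<bar>s\<bar>" using False powr_minus_divide[of 2 "-s"] powr_divide[of 1 2 s] by simp
    finally show ?thesis .
  qed
  moreover have "t powr s = b powr s * a powr s" using assms by (simp add: b_def powr_mult[symmetric])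
  ultimately show ?thesis by (simp add: mult_right_mono)
qed

lemma borel_measurable_punctured:
  fixes f :: "real^'n \<Rightarrow> real"
  assumes "continuous_on (UNIV - {0}) f"
  shows "f \<in> borel_measurable borel"
proof -
  have "(\<lambda>x. indicator (UNIV - {0}) x *\<^sub>R f x) \<in> borel_measurable borel"
    by (intro borel_measurable_continuous_on_indicator assms) auto
  then have m: "(\<lambda>x. indicator (UNIV - {0}) x *\<^sub>R f x + indicator {0} x * f 0) \<in> borel_measurable borel"
    by measurable
  have "(\<lambda>x. indicator (UNIV - {0}) x *\<^sub>R f x + indicator {0} x * f 0) = f" by (auto simp: fun_eq_iff indicator_def)
  with m show ?thesis by simp
qed

lemma has_C2_quadratic: "has_C2 UNIV (\<lambda>x. x \<bullet> (B *v x)) (\<lambda>x. (B + transpose B) *v x) (\<lambda>x. B + transpose B)"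
proof -
  have bl: "bounded_linear ((*v) (A::real^'a^'a))" for A by (simp add: matrix_vector_mul_bounded_linear)
  have d: "((*v) A has_derivative (*v) A) (at x)" for A :: "real^'a^'a" and x
    by (rule bounded_linear_imp_has_derivative[OF bl])
  have t: "x \<bullet> (B *v h) = (transpose B *v x) \<bullet> h" for x h
    by (metis dot_lmul_matrix inner_commute transpose_matrix_vector)
  have e: "x \<bullet> (B *v h) + h \<bullet> (B *v x) = ((B + transpose B) *v x) \<bullet> h" for x h
    unfolding t[of x h] by (simp add: matrix_vector_mult_add_rdistrib inner_add_left inner_add_right inner_commute)
  have "((\<lambda>x. x \<bullet> (B *v x)) has_derivative (\<lambda>h. x \<bullet> (B *v h) + h \<bullet> (B *v x))) (at x)" for x
    by (rule has_derivative_inner[OF has_derivative_ident d])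
  then show ?thesis unfolding has_C2_def e by (auto intro!: d)
qed

lemma trace_transpose_add: "trace (B + transpose B) = 2 * trace (B::real^'n^'n)"
  by (simp add: trace_add) (simp add: trace_def transpose_def)

text \<open>Times a bump, \<open>u\<close> extends by 0 to the punctured space with bounded support.
  Near the origin the Laplacian is unchanged, so the expansion of the potential of the extended
  function is an expansion of \<open>u\<close>.\<close>

lemma local_expansion:
  fixes u :: "real^'n \<Rightarrow> real"
  assumes N3: "CARD('n) \<ge> 3" and r: "r > 0" and u: "has_C2 (ball 0 r - {0}) u G H"
    and A: "\<And>x. x \<in> ball 0 r - {0} \<Longrightarrow> \<bar>u x\<bar> \<le> A"
    and k: "k \<le> 2" and \<beta>: "0 < \<beta>" "\<beta> < 1" and C: "C \<ge> 0"
    and H: "\<And>x. x \<in> ball 0 r - {0} \<Longrightarrow> \<bar>trace (H x)\<bar> \<le> C * norm x powr (real k - 2 + \<beta>)"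
  shows "\<exists>c g B. \<exists>D\<ge>0. (k < 1 \<longrightarrow> g = 0) \<and> (k < 2 \<longrightarrow> B = 0) \<and> trace (B::real^'n^'n) = 0 \<and>
    (\<forall>x. 0 < norm x \<and> norm x < r / 4 \<longrightarrow> \<bar>u x - (c + g \<bullet> x + x \<bullet> (B *v x))\<bar> \<le> D * norm x powr (real k + \<beta>))"
proof -
  define s where "s = real k - 2 + \<beta>"
  define m where "m = (real CARD('n) - 2) / 2"
  \<comment> \<open>Since a (r/2)^2 = 2 and a (r/4)^2 = 1/2, the bump is 0 for |x| \<ge> r/2 and 1
    for |x| \<le> r/4.\<close>
  define a where "a = 8 / r\<^sup>2"
  have a: "a > 0" using r by (simp add: a_def)
  have big: "2 \<le> a * (norm x)\<^sup>2" if "norm x \<ge> r / 2" for x :: "real^'n"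
  proof -
    have "(r/2)\<^sup>2 \<le> (norm x)\<^sup>2" using that r by (intro power_mono) auto
    then show ?thesis using r by (simp add: a_def field_simps power2_eq_square)
  qed
  have small: "a * (norm x)\<^sup>2 \<le> 1" if "norm x \<le> r / 4" for x :: "real^'n"
  proof -
    have "(norm x)\<^sup>2 \<le> (r/4)\<^sup>2" using that r by (intro power_mono) auto
    then show ?thesis using r
      by (simp add: a_def field_simps power2_eq_square, use zero_le_square[of "norm x"] in linarith)
  qed
  have out: "cutoff a x = 1" "cutoffG a x = 0" "cutoffH a x = 0" if "norm x \<ge> r / 2" for x :: "real^'n"
    using cutoff_values(2,5,6)[OF a big[OF that]] .
  have inn: "cutoff a x = 0" "cutoffG a x = 0" "cutoffH a x = 0" if "norm x \<le> r / 4" for x :: "real^'n"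
    using small[OF that] by (auto simp: cutoff_def cutoffG_def cutoffH_def cut_values)
  define U where "U = ball (0::real^'n) r - {0}"
  have \<chi>: "has_C2 U (\<lambda>y. 1 - cutoff a y) (\<lambda>y. 0 - cutoffG a y) (\<lambda>y::real^'n. 0 - cutoffH a y)"
    by (rule has_C2_subset[OF has_C2_diff[OF has_C2_const has_C2_cutoff]]) (auto simp: U_def)
  define G1 where "G1 x = (1 - cutoff a x) *\<^sub>R G x + u x *\<^sub>R (0 - cutoffG a x)" for x
  define H1 where "H1 x = (1 - cutoff a x) *\<^sub>R H x + u x *\<^sub>R (0 - cutoffH a x) + (outer (0 - cutoffG a x) (G x) + outer (G x) (0 - cutoffG a x))" for x
  have p: "has_C2 U (\<lambda>x. (1 - cutoff a x) * u x) G1 H1"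
    unfolding G1_def H1_def by (rule has_C2_mult[OF \<chi>]) (use u in \<open>simp add: U_def\<close>)
  define w where "w x = (if x \<in> U then (1 - cutoff a x) * u x else 0)" for x
  define Gw where "Gw x = (if x \<in> U then G1 x else 0)" for x
  define Hw where "Hw x = (if x \<in> U then H1 x else 0)" for x
  have out0: "outer 0 v = 0" "outer v 0 = 0" for v :: "real^'n" by (auto simp: outer_def vec_eq_iff)
  have w1: "has_C2 U w Gw Hw" by (rule has_C2_cong[OF p]) (auto simp: w_def Gw_def Hw_def)
  have w2: "has_C2 (- cball 0 (r/2)) w Gw Hw"
  proof (rule has_C2_cong[OF has_C2_subset[OF has_C2_const]])
    show "w x = 0" "Gw x = 0" "Hw x = 0" if "x \<in> - cball 0 (r/2)" for x
      using that out[of x] by (auto simp: w_def Gw_def Hw_def G1_def H1_def out0)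
  qed (auto simp: open_Compl)
  \<comment> \<open>The two open sets overlap where the extended function is identically 0, and
    together they cover everything but the origin.\<close>
  have un: "U \<union> - cball 0 (r/2) = UNIV - {0}" using r by (auto simp: U_def)
  have w: "has_C2 (UNIV - {0}) w Gw Hw" using has_C2_Un[OF w1 w2] unfolding un .
  note D = has_C2D[OF w]
  have ctr: "continuous_on (UNIV - {0}) (\<lambda>x. trace (Hw x))" unfolding trace_def by (intro continuous_intros D)
  define F where "F x = trace (Hw x)" for x
  have Fm: "F \<in> borel_measurable borel" unfolding F_def by (rule borel_measurable_punctured[OF ctr])
  \<comment> \<open>On the annulus where the bump varies the Laplacian of the product contains
    derivatives of \<open>u\<close>; compactness bounds it by a multiple of |x|^s.\<close>
  define K where "K = cball (0::real^'n) (r/2) - ball 0 (r/4)"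
  have K: "compact K" "K \<subseteq> UNIV - {0}" using r by (auto simp: K_def intro!: compact_diff)
  have "continuous_on K (\<lambda>x. F x / norm x powr s)"
    unfolding F_def by (intro continuous_intros continuous_on_subset[OF ctr K(2)]) (use K(2) in auto)
  then have "bounded ((\<lambda>x. F x / norm x powr s) ` K)" using K(1) by (intro compact_imp_bounded compact_continuous_image)
  then obtain b where b: "b > 0" "\<And>x. x \<in> K \<Longrightarrow> \<bar>F x / norm x powr s\<bar> \<le> b" by (auto simp: bounded_pos)
  have F0: "F x = 0" if "x = 0 \<or> norm x > r / 2" for x
    using that out[of x] r by (auto simp: F_def Hw_def H1_def out0 U_def trace_0[unfolded mat_0])
  have FH: "F x = trace (H x)" if "x \<noteq> 0" "norm x \<le> r / 4" for x
    using that inn[OF that(2)] r by (auto simp: F_def Hw_def H1_def out0 U_def)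
  have Fb: "\<bar>F x\<bar> \<le> (C + b) * norm x powr s" for x
  proof (cases "x = 0 \<or> norm x > r / 2")
    case True then show ?thesis using F0[OF True] C b by simp
  next
    case ne: False
    show ?thesis
    proof (cases "norm x < r / 4")
      case True
      then have "\<bar>F x\<bar> \<le> C * norm x powr s" using FH[of x] H[of x] ne r by (auto simp: s_def)
      also have "\<dots> \<le> (C + b) * norm x powr s" using b by (intro mult_right_mono) auto
      finally show ?thesis .
    next
      case False
      then have "\<bar>F x / norm x powr s\<bar> \<le> b" using ne by (intro b) (auto simp: K_def)
      then have "\<bar>F x\<bar> \<le> b * norm x powr s" using ne by (simp add: abs_divide divide_le_eq)
      also have "\<dots> \<le> (C + b) * norm x powr s" using C by (intro mult_right_mono) auto
      finally show ?thesis .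
    qed
  qed
  have Cb: "C + b \<ge> 0" using C b by simp
  have FR: "F x = 0" if "norm x > r" for x using F0[of x] that r by auto
  obtain c g B D0 where E: "D0 \<ge> 0" "k < 1 \<longrightarrow> g = 0" "k < 2 \<longrightarrow> B = 0" "trace (B::real^'n^'n) = 0"
    "\<And>x. x \<noteq> 0 \<Longrightarrow> integrable lborel (\<lambda>y. norm (x - y) powr (-2 * m) * F y)"
    "\<And>x. x \<noteq> 0 \<Longrightarrow> \<bar>(LINT y|lborel. norm (x - y) powr (-2 * m) * F y) - (c + g \<bullet> x + x \<bullet> (B *v x))\<bar> \<le> D0 * norm x powr (real k + \<beta>)"
    using potential_expansion[OF N3 m_def k \<beta> Cb r Fm Fb[unfolded s_def] FR] by blast
  have wA: "\<bar>w x\<bar> \<le> max A 0" for x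
  proof (cases "x \<in> U")
    case True
    have "\<bar>w x\<bar> = \<bar>1 - cutoff a x\<bar> * \<bar>u x\<bar>" using True by (simp add: w_def abs_mult)
    also have "\<dots> \<le> 1 * max A 0" using A[of x] True cutoff_values(3,4)[OF a, of x] by (intro mult_mono) (auto simp: U_def)
    finally show ?thesis by simp
  qed (simp add: w_def)
  have wr: "w x = 0" if "norm x > r" for x using that by (simp add: w_def U_def)
  have \<gamma>: "- s < real CARD('n)" using \<beta> N3 by (simp add: s_def)
  have Fb': "\<bar>trace (Hw y)\<bar> \<le> (C + b) * norm y powr (-(-s))" for y using Fb[of y] by (simp add: F_def)
  obtain I where I: "I > 0" "\<And>x. x \<noteq> 0 \<Longrightarrow> I * w x = - (LINT y|lborel. norm (x - y) powr (-2 * m) * F y)"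
    using representation[OF N3 m_def w r wr wA Cb \<gamma> Fb' E(5)[unfolded F_def]] unfolding F_def by blast
  have "\<bar>u x - ((- c / I) + ((- 1 / I) *\<^sub>R g) \<bullet> x + x \<bullet> (((- 1 / I) *\<^sub>R B) *v x))\<bar> \<le> (D0 / I) * norm x powr (real k + \<beta>)"
    if x: "0 < norm x" "norm x < r / 4" for x
  proof -
    define V where "V = (LINT y|lborel. norm (x - y) powr (-2 * m) * F y)"
    define P where "P = c + g \<bullet> x + x \<bullet> (B *v x)"
    have "w x = u x" using x inn(1)[of x] r by (auto simp: w_def U_def)
    then have "u x = - V / I" using I(2)[of x] x I(1) unfolding V_def[symmetric] by (auto simp: field_simps)
    moreover have "(- c / I) + ((- 1 / I) *\<^sub>R g) \<bullet> x + x \<bullet> (((- 1 / I) *\<^sub>R B) *v x) = - P / I"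
      unfolding P_def scaleR_matrix_vector_assoc[symmetric] inner_scaleR_left inner_scaleR_right
      by (simp add: add_divide_distrib diff_divide_distrib)
    ultimately have "u x - ((- c / I) + ((- 1 / I) *\<^sub>R g) \<bullet> x + x \<bullet> (((- 1 / I) *\<^sub>R B) *v x)) = - ((V - P) / I)"
      by (simp add: diff_divide_distrib)
    then show ?thesis using E(6)[of x] x I(1) unfolding V_def[symmetric] P_def[symmetric] by (simp add: abs_divide divide_right_mono)
  qed
  moreover have "D0 / I \<ge> 0" using E I by simp
  moreover have "trace ((- 1 / I) *\<^sub>R B) = 0" by (simp only: trace_scaleR E(4) mult_zero_right)
  ultimately show ?thesis using E(2,3)
    by (intro exI[of _ "- c / I"] exI[of _ "(- 1 / I) *\<^sub>R g"] exI[of _ "(- 1 / I) *\<^sub>R B"] exI[of _ "D0 / I"]) auto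
qed

text \<open>The polynomial is harmonic because B has trace 0, so the remainder has the Laplacian of
  \<open>u\<close>. The gradient bound on the ball of radius |x|/2 around x then trades one power of
  |x| for one derivative.\<close>

lemma gradient_expansion:
  fixes u :: "real^'n \<Rightarrow> real"
  assumes N3: "CARD('n) \<ge> 3" and r: "r > 0" and u: "has_C2 (ball 0 r - {0}) u G H"
    and A: "\<And>x. x \<in> ball 0 r - {0} \<Longrightarrow> \<bar>u x\<bar> \<le> A"
    and k: "k \<le> 2" and \<beta>: "0 < \<beta>" "\<beta> < 1" and C: "C \<ge> 0"
    and H: "\<And>x. x \<in> ball 0 r - {0} \<Longrightarrow> \<bar>trace (H x)\<bar> \<le> C * norm x powr (real k - 2 + \<beta>)"
  shows "\<exists>c g B. \<exists>D\<ge>0. (k < 1 \<longrightarrow> g = 0) \<and> (k < 2 \<longrightarrow> B = 0) \<and> trace (B::real^'n^'n) = 0 \<and>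
    (\<forall>x. 0 < norm x \<and> norm x < r / 8 \<longrightarrow> \<bar>u x - (c + g \<bullet> x + x \<bullet> (B *v x))\<bar> \<le> D * norm x powr (real k + \<beta>) \<and>
        norm (G x - (g + (B + transpose B) *v x)) \<le> D * norm x powr (real k - 1 + \<beta>))"
proof -
  obtain c g B D where E: "D \<ge> 0" "k < 1 \<longrightarrow> g = 0" "k < 2 \<longrightarrow> B = 0" "trace (B::real^'n^'n) = 0"
    "\<And>x. 0 < norm x \<Longrightarrow> norm x < r / 4 \<Longrightarrow> \<bar>u x - (c + g \<bullet> x + x \<bullet> (B *v x))\<bar> \<le> D * norm x powr (real k + \<beta>)"
    using local_expansion[OF N3 r u A k \<beta> C H] by blast
  have v: "has_C2 (ball 0 r - {0}) (\<lambda>x. u x - (c + g \<bullet> x + x \<bullet> (B *v x))) (\<lambda>x. G x - (0 + g + (B + transpose B) *v x))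
      (\<lambda>x. H x - (0 + 0 + (B + transpose B)))"
    by (rule has_C2_diff[OF u has_C2_subset[OF has_C2_add[OF has_C2_add[OF has_C2_const has_C2_linear] has_C2_quadratic]]]) auto
  define s where "s = real k - 2 + \<beta>"
  define D' where "D' = gradient_const TYPE('n) * (D * (2 powr \<bar>real k + \<beta>\<bar>) * 2 + C * 2 powr \<bar>s\<bar>)"
  have D': "D' \<ge> 0" using gradient_const_ge[where 'n='n] E(1) C by (simp add: D'_def)
  have "norm (G x - (g + (B + transpose B) *v x)) \<le> D' * norm x powr (real k - 1 + \<beta>)" if x: "0 < norm x" "norm x < r / 8" for x
  proof -
    have z: "norm x / 2 \<le> norm y \<and> norm y \<le> 2 * norm x" if "y \<in> ball x (norm x / 2)" for y
      using that norm_triangle_ineq3[of x y] norm_triangle_ineq[of "y - x" x] by (auto simp: dist_norm norm_minus_commute)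
    have zr: "0 < norm y" "norm y < r / 4" "y \<in> ball 0 r - {0}" if "y \<in> ball x (norm x / 2)" for y
      using z[OF that] x r by auto
    have "norm (G x - (0 + g + (B + transpose B) *v x)) \<le> gradient_const TYPE('n) * ((D * (2 powr \<bar>real k + \<beta>\<bar> * norm x powr (real k + \<beta>))) / (norm x / 2) + (norm x / 2) * (C * (2 powr \<bar>s\<bar> * norm x powr s)))"
    proof (rule gradient_bound[OF has_C2_subset[OF v]])
      show "ball x (norm x / 2) \<subseteq> ball 0 r - {0}" using zr(3) by blast
      show "\<bar>u y - (c + g \<bullet> y + y \<bullet> (B *v y))\<bar> \<le> D * (2 powr \<bar>real k + \<beta>\<bar> * norm x powr (real k + \<beta>))"
        if "y \<in> ball x (norm x / 2)" for y
        using E(1) z[OF that] x by (intro order_trans[OF E(5)[OF zr(1,2)[OF that]]] mult_left_mono powr_comparable) auto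
      show "\<bar>trace (H y - (0 + 0 + (B + transpose B)))\<bar> \<le> C * (2 powr \<bar>s\<bar> * norm x powr s)"
        if "y \<in> ball x (norm x / 2)" for y
      proof -
        have "trace (H y - (0 + 0 + (B + transpose B))) = trace (H y)"
          by (simp add: trace_sub trace_transpose_add E(4))
        moreover have "\<bar>trace (H y)\<bar> \<le> C * (2 powr \<bar>s\<bar> * norm x powr s)"
          using C z[OF that] x unfolding s_def by (intro order_trans[OF H[OF zr(3)[OF that]]] mult_left_mono powr_comparable) auto
        ultimately show ?thesis by simp
      qed
    qed (use x in auto)
    also have "\<dots> = gradient_const TYPE('n) * (D * (2 powr \<bar>real k + \<beta>\<bar>) * 2 * (norm x powr (real k + \<beta>) / norm x) + C * 2 powr \<bar>s\<bar> / 2 * (norm x * norm x powr s))"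
      using x by (simp add: field_simps)
    also have "norm x powr (real k + \<beta>) / norm x = norm x powr (real k - 1 + \<beta>)"
    proof -
      have "real k - 1 + \<beta> = real k + \<beta> - 1" by simp
      then have "norm x powr (real k - 1 + \<beta>) = norm x powr (real k + \<beta>) / norm x powr 1" by (simp only: powr_diff)
      then show ?thesis using x by simp
    qed
    also have "norm x * norm x powr s = norm x powr (real k - 1 + \<beta>)"
    proof -
      have "real k - 1 + \<beta> = 1 + s" by (simp add: s_def)
      then have "norm x powr (real k - 1 + \<beta>) = norm x powr 1 * norm x powr s" by (simp only: powr_add)
      then show ?thesis using x by simp
    qed
    also have "gradient_const TYPE('n) * (D * (2 powr \<bar>real k + \<beta>\<bar>) * 2 * norm x powr (real k - 1 + \<beta>) + C * 2 powr \<bar>s\<bar> / 2 * norm x powr (real k - 1 + \<beta>))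
      \<le> gradient_const TYPE('n) * (D * (2 powr \<bar>real k + \<beta>\<bar>) * 2 * norm x powr (real k - 1 + \<beta>) + C * 2 powr \<bar>s\<bar> * norm x powr (real k - 1 + \<beta>))"
      using gradient_const_ge[where 'n='n] C by (intro mult_left_mono add_left_mono mult_right_mono) auto
    also have "\<dots> = D' * norm x powr (real k - 1 + \<beta>)" by (simp add: D'_def algebra_simps)
    finally show ?thesis by simp
  qed
  note G = this
  have "\<bar>u x - (c + g \<bullet> x + x \<bullet> (B *v x))\<bar> \<le> (D + D') * norm x powr (real k + \<beta>) \<and>
        norm (G x - (g + (B + transpose B) *v x)) \<le> (D + D') * norm x powr (real k - 1 + \<beta>)"
    if x: "0 < norm x" "norm x < r / 8" for x
  proof
    show "\<bar>u x - (c + g \<bullet> x + x \<bullet> (B *v x))\<bar> \<le> (D + D') * norm x powr (real k + \<beta>)"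
      using x D' r by (intro order_trans[OF E(5)] mult_right_mono) auto
    show "norm (G x - (g + (B + transpose B) *v x)) \<le> (D + D') * norm x powr (real k - 1 + \<beta>)"
      using E(1) by (intro order_trans[OF G[OF x]] mult_right_mono) auto
  qed
  then show ?thesis using E(1-4) D' by (intro exI[of _ c] exI[of _ g] exI[of _ B] exI[of _ "D + D'"]) auto
qed

section \<open>Bounded solutions extend\<close>

lemma powr_lipschitz:
  fixes s t L a :: real
  assumes "0 \<le> s" "s \<le> L" "0 \<le> t" "t \<le> L" "1 \<le> a"
  shows "\<bar>s powr a - t powr a\<bar> \<le> a * L powr (a - 1) * \<bar>s - t\<bar>"
proof -
  have main: "\<bar>s powr a - t powr a\<bar> \<le> a * L powr (a - 1) * \<bar>s - t\<bar>"
    if "0 \<le> t" "t < s" "s \<le> L" for s t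
  proof -
    have "\<exists>x\<in>{t<..<s}. s powr a - t powr a = (\<lambda>y. (a * x powr (a - 1)) * y) (s - t)"
    proof (rule mvt[OF that(2)])
      show "continuous_on {t..s} (\<lambda>x. x powr a)"
        by (intro continuous_on_powr' continuous_intros) (use that assms in auto)
      show "((\<lambda>x. x powr a) has_derivative (\<lambda>y. a * x powr (a - 1) * y)) (at x)" if "t < x" "x < s" for x
        using has_real_derivative_powr[of x a] that \<open>0 \<le> t\<close> by (simp add: has_field_derivative_def)
    qed force
    then obtain x where x: "t < x" "x < s" "s powr a - t powr a = a * x powr (a - 1) * (s - t)" by auto
    have "x powr (a - 1) \<le> L powr (a - 1)" using x that assms by (intro powr_mono2) auto
    then have "a * x powr (a - 1) * (s - t) \<le> a * L powr (a - 1) * (s - t)" using that assms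
      by (intro mult_right_mono mult_left_mono) auto
    moreover have "0 \<le> a * x powr (a - 1) * (s - t)" using that assms by simp
    ultimately show ?thesis using x(3) that by simp
  qed
  consider "t < s" | "s < t" | "s = t" by linarith
  then show ?thesis
  proof cases
    case 1 then show ?thesis using main assms by blast
  next
    case 2 then show ?thesis using main[of s t] assms by (simp add: abs_minus_commute)
  qed simp
qed

lemma has_derivative_at_0I:
  fixes f :: "'a::real_normed_vector \<Rightarrow> 'b::real_normed_vector"
  assumes L: "bounded_linear L" and r: "r > 0" and \<alpha>: "\<alpha> > 0"
    and b: "\<And>y. 0 < norm y \<Longrightarrow> norm y < r \<Longrightarrow> norm (f y - f 0 - L y) \<le> C * norm y powr (1 + \<alpha>)"
  shows "(f has_derivative L) (at 0)"
  unfolding has_derivative_at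
proof (intro conjI L)
  have z: "((\<lambda>h::'a. C * norm h powr \<alpha>) \<longlongrightarrow> C * 0 powr \<alpha>) (at 0)"
  proof (intro tendsto_mult tendsto_const tendsto_powr')
    show "((\<lambda>h::'a. norm h) \<longlongrightarrow> 0) (at 0)" by (rule tendsto_norm_zero) (rule tendsto_ident_at)
  qed (use \<alpha> in auto)
  show "(\<lambda>h. norm (f (0 + h) - f 0 - L h) / norm h) \<midarrow>0\<rightarrow> 0"
  proof (rule Lim_null_comparison)
    show "((\<lambda>h::'a. C * norm h powr \<alpha>) \<longlongrightarrow> 0) (at 0)" using z by simp
    show "\<forall>\<^sub>F h in at 0. norm (norm (f (0 + h) - f 0 - L h) / norm h) \<le> C * norm h powr \<alpha>"
      unfolding eventually_at
    proof (intro exI[of _ r] conjI r ballI impI)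
      fix h :: 'a assume h: "h \<noteq> 0 \<and> dist h 0 < r"
      then have "norm (f h - f 0 - L h) \<le> C * (norm h * norm h powr \<alpha>)" using b[of h] by (simp add: powr_add)
      then show "norm (norm (f (0 + h) - f 0 - L h) / norm h) \<le> C * norm h powr \<alpha>"
        using h by (simp add: field_simps)
    qed
  qed
qed

text \<open>A bounded solution on a punctured ball. The radius is at most 1 so that powers of |x|
  decrease with the exponent, which is used whenever two orders are compared.\<close>

locale punctured_solution =
  fixes u :: "real^'n \<Rightarrow> real" and G :: "real^'n \<Rightarrow> real^'n" and H :: "real^'n \<Rightarrow> real^'n^'n"
    and p q M A R :: real
  assumes N3: "CARD('n) \<ge> 3" and R: "0 < R" "R \<le> 1"
    and u: "has_C2 (ball 0 R - {0}) u G H"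
    and ub: "\<And>x. x \<in> ball 0 R - {0} \<Longrightarrow> 0 \<le> u x \<and> u x \<le> A"
    and eq: "\<And>x. x \<in> ball 0 R - {0} \<Longrightarrow> trace (H x) = u x powr p - M * norm (G x) powr q"
    and p: "1 < p" and q: "1 < q" "q < 2" and M: "0 < M"
begin

lemma A0: "A \<ge> 0"
proof -
  have "(R/2) *\<^sub>R axis undefined 1 \<in> ball (0::real^'n) R - {0}" using R by (simp add: axis_eq_0_iff)
  from ub[OF this] show ?thesis by linarith
qed

lemma near:
  fixes x y :: "real^'n"
  assumes x: "0 < norm x" "norm x < r / 2" and y: "y \<in> cball x (norm x / 2)"
  shows "norm x / 2 \<le> norm y" "norm y \<le> 2 * norm x" "0 < norm y" "norm y < r"
  using x y norm_triangle_ineq3[of x y] norm_triangle_ineq[of "y - x" x] by (auto simp: dist_norm norm_minus_commute)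

lemma nearball:
  fixes x :: "real^'n"
  assumes x: "0 < norm x" "norm x < r / 2" "r \<le> R"
  shows "cball x (norm x / 2) \<subseteq> ball 0 R - {0}" "ball x (norm x / 2) \<subseteq> ball 0 R - {0}"
proof -
  have "y \<in> ball 0 R - {0}" if "y \<in> cball x (norm x / 2)" for y
    using near(3,4)[OF x(1,2) that] x(3) by auto
  then show "cball x (norm x / 2) \<subseteq> ball 0 R - {0}" "ball x (norm x / 2) \<subseteq> ball 0 R - {0}"
    using ball_subset_cball by blast+
qed

text \<open>At a maximum point of \<open>d z * norm (G z)\<close> apply the gradient bound on a ball of radius \<open>\<kappa> * d z\<close>, with
\<open>\<kappa>\<close> so small that the term \<open>norm (G z) powr q\<close> is absorbed; this needs \<open>q < 2\<close>.\<close>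
lemma grad_scale: "\<exists>C\<ge>0. \<forall>x. 0 < norm x \<and> norm x < R / 2 \<longrightarrow> norm (G x) \<le> C * norm x powr (-1)"
proof -
  define K where "K = gradient_const TYPE('n)"
  have K: "K \<ge> 2" unfolding K_def by (rule gradient_const_ge)
  \<comment> \<open>With radius factor \<kappa> = S^{1-q}/c1 the gradient term K M 2^q \<kappa> S^q
    is at most S/2. The other terms are at most c S^{q-1}, and S/2 \<le> c S^{q-1} fails beyond S0
    because q - 1 < 1.\<close>
  define c1 where "c1 = 2 * (1 + K * M * 2 powr q)"
  define c where "c = K * A * c1 + K * A powr p"
  define S0 where "S0 = max 1 ((2 * c) powr (1 / (2 - q)))"
  have c1: "c1 \<ge> 2" using K M by (simp add: c1_def)
  have "norm (G x) \<le> (2 * S0) * norm x powr (-1)" if x: "0 < norm x" "norm x < R / 2" for x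
  proof -
    define \<rho>0 where "\<rho>0 = norm x / 2"
    have \<rho>0: "0 < \<rho>0" "\<rho>0 \<le> 1" using x R by (auto simp: \<rho>0_def)
    \<comment> \<open>The distance to the boundary sphere. The weight vanishes there, so a positive
      maximum lies inside.\<close>
    define d where "d z = \<rho>0 - norm (z - x)" for z
    note nb = nearball[OF x order_refl, folded \<rho>0_def]
    have cG: "continuous_on (cball x \<rho>0) (\<lambda>z. d z * norm (G z))"
      unfolding d_def by (intro continuous_intros continuous_on_subset[OF has_C2D(6)[OF u] nb(1)])
    have "cball x \<rho>0 \<noteq> {}" using \<rho>0 by simp
    then obtain z where z: "z \<in> cball x \<rho>0" "\<And>y. y \<in> cball x \<rho>0 \<Longrightarrow> d y * norm (G y) \<le> d z * norm (G z)"
      using continuous_attains_sup[OF compact_cball _ cG] by blast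
    define S where "S = d z * norm (G z)"
    have S: "d y * norm (G y) \<le> S" if "y \<in> cball x \<rho>0" for y using z(2)[OF that] by (simp add: S_def)
    have "S \<le> S0"
    proof (rule ccontr)
      assume "\<not> S \<le> S0"
      then have S1: "S > 1" "S > (2 * c) powr (1 / (2 - q))" by (auto simp: S0_def)
      have "d z \<ge> 0" using z(1) by (simp add: d_def dist_norm norm_minus_commute)
      moreover have "d z \<noteq> 0" using S1(1) unfolding S_def by auto
      moreover have "d z \<le> \<rho>0" by (simp add: d_def)
      ultimately have dz: "0 < d z" "d z \<le> 1" using \<rho>0 by auto
      define \<kappa> where "\<kappa> = S powr (1 - q) / c1"
      have Sq: "S powr (1 - q) \<le> 1" using S1 q powr_mono[of "1 - q" 0 S] by simp
      have \<kappa>: "0 < \<kappa>" "\<kappa> \<le> 1/2" using c1 S1 Sq by (auto simp: \<kappa>_def field_simps)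
      define b where "b = A powr p + M * (2 * S / d z) powr q"
      \<comment> \<open>On this ball \<open>d\<close> drops by at most half, so maximality at
        \<open>z\<close> gives the bound 2S/d(z) for the gradient on the whole ball.\<close>
      have in1: "y \<in> cball x \<rho>0 \<and> d z / 2 \<le> d y" if "y \<in> ball z (\<kappa> * d z)" for y
      proof -
        have "\<kappa> * d z \<le> (1/2) * d z" using \<kappa> dz by (intro mult_right_mono) auto
        then have "norm (y - z) < d z / 2" using that by (simp add: dist_norm norm_minus_commute)
        then have "d z / 2 \<le> d y" using norm_triangle_ineq[of "y - z" "z - x"] by (simp add: d_def)
        then show ?thesis using dz by (simp add: d_def dist_norm norm_minus_commute)
      qed
      have "norm (G z) \<le> K * (A / (\<kappa> * d z) + \<kappa> * d z * b)"
        unfolding K_def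
      proof (rule gradient_bound[OF has_C2_subset[OF u]])
        show sub: "ball z (\<kappa> * d z) \<subseteq> ball 0 R - {0}" using in1 nb(1) by blast
        show "\<bar>u y\<bar> \<le> A" if "y \<in> ball z (\<kappa> * d z)" for y
          using ub[OF subsetD[OF sub that]] by simp
        show "\<bar>trace (H y)\<bar> \<le> b" if y: "y \<in> ball z (\<kappa> * d z)" for y
        proof -
          have yR: "y \<in> ball 0 R - {0}" using sub y by blast
          have "(d z / 2) * norm (G y) \<le> d y * norm (G y)" using in1[OF y] by (intro mult_right_mono) auto
          also have "\<dots> \<le> S" using S in1[OF y] by blast
          finally have "norm (G y) \<le> 2 * S / d z" using dz by (simp add: field_simps)
          then have "norm (G y) powr q \<le> (2 * S / d z) powr q" using q by (intro powr_mono2) auto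
          then have "M * norm (G y) powr q \<le> M * (2 * S / d z) powr q" using M by simp
          moreover have "u y powr p \<le> A powr p" using ub[OF yR] p by (intro powr_mono2) auto
          moreover have "0 \<le> M * norm (G y) powr q" "0 \<le> u y powr p" using M by auto
          ultimately show ?thesis unfolding eq[OF yR] b_def by linarith
        qed
      qed (use \<kappa> dz in auto)
      then have "S \<le> d z * (K * (A / (\<kappa> * d z) + \<kappa> * d z * b))" unfolding S_def using dz by (intro mult_left_mono) auto
      also have "\<dots> = K * (A / \<kappa> + \<kappa> * ((d z)\<^sup>2 * b))" using dz \<kappa> by (simp add: field_simps power2_eq_square)
      also have "\<dots> \<le> K * (A / \<kappa> + \<kappa> * (A powr p + M * 2 powr q * S powr q))"
      proof -
        have d1: "(d z)\<^sup>2 \<le> 1" using dz by (intro power_le_one) auto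
        have "(d z)\<^sup>2 * (2 * S / d z) powr q = 2 powr q * S powr q * ((d z)\<^sup>2 * d z powr (-q))"
          using dz S1 by (simp add: powr_divide powr_mult powr_minus field_simps)
        \<comment> \<open>The factor d(z)^{2-q} is at most 1 since q < 2 and d(z) \<le> 1.\<close>
        also have "(d z)\<^sup>2 * d z powr (-q) = d z powr (2 - q)"
          using dz by (simp add: powr_diff powr_minus field_simps)
        also have "2 powr q * S powr q * d z powr (2 - q) \<le> 2 powr q * S powr q * 1"
          using dz q by (intro mult_left_mono powr_le1) auto
        finally have "M * ((d z)\<^sup>2 * (2 * S / d z) powr q) \<le> M * (2 powr q * S powr q)" using M by simp
        moreover have "(d z)\<^sup>2 * A powr p \<le> 1 * A powr p" using d1 by (intro mult_right_mono) auto
        ultimately have "(d z)\<^sup>2 * b \<le> A powr p + M * 2 powr q * S powr q" by (simp add: b_def algebra_simps)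
        then show ?thesis using K \<kappa> by (intro mult_left_mono add_left_mono) auto
      qed
      also have "\<dots> = K * A / \<kappa> + K * \<kappa> * A powr p + (K * M * 2 powr q) * (\<kappa> * S powr q)" by (simp add: algebra_simps)
      also have "\<kappa> * S powr q = S / c1"
      proof -
        have "S powr (1 - q) * S powr q = S powr 1" by (simp only: powr_add[symmetric]) simp
        then show ?thesis using S1 by (simp add: \<kappa>_def)
      qed
      also have "(K * M * 2 powr q) * (S / c1) \<le> S / 2"
      proof -
        have "K * M * 2 powr q \<le> c1 / 2" by (simp add: c1_def)
        then have "(K * M * 2 powr q) * (S / c1) \<le> (c1 / 2) * (S / c1)" using S1 c1 by (intro mult_right_mono) auto
        then show ?thesis using c1 by simp
      qed
      also have "K * A / \<kappa> = K * A * c1 * S powr (q - 1)"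
        using S1 c1 powr_minus_divide[of S "q - 1"] by (simp add: \<kappa>_def)
      also have "K * \<kappa> * A powr p \<le> K * A powr p * S powr (q - 1)"
      proof -
        have "1 \<le> S powr (q - 1)" using S1 q by (simp add: ge_one_powr_ge_zero)
        then have "\<kappa> \<le> S powr (q - 1)" using \<kappa> by linarith
        then have "(K * A powr p) * \<kappa> \<le> (K * A powr p) * S powr (q - 1)" using K by (intro mult_left_mono) auto
        then show ?thesis by (simp add: mult_ac)
      qed
      finally have "S / 2 \<le> c * S powr (q - 1)" by (simp add: c_def algebra_simps)
      then have "S powr 1 \<le> 2 * c * S powr (q - 1)" using S1 by simp
      then have "S powr (q - 1) * S powr (2 - q) \<le> S powr (q - 1) * (2 * c)"
        by (simp only: powr_add[symmetric]) (simp add: mult_ac)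
      then have "S powr (2 - q) \<le> 2 * c" using S1 by simp
      then have "(S powr (2 - q)) powr (1 / (2 - q)) \<le> (2 * c) powr (1 / (2 - q))"
        using q by (intro powr_mono2) auto
      then have "S \<le> (2 * c) powr (1 / (2 - q))" using q S1 by (simp add: powr_powr)
      then show False using S1 by simp
    qed
    moreover have "d x * norm (G x) \<le> S" using S[of x] \<rho>0 by simp
    ultimately have "norm x / 2 * norm (G x) \<le> S0" by (simp add: d_def \<rho>0_def)
    then show ?thesis using x by (simp add: powr_minus field_simps)
  qed
  moreover have "2 * S0 \<ge> 0" by (simp add: S0_def)
  ultimately show ?thesis by blast
qed

section \<open>Iterative improvement of the order of the gradient at the puncture\<close>

definition "gradient_order \<theta> \<longleftrightarrow> (\<exists>C\<ge>0. \<exists>r>0. r \<le> R \<and> (\<forall>x. 0 < norm x \<and> norm x < r \<longrightarrow> norm (G x) \<le> C * norm x powr (-\<theta>)))"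

lemma gradient_order_weaken: "gradient_order \<theta> \<Longrightarrow> \<theta> \<le> \<theta>' \<Longrightarrow> gradient_order \<theta>'"
  unfolding gradient_order_def
proof (elim exE conjE, goal_cases)
  case (1 C r)
  have "norm (G x) \<le> C * norm x powr (-\<theta>')" if "0 < norm x" "norm x < r" for x
  proof -
    have "norm x powr (-\<theta>) \<le> norm x powr (-\<theta>')" using that 1 R by (intro powr_mono') auto
    then show ?thesis using 1 that by (meson mult_left_mono order_trans)
  qed
  then show ?case using 1 by blast
qed

lemma trace_bound:
  assumes "C \<ge> 0" "0 < norm x" "norm x < R" "norm (G x) \<le> C * norm x powr (-\<theta>)" "\<theta> \<ge> 0"
  shows "\<bar>trace (H x)\<bar> \<le> (A powr p + M * C powr q) * norm x powr (- (q * \<theta>))"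
proof -
  have xR: "x \<in> ball 0 R - {0}" using assms by auto
  have "norm (G x) powr q \<le> (C * norm x powr (-\<theta>)) powr q" using assms q by (intro powr_mono2) auto
  also have "\<dots> = C powr q * norm x powr (- (q * \<theta>))" using assms by (simp add: powr_mult powr_powr mult.commute)
  finally have 1: "M * norm (G x) powr q \<le> M * C powr q * norm x powr (- (q * \<theta>))" using M by simp
  have "1 \<le> norm x powr (- (q * \<theta>))" using assms R q powr_mono'[of "- (q * \<theta>)" 0 "norm x"] by simp
  then have "A powr p * 1 \<le> A powr p * norm x powr (- (q * \<theta>))" by (intro mult_left_mono) auto
  moreover have "u x powr p \<le> A powr p" using ub[OF xR] p by (intro powr_mono2) auto
  moreover have "0 \<le> M * norm (G x) powr q" "0 \<le> u x powr p" using M by auto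
  ultimately show ?thesis using 1 unfolding eq[OF xR] distrib_right by linarith
qed

text \<open>A gradient of order |x|^{-\<theta>} makes the right-hand side of order |x|^{-q\<theta>},
  and solving gains two orders. The exponent 2 - q\<theta> is split as k + \<beta> into degree of
  the polynomial and fractional part.\<close>

lemma expand:
  assumes g: "gradient_order \<theta>" and \<theta>: "\<theta> \<ge> 0" and k: "k \<le> 2" and \<beta>: "\<beta> = 2 - q * \<theta> - real k" "0 < \<beta>" "\<beta> < 1"
  shows "\<exists>c g B. \<exists>D\<ge>0. \<exists>r>0. r \<le> R \<and> (k < 1 \<longrightarrow> g = 0) \<and> (k < 2 \<longrightarrow> B = 0) \<and> trace (B::real^'n^'n) = 0 \<and>
    (\<forall>x. 0 < norm x \<and> norm x < r \<longrightarrow> \<bar>u x - (c + g \<bullet> x + x \<bullet> (B *v x))\<bar> \<le> D * norm x powr (real k + \<beta>) \<and>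
        norm (G x - (g + (B + transpose B) *v x)) \<le> D * norm x powr (real k - 1 + \<beta>))"
proof -
  obtain C r where C: "C \<ge> 0" "r > 0" "r \<le> R" "\<And>x. 0 < norm x \<Longrightarrow> norm x < r \<Longrightarrow> norm (G x) \<le> C * norm x powr (-\<theta>)"
    using g unfolding gradient_order_def by blast
  have u': "has_C2 (ball 0 r - {0}) u G H" by (rule has_C2_subset[OF u]) (use C in auto)
  have uA: "\<bar>u x\<bar> \<le> A" if "x \<in> ball 0 r - {0}" for x using ub[of x] that C by auto
  have tH: "\<bar>trace (H x)\<bar> \<le> (A powr p + M * C powr q) * norm x powr (real k - 2 + \<beta>)" if "x \<in> ball 0 r - {0}" for x
    using trace_bound[OF C(1), of x \<theta>] C that \<theta> \<beta>(1) by auto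
  have c: "A powr p + M * C powr q \<ge> 0" using M by simp
  obtain c g B D where "D \<ge> 0" "k < 1 \<longrightarrow> g = 0" "k < 2 \<longrightarrow> B = 0" "trace (B::real^'n^'n) = 0"
    "\<forall>x. 0 < norm x \<and> norm x < r / 8 \<longrightarrow> \<bar>u x - (c + g \<bullet> x + x \<bullet> (B *v x))\<bar> \<le> D * norm x powr (real k + \<beta>) \<and>
        norm (G x - (g + (B + transpose B) *v x)) \<le> D * norm x powr (real k - 1 + \<beta>)"
    using gradient_expansion[OF N3 C(2) u' uA k \<beta>(2,3) c tH] by blast
  then show ?thesis using C
    by (intro exI[of _ c] exI[of _ g] exI[of _ B] exI[of _ D] conjI exI[of _ "r/8"]) auto
qed

text \<open>Here k = 0, so the polynomial is constant and its gradient drops out: the remainder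
  estimate is a bound for the gradient itself.\<close>

lemma gradient_order_improve:
  assumes "gradient_order \<theta>" "1 < q * \<theta>" "q * \<theta> < 2"
  shows "gradient_order (q * \<theta> - 1)"
proof -
  have \<theta>: "\<theta> \<ge> 0" using assms(2) q by (smt (verit) mult_nonneg_nonpos)
  have k: "(0::nat) \<le> 2" and \<beta>: "2 - q * \<theta> = 2 - q * \<theta> - real 0" "0 < 2 - q * \<theta>" "2 - q * \<theta> < 1"
    using assms by auto
  from expand[OF assms(1) \<theta> k \<beta>] show ?thesis
  proof (elim exE conjE, goal_cases)
    case (1 c g B D r)
    have t: "transpose (0::real^'n^'n) = 0" by (simp add: transpose_def vec_eq_iff)
    have e: "real 0 - 1 + (2 - q * \<theta>) = - (q * \<theta> - 1)" and gB: "g = 0" "B = 0" using 1(4,5) by auto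
    have "norm (G x) \<le> D * norm x powr (- (q * \<theta> - 1))" if "0 < norm x" "norm x < r" for x
      using 1(7)[rule_format, OF conjI[OF that]] unfolding e gB t by simp
    then show ?case using 1(1,2,3) unfolding gradient_order_def by blast
  qed
qed

text \<open>The map \<theta> -> q\<theta> - 1 lowers \<theta> by (2 - q) + (q - 1)(1 - \<theta>),
  hence by at least 2 - q while \<theta> \<le> 1. So \<open>n\<close> steps bring q\<theta> below 1.
  The numerical hypothesis for n = 0 is exactly \<theta> < 1/q.\<close>

lemma gradient_order_iterate:
  "gradient_order \<theta> \<Longrightarrow> 0 < \<theta> \<Longrightarrow> \<theta> \<le> 1 \<Longrightarrow> 1 - \<theta> + real n * (2 - q) > 1 - 1 / q \<Longrightarrow> \<exists>\<theta>>0. q * \<theta> < 1 \<and> gradient_order \<theta>"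
proof (induction n arbitrary: \<theta>)
  case 0
  then have "q * \<theta> < 1" using q by (simp add: field_simps)
  then show ?case using 0 by blast
next
  case (Suc n)
  show ?case
  proof (cases "q * \<theta> < 1")
    case True then show ?thesis using Suc by blast
  next
    case False
    have "q * \<theta> \<le> q * 1" using Suc.prems q by (intro mult_left_mono) auto
    then have q2: "q * \<theta> < 2" using q by linarith
    show ?thesis
    proof (cases "q * \<theta> = 1")
      case True
      \<comment> \<open>At resonance q\<theta> = 1 the gain would be \<beta> = 1, which the
        expansion excludes, so \<theta> is first worsened by e and one step then leads to qe. The
        bound 1/2 yields qe < 1, and 1/(2q^2) yields q(qe) < 1.\<close>
      define e where "e = min (1/2) (1 / (2 * q\<^sup>2))"
      have e: "0 < e" "q * e < 1" "q * (q * e) < 1"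
      proof -
        show "0 < e" using q by (simp add: e_def)
        have "e \<le> 1 / (2 * q\<^sup>2)" by (simp add: e_def)
        then have "q\<^sup>2 * e \<le> q\<^sup>2 * (1 / (2 * q\<^sup>2))" by (intro mult_left_mono) auto
        then show "q * (q * e) < 1" using q by (simp add: power2_eq_square mult.assoc)
        have "q * e \<le> q * (1/2)" using q by (intro mult_left_mono) (auto simp: e_def)
        then show "q * e < 1" using q by linarith
      qed
      have "gradient_order (\<theta> + e)" using gradient_order_weaken[OF Suc.prems(1)] e by simp
      moreover have "q * (\<theta> + e) = 1 + q * e" using True by (simp add: distrib_left)
      ultimately have "gradient_order (q * e)" using gradient_order_improve[of "\<theta> + e"] e q by simp
      then show ?thesis using e q by (intro exI[of _ "q * e"]) auto
    next
      case ne: False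
      then have q1: "1 < q * \<theta>" using False by simp
      have "gradient_order (q * \<theta> - 1)" by (rule gradient_order_improve[OF Suc.prems(1) q1 q2])
      moreover have "1 - (q * \<theta> - 1) + real n * (2 - q) > 1 - 1 / q"
      proof -
        have "0 \<le> (q - 1) * (1 - \<theta>)" using q Suc.prems by simp
        then have "1 - (q * \<theta> - 1) \<ge> (1 - \<theta>) + (2 - q)" by (simp add: algebra_simps)
        then show ?thesis using Suc.prems(4) by (simp add: algebra_simps)
      qed
      ultimately show ?thesis using Suc.IH[of "q * \<theta> - 1"] q1 q2 by simp
    qed
  qed
qed

text \<open>Once q\<theta> < 1 the gain 2 - q\<theta> exceeds 1, and the expansion with k = 1 is
  available.\<close>

lemma first_order:
  "\<exists>c g \<beta>. \<exists>D\<ge>0. \<exists>r>0. r \<le> R \<and> 0 < \<beta> \<and> \<beta> < 1 \<and>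
    (\<forall>x. 0 < norm x \<and> norm x < r \<longrightarrow> \<bar>u x - (c + g \<bullet> x)\<bar> \<le> D * norm x powr (1 + \<beta>) \<and> norm (G x - g) \<le> D * norm x powr \<beta>)"
proof -
  have "gradient_order 1" using grad_scale R unfolding gradient_order_def
    by (metis (no_types, opaque_lifting) field_sum_of_halves half_gt_zero less_add_same_cancel1 less_eq_real_def)
  moreover obtain n where "real n * (2 - q) > 1 - 1 / q" using ex_less_of_nat_mult[of "2 - q" "1 - 1 / q"] q by auto
  ultimately obtain \<theta> where \<theta>: "\<theta> > 0" "q * \<theta> < 1" "gradient_order \<theta>" using gradient_order_iterate[of 1 n] by auto
  have q\<theta>: "0 < q * \<theta>" using \<theta> q by simp
  have k: "(1::nat) \<le> 2" and \<beta>: "1 - q * \<theta> = 2 - q * \<theta> - real 1" "0 < 1 - q * \<theta>" "1 - q * \<theta> < 1"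
    using \<theta> q\<theta> by auto
  from expand[OF \<theta>(3) less_imp_le[OF \<theta>(1)] k \<beta>] show ?thesis
  proof (elim exE conjE, goal_cases)
    case (1 c g B D r)
    have B: "B = 0" using 1(5) by simp
    have t: "transpose (0::real^'n^'n) = 0" by (simp add: transpose_def vec_eq_iff)
    have F: "\<bar>u x - (c + g \<bullet> x)\<bar> \<le> D * norm x powr (1 + (1 - q * \<theta>)) \<and> norm (G x - g) \<le> D * norm x powr (1 - q * \<theta>)"
      if "0 < norm x" "norm x < r" for x
      using 1(7)[rule_format, OF conjI[OF that]] unfolding B t by simp
    show ?case
      by (rule exI[of _ c], rule exI[of _ g], rule exI[of _ "1 - q * \<theta>"], rule exI[of _ D], rule conjI[OF 1(1)], rule exI[of _ r])
         (use 1(2,3) \<beta>(2,3) F in blast)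
  qed
qed

text \<open>The equation turns Lipschitz bounds for \<open>u\<close> and \<open>G\<close> into one
  for the Laplacian. The bound \<open>h\<close> on the Hessian enters through the gradient term, so
  the Hessian estimates that rely on this must absorb it.\<close>

lemma trace_lipschitz:
  assumes T: "convex T" "T \<subseteq> ball 0 R - {0}" and L: "\<And>y. y \<in> T \<Longrightarrow> norm (G y) \<le> L"
    and h: "\<And>y. y \<in> T \<Longrightarrow> norm (H y) \<le> h" and yz: "y \<in> T" "z \<in> T"
  shows "\<bar>trace (H y) - trace (H z)\<bar> \<le> (p * A powr (p - 1) * L + M * q * L powr (q - 1) * h) * norm (y - z)"
proof -
  have R2: "y \<in> ball 0 R - {0}" "z \<in> ball 0 R - {0}" using T yz by auto
  have "\<bar>u y powr p - u z powr p\<bar> \<le> p * A powr (p - 1) * \<bar>u y - u z\<bar>"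
    using ub R2 p by (intro powr_lipschitz) auto
  also have "\<dots> \<le> p * A powr (p - 1) * (L * norm (y - z))"
    using p by (intro mult_left_mono has_C2_lipschitz(1)[OF u T yz L]) auto
  finally have 1: "\<bar>u y powr p - u z powr p\<bar> \<le> (p * A powr (p - 1) * L) * norm (y - z)" by (simp only: mult.assoc)
  have "\<bar>norm (G y) powr q - norm (G z) powr q\<bar> \<le> q * L powr (q - 1) * \<bar>norm (G y) - norm (G z)\<bar>"
    using L yz q by (intro powr_lipschitz) auto
  also have "\<dots> \<le> q * L powr (q - 1) * (h * norm (y - z))"
    using q by (intro mult_left_mono order_trans[OF norm_triangle_ineq3] has_C2_lipschitz(2)[OF u T yz h]) auto
  finally have "M * \<bar>norm (G y) powr q - norm (G z) powr q\<bar> \<le> M * (q * L powr (q - 1) * (h * norm (y - z)))"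
    using M by (intro mult_left_mono) auto
  then have 2: "\<bar>M * (norm (G y) powr q - norm (G z) powr q)\<bar> \<le> (M * q * L powr (q - 1) * h) * norm (y - z)"
    using M by (simp add: abs_mult mult.assoc)
  have "trace (H y) - trace (H z) = (u y powr p - u z powr p) - M * (norm (G y) powr q - norm (G z) powr q)"
    unfolding eq[OF R2(1)] eq[OF R2(2)] by (simp add: right_diff_distrib)
  then show ?thesis using 1 2 unfolding distrib_right by linarith
qed

text \<open>The weighted maximum argument again, now for second derivatives. With the gradient
  already bounded, the right-hand side is linear in the Hessian bound, so a fixed fraction \<kappa>
  of the distance serves as radius.\<close>

lemma hess_scale:
  assumes r: "0 < r" "r \<le> R" and L: "\<And>x. 0 < norm x \<Longrightarrow> norm x < r \<Longrightarrow> norm (G x) \<le> L" "L \<ge> 0"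
  shows "\<exists>C\<ge>0. \<forall>x. 0 < norm x \<and> norm x < r / 2 \<longrightarrow> norm (H x) \<le> C / norm x"
proof -
  define K where "K = hessian_const TYPE('n)"
  have K: "K \<ge> 4" unfolding K_def by (rule hessian_const_ge)
  define a1 where "a1 = p * A powr (p - 1) * L"
  define a2 where "a2 = M * q * L powr (q - 1)"
  have a: "a1 \<ge> 0" "a2 \<ge> 0" using p q M L(2) by (auto simp: a1_def a2_def)
  \<comment> \<open>Chosen so that the term that reproduces T has coefficient 2 K \<kappa> a2 \<le>
    1/2, while \<kappa> \<le> 1/2 keeps the ball well inside.\<close>
  define \<kappa> where "\<kappa> = 1 / (2 + 4 * K * a2)"
  have \<kappa>: "0 < \<kappa>" "\<kappa> \<le> 1/2" using K a by (auto simp: \<kappa>_def field_simps add_pos_nonneg)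
  define T0 where "T0 = 2 * K * (L / \<kappa> + a1)"
  have T0: "T0 \<ge> 0" using K L \<kappa> a by (simp add: T0_def)
  have "norm (H x) \<le> 2 * T0 / norm x" if x: "0 < norm x" "norm x < r / 2" for x
  proof -
    define \<rho>0 where "\<rho>0 = norm x / 2"
    have \<rho>0: "0 < \<rho>0" "\<rho>0 \<le> 1" using x r R by (auto simp: \<rho>0_def)
    define d where "d z = \<rho>0 - norm (z - x)" for z
    note nb = nearball[OF x r(2), folded \<rho>0_def]
    have cG: "continuous_on (cball x \<rho>0) (\<lambda>z. d z * norm (H z))"
      unfolding d_def by (intro continuous_intros continuous_on_subset[OF has_C2D(4)[OF u] nb(1)])
    have "cball x \<rho>0 \<noteq> {}" using \<rho>0 by simp
    then obtain z where z: "z \<in> cball x \<rho>0" "\<And>y. y \<in> cball x \<rho>0 \<Longrightarrow> d y * norm (H y) \<le> d z * norm (H z)"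
      using continuous_attains_sup[OF compact_cball _ cG] by blast
    define T where "T = d z * norm (H z)"
    have T: "d y * norm (H y) \<le> T" if "y \<in> cball x \<rho>0" for y using z(2)[OF that] by (simp add: T_def)
    have dz0: "d z \<ge> 0" using z(1) by (simp add: d_def dist_norm norm_minus_commute)
    have "T \<le> T0"
    proof (cases "d z = 0")
      case True then show ?thesis using T0 by (simp add: T_def)
    next
      case False
      moreover have "d z \<le> \<rho>0" by (simp add: d_def)
      ultimately have dz: "0 < d z" "d z \<le> 1" using dz0 \<rho>0 by auto
      have Tn: "T \<ge> 0" unfolding T_def using dz by simp
      have in1: "y \<in> cball x \<rho>0 \<and> d z / 2 \<le> d y" if "y \<in> ball z (\<kappa> * d z)" for y
      proof -
        have "\<kappa> * d z \<le> (1/2) * d z" using \<kappa> dz by (intro mult_right_mono) auto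
        then have "norm (y - z) < d z / 2" using that by (simp add: dist_norm norm_minus_commute)
        then have "d z / 2 \<le> d y" using norm_triangle_ineq[of "y - z" "z - x"] by (simp add: d_def)
        then show ?thesis using dz by (simp add: d_def dist_norm norm_minus_commute)
      qed
      have sub: "ball z (\<kappa> * d z) \<subseteq> ball 0 R - {0}" using in1 nb(1) by blast
      have GL: "norm (G y) \<le> L" if "y \<in> ball z (\<kappa> * d z)" for y
        using near(3,4)[OF x, folded \<rho>0_def] in1[OF that] L(1) by blast
      have Hh: "norm (H y) \<le> 2 * T / d z" if y: "y \<in> ball z (\<kappa> * d z)" for y
      proof -
        have "(d z / 2) * norm (H y) \<le> d y * norm (H y)" using in1[OF y] by (intro mult_right_mono) auto
        also have "\<dots> \<le> T" using T in1[OF y] by blast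
        finally show ?thesis using dz by (simp add: field_simps)
      qed
      have "norm (H z) \<le> K * (L / (\<kappa> * d z) + \<kappa> * d z * (a1 + a2 * (2 * T / d z)))"
        unfolding K_def
      proof (rule hessian_bound[OF has_C2_subset[OF u _ sub] _ GL])
        show "\<bar>trace (H y) - trace (H y')\<bar> \<le> (a1 + a2 * (2 * T / d z)) * norm (y - y')"
          if "y \<in> ball z (\<kappa> * d z)" "y' \<in> ball z (\<kappa> * d z)" for y y'
          unfolding a1_def a2_def by (rule trace_lipschitz[OF convex_ball sub GL Hh that])
      qed (use \<kappa> dz in auto)
      then have "T \<le> d z * (K * (L / (\<kappa> * d z) + \<kappa> * d z * (a1 + a2 * (2 * T / d z))))" unfolding T_def using dz by (intro mult_left_mono) auto
      also have "\<dots> = K * (L / \<kappa>) + K * (\<kappa> * (d z)\<^sup>2 * a1) + K * \<kappa> * a2 * 2 * T * d z"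
        using dz \<kappa> by (simp add: field_simps power2_eq_square)
      also have "\<dots> \<le> K * (L / \<kappa>) + K * (1 * 1 * a1) + K * \<kappa> * a2 * 2 * T * 1"
        using K \<kappa> dz a Tn by (intro add_mono mult_left_mono mult_right_mono mult_mono power_le_one) auto
      also have "K * \<kappa> * a2 * 2 * T * 1 \<le> T / 2"
      proof -
        have "K * \<kappa> * a2 * 2 \<le> 1/2" using K a by (simp add: \<kappa>_def field_simps add_pos_nonneg)
        then have "(K * \<kappa> * a2 * 2) * T \<le> 1/2 * T" using Tn by (rule mult_right_mono)
        then show ?thesis by simp
      qed
      finally show ?thesis by (simp add: T0_def distrib_left)
    qed
    moreover have "d x * norm (H x) \<le> T" using T[of x] \<rho>0 by simp
    ultimately have "norm x / 2 * norm (H x) \<le> T0" by (simp add: d_def \<rho>0_def)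
    then show ?thesis using x by (simp add: field_simps)
  qed
  moreover have "2 * T0 \<ge> 0" using T0 by simp
  ultimately show ?thesis by blast
qed

text \<open>The right-hand side tends to a constant f0 at a rate |x|^\<beta>; once a quadratic with
  Laplacian f0 is removed, the expansion with k = 2 applies. The Hessian is compared with
  \<open>Q\<close> on balls much smaller than |x|. The exponents are written as 1 + 1 and 1 +
  \<beta> to match the criterion for a derivative at the origin.\<close>

lemma second_order:
  "\<exists>c g Q E \<beta> r. E \<ge> 0 \<and> r > 0 \<and> r \<le> R \<and> \<beta> > 0 \<and>
    (\<forall>x. 0 < norm x \<and> norm x < r \<longrightarrow> \<bar>u x - c - g \<bullet> x\<bar> \<le> E * norm x powr (1 + 1) \<and>
       norm (G x - g - Q *v x) \<le> E * norm x powr (1 + \<beta>) \<and> norm (H x - Q) \<le> E * norm x powr \<beta>)"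
  using first_order
proof (elim exE conjE, goal_cases)
  case (1 c0 g0 \<beta> D0 r0)
  note r0 = 1(2,3) and \<beta> = 1(4,5) and D0 = 1(1)
  have F: "\<bar>u x - (c0 + g0 \<bullet> x)\<bar> \<le> D0 * norm x powr (1 + \<beta>)" "norm (G x - g0) \<le> D0 * norm x powr \<beta>"
    if "0 < norm x" "norm x < r0" for x using 1(6) that by auto
  define N where "N = real CARD('n)"
  have N: "N \<ge> 3" using N3 by (simp add: N_def)
  have x1: "norm x powr a \<le> 1" "norm x powr a \<le> norm x powr b" if "0 < norm x" "norm x < r0" "0 \<le> b" "b \<le> a" for a b and x :: "real^'n"
    using that r0 R powr_mono'[of b a "norm x"] powr_mono'[of 0 a "norm x"] by auto
  define L where "L = norm g0 + D0"
  have L0: "L \<ge> 0" using D0 by (simp add: L_def)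
  have L: "norm (G x) \<le> L" if x: "0 < norm x" "norm x < r0" for x
  proof -
    have "norm (G x) \<le> norm g0 + norm (G x - g0)" using norm_triangle_ineq[of g0 "G x - g0"] by simp
    also have "norm (G x - g0) \<le> D0 * 1" using F(2)[OF x] x1(1)[OF x, of 0 \<beta>] D0 \<beta> by (meson less_imp_le mult_left_mono order_trans order_refl)
    finally show ?thesis by (simp add: L_def)
  qed
  obtain C1 where C1: "C1 \<ge> 0" "\<And>x. 0 < norm x \<Longrightarrow> norm x < r0 / 2 \<Longrightarrow> norm (H x) \<le> C1 / norm x"
    using hess_scale[OF r0 L L0] by auto
  have uc: "\<bar>u x - c0\<bar> \<le> L * norm x powr \<beta>" if x: "0 < norm x" "norm x < r0" for x
  proof -
    have "\<bar>u x - c0\<bar> \<le> \<bar>u x - (c0 + g0 \<bullet> x)\<bar> + \<bar>g0 \<bullet> x\<bar>" by linarith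
    also have "\<dots> \<le> D0 * norm x powr (1 + \<beta>) + norm g0 * norm x powr 1"
      using F(1)[OF x] Cauchy_Schwarz_ineq2[of g0 x] x by simp
    also have "\<dots> \<le> D0 * norm x powr \<beta> + norm g0 * norm x powr \<beta>"
      using x1(2)[OF x, of \<beta> "1 + \<beta>"] x1(2)[OF x, of \<beta> 1] D0 \<beta> by (intro add_mono mult_left_mono) auto
    finally show ?thesis by (simp add: L_def algebra_simps)
  qed
  \<comment> \<open>As a limit of nonnegative values. The Lipschitz estimate for the power is valid
    between nonnegative numbers only.\<close>
  have c0: "c0 \<ge> 0"
  proof (rule ccontr)
    assume "\<not> 0 \<le> c0"
    then have neg: "- c0 > 0" by simp
    define t where "t = min (r0 / 2) (((- c0) / (2 * (L + 1))) powr (1 / \<beta>))"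
    have t: "0 < t" "t < r0" using r0 neg L0 by (auto simp: t_def)
    define x :: "real^'n" where "x = t *\<^sub>R axis undefined 1"
    have nx: "norm x = t" using t by (simp add: x_def)
    have "t powr \<beta> \<le> (((- c0) / (2 * (L + 1))) powr (1 / \<beta>)) powr \<beta>" using t \<beta> by (intro powr_mono2) (auto simp: t_def)
    also have "\<dots> = (- c0) / (2 * (L + 1))" using \<beta> neg L0 by (simp add: powr_powr)
    finally have "L * t powr \<beta> \<le> L * ((- c0) / (2 * (L + 1)))" using L0 by (intro mult_left_mono)
    also have "\<dots> \<le> (- c0) / 2" using L0 neg by (simp add: field_simps)
    finally have "u x - c0 \<le> (- c0) / 2" using uc[of x] nx t by auto
    moreover have "x \<in> ball 0 R - {0}" using nx t r0 by auto
    then have "u x \<ge> 0" using ub by blast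
    ultimately show False using neg by linarith
  qed
  define f0 where "f0 = c0 powr p - M * norm g0 powr q"
  define C2 where "C2 = p * (max A c0) powr (p - 1) * L + M * (q * L powr (q - 1) * D0)"
  have C2: "C2 \<ge> 0" unfolding C2_def using p q M L0 D0 by (intro add_nonneg_nonneg mult_nonneg_nonneg) auto
  have f: "\<bar>trace (H x) - f0\<bar> \<le> C2 * norm x powr \<beta>" if x: "0 < norm x" "norm x < r0" for x
  proof -
    have xR: "x \<in> ball 0 R - {0}" using x r0 by auto
    have "\<bar>u x powr p - c0 powr p\<bar> \<le> p * (max A c0) powr (p - 1) * \<bar>u x - c0\<bar>"
      using ub[OF xR] c0 p by (intro powr_lipschitz) auto
    also have "\<dots> \<le> p * (max A c0) powr (p - 1) * (L * norm x powr \<beta>)"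
      using p uc[OF x] by (intro mult_left_mono) auto
    finally have a: "\<bar>u x powr p - c0 powr p\<bar> \<le> (p * (max A c0) powr (p - 1) * L) * norm x powr \<beta>" by (simp only: mult.assoc)
    have "\<bar>norm (G x) powr q - norm g0 powr q\<bar> \<le> q * L powr (q - 1) * \<bar>norm (G x) - norm g0\<bar>"
      using L[OF x] q D0 by (intro powr_lipschitz) (auto simp: L_def)
    also have "\<dots> \<le> q * L powr (q - 1) * (D0 * norm x powr \<beta>)"
      using q by (intro mult_left_mono order_trans[OF norm_triangle_ineq3 F(2)[OF x]]) auto
    finally have "M * \<bar>norm (G x) powr q - norm g0 powr q\<bar> \<le> M * (q * L powr (q - 1) * (D0 * norm x powr \<beta>))"
      using M by (intro mult_left_mono) auto
    then have b: "\<bar>M * (norm (G x) powr q - norm g0 powr q)\<bar> \<le> (M * (q * L powr (q - 1) * D0)) * norm x powr \<beta>"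
      using M by (simp add: abs_mult mult.assoc)
    have "trace (H x) - f0 = (u x powr p - c0 powr p) - M * (norm (G x) powr q - norm g0 powr q)"
      unfolding eq[OF xR] f0_def by (simp add: right_diff_distrib)
    then show ?thesis using a b unfolding C2_def distrib_right by linarith
  qed
  \<comment> \<open>The Laplacian of e |x|^2 is 2Ne = f0.\<close>
  define e where "e = f0 / (2 * N)"
  have sq: "has_C2 UNIV (\<lambda>x::real^'n. (norm (x - 0))\<^sup>2) (\<lambda>x. (2 * 1) *\<^sub>R (x - 0))
      (\<lambda>x. (4 * 0) *\<^sub>R outer (x - 0) (x - 0) + (2 * 1) *\<^sub>R mat 1)"
    by (rule has_C2_radial[where T=UNIV and \<phi>="\<lambda>t. t" and \<phi>'="\<lambda>t. 1" and \<phi>''="\<lambda>t. 0"])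
       (auto intro!: derivative_eq_intros)
  have v: "has_C2 (ball 0 r0 - {0}) (\<lambda>x. u x - e * (norm x)\<^sup>2) (\<lambda>x. G x - (2 * e) *\<^sub>R x) (\<lambda>x. H x - (2 * e) *\<^sub>R mat 1)"
    by (rule has_C2_cong[OF has_C2_diff[OF has_C2_subset[OF u] has_C2_cmul[OF has_C2_subset[OF sq], of _ e]]])
       (use r0 in \<open>auto simp: mult.commute\<close>)
  have trv: "trace (H x - (2 * e) *\<^sub>R mat 1) = trace (H x) - f0" for x
    using N by (simp add: trace_sub trace_I e_def N_def[symmetric])
  have vA: "\<bar>u x - e * (norm x)\<^sup>2\<bar> \<le> A + \<bar>e\<bar>" if "x \<in> ball 0 r0 - {0}" for x
  proof -
    have "0 \<le> u x \<and> u x \<le> A" using ub[of x] that r0 by auto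
    moreover have "(norm x)\<^sup>2 \<le> 1" using that r0 R by (intro power_le_one) auto
    then have "\<bar>e * (norm x)\<^sup>2\<bar> \<le> \<bar>e\<bar>" by (simp add: abs_mult mult_left_le)
    ultimately show ?thesis by linarith
  qed
  have vH: "\<bar>trace (H x - (2 * e) *\<^sub>R mat 1)\<bar> \<le> C2 * norm x powr (real 2 - 2 + \<beta>)" if "x \<in> ball 0 r0 - {0}" for x
    using f[of x] that unfolding trv by auto
  obtain c g B D where E: "D \<ge> 0" "trace (B::real^'n^'n) = 0"
    "\<And>x. 0 < norm x \<Longrightarrow> norm x < r0 / 8 \<Longrightarrow> \<bar>u x - e * (norm x)\<^sup>2 - (c + g \<bullet> x + x \<bullet> (B *v x))\<bar> \<le> D * norm x powr (real 2 + \<beta>)"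
    "\<And>x. 0 < norm x \<Longrightarrow> norm x < r0 / 8 \<Longrightarrow> norm (G x - (2 * e) *\<^sub>R x - (g + (B + transpose B) *v x)) \<le> D * norm x powr (real 2 - 1 + \<beta>)"
    using gradient_expansion[OF N3 r0(1) v vA order_refl \<beta> C2 vH] by blast
  define Q where "Q = (B + transpose B) + (2 * e) *\<^sub>R mat 1"
  have Qx: "Q *v x = (B + transpose B) *v x + (2 * e) *\<^sub>R x" for x
    by (simp add: Q_def matrix_vector_mult_add_rdistrib scaleR_matrix_vector_assoc[symmetric])
  have Gb: "norm (G x - g - Q *v x) \<le> D * norm x powr (1 + \<beta>)" if "0 < norm x" "norm x < r0 / 8" for x
    using E(4)[OF that] unfolding Qx by (simp add: algebra_simps)
  have ub2: "\<bar>u x - c - g \<bullet> x\<bar> \<le> (D + norm B + \<bar>e\<bar>) * norm x powr (1 + 1)" if x: "0 < norm x" "norm x < r0 / 8" for x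
  proof -
    have "\<bar>x \<bullet> (B *v x)\<bar> \<le> norm x * (norm B * norm x)"
      by (intro order_trans[OF Cauchy_Schwarz_ineq2] mult_left_mono norm_matrix_vector_le) auto
    then have 1: "\<bar>x \<bullet> (B *v x)\<bar> \<le> norm B * (norm x)\<^sup>2" by (simp add: power2_eq_square mult_ac)
    have "D * norm x powr (real 2 + \<beta>) \<le> D * norm x powr 2"
      using x1(2)[of x 2 "real 2 + \<beta>"] x r0 E(1) \<beta> by (intro mult_left_mono) auto
    then have 2: "D * norm x powr (real 2 + \<beta>) \<le> D * (norm x)\<^sup>2" using x by simp
    have 3: "\<bar>e * (norm x)\<^sup>2\<bar> = \<bar>e\<bar> * (norm x)\<^sup>2" by (simp add: abs_mult)
    have "\<bar>u x - c - g \<bullet> x\<bar> \<le> (D + norm B + \<bar>e\<bar>) * (norm x)\<^sup>2"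
      using E(3)[OF x] 1 2 3 unfolding distrib_right by linarith
    then show ?thesis using x by simp
  qed
  have w: "has_C2 (ball 0 r0 - {0}) (\<lambda>x. u x - e * (norm x)\<^sup>2 - (c + g \<bullet> x + x \<bullet> (B *v x))) (\<lambda>x. G x - g - Q *v x) (\<lambda>x. H x - Q)"
    by (rule has_C2_cong[OF has_C2_diff[OF v has_C2_subset[OF has_C2_add[OF has_C2_add[OF has_C2_const has_C2_linear] has_C2_quadratic]]]],
        auto simp: Qx)
       (simp add: Q_def algebra_simps)
  define K where "K = hessian_const TYPE('n)"
  have K: "K \<ge> 4" unfolding K_def by (rule hessian_const_ge)
  define a1 where "a1 = p * A powr (p - 1) * L"
  define a2 where "a2 = M * q * L powr (q - 1)"
  have a: "a1 \<ge> 0" "a2 \<ge> 0" using p q M L0 by (auto simp: a1_def a2_def)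
  define E3 where "E3 = K * (2 * (D * 2 powr \<bar>1 + \<beta>\<bar>) + (a1 + 2 * a2 * C1))"
  have E3: "E3 \<ge> 0" using K E(1) a C1 by (simp add: E3_def)
  have Hb: "norm (H x - Q) \<le> E3 * norm x powr (\<beta> / 2)" if x: "0 < norm x" "norm x < r0 / 16" for x
  proof -
    define X where "X = norm x"
    \<comment> \<open>This radius balances the two terms of the Hessian bound: the gradient
      remainder X^{1+\<beta>} divided by \<rho>, and \<rho> times the Lipschitz constant of the
      Laplacian, which is of order 1/X. Both become of order X^{\<beta>/2}.\<close>
    define \<rho> where "\<rho> = X powr (1 + \<beta> / 2) / 2"
    have X: "0 < X" "X \<le> 1" using x r0 R by (auto simp: X_def)
    have "X powr (1 + \<beta> / 2) \<le> X powr 1" using X \<beta> by (intro powr_mono') auto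
    then have \<rho>: "0 < \<rho>" "\<rho> \<le> X / 2" using X by (auto simp: \<rho>_def)
    have nr: "X / 2 \<le> norm y" "norm y \<le> 2 * X" "0 < norm y" "norm y < r0 / 8" if "y \<in> ball x \<rho>" for y
      using near[of x "r0 / 8" y] x that \<rho> by (auto simp: X_def dist_norm)
    have sub: "ball x \<rho> \<subseteq> ball 0 r0 - {0}" "ball x \<rho> \<subseteq> ball 0 R - {0}" using nr(3,4) r0 by fastforce+
    have Hy: "norm (H y) \<le> 2 * C1 / X" if "y \<in> ball x \<rho>" for y
    proof -
      have "norm (H y) \<le> C1 / norm y" using nr(3,4)[OF that] r0 by (intro C1(2)) auto
      also have "\<dots> \<le> C1 / (X / 2)" using nr[OF that] C1 X by (intro divide_left_mono) auto
      finally show ?thesis by (simp add: mult.commute)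
    qed
    have Ly: "norm (G y) \<le> L" if "y \<in> ball x \<rho>" for y using nr(3,4)[OF that] r0 by (intro L) auto
    have "norm (H x - Q) \<le> K * (D * (2 powr \<bar>1 + \<beta>\<bar> * X powr (1 + \<beta>)) / \<rho> + \<rho> * (a1 + a2 * (2 * C1 / X)))"
      unfolding K_def
    proof (rule hessian_bound[OF has_C2_subset[OF w _ sub(1)]])
      show "norm (G y - g - Q *v y) \<le> D * (2 powr \<bar>1 + \<beta>\<bar> * X powr (1 + \<beta>))" if "y \<in> ball x \<rho>" for y
        using nr[OF that] X E(1) by (intro order_trans[OF Gb] mult_left_mono powr_comparable) auto
      show "\<bar>trace (H y - Q) - trace (H z - Q)\<bar> \<le> (a1 + a2 * (2 * C1 / X)) * norm (y - z)"
        if "y \<in> ball x \<rho>" "z \<in> ball x \<rho>" for y z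
        using trace_lipschitz[OF convex_ball sub(2) Ly Hy that] unfolding a1_def a2_def trace_sub by simp
    qed (use \<rho> in auto)
    also have "D * (2 powr \<bar>1 + \<beta>\<bar> * X powr (1 + \<beta>)) / \<rho> = 2 * (D * 2 powr \<bar>1 + \<beta>\<bar>) * X powr (\<beta> / 2)"
    proof -
      have "1 + \<beta> = (1 + \<beta> / 2) + \<beta> / 2" by simp
      then have "X powr (1 + \<beta>) = X powr (1 + \<beta> / 2) * X powr (\<beta> / 2)" by (metis powr_add)
      then show ?thesis using X by (simp add: \<rho>_def field_simps)
    qed
    also have "\<rho> * (a1 + a2 * (2 * C1 / X)) \<le> (a1 + 2 * a2 * C1) * X powr (\<beta> / 2)"
    proof -
      have "a1 * X \<le> a1 * 1" using X a by (intro mult_left_mono) auto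
      then have "a1 + a2 * (2 * C1 / X) \<le> (a1 + 2 * a2 * C1) / X" using X by (simp add: field_simps)
      then have "\<rho> * (a1 + a2 * (2 * C1 / X)) \<le> \<rho> * ((a1 + 2 * a2 * C1) / X)" using \<rho> by (intro mult_left_mono) auto
      also have "\<dots> = (a1 + 2 * a2 * C1) * X powr (\<beta> / 2) / 2" using X by (simp add: \<rho>_def powr_add)
      also have "\<dots> \<le> (a1 + 2 * a2 * C1) * X powr (\<beta> / 2)" using a C1 by simp
      finally show ?thesis .
    qed
    finally show ?thesis using K by (simp add: E3_def X_def distrib_right distrib_left mult_ac)
  qed
  define E0 where "E0 = (D + norm B + \<bar>e\<bar>) + D + E3"
  have E0: "E0 \<ge> 0" "D + norm B + \<bar>e\<bar> \<le> E0" "D \<le> E0" "E3 \<le> E0" using E(1) E3 by (auto simp: E0_def)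
  have fin: "\<bar>u x - c - g \<bullet> x\<bar> \<le> E0 * norm x powr (1 + 1) \<and>
       norm (G x - g - Q *v x) \<le> E0 * norm x powr (1 + \<beta> / 2) \<and> norm (H x - Q) \<le> E0 * norm x powr (\<beta> / 2)"
    if x: "0 < norm x" "norm x < r0 / 16" for x
  proof (intro conjI)
    have x8: "norm x < r0 / 8" using x r0 by simp
    show "\<bar>u x - c - g \<bullet> x\<bar> \<le> E0 * norm x powr (1 + 1)"
      by (rule order_trans[OF ub2[OF x(1) x8] mult_right_mono[OF E0(2)]]) simp
    have "norm (G x - g - Q *v x) \<le> D * norm x powr (1 + \<beta> / 2)"
      using x1(2)[of x "1 + \<beta> / 2" "1 + \<beta>"] x r0 \<beta> E(1) by (intro order_trans[OF Gb[OF x(1) x8]] mult_left_mono) auto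
    then show "norm (G x - g - Q *v x) \<le> E0 * norm x powr (1 + \<beta> / 2)"
      by (rule order_trans[OF _ mult_right_mono[OF E0(3)]]) simp
    show "norm (H x - Q) \<le> E0 * norm x powr (\<beta> / 2)"
      by (rule order_trans[OF Hb[OF x] mult_right_mono[OF E0(4)]]) simp
  qed
  show ?case
    by (rule exI[of _ c], rule exI[of _ g], rule exI[of _ Q], rule exI[of _ E0], rule exI[of _ "\<beta> / 2"], rule exI[of _ "r0 / 16"])
       (use E0(1) r0 \<beta> fin in auto)
qed

lemma extension:
  "\<exists>v Gv Hv r. 0 < r \<and> r \<le> R \<and> has_C2 (ball 0 r) v Gv Hv \<and> (\<forall>x\<in>ball 0 r - {0}. v x = u x \<and> Gv x = G x \<and> Hv x = H x)"
  using second_order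
proof (elim exE conjE, goal_cases)
  case (1 c g Q E \<beta> r)
  note r = 1(2,3) and \<beta> = 1(4)
  have B: "\<bar>u x - c - g \<bullet> x\<bar> \<le> E * norm x powr (1 + 1)" "norm (G x - g - Q *v x) \<le> E * norm x powr (1 + \<beta>)"
    "norm (H x - Q) \<le> E * norm x powr \<beta>" if "0 < norm x" "norm x < r" for x
    using 1(5) that by auto
  define v where "v x = (if x = 0 then c else u x)" for x
  define Gv where "Gv x = (if x = 0 then g else G x)" for x
  define Hv where "Hv x = (if x = 0 then Q else H x)" for x
  have p: "has_C2 (ball 0 r - {0}) v Gv Hv"
    by (rule has_C2_cong[OF has_C2_subset[OF u]]) (use r in \<open>auto simp: v_def Gv_def Hv_def\<close>)
  note D = has_C2D[OF p]
  have "has_C2 (ball 0 r) v Gv Hv"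
    unfolding has_C2_def
  proof (intro conjI ballI)
    fix x :: "real^'n" assume x: "x \<in> ball 0 r"
    show "(v has_derivative (\<lambda>h. Gv x \<bullet> h)) (at x)"
    proof (cases "x = 0")
      case True
      have "(v has_derivative (\<lambda>h. g \<bullet> h)) (at 0)"
        by (rule has_derivative_at_0I[OF bounded_linear_inner_right r(1) zero_less_one])
           (use B(1) in \<open>auto simp: v_def\<close>)
      then show ?thesis using True by (simp add: Gv_def)
    qed (use D(2) x in auto)
    show "(Gv has_derivative (\<lambda>h. Hv x *v h)) (at x)"
    proof (cases "x = 0")
      case True
      have "(Gv has_derivative (\<lambda>h. Q *v h)) (at 0)"
        by (rule has_derivative_at_0I[OF matrix_vector_mul_bounded_linear r(1) \<beta>])
           (use B(2) in \<open>auto simp: Gv_def\<close>)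
      then show ?thesis using True by (simp add: Hv_def)
    qed (use D(3) x in auto)
  next
    show "continuous_on (ball 0 r) Hv"
    proof (rule continuous_at_imp_continuous_on, intro ballI)
      fix x :: "real^'n" assume x: "x \<in> ball 0 r"
      show "isCont Hv x"
      proof (cases "x = 0")
        case False
        then show ?thesis using D(1,4) x by (simp add: continuous_on_eq_continuous_at)
      next
        case True
        have "((\<lambda>y. Hv y - Q) \<longlongrightarrow> 0) (at 0)"
        proof (rule Lim_null_comparison)
          have "((\<lambda>y::real^'n. E * norm y powr \<beta>) \<longlongrightarrow> E * 0 powr \<beta>) (at 0)"
          proof (intro tendsto_mult tendsto_const tendsto_powr')
            show "((\<lambda>h::real^'n. norm h) \<longlongrightarrow> 0) (at 0)" by (rule tendsto_norm_zero) (rule tendsto_ident_at)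
          qed (use \<beta> in auto)
          then show "((\<lambda>y::real^'n. E * norm y powr \<beta>) \<longlongrightarrow> 0) (at 0)" by simp
          show "\<forall>\<^sub>F y in at 0. norm (Hv y - Q) \<le> E * norm y powr \<beta>"
            unfolding eventually_at using r(1) B(3) by (intro exI[of _ r]) (auto simp: Hv_def)
        qed
        from LIM_zero_cancel[OF this] have "(Hv \<longlongrightarrow> Hv 0) (at 0)" by (simp add: Hv_def[of 0])
        then show ?thesis using True by (simp add: isCont_def)
      qed
    qed
  qed simp
  moreover have "\<forall>x\<in>ball 0 r - {0}. v x = u x \<and> Gv x = G x \<and> Hv x = H x" by (auto simp: v_def Gv_def Hv_def)
  ultimately show ?case using r by blast
qed

end

lemma classical_extension:
  fixes u :: "real^'n \<Rightarrow> real"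
  assumes N3: "CARD('n) \<ge> 3" and \<Omega>: "open \<Omega>" "0 \<in> \<Omega>" and u: "has_C2 (\<Omega> - {0}) u G H"
    and u0: "\<And>x. x \<in> \<Omega> - {0} \<Longrightarrow> 0 \<le> u x"
    and eq: "\<And>x. x \<in> \<Omega> - {0} \<Longrightarrow> trace (H x) = u x powr p - M * norm (G x) powr q"
    and p: "1 < p" and q: "1 < q" "q < 2" and M: "0 < M" and r: "r > 0"
    and A: "\<And>x. 0 < norm x \<Longrightarrow> norm x < r \<Longrightarrow> u x \<le> A"
  shows "\<exists>v. C2_on \<Omega> v \<and> (\<forall>x\<in>\<Omega> - {0}. v x = u x) \<and>
              (\<forall>x\<in>\<Omega>. - laplacian v x + v x powr p - M * norm (grad v x) powr q = 0)"
proof -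
  obtain r0 where r0: "r0 > 0" "ball 0 r0 \<subseteq> \<Omega>" using \<Omega> open_contains_ball by blast
  define R where "R = min (min r r0) 1"
  have R: "0 < R" "R \<le> 1" "R \<le> r" "ball 0 R \<subseteq> \<Omega>" using r r0 by (auto simp: R_def)
  interpret ps: punctured_solution u G H p q M A R
  proof
    show "has_C2 (ball 0 R - {0}) u G H" by (rule has_C2_subset[OF u]) (use R in auto)
    show "0 \<le> u x \<and> u x \<le> A" if "x \<in> ball 0 R - {0}" for x using u0[of x] A[of x] that R by auto
    show "trace (H x) = u x powr p - M * norm (G x) powr q" if "x \<in> ball 0 R - {0}" for x using eq[of x] that R by auto
  qed (use N3 R p q M in auto)
  obtain v Gv Hv s where v: "0 < s" "s \<le> R" "has_C2 (ball 0 s) v Gv Hv"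
    "\<And>x. x \<in> ball 0 s - {0} \<Longrightarrow> v x = u x \<and> Gv x = G x \<and> Hv x = H x"
    using ps.extension by blast
  define V where "V x = (if x = 0 then v 0 else u x)" for x
  define GV where "GV x = (if x = 0 then Gv 0 else G x)" for x
  define HV where "HV x = (if x = 0 then Hv 0 else H x)" for x
  have 1: "has_C2 (ball 0 s) V GV HV" by (rule has_C2_cong[OF v(3)]) (use v(4) in \<open>auto simp: V_def GV_def HV_def\<close>)
  have 2: "has_C2 (\<Omega> - {0}) V GV HV" by (rule has_C2_cong[OF u]) (auto simp: V_def GV_def HV_def)
  have un: "ball 0 s \<union> (\<Omega> - {0}) = \<Omega>" using v(1,2) R(4) \<Omega>(2) by auto
  have V: "has_C2 \<Omega> V GV HV" using has_C2_Un[OF 1 2] unfolding un .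
  note D = has_C2D[OF V]
  \<comment> \<open>The absolute value makes \<open>F\<close> continuous at the origin before the
    sign of \<open>V 0\<close> is known. Continuity then carries the equation, and after it the
    sign, over to the origin.\<close>
  define F where "F x = - trace (HV x) + \<bar>V x\<bar> powr p - M * norm (GV x) powr q" for x
  have cF: "continuous_on \<Omega> F" unfolding F_def trace_def
    by (intro continuous_intros continuous_on_powr' D) (use p q in auto)
  have F0: "F x = 0" if "x \<in> \<Omega> - {0}" for x using eq[OF that] u0[OF that] that by (auto simp: F_def V_def GV_def HV_def)
  have lim: "(F \<longlongrightarrow> F 0) (at 0)" using cF \<Omega> by (simp add: continuous_on_eq_continuous_at isCont_def)
  have ev: "\<forall>\<^sub>F x in at 0. F x = 0" unfolding eventually_at_topological using \<Omega> F0 by blast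
  have "((\<lambda>x. 0) \<longlongrightarrow> F 0) (at (0::real^'n))" by (rule Lim_transform_eventually[OF lim]) (use ev in simp)
  then have F00: "F 0 = 0" by (metis tendsto_unique tendsto_const at_neq_bot)
  have V0: "V 0 \<ge> 0"
  proof (rule tendsto_lowerbound)
    show "(V \<longlongrightarrow> V 0) (at 0)" using D(5) \<Omega> by (simp add: continuous_on_eq_continuous_at isCont_def)
    show "\<forall>\<^sub>F x in at 0. 0 \<le> V x" unfolding eventually_at_topological using \<Omega> u0 by (intro exI[of _ \<Omega>]) (auto simp: V_def)
  qed simp
  have "- laplacian V x + V x powr p - M * norm (grad V x) powr q = 0" if x: "x \<in> \<Omega>" for x
  proof -
    have "V x \<ge> 0" using V0 u0[of x] x by (cases "x = 0") (auto simp: V_def)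
    moreover have "F x = 0" using F0[of x] F00 x by (cases "x = 0") auto
    ultimately show ?thesis using has_C2_imp(2,3)[OF V x] by (simp add: F_def)
  qed
  then show ?thesis using has_C2_imp(1)[OF V] by (intro exI[of _ V]) (auto simp: V_def)
qed

section \<open>The Keller--Osserman estimate\<close>

text \<open>Where the gradients coincide, the two inequalities leave u^p \<le> w^p, and the power is
  strictly increasing on nonnegative numbers.\<close>

lemma supersolution_compare:
  fixes u w :: "real^'n \<Rightarrow> real"
  assumes u: "has_C2 U u G H" and w: "has_C2 U w Gw Hw" and K: "compact K" "K \<subseteq> U" "\<And>x. x \<in> U - K \<Longrightarrow> u x \<le> w x"
    and eq: "\<And>x. x \<in> U \<Longrightarrow> trace (H x) = u x powr p - M * norm (G x) powr q"
    and sup: "\<And>x. x \<in> U \<Longrightarrow> 0 \<le> w x \<and> trace (Hw x) \<le> w x powr p - M * norm (Gw x) powr q"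
    and p: "p > 0" and x: "x \<in> U"
  shows "u x \<le> w x"
proof (rule comparison[OF u w K _ x])
  fix x assume x: "x \<in> K" "G x = Gw x" "trace (H x) \<le> trace (Hw x)"
  show "u x \<le> w x"
  proof (rule ccontr)
    assume "\<not> u x \<le> w x"
    moreover have xU: "x \<in> U" using x K by blast
    ultimately have "w x powr p < u x powr p" using sup p by (intro powr_less_mono2) auto
    then show False using eq[OF xU] sup[OF xU] x by simp
  qed
qed

text \<open>The factor s + 2 - N distinguishes the barriers below: negative for 0 < s < N - 2, zero
  at the fundamental solution s = N - 2, and small and positive just above it.\<close>

lemma has_C2_norm_powr:
  fixes s :: real
  shows "\<exists>G H. has_C2 (UNIV - {0}) (\<lambda>x::real^'n. norm x powr (-s)) G H \<and>
    (\<forall>x. x \<noteq> 0 \<longrightarrow> norm (G x) = \<bar>s\<bar> * norm x powr (-(s + 1)) \<and>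
       trace (H x) = s * (s + 2 - real CARD('n)) * norm x powr (-(s + 2)))"
proof -
  define a where "a = - s / 2"
  define \<phi> where "\<phi> t = t powr a" for t :: real
  define \<phi>' where "\<phi>' t = a * t powr (a - 1)" for t :: real
  define \<phi>'' where "\<phi>'' t = a * (a - 1) * t powr (a - 2)" for t :: real
  have 1: "(\<phi> has_real_derivative \<phi>' t) (at t)" if "t \<in> {0<..}" for t
    unfolding \<phi>_def \<phi>'_def using that has_real_derivative_powr[of t a] by simp
  have 2: "(\<phi>' has_real_derivative \<phi>'' t) (at t)" if "t \<in> {0<..}" for t
  proof -
    have "((\<lambda>t. t powr (a - 1)) has_real_derivative (a - 1) * t powr (a - 1 - 1)) (at t)"
      using that by (intro has_real_derivative_powr) auto
    from DERIV_cmult[OF this, of a] show ?thesis unfolding \<phi>'_def \<phi>''_def by (simp add: mult.assoc)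
  qed
  have 3: "continuous_on {0<..} \<phi>''" unfolding \<phi>''_def by (intro continuous_intros) auto
  have S: "(norm (x - 0))\<^sup>2 \<in> {0<..}" if "x \<in> UNIV - {0}" for x :: "real^'n" using that by simp
  have op: "open (UNIV - {0::real^'n})" by (simp add: open_Diff)
  note C = has_C2_radial[OF 1 2 3 op S]
  have pw: "((norm x)\<^sup>2) powr b = norm x powr (2 * b)" if "x \<noteq> 0" for b and x :: "real^'n"
  proof -
    have "(norm x)\<^sup>2 = norm x powr 2" using that by simp
    then show ?thesis by (simp only: powr_powr)
  qed
  have f: "has_C2 (UNIV - {0}) (\<lambda>x::real^'n. norm x powr (-s)) (\<lambda>x. (2 * \<phi>' ((norm (x - 0))\<^sup>2)) *\<^sub>R (x - 0))
     (\<lambda>x. (4 * \<phi>'' ((norm (x - 0))\<^sup>2)) *\<^sub>R outer (x - 0) (x - 0) + (2 * \<phi>' ((norm (x - 0))\<^sup>2)) *\<^sub>R mat 1)"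
    by (rule has_C2_cong[OF C]) (auto simp: \<phi>_def pw a_def)
  have g: "norm ((2 * \<phi>' ((norm (x - 0))\<^sup>2)) *\<^sub>R (x - 0)) = \<bar>s\<bar> * norm x powr (-(s + 1))"
    "trace ((4 * \<phi>'' ((norm (x - 0))\<^sup>2)) *\<^sub>R outer (x - 0) (x - 0) + (2 * \<phi>' ((norm (x - 0))\<^sup>2)) *\<^sub>R mat 1 :: real^'n^'n)
       = s * (s + 2 - real CARD('n)) * norm x powr (-(s + 2))" if x: "x \<noteq> 0" for x :: "real^'n"
  proof -
    have e1: "2 * \<phi>' ((norm x)\<^sup>2) = - s * norm x powr (-(s + 2))"
      unfolding \<phi>'_def pw[OF x] by (simp add: a_def algebra_simps)
    have "norm x powr (-(s + 1)) = norm x powr (-(s + 2) + 1)" by (simp add: algebra_simps)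
    also have "\<dots> = norm x powr (-(s + 2)) * norm x powr 1" by (rule powr_add)
    finally have e2: "norm x powr (-(s + 1)) = norm x powr (-(s + 2)) * norm x" using x by simp
    show "norm ((2 * \<phi>' ((norm (x - 0))\<^sup>2)) *\<^sub>R (x - 0)) = \<bar>s\<bar> * norm x powr (-(s + 1))"
      by (simp only: diff_0_right norm_scaleR e1 e2) (simp add: abs_mult)
    have "\<phi>'' ((norm x)\<^sup>2) * (norm x)\<^sup>2 = a * (a - 1) * (norm x powr (2 * (a - 2)) * norm x powr 2)"
      unfolding \<phi>''_def pw[OF x] using x by simp
    also have "norm x powr (2 * (a - 2)) * norm x powr 2 = norm x powr (-(s + 2))"
      by (simp only: powr_add[symmetric]) (simp add: a_def algebra_simps)
    finally have e3: "\<phi>'' ((norm x)\<^sup>2) * (norm x)\<^sup>2 = a * (a - 1) * norm x powr (-(s + 2))" .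
    have "4 * \<phi>'' ((norm x)\<^sup>2) * (norm x)\<^sup>2 + 2 * real CARD('n) * \<phi>' ((norm x)\<^sup>2)
       = 4 * (\<phi>'' ((norm x)\<^sup>2) * (norm x)\<^sup>2) + real CARD('n) * (2 * \<phi>' ((norm x)\<^sup>2))" by simp
    also have "\<dots> = s * (s + 2 - real CARD('n)) * norm x powr (-(s + 2))"
      unfolding e3 e1 by (simp add: a_def algebra_simps)
    finally show "trace ((4 * \<phi>'' ((norm (x - 0))\<^sup>2)) *\<^sub>R outer (x - 0) (x - 0) + (2 * \<phi>' ((norm (x - 0))\<^sup>2)) *\<^sub>R mat 1 :: real^'n^'n)
       = s * (s + 2 - real CARD('n)) * norm x powr (-(s + 2))" by (simp add: trace_radial)
  qed
  show ?thesis using f g by blast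
qed

lemma powr_dominated_near_0:
  fixes \<sigma> \<sigma>' :: real
  assumes "\<sigma> < \<sigma>'" "l > 0" "C \<ge> 0"
  shows "\<exists>\<delta>>0. \<forall>t. 0 < t \<and> t < \<delta> \<longrightarrow> C * t powr (-\<sigma>) \<le> l * t powr (-\<sigma>')"
proof -
  define \<delta> where "\<delta> = (l / (C + 1)) powr (1 / (\<sigma>' - \<sigma>))"
  have d: "\<delta> > 0" using assms by (simp add: \<delta>_def)
  have "C * t powr (-\<sigma>) \<le> l * t powr (-\<sigma>')" if t: "0 < t" "t < \<delta>" for t
  proof -
    have "t powr (\<sigma>' - \<sigma>) \<le> \<delta> powr (\<sigma>' - \<sigma>)" using t assms by (intro powr_mono2) auto
    also have "\<dots> = l / (C + 1)" using assms by (simp add: \<delta>_def powr_powr)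
    finally have "C * t powr (\<sigma>' - \<sigma>) \<le> C * (l / (C + 1))" using assms by (intro mult_left_mono)
    also have "\<dots> \<le> l" using assms by (simp add: field_simps)
    finally have "(C * t powr (\<sigma>' - \<sigma>)) * t powr (-\<sigma>') \<le> l * t powr (-\<sigma>')" by (intro mult_right_mono) auto
    moreover have "t powr (\<sigma>' - \<sigma>) * t powr (-\<sigma>') = t powr (-\<sigma>)" by (simp only: powr_add[symmetric]) simp
    ultimately show ?thesis by (simp add: mult.assoc)
  qed
  then show ?thesis using d by blast
qed

locale singular_solution =
  fixes \<Omega> :: "(real^'n) set" and u :: "real^'n \<Rightarrow> real" and G :: "real^'n \<Rightarrow> real^'n" and H :: "real^'n \<Rightarrow> real^'n^'n"
    and p q M N :: real
  assumes Ndef: "N = real CARD('n)" and N3: "CARD('n) \<ge> 3" and \<Omega>: "open \<Omega>" "0 \<in> \<Omega>"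
    and u: "has_C2 (\<Omega> - {0}) u G H" and u0: "\<And>x. x \<in> \<Omega> - {0} \<Longrightarrow> 0 \<le> u x"
    and eq: "\<And>x. x \<in> \<Omega> - {0} \<Longrightarrow> trace (H x) = u x powr p - M * norm (G x) powr q"
    and p: "1 < p" and q: "1 < q" "q \<le> 2 * p / (p + 1)" and M: "0 < M"
begin

lemma pq: "q < p" "q < 2"
proof -
  have "2 * p < p * (p + 1)" using p by (simp add: algebra_simps)
  then have "2 * p / (p + 1) < p" using p by (simp add: pos_divide_less_eq)
  then show "q < p" using q by simp
  have "2 * p / (p + 1) < 2" using p by (simp add: field_simps)
  then show "q < 2" using q by simp
qed

text \<open>The barrier b (\<rho>^2 - |y-x|^2)^{-k} is infinite on the sphere. With k = 2/(p-1) its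
  p-th power and its Laplacian blow up at the same rate k + 2, and the gradient term at the rate
  (k+1)q \<le> k + 2. The factor \<rho>^k in \<open>b\<close> is dictated by scaling and yields
  \<rho>^{-k} at the centre.\<close>

lemma keller_osserman_ball:
  "\<exists>C\<ge>0. \<forall>x \<rho>. 0 < \<rho> \<and> \<rho> \<le> 1 \<and> cball x \<rho> \<subseteq> \<Omega> - {0} \<longrightarrow> u x \<le> C * \<rho> powr (-(2 / (p - 1)))"
proof -
  define k where "k = 2 / (p - 1)"
  have k: "k > 0" "k * p = k + 2" "(k + 1) * q \<le> k + 2"
  proof -
    show "k > 0" using p by (simp add: k_def)
    show "k * p = k + 2" using p by (simp add: k_def field_simps)
    have "(k + 1) * q \<le> (k + 1) * (2 * p / (p + 1))" using q \<open>k > 0\<close> by (intro mult_left_mono) auto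
    also have "\<dots> = k + 2"
    proof -
      have "k + 1 = (p + 1) / (p - 1)" "k + 2 = 2 * p / (p - 1)" using p by (auto simp: k_def field_simps)
      then show ?thesis using p by simp
    qed
    finally show "(k + 1) * q \<le> k + 2" .
  qed
  define c1 where "c1 = 4 * k * (k + 1) + 2 * N * k"
  have c1: "c1 \<ge> 0" using k by (simp add: c1_def Ndef)
  \<comment> \<open>Solves l^{p-q} = 1 + c1 + M (2k)^q. Since l \<ge> 1, the term linear in l is
    bounded by l^q, and p > q lets the absorption win.\<close>
  define l where "l = (1 + c1 + M * (2 * k) powr q) powr (1 / (p - q))"
  have b1: "1 + c1 + M * (2 * k) powr q \<ge> 1" using c1 M by simp
  have l1: "l \<ge> 1" unfolding l_def using b1 pq by (intro ge_one_powr_ge_zero) auto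
  have lp: "l * c1 + M * (2 * k * l) powr q \<le> l powr p"
  proof -
    have "l powr 1 \<le> l powr q" using l1 q by (intro powr_mono) auto
    then have "l * c1 + M * (2 * k * l) powr q \<le> l powr q * c1 + M * (2 * k) powr q * l powr q"
      using c1 l1 by (intro add_mono mult_right_mono) (auto simp: powr_mult)
    also have "\<dots> \<le> l powr q * (1 + c1 + M * (2 * k) powr q)" by (simp add: algebra_simps)
    also have "1 + c1 + M * (2 * k) powr q = l powr (p - q)" unfolding l_def using b1 pq by (simp add: powr_powr)
    also have "l powr q * l powr (p - q) = l powr p" by (simp only: powr_add[symmetric]) simp
    finally show ?thesis .
  qed
  have "u x \<le> l * \<rho> powr (-k)" if \<rho>: "0 < \<rho>" "\<rho> \<le> 1" and sub: "cball x \<rho> \<subseteq> \<Omega> - {0}" for x \<rho>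
  proof -
    define b where "b = l * \<rho> powr k"
    have bp: "b > 0" using l1 \<rho> by (simp add: b_def)
    define \<phi> where "\<phi> t = b * (\<rho>\<^sup>2 - t) powr (-k)" for t
    define \<phi>' where "\<phi>' t = b * k * (\<rho>\<^sup>2 - t) powr (-k-1)" for t
    define \<phi>'' where "\<phi>'' t = b * k * (k + 1) * (\<rho>\<^sup>2 - t) powr (-k-2)" for t
    have dp: "((\<lambda>t. (\<rho>\<^sup>2 - t) powr s) has_real_derivative - s * (\<rho>\<^sup>2 - t) powr (s - 1)) (at t)" if "t \<in> {..<\<rho>\<^sup>2}" for t s
      using that DERIV_fun_powr[of "\<lambda>t. \<rho>\<^sup>2 - t" "-1" t s] by (auto intro!: derivative_eq_intros)
    have 1: "(\<phi> has_real_derivative \<phi>' t) (at t)" if "t \<in> {..<\<rho>\<^sup>2}" for t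
      unfolding \<phi>_def \<phi>'_def using DERIV_cmult[OF dp[OF that, of "-k"], of b] by (simp add: mult.assoc)
    have 2: "(\<phi>' has_real_derivative \<phi>'' t) (at t)" if "t \<in> {..<\<rho>\<^sup>2}" for t
      unfolding \<phi>'_def \<phi>''_def using DERIV_cmult[OF dp[OF that, of "-k-1"], of "b * k"] by (simp add: mult.assoc add.commute)
    have 3: "continuous_on {..<\<rho>\<^sup>2} \<phi>''" unfolding \<phi>''_def by (intro continuous_intros) auto
    have S: "(norm (y - x))\<^sup>2 \<in> {..<\<rho>\<^sup>2}" if "y \<in> ball x \<rho>" for y
      using that \<rho> by (auto simp: dist_norm norm_minus_commute intro!: power_strict_mono)
    note w = has_C2_radial[OF 1 2 3 open_ball S]
    have ub: "has_C2 (ball x \<rho>) u G H" by (rule has_C2_subset[OF u open_ball order_trans[OF ball_subset_cball sub]])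
    have "continuous_on (cball x \<rho>) u" using has_C2D(5)[OF u] sub continuous_on_subset by blast
    then have "bounded (u ` cball x \<rho>)" by (intro compact_imp_bounded compact_continuous_image) auto
    then obtain A where A: "A > 0" "\<And>y. y \<in> cball x \<rho> \<Longrightarrow> \<bar>u y\<bar> \<le> A" by (auto simp: bounded_pos)
    \<comment> \<open>Once \<rho>^2 - |y-x|^2 is below (b/A)^{1/k} the barrier exceeds the maximum
      \<open>A\<close> of \<open>u\<close>, which gives the compact set of the comparison.\<close>
    define D0 where "D0 = min ((b / A) powr (1 / k)) (\<rho>\<^sup>2 / 2)"
    have D0: "D0 > 0" using bp A \<rho> by (simp add: D0_def)
    define K where "K = {y. (norm (y - x))\<^sup>2 \<le> \<rho>\<^sup>2 - D0} \<inter> cball x \<rho>"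
    have Kc: "compact K" unfolding K_def
      by (intro closed_Int_compact closed_Collect_le continuous_intros compact_cball)
    have KU: "K \<subseteq> ball x \<rho>"
    proof
      fix y assume "y \<in> K"
      then have "(norm (y - x))\<^sup>2 < \<rho>\<^sup>2" using D0 by (auto simp: K_def)
      then have "norm (y - x) < \<rho>" using \<rho> by (simp add: power_less_imp_less_base)
      then show "y \<in> ball x \<rho>" by (simp add: dist_norm norm_minus_commute)
    qed
    have "u x \<le> \<phi> ((norm (x - x))\<^sup>2)"
    proof (rule supersolution_compare[OF ub w Kc KU])
      show "trace (H y) = u y powr p - M * norm (G y) powr q" if "y \<in> ball x \<rho>" for y
        by (rule eq[OF subsetD[OF order_trans[OF ball_subset_cball sub] that]])
      show "u y \<le> \<phi> ((norm (y - x))\<^sup>2)" if y: "y \<in> ball x \<rho> - K" for y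
      proof -
        define D where "D = \<rho>\<^sup>2 - (norm (y - x))\<^sup>2"
        have D: "0 < D" "D < D0" using S[of y] y by (auto simp: D_def K_def)
        have "D powr k \<le> ((b / A) powr (1 / k)) powr k" using D k by (intro powr_mono2) (auto simp: D0_def)
        also have "\<dots> = b / A" using k bp A by (simp add: powr_powr)
        finally have "A * D powr k \<le> b" using A by (simp add: field_simps)
        then have "A \<le> b * D powr (-k)" using D by (simp add: powr_minus field_simps)
        moreover have "u y \<le> A" using A(2)[of y] y by auto
        ultimately show ?thesis by (simp add: \<phi>_def D_def)
      qed
      show "0 \<le> \<phi> ((norm (y - x))\<^sup>2) \<and>
        trace ((4 * \<phi>'' ((norm (y - x))\<^sup>2)) *\<^sub>R outer (y - x) (y - x) + (2 * \<phi>' ((norm (y - x))\<^sup>2)) *\<^sub>R mat 1)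
        \<le> \<phi> ((norm (y - x))\<^sup>2) powr p - M * norm ((2 * \<phi>' ((norm (y - x))\<^sup>2)) *\<^sub>R (y - x)) powr q"
        if y: "y \<in> ball x \<rho>" for y
      proof
        define s where "s = norm (y - x)"
        define D where "D = \<rho>\<^sup>2 - s\<^sup>2"
        have s: "0 \<le> s" "s \<le> \<rho>" using y by (auto simp: s_def dist_norm norm_minus_commute)
        have D: "0 < D" "D \<le> \<rho>\<^sup>2" using S[OF y] by (auto simp: D_def s_def)
        show "0 \<le> \<phi> ((norm (y - x))\<^sup>2)" using bp by (simp add: \<phi>_def)
        \<comment> \<open>The common rate: the Laplacian, the gradient term and the absorption are
          all expressed as constants times Y, which reduces the supersolution inequality to the
          inequality \<open>lp\<close> for l.\<close>
        define Y where "Y = \<rho> powr (k + 2) * D powr (-k-2)"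
        have Y: "Y \<ge> 0" by (simp add: Y_def)
        have r2: "\<rho> powr (k + 2) = \<rho> powr k * \<rho>\<^sup>2" using \<rho> by (simp add: powr_add)
        have D1: "D powr (-k-1) = D powr (-k-2) * D"
        proof -
          have "-k-1 = (-k-2) + 1" by simp
          then have "D powr (-k-1) = D powr (-k-2) * D powr 1" by (simp only: powr_add)
          then show ?thesis using D by simp
        qed
        have t1: "4 * \<phi>'' (s\<^sup>2) * s\<^sup>2 \<le> l * (4 * k * (k + 1)) * Y"
        proof -
          have "4 * \<phi>'' (s\<^sup>2) * s\<^sup>2 \<le> 4 * \<phi>'' (s\<^sup>2) * \<rho>\<^sup>2"
            using s bp k by (intro mult_left_mono power_mono) (auto simp: \<phi>''_def)
          also have "\<dots> = l * (4 * k * (k + 1)) * Y" by (simp add: \<phi>''_def b_def Y_def r2 D_def mult_ac)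
          finally show ?thesis .
        qed
        have t2: "2 * N * \<phi>' (s\<^sup>2) \<le> l * (2 * N * k) * Y"
        proof -
          have "2 * N * \<phi>' (s\<^sup>2) = l * (2 * N * k) * (\<rho> powr k * D powr (-k-2)) * D"
            by (simp add: \<phi>'_def b_def D_def[symmetric] D1 mult_ac)
          also have "\<dots> \<le> l * (2 * N * k) * (\<rho> powr k * D powr (-k-2)) * \<rho>\<^sup>2"
            using D k l1 Ndef by (intro mult_left_mono) auto
          also have "\<dots> = l * (2 * N * k) * Y" by (simp add: Y_def r2 mult_ac)
          finally show ?thesis .
        qed
        have tr: "trace ((4 * \<phi>'' ((norm (y - x))\<^sup>2)) *\<^sub>R outer (y - x) (y - x) + (2 * \<phi>' ((norm (y - x))\<^sup>2)) *\<^sub>R mat 1) \<le> l * c1 * Y"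
        proof -
          have "l * (4 * k * (k + 1)) * Y + l * (2 * N * k) * Y = l * c1 * Y" by (simp add: c1_def algebra_simps)
          then show ?thesis unfolding trace_radial s_def[symmetric] Ndef[symmetric] using t1 t2 by linarith
        qed
        define Z where "Z = (\<rho> / D) powr (k + 1)"
        \<comment> \<open>Here \<rho> \<le> 1 enters. The ratio being at least 1, the exponent
          (k+1)q may be raised to k + 2.\<close>
        have rD: "1 \<le> \<rho> / D"
        proof -
          have "D \<le> \<rho> * \<rho>" using D by (simp add: power2_eq_square)
          also have "\<dots> \<le> \<rho> * 1" using \<rho> by (intro mult_left_mono) auto
          finally show ?thesis using D by simp
        qed
        have Yp: "Y = (\<rho> / D) powr (k + 2)"
        proof -
          have "-k-2 = -(k+2)" by simp
          then show ?thesis unfolding Y_def powr_divide by (simp only: powr_minus divide_inverse)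
        qed
        have gn: "norm ((2 * \<phi>' ((norm (y - x))\<^sup>2)) *\<^sub>R (y - x)) \<le> 2 * k * l * Z"
        proof -
          have "norm ((2 * \<phi>' ((norm (y - x))\<^sup>2)) *\<^sub>R (y - x)) = 2 * \<phi>' (s\<^sup>2) * s"
            using bp k by (simp add: s_def \<phi>'_def abs_mult)
          also have "\<dots> \<le> 2 * \<phi>' (s\<^sup>2) * \<rho>" using s bp k by (intro mult_left_mono) (auto simp: \<phi>'_def)
          also have "\<dots> = 2 * k * l * ((\<rho> powr k * \<rho>) * D powr (-k-1))" by (simp add: \<phi>'_def b_def D_def mult_ac)
          also have "\<rho> powr k * \<rho> = \<rho> powr (k + 1)" using \<rho> by (simp add: powr_add)
          also have "\<rho> powr (k + 1) * D powr (-k-1) = Z"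
          proof -
            have "-k-1 = -(k+1)" by simp
            then show ?thesis unfolding Z_def powr_divide by (simp only: powr_minus divide_inverse)
          qed
          finally show ?thesis .
        qed
        have "norm ((2 * \<phi>' ((norm (y - x))\<^sup>2)) *\<^sub>R (y - x)) powr q \<le> (2 * k * l * Z) powr q"
          using gn q by (intro powr_mono2) auto
        also have "\<dots> = (2 * k * l) powr q * (\<rho> / D) powr ((k + 1) * q)" by (simp add: powr_mult Z_def powr_powr)
        also have "\<dots> \<le> (2 * k * l) powr q * (\<rho> / D) powr (k + 2)"
          using rD k(3) by (intro mult_left_mono powr_mono) auto
        finally have gq: "M * norm ((2 * \<phi>' ((norm (y - x))\<^sup>2)) *\<^sub>R (y - x)) powr q \<le> M * ((2 * k * l) powr q * Y)"
          unfolding Yp using M by simp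
        have wp: "\<phi> ((norm (y - x))\<^sup>2) powr p = l powr p * Y"
        proof -
          have "\<phi> ((norm (y - x))\<^sup>2) powr p = l powr p * (\<rho> powr (k * p) * D powr (-k * p))"
            by (simp add: \<phi>_def b_def s_def[symmetric] D_def[symmetric] powr_mult powr_powr)
          also have "-k * p = -k-2" using k(2) by simp
          finally show ?thesis unfolding k(2) Y_def .
        qed
        have "(l * c1 + M * (2 * k * l) powr q) * Y \<le> l powr p * Y" using lp Y by (rule mult_right_mono)
        then show "trace ((4 * \<phi>'' ((norm (y - x))\<^sup>2)) *\<^sub>R outer (y - x) (y - x) + (2 * \<phi>' ((norm (y - x))\<^sup>2)) *\<^sub>R mat 1)
        \<le> \<phi> ((norm (y - x))\<^sup>2) powr p - M * norm ((2 * \<phi>' ((norm (y - x))\<^sup>2)) *\<^sub>R (y - x)) powr q"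
          using tr gq unfolding wp distrib_right by (simp add: mult.assoc)
      qed
    qed (use p \<rho> in auto)
    also have "\<phi> ((norm (x - x))\<^sup>2) = l * (\<rho> powr k * \<rho> powr (2 * -k))"
    proof -
      have "\<rho>\<^sup>2 = \<rho> powr 2" using \<rho> by simp
      then have "(\<rho>\<^sup>2) powr (-k) = \<rho> powr (2 * -k)" by (simp only: powr_powr)
      then show ?thesis by (simp add: \<phi>_def b_def)
    qed
    also have "\<rho> powr k * \<rho> powr (2 * -k) = \<rho> powr (-k)" by (simp only: powr_add[symmetric]) simp
    finally show ?thesis .
  qed
  then show ?thesis using l1 unfolding k_def by (intro exI[of _ l]) auto
qed

lemma keller_osserman:
  "\<exists>C\<ge>0. \<exists>r>0. \<forall>x. 0 < norm x \<and> norm x < r \<longrightarrow> u x \<le> C * norm x powr (-(2 / (p - 1)))"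
proof -
  obtain C where C: "C \<ge> 0" "\<And>x \<rho>. 0 < \<rho> \<Longrightarrow> \<rho> \<le> 1 \<Longrightarrow> cball x \<rho> \<subseteq> \<Omega> - {0} \<Longrightarrow> u x \<le> C * \<rho> powr (-(2 / (p - 1)))"
    using keller_osserman_ball by auto
  obtain r0 where r0: "r0 > 0" "ball 0 r0 \<subseteq> \<Omega>" using \<Omega> open_contains_ball by blast
  define r where "r = min (r0 / 2) 1"
  have r: "r > 0" "r \<le> 1" "2 * r \<le> r0" using r0 by (auto simp: r_def)
  have "u x \<le> (C * 2 powr (2 / (p - 1))) * norm x powr (-(2 / (p - 1)))" if x: "0 < norm x" "norm x < r" for x
  proof -
    have "cball x (norm x / 2) \<subseteq> \<Omega> - {0}"
    proof
      fix y assume y: "y \<in> cball x (norm x / 2)"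
      have "norm y \<le> norm x + norm (y - x)" using norm_triangle_ineq[of x "y - x"] by simp
      moreover have "norm x \<le> norm y + norm (y - x)" using norm_triangle_ineq4[of y "y - x"] by simp
      ultimately have "norm y < r0" "y \<noteq> 0" using y x r by (auto simp: dist_norm norm_minus_commute)
      then show "y \<in> \<Omega> - {0}" using r0(2) by auto
    qed
    then have "u x \<le> C * (norm x / 2) powr (-(2 / (p - 1)))" using x r by (intro C(2)) auto
    also have "(norm x / 2) powr (-(2 / (p - 1))) = 2 powr (2 / (p - 1)) * norm x powr (-(2 / (p - 1)))"
      unfolding powr_divide by (simp only: powr_minus[of 2] divide_inverse inverse_inverse_eq mult.commute)
    finally show ?thesis by (simp add: mult.assoc)
  qed
  then show ?thesis using C(1) r(1) by (intro exI[of _ "C * 2 powr (2 / (p - 1))"]) auto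
qed

end

section \<open>Boundedness in the removable cases\<close>

lemma le_of_small_multiples:
  fixes a b A l0 :: real
  assumes "\<And>l. 0 < l \<Longrightarrow> l \<le> l0 \<Longrightarrow> a \<le> A + l * b" "b \<ge> 0" "l0 > 0"
  shows "a \<le> A"
proof (rule field_le_epsilon)
  fix e :: real assume e: "e > 0"
  define l where "l = min l0 (e / (b + 1))"
  have l: "0 < l" "l \<le> l0" using assms e by (auto simp: l_def)
  have "l * b \<le> (e / (b + 1)) * b" using assms by (intro mult_right_mono) (auto simp: l_def)
  also have "\<dots> \<le> e" using assms e by (simp add: field_simps)
  finally show "a \<le> A + e" using assms(1)[OF l] by linarith
qed

text \<open>Source of the constant \<open>m\<^sup>*\<close>: after scaling, the supersolution inequality for a power is this weighted AM-GM.\<close>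
lemma young_power:
  fixes L X p :: real
  assumes "L > 0" "X > 0" "p > 1"
  shows "(p + 1) * (L / p) powr (p / (p + 1)) * X powr (1 / (p + 1)) \<le> L + X"
proof -
  \<comment> \<open>Scaled so that the weighted mean of \<open>a\<close> and \<open>b\<close> with
    weights p/(p+1) and 1/(p+1) is L + X.\<close>
  define a where "a = L * (p + 1) / p"
  define b where "b = (p + 1) * X"
  have ab: "a > 0" "b > 0" using assms by (auto simp: a_def b_def)
  have "a powr (p / (p + 1)) * b powr (1 / (p + 1)) \<le> (p / (p + 1)) * a + (1 / (p + 1)) * b"
  proof -
    have "exp ((p / (p + 1)) * ln a + (1 / (p + 1)) * ln b) \<le> (p / (p + 1)) * exp (ln a) + (1 / (p + 1)) * exp (ln b)"
      using convex_onD[OF exp_convex, of "1 / (p + 1)" "ln a" "ln b"] assms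
      by (simp add: field_simps)
    then show ?thesis using ab by (simp add: powr_def exp_add)
  qed
  also have "\<dots> = L + X" using assms by (simp add: a_def b_def)
  also have "a powr (p / (p + 1)) * b powr (1 / (p + 1)) = (p + 1) * (L / p) powr (p / (p + 1)) * X powr (1 / (p + 1))"
  proof -
    have "a = (p + 1) * (L / p)" by (simp add: a_def)
    then have "a powr (p / (p + 1)) * b powr (1 / (p + 1)) = ((p + 1) powr (p / (p + 1)) * (p + 1) powr (1 / (p + 1))) * (L / p) powr (p / (p + 1)) * X powr (1 / (p + 1))"
      by (simp only: b_def powr_mult mult_ac)
    also have "(p + 1) powr (p / (p + 1)) * (p + 1) powr (1 / (p + 1)) = (p + 1) powr 1"
    proof -
      have "p / (p + 1) + 1 / (p + 1) = 1" using assms by (simp add: field_simps)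
      then show ?thesis by (metis powr_add)
    qed
    finally show ?thesis using assms by simp
  qed
  finally show ?thesis .
qed

context singular_solution
begin

section \<open>Comparison with powers of the norm near the puncture\<close>

lemma small_ball: "\<exists>r>0. r < 1 \<and> cball 0 r \<subseteq> \<Omega>"
proof -
  obtain r0 where r0: "r0 > 0" "cball 0 r0 \<subseteq> \<Omega>" using \<Omega> open_contains_cball by blast
  have "cball 0 (min r0 (1/2)) \<subseteq> cball (0::real^'n) r0" by auto
  then show ?thesis using r0 by (intro exI[of _ "min r0 (1/2)"]) auto
qed

lemma annulus_bound:
  assumes "0 < r" "cball 0 r \<subseteq> \<Omega>"
  shows "\<exists>A\<ge>0. \<forall>x. r / 2 \<le> norm x \<and> norm x \<le> r \<longrightarrow> u x \<le> A"
proof -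
  have c: "compact (cball (0::real^'n) r - ball 0 (r/2))" by (intro compact_diff) auto
  have "continuous_on (cball 0 r - ball 0 (r/2)) u"
    by (rule continuous_on_subset[OF has_C2D(5)[OF u]]) (use assms in auto)
  then have "bounded (u ` (cball 0 r - ball 0 (r/2)))" using c by (intro compact_imp_bounded compact_continuous_image)
  then obtain A where "A > 0" "\<And>x. x \<in> cball 0 r - ball 0 (r/2) \<Longrightarrow> \<bar>u x\<bar> \<le> A" by (auto simp: bounded_pos)
  then show ?thesis by (intro exI[of _ A]) fastforce
qed

text \<open>The constant \<open>A\<close> settles the outer boundary and \<open>h\<close> the
  neighbourhood of the puncture. Adding a nonnegative constant to a supersolution keeps it one, as
  only the absorption term feels the change and it grows.\<close>

lemma barrier:
  assumes r: "0 < r" "cball 0 r \<subseteq> \<Omega>" and h: "has_C2 (UNIV - {0}) h Gh Hh" and A: "A \<ge> 0"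
    and Au: "\<And>x. r / 2 \<le> norm x \<Longrightarrow> norm x \<le> r \<Longrightarrow> u x \<le> A" and h0: "\<And>x. x \<noteq> 0 \<Longrightarrow> h x \<ge> 0"
    and near: "\<exists>\<delta>>0. \<forall>x. 0 < norm x \<and> norm x < \<delta> \<longrightarrow> u x \<le> h x"
    and sup: "\<And>x. 0 < norm x \<Longrightarrow> norm x < r \<Longrightarrow> trace (Hh x) \<le> h x powr p - M * norm (Gh x) powr q"
    and x: "0 < norm x" "norm x < r"
  shows "u x \<le> A + h x"
proof -
  obtain \<delta> where d: "\<delta> > 0" "\<And>x. 0 < norm x \<Longrightarrow> norm x < \<delta> \<Longrightarrow> u x \<le> h x" using near by auto
  define U where "U = ball (0::real^'n) r - {0}"
  define K where "K = cball (0::real^'n) (r/2) - ball 0 (min \<delta> r)"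
  define K' where "K' = cball (0::real^'n) (r/2) - ball 0 (min \<delta> (r/2))"
  have oU: "open U" by (simp add: U_def open_Diff)
  have uU: "has_C2 U u G H" by (rule has_C2_subset[OF u oU]) (use r in \<open>auto simp: U_def\<close>)
  have w: "has_C2 U (\<lambda>x. A + h x) (\<lambda>x. 0 + Gh x) (\<lambda>x. 0 + Hh x)"
    by (rule has_C2_add[OF has_C2_subset[OF has_C2_const oU] has_C2_subset[OF h oU]]) (auto simp: U_def)
  show ?thesis
  proof (rule supersolution_compare[OF uU w])
    show "compact K'" unfolding K'_def by (intro compact_diff) auto
    show "K' \<subseteq> U" using d(1) r by (auto simp: K'_def U_def)
    show "u y \<le> A + h y" if "y \<in> U - K'" for y
    proof (cases "norm y < min \<delta> (r/2)")
      case True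
      then have "u y \<le> h y" using that by (intro d(2)) (auto simp: U_def)
      then show ?thesis using A by simp
    next
      case False
      then have "u y \<le> A" using that by (intro Au) (auto simp: U_def K'_def)
      then show ?thesis using h0[of y] that by (auto simp: U_def)
    qed
    show "trace (H y) = u y powr p - M * norm (G y) powr q" if "y \<in> U" for y
      using that r by (intro eq) (auto simp: U_def)
    show "0 \<le> A + h y \<and> trace (0 + Hh y) \<le> (A + h y) powr p - M * norm (0 + Gh y) powr q" if y: "y \<in> U" for y
    proof
      have y': "0 < norm y" "norm y < r" "y \<noteq> 0" using y by (auto simp: U_def)
      show "0 \<le> A + h y" using A h0[OF y'(3)] by simp
      have "h y powr p \<le> (A + h y) powr p" using A h0[OF y'(3)] p by (intro powr_mono2) auto
      then show "trace (0 + Hh y) \<le> (A + h y) powr p - M * norm (0 + Gh y) powr q" using sup[OF y'(1,2)] by simp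
    qed
    show "x \<in> U" using x by (auto simp: U_def)
  qed (use p in auto)
qed

text \<open>Because s exceeds the Keller--Osserman exponent, each multiple l |x|^{-s} dominates
  \<open>u\<close> near the puncture, and the constant from the outer annulus does not depend on l.
  The hypothesis \<open>sup\<close> is the supersolution inequality in the radial variable.\<close>

lemma bounded_by_power_barrier:
  assumes s: "2 / (p - 1) < s" "l0 > 0"
    and sup: "\<And>l t. 0 < l \<Longrightarrow> l \<le> l0 \<Longrightarrow> 0 < t \<Longrightarrow> t < 1 \<Longrightarrow>
      l * (s * (s + 2 - N) * t powr (-(s + 2))) \<le> (l * t powr (-s)) powr p - M * (l * (s * t powr (-(s + 1)))) powr q"
  shows "\<exists>A r. 0 < r \<and> (\<forall>x. 0 < norm x \<and> norm x < r \<longrightarrow> u x \<le> A)"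
proof -
  have s0: "s > 0" using s p by (smt (verit) divide_pos_pos)
  obtain r where r: "0 < r" "r < 1" "cball 0 r \<subseteq> \<Omega>" using small_ball by blast
  obtain A where A: "A \<ge> 0" "\<And>x. r / 2 \<le> norm x \<Longrightarrow> norm x \<le> r \<Longrightarrow> u x \<le> A" using annulus_bound[OF r(1,3)] by auto
  obtain C rk where C: "C \<ge> 0" "rk > 0" "\<And>x. 0 < norm x \<Longrightarrow> norm x < rk \<Longrightarrow> u x \<le> C * norm x powr (-(2 / (p - 1)))"
    using keller_osserman by auto
  obtain Gp Hp where P: "has_C2 (UNIV - {0}) (\<lambda>x::real^'n. norm x powr (-s)) Gp Hp"
    "\<And>x. x \<noteq> 0 \<Longrightarrow> norm (Gp x) = \<bar>s\<bar> * norm x powr (-(s + 1))"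
    "\<And>x. x \<noteq> 0 \<Longrightarrow> trace (Hp x) = s * (s + 2 - real CARD('n)) * norm x powr (-(s + 2))"
    using has_C2_norm_powr[of s, where 'n='n] by auto
  have "u x \<le> A" if x: "0 < norm x" "norm x < r" for x
  proof (rule le_of_small_multiples[where b="norm x powr (-s)"])
    fix l assume l: "0 < l" "l \<le> l0"
    show "u x \<le> A + l * norm x powr (-s)"
    proof (rule barrier[OF r(1,3) has_C2_cmul[OF P(1)] A])
      obtain \<delta> where d: "\<delta> > 0" "\<And>t. 0 < t \<Longrightarrow> t < \<delta> \<Longrightarrow> C * t powr (-(2 / (p - 1))) \<le> l * t powr (-s)"
        using powr_dominated_near_0[OF s(1) l(1) C(1)] by auto
      show "\<exists>\<delta>>0. \<forall>x. 0 < norm x \<and> norm x < \<delta> \<longrightarrow> u x \<le> l * norm x powr (-s)"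
        using d C(2) by (intro exI[of _ "min \<delta> rk"]) (auto intro!: order_trans[OF C(3)])
      show "trace (l *\<^sub>R Hp y) \<le> (l * norm y powr (-s)) powr p - M * norm (l *\<^sub>R Gp y) powr q"
        if y: "0 < norm y" "norm y < r" for y
      proof -
        have y0: "y \<noteq> 0" using y by auto
        show ?thesis using sup[of l "norm y"] l y r s0 P(2,3)[OF y0] by (simp add: Ndef)
      qed
    qed (use l x in auto)
  qed (use s in auto)
  then show ?thesis using r(1) by blast
qed

text \<open>The condition q < 2p/(p+1) is equivalent to 2/(p-1) < (2-q)/(q-1), so s fits strictly
  between the Keller--Osserman exponent and both N - 2 and (2-q)/(q-1). The first bound makes the
  barrier superharmonic, the second means (s+1)q \<le> s + 2. The gradient term has the factor l^q
  against l, so for small l the Laplacian alone controls it.\<close>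

lemma bounded_strict:
  assumes cr: "p > N / (N - 2)" and qs: "q < 2 * p / (p + 1)"
  shows "\<exists>A r. 0 < r \<and> (\<forall>x. 0 < norm x \<and> norm x < r \<longrightarrow> u x \<le> A)"
proof -
  have N: "N \<ge> 3" using N3 by (simp add: Ndef)
  define \<sigma> where "\<sigma> = 2 / (p - 1)"
  have sN: "\<sigma> < N - 2" using cr p N by (simp add: \<sigma>_def field_simps)
  have "q * (p + 1) < 2 * p" using qs p by (simp add: field_simps)
  then have sq: "\<sigma> < (2 - q) / (q - 1)" using p q by (simp add: \<sigma>_def field_simps)
  obtain s where s: "\<sigma> < s" "s < min (N - 2) ((2 - q) / (q - 1))" using dense[of \<sigma> "min (N - 2) ((2 - q) / (q - 1))"] sN sq by auto
  have s0: "s > 0" using s p by (smt (verit) divide_pos_pos \<sigma>_def)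
  have s1: "(s + 1) * q \<le> s + 2"
  proof -
    have "s * (q - 1) < 2 - q" using s q by (simp add: field_simps)
    then show ?thesis by (simp add: algebra_simps)
  qed
  \<comment> \<open>The value at which M s^q l^{q-1} equals s (N-2-s).\<close>
  define l0 where "l0 = (s * (N - 2 - s) / (M * s powr q)) powr (1 / (q - 1))"
  have l0: "l0 > 0" using s s0 M by (simp add: l0_def)
  show ?thesis
  proof (rule bounded_by_power_barrier[OF s(1)[unfolded \<sigma>_def] l0])
    fix l t :: real assume l: "0 < l" "l \<le> l0" and t: "0 < t" "t < 1"
    have "l powr (q - 1) \<le> l0 powr (q - 1)" using l q by (intro powr_mono2) auto
    also have "\<dots> = s * (N - 2 - s) / (M * s powr q)" using q s s0 M by (simp add: l0_def powr_powr)
    finally have a: "M * s powr q * l powr (q - 1) \<le> s * (N - 2 - s)" using M s0 by (simp add: field_simps)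
    have lq: "l powr q = l * l powr (q - 1)" using l powr_add[of l 1 "q - 1"] by simp
    have "M * (l * (s * t powr (-(s + 1)))) powr q = (l * (M * s powr q * l powr (q - 1))) * t powr (-(s + 1) * q)"
      using l s0 by (simp only: powr_mult powr_powr lq mult_ac)
    also have "\<dots> \<le> (l * (s * (N - 2 - s))) * t powr (-(s + 2))"
    proof -
      have "-(s + 2) \<le> -(s + 1) * q" using s1 by (simp add: algebra_simps)
      then have f1: "t powr (-(s + 1) * q) \<le> t powr (-(s + 2))" using t by (intro powr_mono') auto
      have f2: "l * (M * s powr q * l powr (q - 1)) \<le> l * (s * (N - 2 - s))" using a l by (intro mult_left_mono) auto
      have f3: "0 \<le> l * (s * (N - 2 - s))" using l s s0 by simp
      show ?thesis by (rule mult_mono[OF f2 f1 f3]) simp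
    qed
    finally have "M * (l * (s * t powr (-(s + 1)))) powr q \<le> - (l * (s * (s + 2 - N) * t powr (-(s + 2))))"
      by (simp add: algebra_simps)
    moreover have "0 \<le> (l * t powr (-s)) powr p" by simp
    ultimately show "l * (s * (s + 2 - N) * t powr (-(s + 2))) \<le> (l * t powr (-s)) powr p - M * (l * (s * t powr (-(s + 1)))) powr q" by linarith
  qed
qed

text \<open>For q = 2p/(p+1) both thresholds for s coincide with \<sigma> = 2/(p-1), so the
  Laplacian no longer controls the gradient term by itself and the absorption has to help. The bound
  on \<open>M\<close> gives a strict inequality at s = \<sigma>, and continuity keeps it for some s
  slightly above.\<close>

lemma bounded_equal:
  assumes cr: "p > N / (N - 2)" and qe: "q = 2 * p / (p + 1)"
    and Mm: "M < (p + 1) * (((N - 2) * p - N) / (2 * p)) powr (p / (p + 1))"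
  shows "\<exists>A r. 0 < r \<and> (\<forall>x. 0 < norm x \<and> norm x < r \<longrightarrow> u x \<le> A)"
proof -
  have N: "N \<ge> 3" using N3 by (simp add: Ndef)
  define \<sigma> where "\<sigma> = 2 / (p - 1)"
  have \<sigma>0: "\<sigma> > 0" using p by (simp add: \<sigma>_def)
  have sN: "\<sigma> < N - 2" using cr p N by (simp add: \<sigma>_def field_simps)
  \<comment> \<open>Positivity of \<open>f s\<close> lets the AM-GM bound with L = s (N-2-s)
    dominate the gradient term. At s = \<sigma> one has L/p = (((N-2)p - N)/(2p)) \<sigma>^2, and
    \<open>f\<close> becomes \<sigma>^q times the gap between the critical constant and M.\<close>
  define f where "f s = (p + 1) * (s * (N - 2 - s) / p) powr (p / (p + 1)) - M * s powr q" for s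
  have fs: "f \<sigma> > 0"
  proof -
    have e1: "\<sigma> * (N - 2 - \<sigma>) / p = (((N - 2) * p - N) / (2 * p)) * \<sigma>\<^sup>2"
    proof -
      have e: "N - 2 - \<sigma> = (((N - 2) * p - N) / 2) * \<sigma>" using p by (simp add: \<sigma>_def field_simps)
      show ?thesis unfolding e by (simp add: power2_eq_square)
    qed
    have e2: "(\<sigma>\<^sup>2) powr (p / (p + 1)) = \<sigma> powr q"
    proof -
      have "\<sigma>\<^sup>2 = \<sigma> powr 2" using \<sigma>0 by simp
      then have "(\<sigma>\<^sup>2) powr (p / (p + 1)) = \<sigma> powr (2 * (p / (p + 1)))" by (simp only: powr_powr)
      then show ?thesis by (simp add: qe)
    qed
    have "f \<sigma> = ((p + 1) * (((N - 2) * p - N) / (2 * p)) powr (p / (p + 1)) - M) * \<sigma> powr q"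
      unfolding f_def e1 powr_mult e2 by (simp add: algebra_simps)
    then show ?thesis using Mm \<sigma>0 by simp
  qed
  have "isCont f \<sigma>" unfolding f_def using \<sigma>0 sN p by (intro continuous_intros) auto
  then have "(f \<longlongrightarrow> f \<sigma>) (at_right \<sigma>)" unfolding isCont_def filterlim_at_split by simp
  from order_tendstoD(1)[OF this fs] have ev: "eventually (\<lambda>s. f s > 0) (at_right \<sigma>)" .
  have "eventually (\<lambda>s. s > \<sigma> \<and> s < N - 2) (at_right \<sigma>)"
    unfolding eventually_at_right_field using sN by (intro exI[of _ "N - 2"]) auto
  with ev have "eventually (\<lambda>s. f s > 0 \<and> s > \<sigma> \<and> s < N - 2) (at_right \<sigma>)" by eventually_elim auto
  then obtain s where s: "f s > 0" "s > \<sigma>" "s < N - 2"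
    using eventually_happens'[OF trivial_limit_at_right_real] by blast
  have s0: "s > 0" using s \<sigma>0 by linarith
  define L where "L = s * (N - 2 - s)"
  have L: "L > 0" using s s0 by (simp add: L_def)
  show ?thesis
  proof (rule bounded_by_power_barrier[OF s(2)[unfolded \<sigma>_def] zero_less_one])
    fix l t :: real assume l: "0 < l" "l \<le> 1" and t: "0 < t" "t < 1"
    \<comment> \<open>With W = l t^{-(s+2)}, the product W L is minus the Laplacian of the barrier,
      W X is its p-th power, and W M s^q X^{1/(p+1)} is its gradient term.\<close>
    define X where "X = (l * t powr (\<sigma> - s)) powr (p - 1)"
    have X: "X > 0" using l t by (simp add: X_def)
    define W where "W = l * t powr (-(s + 2))"
    have W: "W > 0" using l t by (simp add: W_def)
    have "M * s powr q * X powr (1 / (p + 1)) \<le> (p + 1) * (L / p) powr (p / (p + 1)) * X powr (1 / (p + 1))"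
      using s(1) X unfolding f_def L_def by (intro mult_right_mono) auto
    also have "\<dots> \<le> L + X" by (rule young_power[OF L X p])
    finally have "W * (M * s powr q * X powr (1 / (p + 1))) \<le> W * (L + X)" using W by (intro mult_left_mono) auto
    moreover have "W * X = (l * t powr (-s)) powr p"
    proof -
      have "W * X = (l powr 1 * l powr (p - 1)) * (t powr (-(s + 2)) * t powr ((\<sigma> - s) * (p - 1)))"
        using l by (simp add: W_def X_def powr_mult powr_powr mult_ac)
      also have "\<dots> = l powr p * t powr (-(s + 2) + (\<sigma> - s) * (p - 1))" by (simp only: powr_add[symmetric]) simp
      also have "-(s + 2) + (\<sigma> - s) * (p - 1) = -s * p" using p by (simp add: \<sigma>_def field_simps)
      finally show ?thesis by (simp only: powr_mult powr_powr)
    qed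
    moreover have "W * (M * s powr q * X powr (1 / (p + 1))) = M * (l * (s * t powr (-(s + 1)))) powr q"
    proof -
      have e: "(p - 1) * (1 / (p + 1)) = q - 1" using p by (simp add: qe field_simps)
      have "X powr (1 / (p + 1)) = l powr (q - 1) * t powr ((\<sigma> - s) * (q - 1))"
        unfolding X_def powr_powr e by (simp only: powr_mult powr_powr)
      then have "W * (M * s powr q * X powr (1 / (p + 1))) = M * s powr q * (l powr 1 * l powr (q - 1)) * (t powr (-(s + 2)) * t powr ((\<sigma> - s) * (q - 1)))"
        using l by (simp add: W_def mult_ac)
      also have "\<dots> = M * s powr q * l powr q * t powr (-(s + 2) + (\<sigma> - s) * (q - 1))" by (simp only: powr_add[symmetric]) simp
      also have "-(s + 2) + (\<sigma> - s) * (q - 1) = -(s + 1) * q"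
      proof -
        have "\<sigma> * (q - 1) = 2 - q"
        proof -
          have e1: "q - 1 = (p - 1) / (p + 1)" using p by (simp add: qe field_simps)
          have e2: "\<sigma> * (p - 1) = 2" unfolding \<sigma>_def by (rule nonzero_eq_divide_eq[THEN iffD1, OF _ refl]) (use p in simp)
          have "\<sigma> * (q - 1) = 2 / (p + 1)" unfolding e1 times_divide_eq_right e2 ..
          also have "\<dots> = 2 - q" using p by (simp add: qe field_simps)
          finally show ?thesis .
        qed
        then show ?thesis by (simp add: algebra_simps)
      qed
      also have "M * s powr q * l powr q * t powr (-(s + 1) * q) = M * (l * (s * t powr (-(s + 1)))) powr q"
        by (simp only: powr_mult powr_powr mult_ac)
      finally show ?thesis .
    qed
    moreover have "W * L = - (l * (s * (s + 2 - N) * t powr (-(s + 2))))" by (simp add: W_def L_def algebra_simps)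
    ultimately show "l * (s * (s + 2 - N) * t powr (-(s + 2))) \<le> (l * t powr (-s)) powr p - M * (l * (s * t powr (-(s + 1)))) powr q"
      unfolding distrib_left by linarith
  qed
qed

text \<open>For p = N/(N-2) the Keller--Osserman exponent is N - 2 itself, so a dominating power
  must have exponent N - 2 + k and is subharmonic. Its Laplacian is only of order k, however, and
  for small k half of the absorption pays for it; the other half pays for the gradient term near the
  origin. As l is arbitrary, \<open>u\<close> is of smaller order than the fundamental
  solution.\<close>

lemma critical_decay:
  assumes cr: "p = N / (N - 2)" and qs: "q < N / (N - 1)" and l: "0 < l"
  shows "\<exists>\<delta>>0. \<forall>x. 0 < norm x \<and> norm x < \<delta> \<longrightarrow> u x \<le> 2 * l * norm x powr (-(N - 2))"
proof -
  have N: "N \<ge> 3" using N3 by (simp add: Ndef)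
  have pN: "p * (N - 2) = N" using cr N by simp
  have \<sigma>: "2 / (p - 1) = N - 2"
  proof -
    have "p - 1 = 2 / (N - 2)" using cr N by (simp add: field_simps)
    then show ?thesis using N by simp
  qed
  \<comment> \<open>The margin by which the gradient term is less singular than the absorption; it
    is positive because q < N/(N-1).\<close>
  define e where "e = N - (N - 1) * q"
  have e: "e > 0" using qs N by (simp add: e_def field_simps)
  define c where "c = M * l powr q * (N - 1) powr q"
  have c: "c > 0" using M l N by (simp add: c_def)
  obtain r1 where r1: "0 < r1" "r1 < 1" "cball 0 r1 \<subseteq> \<Omega>" using small_ball by blast
  \<comment> \<open>On this ball the gradient term, which carries the factor c t^e, is at most half
    of the absorption. The radius does not depend on k, so the limit k -> 0 can be taken at a fixed
    point.\<close>
  define r where "r = min r1 ((l powr p / (2 * c)) powr (1 / e))"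
  have r: "0 < r" "r < 1" "cball 0 r \<subseteq> \<Omega>"
  proof -
    show "0 < r" "r < 1" using r1 l c by (auto simp: r_def)
    have "cball 0 r \<subseteq> cball (0::real^'n) r1" by (auto simp: r_def)
    then show "cball 0 r \<subseteq> \<Omega>" using r1 by blast
  qed
  have re: "c * t powr e \<le> l powr p / 2" if "0 < t" "t < r" for t
  proof -
    have "t powr e \<le> ((l powr p / (2 * c)) powr (1 / e)) powr e" using that e by (intro powr_mono2) (auto simp: r_def)
    also have "\<dots> = l powr p / (2 * c)" using e l c by (simp add: powr_powr)
    finally show ?thesis using c by (simp add: field_simps)
  qed
  obtain A where A: "A \<ge> 0" "\<And>x. r / 2 \<le> norm x \<Longrightarrow> norm x \<le> r \<Longrightarrow> u x \<le> A" using annulus_bound[OF r(1,3)] by auto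
  obtain C rk where C: "C \<ge> 0" "rk > 0" "\<And>x. 0 < norm x \<Longrightarrow> norm x < rk \<Longrightarrow> u x \<le> C * norm x powr (-(N - 2))"
    using keller_osserman unfolding \<sigma> by auto
  \<comment> \<open>Guarantees (N-1) k \<le> l^{p-1}/2, so that half of the absorption covers the
    positive Laplacian.\<close>
  define k0 where "k0 = min 1 (l powr (p - 1) / (2 * (N - 1)))"
  have k0: "k0 > 0" using l N by (simp add: k0_def)
  have main: "u x \<le> A + l * norm x powr (-(N - 2 + k))" if x: "0 < norm x" "norm x < r" and k: "0 < k" "k \<le> k0" for x k
  proof -
    define s where "s = N - 2 + k"
    have k1: "k \<le> 1" "(N - 1) * k \<le> l powr (p - 1) / 2"
    proof -
      show "k \<le> 1" using k by (simp add: k0_def)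
      have "k \<le> l powr (p - 1) / (2 * (N - 1))" using k by (simp add: k0_def)
      then show "(N - 1) * k \<le> l powr (p - 1) / 2" using N by (simp add: field_simps)
    qed
    have s: "0 < s" "s \<le> N - 1" "N - 2 < s" using k k1 N by (auto simp: s_def)
    obtain Gp Hp where P: "has_C2 (UNIV - {0}) (\<lambda>x::real^'n. norm x powr (-s)) Gp Hp"
      "\<And>x. x \<noteq> 0 \<Longrightarrow> norm (Gp x) = \<bar>s\<bar> * norm x powr (-(s + 1))"
      "\<And>x. x \<noteq> 0 \<Longrightarrow> trace (Hp x) = s * (s + 2 - real CARD('n)) * norm x powr (-(s + 2))"
      using has_C2_norm_powr[of s, where 'n='n] by auto
    have "u x \<le> A + l * norm x powr (-s)"
    proof (rule barrier[OF r(1,3) has_C2_cmul[OF P(1)] A _ _ _ x])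
      obtain \<delta> where d: "\<delta> > 0" "\<And>t. 0 < t \<Longrightarrow> t < \<delta> \<Longrightarrow> C * t powr (-(N - 2)) \<le> l * t powr (-s)"
        using powr_dominated_near_0[OF s(3) l C(1)] by auto
      show "\<exists>\<delta>>0. \<forall>x. 0 < norm x \<and> norm x < \<delta> \<longrightarrow> u x \<le> l * norm x powr (-s)"
        using d C(2) by (intro exI[of _ "min \<delta> rk"]) (auto intro!: order_trans[OF C(3)])
      show "trace (l *\<^sub>R Hp y) \<le> (l * norm y powr (-s)) powr p - M * norm (l *\<^sub>R Gp y) powr q"
        if y: "0 < norm y" "norm y < r" for y
      proof -
        define t where "t = norm y"
        have t: "0 < t" "t < r" "t \<le> 1" using y r by (auto simp: t_def)
        have y0: "y \<noteq> 0" using y by auto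
        have ps: "p * s = N + k * p" using pN by (simp add: s_def algebra_simps)
        have wp: "(l * t powr (-s)) powr p = l powr p * t powr (-(N + k * p))"
        proof -
          have "-s * p = -(N + k * p)" using ps by (simp add: mult.commute)
          then show ?thesis by (simp only: powr_mult powr_powr)
        qed
        have "trace (l *\<^sub>R Hp y) = l * (s * k) * t powr (-(N + k))"
          unfolding trace_scaleR P(3)[OF y0] by (simp add: t_def s_def Ndef algebra_simps)
        also have "\<dots> \<le> l * ((N - 1) * k) * t powr (-(N + k * p))"
        proof -
          have "k * 1 \<le> k * p" using k p by (intro mult_left_mono) auto
          then have f1: "t powr (-(N + k)) \<le> t powr (-(N + k * p))" using t by (intro powr_mono') auto
          have f2: "l * (s * k) \<le> l * ((N - 1) * k)" using l s k by (intro mult_left_mono mult_right_mono) auto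
          have f3: "0 \<le> l * ((N - 1) * k)" using l N k by simp
          show ?thesis by (rule mult_mono[OF f2 f1 f3]) simp
        qed
        also have "\<dots> \<le> l * (l powr (p - 1) / 2) * t powr (-(N + k * p))"
          using l k1 by (intro mult_right_mono mult_left_mono) auto
        also have "l * (l powr (p - 1) / 2) = l powr p / 2"
          using l powr_add[of l 1 "p - 1"] by simp
        finally have a: "trace (l *\<^sub>R Hp y) \<le> (l powr p / 2) * t powr (-(N + k * p))" .
        have "M * norm (l *\<^sub>R Gp y) powr q = M * (l * (s * t powr (-(s + 1)))) powr q"
          using l s P(2)[OF y0] by (simp add: t_def)
        also have "\<dots> = M * l powr q * s powr q * t powr (-(s + 1) * q)" by (simp only: powr_mult powr_powr mult_ac)
        also have "\<dots> \<le> M * l powr q * (N - 1) powr q * t powr (-(N + k * p) + e)"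
        proof -
          have "k * q \<le> k * p" using k pq by (intro mult_left_mono) auto
          then have "-(N + k * p) + e \<le> -(s + 1) * q" by (simp add: e_def s_def algebra_simps)
          then have f1: "t powr (-(s + 1) * q) \<le> t powr (-(N + k * p) + e)" using t by (intro powr_mono') auto
          have "s powr q \<le> (N - 1) powr q" using s q by (intro powr_mono2) auto
          then have f2: "M * l powr q * s powr q \<le> M * l powr q * (N - 1) powr q" using M by (intro mult_left_mono) auto
          have f3: "0 \<le> M * l powr q * (N - 1) powr q" using M by simp
          show ?thesis by (rule mult_mono[OF f2 f1 f3]) simp
        qed
        also have "\<dots> = (c * t powr e) * t powr (-(N + k * p))" by (simp only: c_def powr_add mult_ac)
        also have "\<dots> \<le> (l powr p / 2) * t powr (-(N + k * p))" using re[OF t(1,2)] by (intro mult_right_mono) auto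
        finally have b: "M * norm (l *\<^sub>R Gp y) powr q \<le> (l powr p / 2) * t powr (-(N + k * p))" .
        show ?thesis using a b wp unfolding t_def by simp
      qed
    qed (use l in auto)
    then show ?thesis by (simp add: s_def)
  qed
  have lim: "u x \<le> A + l * norm x powr (-(N - 2))" if x: "0 < norm x" "norm x < r" for x
  proof -
    \<comment> \<open>let the excess \<open>k\<close> of the exponent over \<open>N - 2\<close> tend to \<open>0\<close>\<close>
    define k where "k n = k0 / (real n + 1)" for n
    have k: "0 < k n" "k n \<le> k0" for n using k0 by (auto simp: k_def field_simps)
    have "(\<lambda>n. k0 * (1 / (real n + 1))) \<longlonglongrightarrow> k0 * 0"
      using LIMSEQ_inverse_real_of_nat by (intro tendsto_mult tendsto_const) (simp add: inverse_eq_divide add.commute)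
    then have kl: "k \<longlonglongrightarrow> 0" by (simp add: k_def[abs_def])
    have "(\<lambda>n. A + l * norm x powr (-(N - 2 + k n))) \<longlonglongrightarrow> A + l * norm x powr (-(N - 2 + 0))"
      using x by (intro tendsto_intros kl) auto
    then have "(\<lambda>n. A + l * norm x powr (-(N - 2 + k n))) \<longlonglongrightarrow> A + l * norm x powr (-(N - 2))" by simp
    then show ?thesis by (rule LIMSEQ_le_const) (use main[OF x k] in blast)
  qed
  have "0 < N - 2" using N by simp
  from powr_dominated_near_0[OF this l A(1)] obtain \<delta> where d: "\<delta> > 0" "\<And>t. 0 < t \<Longrightarrow> t < \<delta> \<Longrightarrow> A * t powr (-0) \<le> l * t powr (-(N - 2))"
    by auto
  have "u x \<le> 2 * l * norm x powr (-(N - 2))" if "0 < norm x" "norm x < min \<delta> r" for x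
    using lim[of x] d(2)[of "norm x"] that by simp
  then show ?thesis using d r by (intro exI[of _ "min \<delta> r"]) auto
qed

text \<open>The barrier is a sum. The harmonic power |x|^{2-N} dominates \<open>u\<close> near the
  origin by \<open>critical_decay\<close>, but has no Laplacian to offset its gradient term; the
  milder power |x|^{-\<tau>} is strictly superharmonic and provides it.\<close>

lemma bounded_critical:
  assumes cr: "p = N / (N - 2)" and qs: "q < N / (N - 1)"
  shows "\<exists>A r. 0 < r \<and> (\<forall>x. 0 < norm x \<and> norm x < r \<longrightarrow> u x \<le> A)"
proof -
  have N: "N \<ge> 3" using N3 by (simp add: Ndef)
  obtain r where r: "0 < r" "r < 1" "cball 0 r \<subseteq> \<Omega>" using small_ball by blast
  obtain A where A: "A \<ge> 0" "\<And>x. r / 2 \<le> norm x \<Longrightarrow> norm x \<le> r \<Longrightarrow> u x \<le> A" using annulus_bound[OF r(1,3)] by auto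
  \<comment> \<open>The first entry gives (N-1)q \<le> \<tau> + 2, so that the gradient of the
    harmonic power is controlled; the second keeps \<tau> positive. Both are below N - 2, the first
    because q < N/(N-1).\<close>
  define \<tau> where "\<tau> = max ((N - 1) * q - 2) ((N - 2) / 2)"
  have "(N - 1) * q < N" using qs N by (simp add: field_simps)
  then have \<tau>: "0 < \<tau>" "\<tau> < N - 2" "(N - 1) * q \<le> \<tau> + 2" using N by (auto simp: \<tau>_def less_max_iff_disj)
  define s where "s = N - 2"
  have s: "s > 0" using N by (simp add: s_def)
  obtain Gp Hp where P: "has_C2 (UNIV - {0}) (\<lambda>x::real^'n. norm x powr (-s)) Gp Hp"
    "\<And>x. x \<noteq> 0 \<Longrightarrow> norm (Gp x) = \<bar>s\<bar> * norm x powr (-(s + 1))"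
    "\<And>x. x \<noteq> 0 \<Longrightarrow> trace (Hp x) = s * (s + 2 - real CARD('n)) * norm x powr (-(s + 2))"
    using has_C2_norm_powr[of s, where 'n='n] by auto
  obtain Gt Ht where T: "has_C2 (UNIV - {0}) (\<lambda>x::real^'n. norm x powr (-\<tau>)) Gt Ht"
    "\<And>x. x \<noteq> 0 \<Longrightarrow> norm (Gt x) = \<bar>\<tau>\<bar> * norm x powr (-(\<tau> + 1))"
    "\<And>x. x \<noteq> 0 \<Longrightarrow> trace (Ht x) = \<tau> * (\<tau> + 2 - real CARD('n)) * norm x powr (-(\<tau> + 2))"
    using has_C2_norm_powr[of \<tau>, where 'n='n] by auto
  define c where "c = \<tau> * (N - 2 - \<tau>)"
  have c: "c > 0" using \<tau> by (simp add: c_def)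
  \<comment> \<open>The value at which M (2s)^q l^{q-1} equals c, where \<open>2 * s\<close> bounds
    the gradients of both powers together.\<close>
  define l0 where "l0 = (c / (M * (2 * s) powr q)) powr (1 / (q - 1))"
  have l0: "l0 > 0" using c M s by (simp add: l0_def)
  have "u x \<le> A" if x: "0 < norm x" "norm x < r" for x
  proof (rule le_of_small_multiples[where b="norm x powr (-s) + norm x powr (-\<tau>)" and ?l0.0=l0])
    fix l assume l: "0 < l" "l \<le> l0"
    show "u x \<le> A + l * (norm x powr (-s) + norm x powr (-\<tau>))"
    proof (rule barrier[OF r(1,3) has_C2_cmul[OF has_C2_add[OF P(1) T(1)]] A])
      obtain \<delta> where d: "\<delta> > 0" "\<And>x. 0 < norm x \<Longrightarrow> norm x < \<delta> \<Longrightarrow> u x \<le> 2 * (l / 2) * norm x powr (-(N - 2))"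
        using critical_decay[OF cr qs, of "l / 2"] l by auto
      have "u y \<le> l * (norm y powr (-s) + norm y powr (-\<tau>))" if "0 < norm y" "norm y < \<delta>" for y
      proof -
        have "0 \<le> l * norm y powr (-\<tau>)" using l by simp
        then show ?thesis using d(2)[OF that] by (simp add: s_def distrib_left)
      qed
      then show "\<exists>\<delta>>0. \<forall>x. 0 < norm x \<and> norm x < \<delta> \<longrightarrow> u x \<le> l * (norm x powr (-s) + norm x powr (-\<tau>))"
        using d(1) by blast
      show "trace (l *\<^sub>R (Hp y + Ht y)) \<le> (l * (norm y powr (-s) + norm y powr (-\<tau>))) powr p - M * norm (l *\<^sub>R (Gp y + Gt y)) powr q"
        if y: "0 < norm y" "norm y < r" for y
      proof -
        define t where "t = norm y"
        have t: "0 < t" "t \<le> 1" using y r by (auto simp: t_def)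
        have y0: "y \<noteq> 0" using y by auto
        have tr: "trace (l *\<^sub>R (Hp y + Ht y)) = - (l * c * t powr (-(\<tau> + 2)))"
          unfolding trace_scaleR trace_add P(3)[OF y0] T(3)[OF y0] by (simp add: t_def s_def c_def Ndef algebra_simps)
        have "norm (Gp y + Gt y) \<le> s * t powr (-(s + 1)) + \<tau> * t powr (-(\<tau> + 1))"
          using norm_triangle_ineq[of "Gp y" "Gt y"] P(2)[OF y0] T(2)[OF y0] s \<tau> by (simp add: t_def)
        also have "\<dots> \<le> s * t powr (-(s + 1)) + s * t powr (-(s + 1))"
          using t \<tau> s by (intro add_left_mono mult_mono powr_mono') (auto simp: s_def)
        finally have "norm (Gp y + Gt y) \<le> 2 * s * t powr (-(s + 1))" by simp
        then have "norm (l *\<^sub>R (Gp y + Gt y)) \<le> l * (2 * s * t powr (-(s + 1)))" using l by (simp add: mult_left_mono)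
        then have "norm (l *\<^sub>R (Gp y + Gt y)) powr q \<le> (l * (2 * s * t powr (-(s + 1)))) powr q"
          using q by (intro powr_mono2) auto
        also have "\<dots> = l powr q * (2 * s) powr q * t powr (-(s + 1) * q)" by (simp only: powr_mult powr_powr mult_ac)
        also have "\<dots> \<le> l powr q * (2 * s) powr q * t powr (-(\<tau> + 2))"
        proof -
          have "(s + 1) * q \<le> \<tau> + 2" using \<tau>(3) by (simp add: s_def)
          then have "-(\<tau> + 2) \<le> -(s + 1) * q" by (simp add: algebra_simps)
          then have "t powr (-(s + 1) * q) \<le> t powr (-(\<tau> + 2))" using t by (intro powr_mono') auto
          then show ?thesis by (intro mult_left_mono) auto
        qed
        finally have "M * norm (l *\<^sub>R (Gp y + Gt y)) powr q \<le> M * (l powr q * (2 * s) powr q * t powr (-(\<tau> + 2)))" using M by simp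
        also have "\<dots> = (l * (M * (2 * s) powr q * l powr (q - 1))) * t powr (-(\<tau> + 2))"
        proof -
          have "l powr q = l * l powr (q - 1)" using l powr_add[of l 1 "q - 1"] by simp
          then show ?thesis by (simp only: mult_ac)
        qed
        also have "\<dots> \<le> (l * c) * t powr (-(\<tau> + 2))"
        proof -
          have "l powr (q - 1) \<le> l0 powr (q - 1)" using l q by (intro powr_mono2) auto
          also have "\<dots> = c / (M * (2 * s) powr q)" using q c M s by (simp add: l0_def powr_powr)
          finally have "M * (2 * s) powr q * l powr (q - 1) \<le> c" using M s by (simp add: field_simps)
          then show ?thesis using l by (intro mult_right_mono mult_left_mono) auto
        qed
        finally have "M * norm (l *\<^sub>R (Gp y + Gt y)) powr q \<le> l * c * t powr (-(\<tau> + 2))" .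
        moreover have "0 \<le> (l * (norm y powr (-s) + norm y powr (-\<tau>))) powr p" by simp
        ultimately show ?thesis unfolding tr by linarith
      qed
    qed (use l x in auto)
  qed (use l0 in auto)
  then show ?thesis using r(1) by blast
qed

end

theorem theorem1p1:
  fixes \<Omega> :: "(real^'n) set" and u :: "real^'n \<Rightarrow> real" and M p q :: real
  defines "N \<equiv> real CARD('n)"
  assumes N3: "CARD('n) \<ge> 3"
    and dom: "open \<Omega>" "connected \<Omega>" "bounded \<Omega>" "0 \<in> \<Omega>"
    and M: "M > 0"
    and p: "p \<ge> N / (N - 2)"
    and q: "1 < q" "q \<le> 2 * p / (p + 1)"
    and pq: "(p, q) \<noteq> (N / (N - 2), N / (N - 1))"
    and reg: "C2_on (\<Omega> - {0}) u"
    and nonneg: "\<forall>x\<in>\<Omega> - {0}. u x \<ge> 0"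
    and eq: "\<forall>x\<in>\<Omega> - {0}. - laplacian u x + u x powr p - M * norm (grad u x) powr q = 0"
  shows "W1loc q \<Omega> u \<and> Lloc p \<Omega> u \<and>
     (\<exists>g. weak_grad \<Omega> u g \<and>
        (\<forall>\<zeta>. test_fun \<Omega> \<zeta> \<longrightarrow>
           (LINT x:\<Omega>|lborel. g x \<bullet> grad \<zeta> x) + (LINT x:\<Omega>|lborel. u x powr p * \<zeta> x)
             - M * (LINT x:\<Omega>|lborel. norm (g x) powr q * \<zeta> x) = 0))
   \<and> (((p \<ge> N / (N - 2) \<and> 1 < q \<and> q < 2 * p / (p + 1)) \<or>
        (p > N / (N - 2) \<and> q = 2 * p / (p + 1) \<and>
         M < (p + 1) * (((N - 2) * p - N) / (2 * p)) powr (p / (p + 1))))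
      \<longrightarrow> (\<exists>v. C2_on \<Omega> v \<and> (\<forall>x\<in>\<Omega> - {0}. v x = u x) \<and>
              (\<forall>x\<in>\<Omega>. - laplacian v x + v x powr p - M * norm (grad v x) powr q = 0)))"
proof -
  have N: "N \<ge> 3" using N3 by (simp add: N_def)
  have p1: "1 < p"
  proof -
    have "1 < N / (N - 2)" using N by (simp add: field_simps)
    then show ?thesis using p by linarith
  qed
  note C2 = C2_on_imp_has_C2[OF reg]
  have tr: "trace (hess u x) = u x powr p - M * norm (grad u x) powr q" if "x \<in> \<Omega> - {0}" for x
    unfolding trace_hess using bspec[OF eq that] by linarith
  interpret s: singular_solution \<Omega> u "grad u" "hess u" p q M N
    by unfold_locales (use N3 dom C2 nonneg tr p1 q M N_def in auto)
  \<comment> \<open>At the critical p the largest admissible q is N/(N-1), so excluding the pair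
    leaves the strict inequality needed for boundedness.\<close>
  have crit: "2 * p / (p + 1) = N / (N - 1)" if "p = N / (N - 2)"
  proof -
    have "p + 1 = (2 * N - 2) / (N - 2)" unfolding that using N by (simp add: field_simps)
    then have "2 * p / (p + 1) = 2 * N / (2 * N - 2)" unfolding that using N by simp
    also have "\<dots> = N / (N - 1)" using N by (simp add: field_simps)
    finally show ?thesis .
  qed
  have bdd: "\<exists>A r. 0 < r \<and> (\<forall>x. 0 < norm x \<and> norm x < r \<longrightarrow> u x \<le> A)"
    if removable: "(p \<ge> N / (N - 2) \<and> 1 < q \<and> q < 2 * p / (p + 1)) \<or>
        (p > N / (N - 2) \<and> q = 2 * p / (p + 1) \<and>
         M < (p + 1) * (((N - 2) * p - N) / (2 * p)) powr (p / (p + 1)))"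
  proof -
    consider "p > N / (N - 2)" "q < 2 * p / (p + 1)" | "p = N / (N - 2)" "q < 2 * p / (p + 1)" |
      "p > N / (N - 2)" "q = 2 * p / (p + 1)" "M < (p + 1) * (((N - 2) * p - N) / (2 * p)) powr (p / (p + 1))"
      using removable by (metis order_le_less)
    then show ?thesis
    proof cases
      case 1 then show ?thesis by (rule s.bounded_strict)
    next
      case 2 then show ?thesis using s.bounded_critical crit by simp
    next
      case 3 then show ?thesis by (rule s.bounded_equal)
    qed
  qed
  \<comment> \<open>At the critical p the solution is already bounded and \<sigma> = 0 works.
    Otherwise \<sigma> = 2/(p-1), for which \<sigma> + 2 and \<sigma>p are the same number 2p/(p-1),
    less than N precisely when p > N/(N-2).\<close>
  have decay: "\<exists>C \<sigma> r. 0 \<le> C \<and> 0 < r \<and> \<sigma> + 2 < N \<and> \<sigma> * p < N \<and> (\<forall>x. 0 < norm x \<and> norm x < r \<longrightarrow> u x \<le> C * norm x powr (-\<sigma>))"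
  proof (cases "p = N / (N - 2)")
    case True
    then have "q < 2 * p / (p + 1)" using crit q pq by auto
    then obtain A r where A: "0 < r" "\<And>x. 0 < norm x \<Longrightarrow> norm x < r \<Longrightarrow> u x \<le> A" using bdd p q by auto
    have "u x \<le> max A 0 * norm x powr (-0)" if "0 < norm x" "norm x < r" for x using A(2)[OF that] that by simp
    then show ?thesis using A(1) N by (intro exI[of _ "max A 0"] exI[of _ 0] exI[of _ r]) auto
  next
    case False
    then have pc: "p > N / (N - 2)" using p by simp
    obtain C r where C: "C \<ge> 0" "r > 0" "\<And>x. 0 < norm x \<Longrightarrow> norm x < r \<Longrightarrow> u x \<le> C * norm x powr (-(2 / (p - 1)))"
      using s.keller_osserman by auto
    have "N < p * (N - 2)" using pc N by (simp add: field_simps)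
    then have "2 / (p - 1) + 2 < N" "2 / (p - 1) * p < N" using p1 by (simp_all add: field_simps)
    then show ?thesis using C by (intro exI[of _ C] exI[of _ "2 / (p - 1)"] exI[of _ r]) auto
  qed
  then obtain C \<sigma> r where D: "0 \<le> C" "0 < r" "\<sigma> + 2 < N" "\<sigma> * p < N"
    "\<And>x. 0 < norm x \<Longrightarrow> norm x < r \<Longrightarrow> u x \<le> C * norm x powr (-\<sigma>)" by blast
  have part1: "W1loc q \<Omega> u \<and> Lloc p \<Omega> u \<and>
     (\<exists>g. weak_grad \<Omega> u g \<and>
        (\<forall>\<zeta>. test_fun \<Omega> \<zeta> \<longrightarrow>
           (LINT x:\<Omega>|lborel. g x \<bullet> grad \<zeta> x) + (LINT x:\<Omega>|lborel. u x powr p * \<zeta> x)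
             - M * (LINT x:\<Omega>|lborel. norm (g x) powr q * \<zeta> x) = 0))"
    by (rule weak_solution[OF dom(1,4) C2 _ tr M q(1) less_imp_le[OF s.pq(1)] D(2) D(5) D(1) D(3,4)[unfolded N_def]])
       (use nonneg in auto)
  have part2: "\<exists>v. C2_on \<Omega> v \<and> (\<forall>x\<in>\<Omega> - {0}. v x = u x) \<and>
              (\<forall>x\<in>\<Omega>. - laplacian v x + v x powr p - M * norm (grad v x) powr q = 0)"
    if bd: "\<exists>A r. 0 < r \<and> (\<forall>x. 0 < norm x \<and> norm x < r \<longrightarrow> u x \<le> A)"
  proof -
    obtain A r where A: "0 < r" "\<And>x. 0 < norm x \<Longrightarrow> norm x < r \<Longrightarrow> u x \<le> A" using bd by auto
    show ?thesis
      by (rule classical_extension[OF N3 dom(1,4) C2 _ tr p1 q(1) s.pq(2) M A]) (use nonneg in auto)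
  qed
  show ?thesis using part1 part2 bdd by blast
qed

end
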